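(* There is a randomized algorithm which, given $n\ge2$, outputs a uniformly random square permutation of size $n$ in expected time $O(n)$; and there is a randomized algorithm which, given $n\ge 2$, outputs a uniformly random convex permutomino of size $n$ in expected time $O(n)$.
   Context: A permutation $\sigma$ of $\{1,\dots,n\}$ (size $n$) is identified with the point set $\{(i,\sigma(i))\}$. In a finite planar point set $S$, a point $(x,y)$ is an upper-right record if no $(x',y')\in S$ has $x'>x$ and $y'>y$; upper-left, bottom-left and bottom-right records are defined similarly. A point that is a record of at least one of the four types is exterior, otherwise interior. A square permutation is a permutation with no interior point. A polygon is a closed self-avoiding walk on the square lattice (starting point and orientation irrelevant); its turnpoints are the vertices where it changes direction and its sides are the segments between consecutive turnpoints. It is convex if its set of lattice vertices has no interior point. A permutomino of size $n$ is a polygon, up to translation lying in $[1,n]^2$, such that for each $i=1,\dots,n$ the vertical line of abscissa $i$ contains exactly one side and the horizontal line of ordinate $i$ contains exactly one side. A convex permutomino is a convex polygon that is a permutomino (output, e.g., as the cyclic sequence of its $2n$ turnpoints). Time is measured in the usual unit-cost model, where elementary operations on integers of size polynomial in $n$ and uniform random choices among at most polynomially many integers cost $O(1)$. *)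

theory Defs
  imports "HOL-Probability.Probability" "HOL-Combinatorics.Permutations"
begin

section \<open>Points, records and square permutations\<close>

definition upper_right_record :: "(int \<times> int) set \<Rightarrow> int \<times> int \<Rightarrow> bool" where
  "upper_right_record S p \<longleftrightarrow> \<not> (\<exists>q\<in>S. fst q > fst p \<and> snd q > snd p)"

definition upper_left_record :: "(int \<times> int) set \<Rightarrow> int \<times> int \<Rightarrow> bool" where
  "upper_left_record S p \<longleftrightarrow> \<not> (\<exists>q\<in>S. fst q < fst p \<and> snd q > snd p)"

definition bottom_left_record :: "(int \<times> int) set \<Rightarrow> int \<times> int \<Rightarrow> bool" where
  "bottom_left_record S p \<longleftrightarrow> \<not> (\<exists>q\<in>S. fst q < fst p \<and> snd q < snd p)"

definition bottom_right_record :: "(int \<times> int) set \<Rightarrow> int \<times> int \<Rightarrow> bool" where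
  "bottom_right_record S p \<longleftrightarrow> \<not> (\<exists>q\<in>S. fst q > fst p \<and> snd q < snd p)"

definition exterior :: "(int \<times> int) set \<Rightarrow> int \<times> int \<Rightarrow> bool" where
  "exterior S p \<longleftrightarrow> upper_right_record S p \<or> upper_left_record S p
     \<or> bottom_left_record S p \<or> bottom_right_record S p"

definition no_interior_point :: "(int \<times> int) set \<Rightarrow> bool" where
  "no_interior_point S \<longleftrightarrow> (\<forall>p\<in>S. exterior S p)"

definition square_permutations :: "nat \<Rightarrow> (int \<Rightarrow> int) set" where
  "square_permutations n =
     {\<sigma>. \<sigma> permutes {1..int n} \<and> no_interior_point {(i, \<sigma> i) |i. i \<in> {1..int n}}}"


section \<open>Lattice polygons and convex permutominoes\<close>

definition lattice_adjacent :: "int \<times> int \<Rightarrow> int \<times> int \<Rightarrow> bool" where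
  "lattice_adjacent p q \<longleftrightarrow> \<bar>fst p - fst q\<bar> + \<bar>snd p - snd q\<bar> = 1"

text \<open>A closed walk is the list of its successive vertices, with the starting point not repeated
  at the end. The condition on the length excludes the degenerate walk that goes back and forth
  along one edge.\<close>

definition closed_self_avoiding_walk :: "(int \<times> int) list \<Rightarrow> bool" where
  "closed_self_avoiding_walk w \<longleftrightarrow> 2 < length w \<and> distinct w \<and>
     (\<forall>i<length w. lattice_adjacent (w ! i) (w ! (Suc i mod length w)))"

text \<open>Sequences up to the choice of the starting point and of the orientation.\<close>

definition cyclic_class :: "'a list \<Rightarrow> 'a list set" where
  "cyclic_class w = {rotate k w |k. True} \<union> {rotate k (rev w) |k. True}"

definition turns_at :: "(int \<times> int) list \<Rightarrow> nat \<Rightarrow> bool" where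
  "turns_at w i \<longleftrightarrow>
     (let m = length w; prev = w ! ((i + m - 1) mod m); nxt = w ! (Suc i mod m)
      in w ! i - prev \<noteq> nxt - w ! i)"

definition turnpoints :: "(int \<times> int) list \<Rightarrow> (int \<times> int) list" where
  "turnpoints w = nths w {i. turns_at w i}"

text \<open>A side is given by its two endpoints, in the order in which the walk visits them; it is
  contained in a vertical or horizontal line iff both endpoints are.\<close>

definition sides :: "(int \<times> int) list \<Rightarrow> ((int \<times> int) \<times> (int \<times> int)) set" where
  "sides w = set (zip (turnpoints w) (rotate1 (turnpoints w)))"

text \<open>Translations are factored out by asking the polygon itself to lie in \<open>[1,n]\<^sup>2\<close>: as all lines
  of abscissa or ordinate \<open>1, \<dots>, n\<close> contain a side, each translation class has exactly one such
  representative.\<close>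

definition permutomino_walk :: "nat \<Rightarrow> (int \<times> int) list \<Rightarrow> bool" where
  "permutomino_walk n w \<longleftrightarrow> closed_self_avoiding_walk w \<and>
     set w \<subseteq> {1..int n} \<times> {1..int n} \<and>
     (\<forall>i\<in>{1..int n}. \<exists>!s. s \<in> sides w \<and> fst (fst s) = i \<and> fst (snd s) = i) \<and>
     (\<forall>i\<in>{1..int n}. \<exists>!s. s \<in> sides w \<and> snd (fst s) = i \<and> snd (snd s) = i)"

text \<open>A polygon is the cyclic class of a closed self-avoiding walk; all conditions above are
  invariant under change of starting point and orientation.\<close>

definition convex_permutominoes :: "nat \<Rightarrow> (int \<times> int) list set set" where
  "convex_permutominoes n =
     {cyclic_class w |w. permutomino_walk n w \<and> no_interior_point (set w)}"

text \<open>The turnpoints of a polygon, again as a cyclic class of lists. This class determines the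
  polygon, as the walk runs straight between consecutive turnpoints.\<close>

definition turnpoint_cycle :: "(int \<times> int) list set \<Rightarrow> (int \<times> int) list set" where
  "turnpoint_cycle P = turnpoints ` P"


section \<open>Randomized unit-cost machine\<close>

text \<open>Programs of a randomized RAM with finitely many integer variables and integer arrays.\<close>

datatype aexp =
    N int
  | V string
  | Read string aexp
  | Plus aexp aexp
  | Minus aexp aexp
  | Times aexp aexp
  | Div aexp aexp
  | Mod aexp aexp

datatype bexp =
    Less aexp aexp
  | Equal aexp aexp
  | Not bexp
  | And bexp bexp

datatype com =
    Skip
  | Assign string aexp
  | Store string aexp aexp
  | Random string aexp
  | Seq com com
  | If bexp com com
  | While bexp com

record state =
  vars :: "string \<Rightarrow> int"
  arrays :: "string \<Rightarrow> int \<Rightarrow> int"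
  clock :: nat

primrec aval :: "state \<Rightarrow> aexp \<Rightarrow> int" where
  "aval s (N k) = k"
| "aval s (V x) = vars s x"
| "aval s (Read a e) = arrays s a (aval s e)"
| "aval s (Plus e f) = aval s e + aval s f"
| "aval s (Minus e f) = aval s e - aval s f"
| "aval s (Times e f) = aval s e * aval s f"
| "aval s (Div e f) = aval s e div aval s f"
| "aval s (Mod e f) = aval s e mod aval s f"

primrec bval :: "state \<Rightarrow> bexp \<Rightarrow> bool" where
  "bval s (Less e f) \<longleftrightarrow> aval s e < aval s f"
| "bval s (Equal e f) \<longleftrightarrow> aval s e = aval s f"
| "bval s (Not b) \<longleftrightarrow> \<not> bval s b"
| "bval s (And b c) \<longleftrightarrow> bval s b \<and> bval s c"

definition tick :: "state \<Rightarrow> state" where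
  "tick s = s\<lparr>clock := Suc (clock s)\<rparr>"

definition set_var :: "string \<Rightarrow> int \<Rightarrow> state \<Rightarrow> state" where
  "set_var x v s = s\<lparr>vars := (vars s)(x := v)\<rparr>"

definition set_cell :: "string \<Rightarrow> int \<Rightarrow> int \<Rightarrow> state \<Rightarrow> state" where
  "set_cell a i v s = s\<lparr>arrays := (arrays s)(a := (arrays s a)(i := v))\<rparr>"

partial_function (spmf) loop :: "('s \<Rightarrow> bool) \<Rightarrow> ('s \<Rightarrow> 's spmf) \<Rightarrow> 's \<Rightarrow> 's spmf" where
  "loop b f s = (if b s then bind_spmf (f s) (loop b f) else return_spmf s)"

text \<open>The semantics is relative to a bound \<open>W\<close> on the absolute values of the addresses written,
  the values stored and the ranges of random choices. Exceeding it, or drawing from an empty range,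
  aborts the run, which like divergence puts the probability mass on \<open>None\<close>.

  The clock, which programs cannot read, counts the executed commands, each evaluation of a loop
  or branching condition included. A program contains only finitely many expressions, so up to a
  constant factor this is the number of elementary operations; and when \<open>W\<close> is polynomial in the
  input, so are the intermediate results of these expressions.\<close>

primrec exec :: "int \<Rightarrow> com \<Rightarrow> state \<Rightarrow> state spmf" where
  "exec W Skip = (\<lambda>s. return_spmf (tick s))"
| "exec W (Assign x e) = (\<lambda>s.
     if \<bar>aval s e\<bar> \<le> W then return_spmf (tick (set_var x (aval s e) s)) else return_pmf None)"
| "exec W (Store a i e) = (\<lambda>s.
     if \<bar>aval s i\<bar> \<le> W \<and> \<bar>aval s e\<bar> \<le> W
     then return_spmf (tick (set_cell a (aval s i) (aval s e) s)) else return_pmf None)"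
| "exec W (Random x e) = (\<lambda>s.
     if 0 < aval s e \<and> aval s e \<le> W
     then map_spmf (\<lambda>v. tick (set_var x v s)) (spmf_of_set {0..<aval s e})
     else return_pmf None)"
| "exec W (Seq c d) = (\<lambda>s. bind_spmf (exec W c s) (exec W d))"
| "exec W (If b c d) = (\<lambda>s. if bval s b then exec W c (tick s) else exec W d (tick s))"
| "exec W (While b c) = (\<lambda>s. loop (\<lambda>t. bval t b) (\<lambda>t. bind_spmf (exec W c t)
     (\<lambda>t'. return_spmf (tick t'))) (tick s))"

definition initial_state :: "nat \<Rightarrow> state" where
  "initial_state n =
     \<lparr>vars = (\<lambda>x. if x = ''n'' then int n else 0), arrays = (\<lambda>a i. 0), clock = 0\<rparr>"

text \<open>A single program, for all \<open>n \<ge> 2\<close>, produces an output with law \<open>law n\<close> in expected time at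
  most \<open>C * n\<close>, on integers of absolute value at most \<open>n ^ k\<close>; powers of \<open>n\<close> dominate all
  polynomials as \<open>n \<ge> 2\<close>. Losslessness says that almost surely the run terminates without
  abort, so that the integral, which extends over terminating runs only, is the expected time.\<close>

definition samples_in_linear_time ::
    "com \<Rightarrow> (nat \<Rightarrow> state \<Rightarrow> 'a) \<Rightarrow> (nat \<Rightarrow> 'a spmf) \<Rightarrow> bool" where
  "samples_in_linear_time c output law \<longleftrightarrow>
     (\<exists>k C :: nat. \<forall>n\<ge>2.
        let result = exec (int n ^ k) c (initial_state n) in
          lossless_spmf result \<and>
          map_spmf (output n) result = law n \<and>
          (\<integral>\<^sup>+ s. of_nat (clock s) \<partial>measure_spmf result) \<le> of_nat (C * n))"

definition output_permutation :: "nat \<Rightarrow> state \<Rightarrow> int \<Rightarrow> int" where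
  "output_permutation n s = (\<lambda>i. if i \<in> {1..int n} then arrays s ''out'' i else i)"

text \<open>The \<open>2 * n\<close> turnpoints are output by their coordinates in two arrays.\<close>

definition output_cycle :: "nat \<Rightarrow> state \<Rightarrow> (int \<times> int) list set" where
  "output_cycle n s = cyclic_class
     (map (\<lambda>j. (arrays s ''outx'' (int j), arrays s ''outy'' (int j))) [0..<2 * n])"

end

theory Submission
  imports Defs
begin

text \<open>Both samplers are rejection samplers that draw from the same set of codes. Call a column
  \<^emph>\<open>down\<close> or \<^emph>\<open>up\<close> and a row \<^emph>\<open>left\<close> or \<^emph>\<open>right\<close>; a code is a set \<open>D\<close> of down columns, a set \<open>L\<close>
  of left rows and a number \<open>a\<close>. It describes a permutation that consists of four monotone chains:
  the points in down columns and left rows descend, those in down columns and right rows ascend,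
  and so on around the square. Once it is known that there are \<open>a\<close> points in down columns and
  left rows, the position of every point is forced, because the row of a point has a rank that is an
  affine function of the rank of its column. So a code is decoded in linear time, by two
  passes over tables of ranks (\<open>decodes_unique\<close>, \<open>decodes_exists\<close>, \<open>chained_decodes\<close>).

  A square permutation gets a code when each point is labelled by one of its record types, with a
  fixed order of priority between these types (\<open>square_code\<close>). A convex permutomino is bounded by a
  lower and an upper lattice path; its turnpoints are recorded by the permutation that maps each
  column to the row on which the walk leaves this column, and by the set of columns in which it is
  the lower path that turns. Such pairs are the \<open>shapes\<close>, they are in bijection with the convex
  permutominoes (\<open>convex_permutominoes_eq\<close>, \<open>inj_shape_walk\<close>), and the left rows are those on the
  descending part of the lower path and on the ascending part of the upper one
  (\<open>shape_code\<close>). That every convex permutomino arises in this way rests on \<open>strip\<close>: between two neighbouring columns a convex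
  permutomino has exactly two horizontal edges.

  In either case the codes of objects are recognised in linear time: decode, and test in two scans
  whether the labels are the right ones. Accepting exactly these codes gives the uniform law on the
  objects, and the expected time is linear provided that the proportion of accepted codes is
  bounded below. This holds because for many sets \<open>D\<close> and \<open>L\<close> the ranks grow like \<open>i / 2\<close>, with an
  error that is a small fraction of \<open>n\<close>; together with \<open>a\<close> near \<open>n / 4\<close> this places the four chains
  close to the sides of the diamond whose vertices are the midpoints of the sides of the square, where
  all labels are right (\<open>balanced_accepted\<close>). A fourth moment estimate shows that a constant
  proportion of the sets is balanced in this sense (\<open>card_balanced\<close>).\<close>

section \<open>Rejection sampling\<close>

lemma nn_integral_bind_spmf:
  "(\<integral>\<^sup>+ y. h y \<partial>measure_spmf (bind_spmf p f)) = (\<integral>\<^sup>+ x. \<integral>\<^sup>+ y. h y \<partial>measure_spmf (f x) \<partial>measure_spmf p)"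
  unfolding measure_spmf_bind o_def
  by (rule nn_integral_bind[where B = "count_space UNIV"])
     (auto simp: space_subprob_algebra measurable_def)

text \<open>A distribution of total mass at most one that dominates a distribution of mass one pointwise has
  no room left to exceed it.\<close>

lemma spmf_eqI_lower_bound:
  assumes "lossless_spmf q" and le: "\<And>x. spmf q x \<le> spmf p x"
  shows "p = q"
proof -
  have ord: "ord_spmf (=) q p"
  proof (rule ord_pmf_increaseI)
    show "spmf q x \<le> spmf p x" for x by (rule le)
  qed auto
  have "pmf q None = 0" using assms(1) by (simp add: lossless_iff_pmf_None)
  moreover have "pmf p None \<le> pmf q None" by (rule ord_spmf_eqD_pmf_None[OF chain_empty ord])
  ultimately have "pmf q None = pmf p None" using pmf_nonneg[of p None] by linarith
  then show ?thesis using ord_spmf_eq_pmf_None_eq[OF chain_empty ord] by simp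
qed

text \<open>The loop body draws a uniform element of \<open>A\<close>, hidden in the state that it produces,
  and the loop goes on as long as this element misses \<open>G\<close>. The function
  \<open>g\<close> may depend on the state \<open>s\<close>: the clock and the contents of the
  arrays left over from rejected rounds vary, and only the invariant \<open>I\<close> survives
  from one round to the next.\<close>

locale rejection =
  fixes b :: "'s \<Rightarrow> bool" and f :: "'s \<Rightarrow> 's spmf" and I :: "'s \<Rightarrow> bool"
    and A G :: "'c set" and T :: "'s \<Rightarrow> nat" and K :: nat
    and out :: "'s \<Rightarrow> 'o" and h :: "'c \<Rightarrow> 'o"
  assumes fin: "finite A" and sub: "G \<subseteq> A" and ne: "G \<noteq> {}"
    and body: "\<And>s. I s \<Longrightarrow> b s \<Longrightarrow> \<exists>g. f s = map_spmf g (spmf_of_set A) \<and>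
      (\<forall>c\<in>A. I (g c) \<and> T (g c) \<le> T s + K \<and> (b (g c) \<longleftrightarrow> c \<notin> G) \<and> (c \<in> G \<longrightarrow> out (g c) = h c))"
begin

lemma finG: "finite G" using fin sub finite_subset by blast

lemma cards: "0 < card G" "card G \<le> card A" "card (A - G) = card A - card G"
  using fin sub ne finG by (auto simp: card_gt_0_iff card_mono card_Diff_subset)

lemma loop_halt: "\<not> b s \<Longrightarrow> loop b f s = return_spmf s"
  by (subst loop.simps) simp

lemma sum_split: "(\<Sum>c\<in>A. F c) = (\<Sum>c\<in>G. F c) + (\<Sum>c\<in>A - G. F c)" for F :: "'c \<Rightarrow> 'z::comm_monoid_add"
  using sum.subset_diff[OF sub fin, of F] by (simp add: add.commute)

text \<open>For a single initial state there is no recurrence, as every round starts from different states.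
  But the infimum \<open>m\<close> of the mass at \<open>o'\<close> over all states at the head of
  the loop satisfies a recursive inequality, because a rejected round leads to another such state,
  and this inequality already gives the bound.\<close>

lemma point_mass:
  assumes "I s" "b s"
  shows "spmf (map_spmf h (spmf_of_set G)) o' \<le> spmf (map_spmf out (loop b f s)) o'"
proof -
  define q where "q s = spmf (map_spmf out (loop b f s)) o'" for s
  define S where "S = {s. I s \<and> b s}"
  define m where "m = Inf (q ` S)"
  define \<gamma> where "\<gamma> = (\<Sum>c\<in>G. spmf (return_spmf (h c)) o')"
  have S: "S \<noteq> {}" using assms by (auto simp: S_def)
  have bdd: "bdd_below (q ` S)" by (rule bdd_belowI[of _ 0]) (auto simp: q_def)
  have step: "real (card A) * q s \<ge> \<gamma> + (real (card A) - card G) * m" if "s \<in> S" for s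
  proof -
    from that have s: "I s" "b s" by (auto simp: S_def)
    from body[OF s] obtain g where g: "f s = map_spmf g (spmf_of_set A)"
      and gc: "\<And>c. c \<in> A \<Longrightarrow> I (g c) \<and> (b (g c) \<longleftrightarrow> c \<notin> G) \<and> (c \<in> G \<longrightarrow> out (g c) = h c)" by blast
    have "map_spmf out (loop b f s) = bind_spmf (spmf_of_set A) (\<lambda>c. map_spmf out (loop b f (g c)))"
      using s by (subst loop.simps) (simp add: g map_spmf_bind_spmf bind_map_spmf o_def)
    then have "q s = (\<Sum>c\<in>A. q (g c)) / card A"
      by (simp add: q_def spmf_bind integral_spmf_of_set)
    then have "real (card A) * q s = (\<Sum>c\<in>A. q (g c))"
      using cards by simp
    also have "\<dots> = (\<Sum>c\<in>G. q (g c)) + (\<Sum>c\<in>A-G. q (g c))" by (rule sum_split)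
    also have "(\<Sum>c\<in>G. q (g c)) = \<gamma>"
      unfolding \<gamma>_def using gc sub by (intro sum.cong) (auto simp: q_def loop_halt subset_iff)
    finally have "real (card A) * q s = \<gamma> + (\<Sum>c\<in>A-G. q (g c))" .
    moreover have "(\<Sum>c\<in>A-G. q (g c)) \<ge> (\<Sum>c\<in>A-G. m)"
      using gc by (intro sum_mono) (auto simp: m_def S_def intro!: cINF_lower bdd[unfolded S_def])
    ultimately show ?thesis using cards by (simp add: of_nat_diff)
  qed
  \<comment> \<open>The right-hand side of the bound in \<open>step\<close> does not depend on
    the state, so it passes to the infimum.\<close>
  have "(\<gamma> + (real (card A) - card G) * m) / card A \<le> m"
    unfolding m_def
  proof (rule cINF_greatest[OF S])
    fix s assume "s \<in> S"
    from step[OF this] cards show "(\<gamma> + (real (card A) - card G) * Inf (q ` S)) / card A \<le> q s"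
      by (simp add: divide_simps m_def mult.commute)
  qed
  then have "\<gamma> / card G \<le> m" using cards by (simp add: divide_simps algebra_simps split: if_splits)
  also have "m \<le> q s" unfolding m_def using assms by (intro cINF_lower bdd) (auto simp: S_def)
  also have "\<gamma> / card G = spmf (map_spmf h (spmf_of_set G)) o'"
  proof -
    have "spmf (map_spmf h (spmf_of_set G)) o' = (\<Sum>c\<in>G. spmf (return_spmf (h c)) o') / card G"
      by (simp add: map_spmf_conv_bind_spmf spmf_bind integral_spmf_of_set del: bind_return_spmf)
    then show ?thesis by (simp only: \<gamma>_def)
  qed
  finally show ?thesis by (simp add: q_def)
qed

theorem law:
  assumes "I s" "b s"
  shows "map_spmf out (loop b f s) = map_spmf h (spmf_of_set G)"
  using point_mass[OF assms] ne finG by (intro spmf_eqI_lower_bound) auto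

theorem lossless:
  assumes "I s" "b s"
  shows "lossless_spmf (loop b f s)"
  using law[OF assms] ne finG lossless_map_spmf[of out] by fastforce

text \<open>The supremum \<open>m\<close> of the expected remaining times satisfies \<open>m \<le> K + (1 -
  card G / card A) * m\<close>. To solve this inequality for \<open>m\<close> one has to know that
  \<open>m\<close> is finite, which the truncation at \<open>B\<close> guarantees.\<close>

lemma truncated_time:
  assumes "I s" "b s"
  shows "(\<integral>\<^sup>+ t. of_nat (min (T t - T s) B) \<partial>measure_spmf (loop b f s)) \<le> of_nat K * of_nat (card A) / of_nat (card G)"
proof -
  define e where "e s = (\<integral>\<^sup>+ t. of_nat (min (T t - T s) B) \<partial>measure_spmf (loop b f s))" for s
  define S where "S = {s. I s \<and> b s}"
  define m where "m = (SUP s\<in>S. e s)"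
  have "e s \<le> of_nat B" for s
  proof -
    have "e s \<le> (\<integral>\<^sup>+ t. of_nat B \<partial>measure_spmf (loop b f s))"
      unfolding e_def by (intro nn_integral_mono) simp
    also have "\<dots> \<le> of_nat B * 1"
      unfolding nn_integral_const by (intro mult_left_mono measure_spmf.emeasure_space_le_1) auto
    finally show ?thesis by simp
  qed
  then have mB: "m \<le> of_nat B" unfolding m_def by (intro SUP_least)
  then have fin_m: "m < top" using ennreal_of_nat_neq_top[of B] by (auto simp: less_top[symmetric] top_unique)
  have step: "of_nat (card A) * e s \<le> of_nat (card A) * of_nat K + of_nat (card A - card G) * m" if "s \<in> S" for s
  proof -
    from that have s: "I s" "b s" by (auto simp: S_def)
    from body[OF s] obtain g where g: "f s = map_spmf g (spmf_of_set A)"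
      and gc: "\<And>c. c \<in> A \<Longrightarrow> I (g c) \<and> T (g c) \<le> T s + K \<and> (b (g c) \<longleftrightarrow> c \<notin> G)" by blast
    have lp: "loop b f s = bind_spmf (spmf_of_set A) (\<lambda>c. loop b f (g c))"
      using s by (subst loop.simps) (simp add: g bind_map_spmf o_def)
    let ?E = "\<lambda>c. \<integral>\<^sup>+ t. of_nat (min (T t - T s) B) \<partial>measure_spmf (loop b f (g c))"
    have "e s = (\<Sum>c\<in>A. ?E c) / of_nat (card A)"
      by (simp add: e_def lp nn_integral_bind_spmf nn_integral_spmf_of_set)
    then have "of_nat (card A) * e s = (\<Sum>c\<in>A. ?E c)"
      using cards ennreal_mult_divide_eq[of "of_nat (card A)" "\<Sum>c\<in>A. ?E c"] by (simp add: ennreal_times_divide mult.commute)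
    also have "\<dots> = (\<Sum>c\<in>G. ?E c) + (\<Sum>c\<in>A-G. ?E c)" by (rule sum_split)
    also have "\<dots> \<le> (\<Sum>c\<in>G. of_nat K) + (\<Sum>c\<in>A-G. of_nat K + m)"
    proof (intro add_mono sum_mono)
      fix c assume c: "c \<in> G"
      then have "\<not> b (g c)" and "T (g c) \<le> T s + K" using gc sub by auto
      then have "?E c = of_nat (min (T (g c) - T s) B)"
        by (simp add: loop_halt measure_spmf_return_spmf nn_integral_return)
      also have "\<dots> \<le> of_nat K" using \<open>T (g c) \<le> T s + K\<close> by (intro of_nat_mono) linarith
      finally show "?E c \<le> of_nat K" .
    next
      fix c assume c: "c \<in> A - G"
      then have "g c \<in> S" and Tg: "T (g c) \<le> T s + K" using gc by (auto simp: S_def)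
      have "?E c \<le> (\<integral>\<^sup>+ t. of_nat K + of_nat (min (T t - T (g c)) B) \<partial>measure_spmf (loop b f (g c)))"
      proof (rule nn_integral_mono)
        fix t
        have "min (T t - T s) B \<le> K + min (T t - T (g c)) B" using Tg by linarith
        then show "of_nat (min (T t - T s) B) \<le> (of_nat K + of_nat (min (T t - T (g c)) B) :: ennreal)"
          by (metis of_nat_add of_nat_mono)
      qed
      also have "\<dots> = (\<integral>\<^sup>+ t. of_nat K \<partial>measure_spmf (loop b f (g c))) + e (g c)"
        unfolding e_def by (rule nn_integral_add) auto
      also have "\<dots> \<le> of_nat K * 1 + m"
        unfolding nn_integral_const m_def using \<open>g c \<in> S\<close>
        by (intro add_mono mult_left_mono SUP_upper measure_spmf.emeasure_space_le_1) auto
      finally show "?E c \<le> of_nat K + m" by simp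
    qed
    also have "\<dots> = of_nat (card A) * of_nat K + of_nat (card A - card G) * m"
      using cards by (simp add: distrib_left add.assoc[symmetric] flip: of_nat_mult of_nat_add distrib_right)
    finally show ?thesis .
  qed
  have "of_nat (card A) * m \<le> of_nat (card A) * of_nat K + of_nat (card A - card G) * m"
  proof -
    have "of_nat (card A) * m = (SUP s\<in>S. of_nat (card A) * e s)"
      unfolding m_def by (rule SUP_mult_left_ennreal)
    also have "\<dots> \<le> of_nat (card A) * of_nat K + of_nat (card A - card G) * m"
      by (rule SUP_least) (rule step)
    finally show ?thesis .
  qed
  moreover obtain r where r: "m = ennreal r" "r \<ge> 0" using fin_m by (cases m) auto
  ultimately have "real (card A) * r \<le> real (card A) * K + real (card A - card G) * r"
    by (simp add: ennreal_of_nat_eq_real_of_nat flip: ennreal_mult ennreal_plus)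
  then have "real (card G) * r \<le> real K * real (card A)"
    using cards by (simp add: of_nat_diff algebra_simps)
  then have "r \<le> real K * real (card A) / real (card G)" using cards by (simp add: field_simps)
  then have "m \<le> of_nat K * of_nat (card A) / of_nat (card G)"
    using cards r by (simp add: ennreal_of_nat_eq_real_of_nat divide_ennreal flip: ennreal_mult)
  moreover have "e s \<le> m" unfolding m_def using assms by (intro SUP_upper) (auto simp: S_def)
  ultimately show ?thesis by (simp add: e_def)
qed

theorem expected_time:
  assumes "I s" "b s"
  shows "(\<integral>\<^sup>+ t. of_nat (T t) \<partial>measure_spmf (loop b f s)) \<le> of_nat (T s) + of_nat K * of_nat (card A) / of_nat (card G)"
proof -
  let ?M = "measure_spmf (loop b f s)"
  have sup: "(SUP B. of_nat (min n B)) = (of_nat n :: ennreal)" for n :: nat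
    by (intro antisym SUP_least SUP_upper2[of n]) auto
  have "(\<integral>\<^sup>+ t. of_nat (T t) \<partial>?M) \<le> (\<integral>\<^sup>+ t. of_nat (T s) + of_nat (T t - T s) \<partial>?M)"
    by (intro nn_integral_mono) (simp add: le_add_diff_inverse of_nat_mono flip: of_nat_add)
  also have "\<dots> = (\<integral>\<^sup>+ t. of_nat (T s) \<partial>?M) + (\<integral>\<^sup>+ t. of_nat (T t - T s) \<partial>?M)"
    by (rule nn_integral_add) auto
  also have "(\<integral>\<^sup>+ t. of_nat (T t - T s) \<partial>?M) = (\<integral>\<^sup>+ t. (SUP B. of_nat (min (T t - T s) B)) \<partial>?M)"
    by (simp add: sup)
  also have "\<dots> = (SUP B. \<integral>\<^sup>+ t. of_nat (min (T t - T s) B) \<partial>?M)"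
    by (rule nn_integral_monotone_convergence_SUP) (auto simp: incseq_def le_fun_def)
  also have "\<dots> \<le> of_nat K * of_nat (card A) / of_nat (card G)"
    using truncated_time[OF assms] by (rule SUP_least)
  also have "(\<integral>\<^sup>+ t. of_nat (T s) \<partial>?M) \<le> of_nat (T s) * 1"
    unfolding nn_integral_const by (intro mult_left_mono measure_spmf.emeasure_space_le_1) auto
  finally show ?thesis by simp
qed

end

section \<open>Reasoning about programs\<close>

lemma state_simps [simp]:
  "vars (tick s) = vars s" "arrays (tick s) = arrays s" "clock (tick s) = Suc (clock s)"
  "vars (set_var x v s) = (vars s)(x := v)" "arrays (set_var x v s) = arrays s" "clock (set_var x v s) = clock s"
  "vars (set_cell a i v s) = vars s" "arrays (set_cell a i v s) = (arrays s)(a := (arrays s a)(i := v))"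
  "clock (set_cell a i v s) = clock s"
  by (simp_all add: tick_def set_var_def set_cell_def)

text \<open>Total correctness of programs that behave deterministically from the given state.\<close>

definition ok :: "int \<Rightarrow> com \<Rightarrow> (state \<Rightarrow> bool) \<Rightarrow> state \<Rightarrow> bool" where
  "ok W c Q s \<longleftrightarrow> (\<exists>s'. exec W c s = return_spmf s' \<and> Q s')"

lemma ok_Skip [simp]: "ok W Skip Q s = Q (tick s)"
  by (auto simp: ok_def)

lemma ok_Assign [simp]: "\<bar>aval s e\<bar> \<le> W \<Longrightarrow> ok W (Assign x e) Q s = Q (tick (set_var x (aval s e) s))"
  by (auto simp: ok_def)

lemma ok_Store [simp]: "\<bar>aval s i\<bar> \<le> W \<Longrightarrow> \<bar>aval s e\<bar> \<le> W \<Longrightarrow>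
    ok W (Store a i e) Q s = Q (tick (set_cell a (aval s i) (aval s e) s))"
  by (auto simp: ok_def)

lemma ok_If [simp]: "ok W (If b c d) Q s = (if bval s b then ok W c Q (tick s) else ok W d Q (tick s))"
  by (auto simp: ok_def)

lemma ok_SeqI: "ok W c (ok W d Q) s \<Longrightarrow> ok W (Seq c d) Q s"
  by (auto simp: ok_def)

lemma ok_mono: "ok W c P s \<Longrightarrow> (\<And>t. P t \<Longrightarrow> Q t) \<Longrightarrow> ok W c Q s"
  by (auto simp: ok_def)

lemma ok_While:
  fixes m :: "state \<Rightarrow> nat"
  assumes "I (tick s)"
    and step: "\<And>t. I t \<Longrightarrow> bval t b \<Longrightarrow> ok W c (\<lambda>t'. I (tick t') \<and> m (tick t') < m t) t"
    and halt: "\<And>t. I t \<Longrightarrow> \<not> bval t b \<Longrightarrow> Q t"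
  shows "ok W (While b c) Q s"
proof -
  let ?loop = "loop (\<lambda>t. bval t b) (\<lambda>t. bind_spmf (exec W c t) (\<lambda>t'. return_spmf (tick t')))"
  have "\<exists>t'. ?loop t = return_spmf t' \<and> Q t'" if "I t" for t
    using that
  proof (induction "m t" arbitrary: t rule: less_induct)
    case less
    show ?case
    proof (cases "bval t b")
      case False
      then show ?thesis using halt[OF less.prems] by (subst loop.simps) auto
    next
      case True
      from step[OF less.prems True] obtain t' where t': "exec W c t = return_spmf t'"
        "I (tick t')" "m (tick t') < m t" by (auto simp: ok_def)
      from less.hyps[OF t'(3,2)] show ?thesis using True t'(1) by (subst loop.simps) simp
    qed
  qed
  with assms(1) show ?thesis by (simp add: ok_def)
qed

text \<open>A randomized program, analysed as a deterministic one whose random choices have been made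
  beforehand: the final state is a function of a uniform element of \<open>A\<close>.\<close>

definition draws :: "int \<Rightarrow> com \<Rightarrow> 'a set \<Rightarrow> ('a \<Rightarrow> state \<Rightarrow> bool) \<Rightarrow> state \<Rightarrow> bool" where
  "draws W c A P s \<longleftrightarrow> (\<exists>g. exec W c s = map_spmf g (spmf_of_set A) \<and> (\<forall>a\<in>A. P a (g a)))"

lemma bind_spmf_of_set_map:
  assumes "finite A" "finite B"
  shows "bind_spmf (spmf_of_set A) (\<lambda>a. map_spmf (g a) (spmf_of_set B)) = map_spmf (\<lambda>(a, b). g a b) (spmf_of_set (A \<times> B))"
proof (rule spmf_eqI)
  fix i
  have "spmf (bind_spmf (spmf_of_set A) (\<lambda>a. map_spmf (g a) (spmf_of_set B))) i
      = (\<Sum>a\<in>A. spmf (map_spmf (g a) (spmf_of_set B)) i) / card A"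
    by (simp only: spmf_bind integral_spmf_of_set)
  also have "\<dots> = (\<Sum>a\<in>A. (\<Sum>b\<in>B. spmf (return_spmf (g a b)) i) / card B) / card A"
    by (simp only: map_spmf_conv_bind_spmf spmf_bind integral_spmf_of_set)
  also have "\<dots> = (\<Sum>(a, b)\<in>A \<times> B. spmf (return_spmf (g a b)) i) / card (A \<times> B)"
    by (simp only: sum.cartesian_product card_cartesian_product sum_divide_distrib[symmetric] of_nat_mult
         divide_divide_eq_left' mult.commute)
  also have "\<dots> = spmf (map_spmf (\<lambda>(a, b). g a b) (spmf_of_set (A \<times> B))) i"
    by (simp only: map_spmf_conv_bind_spmf spmf_bind integral_spmf_of_set case_prod_unfold)
  finally show "spmf (bind_spmf (spmf_of_set A) (\<lambda>a. map_spmf (g a) (spmf_of_set B))) i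
     = spmf (map_spmf (\<lambda>(a, b). g a b) (spmf_of_set (A \<times> B))) i" .
qed

lemma draws_ok:
  assumes "draws W c A P s" and "\<And>a t. a \<in> A \<Longrightarrow> P a t \<Longrightarrow> ok W d (Q a) t"
  shows "draws W (Seq c d) A Q s"
proof -
  from assms(1) obtain g where g: "exec W c s = map_spmf g (spmf_of_set A)" "\<forall>a\<in>A. P a (g a)"
    by (auto simp: draws_def)
  then have "\<forall>a\<in>A. \<exists>t. exec W d (g a) = return_spmf t \<and> Q a t"
    using assms(2) by (auto simp: ok_def)
  then obtain h where h: "\<And>a. a \<in> A \<Longrightarrow> exec W d (g a) = return_spmf (h a) \<and> Q a (h a)" by metis
  have "exec W (Seq c d) s = bind_spmf (spmf_of_set A) (\<lambda>a. exec W d (g a))"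
    by (simp add: g bind_map_spmf o_def)
  also have "\<dots> = bind_spmf (spmf_of_set A) (\<lambda>a. return_spmf (h a))"
    using h by (intro bind_spmf_cong) (auto simp: set_spmf_of_set split: if_splits)
  finally show ?thesis using h unfolding draws_def by (auto simp: map_spmf_conv_bind_spmf)
qed

lemma ok_draws: "ok W c (draws W d A P) s \<Longrightarrow> draws W (Seq c d) A P s"
  by (auto simp: ok_def draws_def)

lemma draws_Random:
  assumes "0 < aval s e" "aval s e \<le> W" "\<And>v. 0 \<le> v \<Longrightarrow> v < aval s e \<Longrightarrow> P v (tick (set_var x v s))"
  shows "draws W (Random x e) {0..<aval s e} P s"
  using assms by (auto simp: draws_def)

text \<open>Independent uniform choices from \<open>A\<close> and \<open>B\<close> amount to one uniform
  choice from any set \<open>C\<close> that \<open>f\<close> parametrizes bijectively by \<open>A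
  \<times> B\<close>.\<close>

lemma bind_product:
  assumes "finite A" "finite B" "bij_betw (\<lambda>(a, b). f a b) (A \<times> B) C"
    and "\<And>a. a \<in> A \<Longrightarrow> \<exists>h. F a = map_spmf h (spmf_of_set B) \<and> (\<forall>b\<in>B. Q (f a b) (h b))"
  shows "\<exists>g. bind_spmf (spmf_of_set A) F = map_spmf g (spmf_of_set C) \<and> (\<forall>c\<in>C. Q c (g c))"
proof -
  obtain h where h: "\<And>a. a \<in> A \<Longrightarrow> F a = map_spmf (h a) (spmf_of_set B) \<and> (\<forall>b\<in>B. Q (f a b) (h a b))"
    using assms(4) by metis
  let ?f = "\<lambda>(a, b). f a b"
  let ?i = "inv_into (A \<times> B) ?f"
  have inj: "inj_on ?f (A \<times> B)" and C: "?f ` (A \<times> B) = C" using assms(3) by (auto simp: bij_betw_def)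
  have "bind_spmf (spmf_of_set A) F = bind_spmf (spmf_of_set A) (\<lambda>a. map_spmf (h a) (spmf_of_set B))"
    using h assms(1) by (intro bind_spmf_cong) auto
  also have "\<dots> = map_spmf (\<lambda>(a, b). h a b) (spmf_of_set (A \<times> B))"
    by (rule bind_spmf_of_set_map) fact+
  also have "spmf_of_set (A \<times> B) = map_spmf ?i (spmf_of_set C)"
    using inj_on_inv_into[of C ?f "A \<times> B"] C inj by (auto simp: inv_into_image_cancel)
  finally have "bind_spmf (spmf_of_set A) F = map_spmf ((\<lambda>(a, b). h a b) \<circ> ?i) (spmf_of_set C)"
    by (simp add: spmf.map_comp)
  moreover have "Q c (((\<lambda>(a, b). h a b) \<circ> ?i) c)" if "c \<in> C" for c
  proof -
    from that C obtain a b where ab: "a \<in> A" "b \<in> B" "c = f a b" by auto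
    then have "?i c = (a, b)" using inv_into_f_f[OF inj, of "(a, b)"] by simp
    then show ?thesis using h ab by auto
  qed
  ultimately show ?thesis by blast
qed

lemma draws_Seq:
  assumes "draws W c A P s" "finite A" "finite B" "bij_betw (\<lambda>(a, b). f a b) (A \<times> B) C"
    and "\<And>a t. a \<in> A \<Longrightarrow> P a t \<Longrightarrow> draws W d B (\<lambda>b. Q (f a b)) t"
  shows "draws W (Seq c d) C Q s"
proof -
  from assms(1) obtain g where g: "exec W c s = map_spmf g (spmf_of_set A)" "\<forall>a\<in>A. P a (g a)"
    by (auto simp: draws_def)
  have "\<exists>k. bind_spmf (spmf_of_set A) (\<lambda>a. exec W d (g a)) = map_spmf k (spmf_of_set C) \<and> (\<forall>c\<in>C. Q c (k c))"
    by (rule bind_product[OF assms(2-4)]) (use assms(5) g(2) in \<open>auto simp: draws_def\<close>)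
  then show ?thesis by (auto simp: draws_def g bind_map_spmf o_def)
qed

text \<open>A loop with a fixed number of rounds, each of which extends the choice made so far: after
  \<open>k\<close> rounds this is a uniform element of \<open>A k\<close>.\<close>

lemma draws_While:
  fixes N :: nat
  assumes fin: "\<And>k. finite (A k)" "finite B" and A0: "A 0 = {a0}" and I0: "I 0 a0 (tick s)"
    and step: "\<And>k a t. k < N \<Longrightarrow> a \<in> A k \<Longrightarrow> I k a t \<Longrightarrow> bval t b \<and> draws W c B (\<lambda>v t'. I (Suc k) (f k a v) (tick t')) t"
    and bij: "\<And>k. k < N \<Longrightarrow> bij_betw (\<lambda>(a, v). f k a v) (A k \<times> B) (A (Suc k))"
    and halt: "\<And>a t. a \<in> A N \<Longrightarrow> I N a t \<Longrightarrow> \<not> bval t b"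
  shows "draws W (While b c) (A N) (I N) s"
proof -
  let ?f = "\<lambda>t. bind_spmf (exec W c t) (\<lambda>t'. return_spmf (tick t'))"
  let ?loop = "loop (\<lambda>t. bval t b) ?f"
  have "\<exists>g. ?loop (tick s) = bind_spmf (spmf_of_set (A k)) (\<lambda>a. ?loop (g a)) \<and> (\<forall>a\<in>A k. I k a (g a))"
    if "k \<le> N" for k using that
  proof (induction k)
    case 0
    show ?case by (rule exI[of _ "\<lambda>_. tick s"]) (simp add: A0 I0 spmf_of_set_singleton)
  next
    case (Suc k)
    then obtain g where g: "?loop (tick s) = bind_spmf (spmf_of_set (A k)) (\<lambda>a. ?loop (g a))"
      "\<forall>a\<in>A k. I k a (g a)" by auto
    have "\<exists>h. bind_spmf (spmf_of_set (A k)) (\<lambda>a. ?f (g a)) = map_spmf h (spmf_of_set (A (Suc k))) \<and>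
       (\<forall>a\<in>A (Suc k). I (Suc k) a (h a))"
    proof (rule bind_product[OF fin bij])
      show "k < N" using Suc.prems by simp
      fix a assume a: "a \<in> A k"
      with step[OF _ a] g(2) Suc.prems have "draws W c B (\<lambda>v t'. I (Suc k) (f k a v) (tick t')) (g a)" by auto
      then obtain h where "exec W c (g a) = map_spmf h (spmf_of_set B)" "\<forall>v\<in>B. I (Suc k) (f k a v) (tick (h v))"
        by (auto simp: draws_def)
      then show "\<exists>h. ?f (g a) = map_spmf h (spmf_of_set B) \<and> (\<forall>v\<in>B. I (Suc k) (f k a v) (h v))"
        by (intro exI[of _ "\<lambda>v. tick (h v)"]) (auto simp: bind_map_spmf o_def map_spmf_conv_bind_spmf)
    qed
    then obtain h where h: "bind_spmf (spmf_of_set (A k)) (\<lambda>a. ?f (g a)) = map_spmf h (spmf_of_set (A (Suc k)))"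
       "\<forall>a\<in>A (Suc k). I (Suc k) a (h a)" by auto
    have "?loop (tick s) = bind_spmf (spmf_of_set (A k)) (\<lambda>a. bind_spmf (?f (g a)) ?loop)"
      unfolding g(1)
    proof (rule bind_spmf_cong[OF refl])
      fix a assume "a \<in> set_spmf (spmf_of_set (A k))"
      then have "bval (g a) b" using step[of k a "g a"] g(2) fin Suc.prems by auto
      then show "?loop (g a) = bind_spmf (?f (g a)) ?loop" by (subst loop.simps) simp
    qed
    also have "\<dots> = bind_spmf (map_spmf h (spmf_of_set (A (Suc k)))) ?loop"
      by (simp only: h(1)[symmetric] bind_spmf_assoc)
    finally show ?case using h(2) by (intro exI[of _ h]) (auto simp: bind_map_spmf o_def)
  qed
  from this[of N] obtain g where g: "?loop (tick s) = bind_spmf (spmf_of_set (A N)) (\<lambda>a. ?loop (g a))"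
      "\<forall>a\<in>A N. I N a (g a)" by auto
  have "bind_spmf (spmf_of_set (A N)) (\<lambda>a. ?loop (g a)) = bind_spmf (spmf_of_set (A N)) (\<lambda>a. return_spmf (g a))"
  proof (rule bind_spmf_cong[OF refl])
    fix a assume "a \<in> set_spmf (spmf_of_set (A N))"
    then have "\<not> bval (g a) b" using halt g(2) fin by auto
    then show "?loop (g a) = return_spmf (g a)" by (subst loop.simps) simp
  qed
  with g show ?thesis by (auto simp: draws_def map_spmf_conv_bind_spmf)
qed

section \<open>Ranks and decoding\<close>

definition rk :: "int set \<Rightarrow> int \<Rightarrow> int" where
  "rk A i = int (card (A \<inter> {1..i}))"

lemma rk_0 [simp]: "rk A 0 = 0"
  by (simp add: rk_def)

lemma rk_Suc: "0 \<le> i \<Longrightarrow> rk A (i + 1) = rk A i + (if i + 1 \<in> A then 1 else 0)"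
proof -
  assume i: "0 \<le> i"
  have "A \<inter> {1..i+1} = (if i + 1 \<in> A then insert (i+1) (A \<inter> {1..i}) else A \<inter> {1..i})"
    using i by auto (metis add_le_cancel_right atLeastAtMost_iff zle_add1_eq_le order_le_less)+
  then show ?thesis by (simp add: rk_def)
qed

lemma rk_mono: "i \<le> j \<Longrightarrow> rk A i \<le> rk A j"
  unfolding rk_def by (intro of_nat_mono card_mono) auto

lemma rk_strict: "i < j \<Longrightarrow> j \<in> A \<Longrightarrow> 1 \<le> j \<Longrightarrow> rk A i < rk A j"
proof -
  assume *: "i < j" "j \<in> A" "1 \<le> j"
  then have "j \<in> A \<inter> {1..j}" "j \<notin> A \<inter> {1..i}" "A \<inter> {1..i} \<subseteq> A \<inter> {1..j}" by auto
  then have "A \<inter> {1..i} \<subset> A \<inter> {1..j}" by blast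
  then show ?thesis unfolding rk_def of_nat_less_iff by (intro psubset_card_mono) auto
qed

lemma rk_less_iff: "i \<in> A \<Longrightarrow> j \<in> A \<Longrightarrow> 1 \<le> i \<Longrightarrow> 1 \<le> j \<Longrightarrow> rk A i < rk A j \<longleftrightarrow> i < j"
  by (meson leD linorder_le_less_linear rk_mono rk_strict)

lemma rk_le_iff: "i \<in> A \<Longrightarrow> j \<in> A \<Longrightarrow> 1 \<le> i \<Longrightarrow> 1 \<le> j \<Longrightarrow> rk A i \<le> rk A j \<longleftrightarrow> i \<le> j"
  by (meson leD linorder_le_less_linear rk_mono rk_strict)

lemma rk_inj: "i \<in> A \<Longrightarrow> j \<in> A \<Longrightarrow> 1 \<le> i \<Longrightarrow> 1 \<le> j \<Longrightarrow> rk A i = rk A j \<Longrightarrow> i = j"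
  by (metis antisym order.refl rk_le_iff)

lemma inj_on_rk: "B \<subseteq> A \<inter> {1..} \<Longrightarrow> inj_on (rk A) B"
  using rk_inj[of _ A] by (intro inj_onI) (meson IntD1 IntD2 atLeast_iff subsetD)

lemma rk_nonneg [simp]: "0 \<le> rk A i"
  by (simp add: rk_def)

lemma rk_pos: "i \<in> A \<Longrightarrow> 1 \<le> i \<Longrightarrow> 1 \<le> rk A i"
  using rk_strict[of 0 i A] by simp

lemma rk_le: "0 \<le> i \<Longrightarrow> rk A i \<le> i"
  using card_mono[of "{1..i}" "A \<inter> {1..i}"] by (simp add: rk_def)

lemma rk_compl:
  assumes "0 \<le> i" "i \<le> n"
  shows "rk ({1..n} - A) i = i - rk A i"
proof -
  have "({1..n} - A) \<inter> {1..i} = {1..i} - A \<inter> {1..i}" using assms by auto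
  then show ?thesis using assms card_mono[of "{1..i}" "A \<inter> {1..i}"]
    by (simp add: rk_def card_Diff_subset of_nat_diff)
qed

lemma rk_surj:
  assumes "1 \<le> r" "r \<le> rk A n" "0 \<le> n"
  obtains i where "i \<in> A" "1 \<le> i" "i \<le> n" "rk A i = r"
proof -
  let ?B = "A \<inter> {1..n}"
  have "inj_on (rk A) ?B" by (rule inj_on_rk) auto
  then have "card (rk A ` ?B) = card ?B" by (rule card_image)
  moreover have "rk A ` ?B \<subseteq> {1..rk A n}" using rk_pos[of _ A] rk_mono[of _ n A] by fastforce
  ultimately have "rk A ` ?B = {1..rk A n}"
    by (intro card_subset_eq) (auto simp: rk_def)
  moreover have "r \<in> {1..rk A n}" using assms by simp
  ultimately have "r \<in> rk A ` ?B" by simp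
  then obtain i where "i \<in> ?B" "r = rk A i" by (rule imageE)
  then show thesis using that[of i] by simp
qed

text \<open>The four cases are the four chains. The first \<open>a\<close> down columns carry the first
  \<open>a\<close> left rows in opposite order; the later down columns carry the right rows from
  the bottom up; the left rows beyond the first \<open>a\<close> are carried by the up columns
  from left to right; and the remaining up columns, of which the last one comes first, carry the
  right rows that remain, whence the total \<open>n + 1 - a\<close>.\<close>

definition decodes :: "int \<Rightarrow> int set \<times> int set \<times> int \<Rightarrow> (int \<Rightarrow> int) \<Rightarrow> bool" where
  "decodes n = (\<lambda>(D, L, a) \<sigma>. \<forall>i\<in>{1..n}. \<sigma> i \<in> {1..n} \<and>
     (if i \<in> D
      then if \<sigma> i \<in> L then rk D i + rk L (\<sigma> i) = a + 1 else rk D i = a + rk ({1..n} - L) (\<sigma> i)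
      else if \<sigma> i \<in> L then rk L (\<sigma> i) = a + rk ({1..n} - D) i
      else rk ({1..n} - D) i + rk ({1..n} - L) (\<sigma> i) = n + 1 - a))"

text \<open>The first four conditions say that each of the four classes of points is monotone. The last four
  say how neighbouring chains meet: in the down columns the left rows come first, and so on.\<close>

definition chained :: "int \<Rightarrow> int set \<Rightarrow> int set \<Rightarrow> (int \<Rightarrow> int) \<Rightarrow> bool" where
  "chained n D L \<sigma> \<longleftrightarrow> (\<forall>i\<in>{1..n}. \<forall>j\<in>{1..n}.
     (i \<in> D \<longrightarrow> j \<in> D \<longrightarrow> \<sigma> i \<in> L \<longrightarrow> \<sigma> j \<in> L \<longrightarrow> i < j \<longrightarrow> \<sigma> j < \<sigma> i) \<and>
     (i \<in> D \<longrightarrow> j \<in> D \<longrightarrow> \<sigma> i \<notin> L \<longrightarrow> \<sigma> j \<notin> L \<longrightarrow> i < j \<longrightarrow> \<sigma> i < \<sigma> j) \<and>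
     (i \<notin> D \<longrightarrow> j \<notin> D \<longrightarrow> \<sigma> i \<in> L \<longrightarrow> \<sigma> j \<in> L \<longrightarrow> i < j \<longrightarrow> \<sigma> i < \<sigma> j) \<and>
     (i \<notin> D \<longrightarrow> j \<notin> D \<longrightarrow> \<sigma> i \<notin> L \<longrightarrow> \<sigma> j \<notin> L \<longrightarrow> i < j \<longrightarrow> \<sigma> j < \<sigma> i) \<and>
     (i \<in> D \<longrightarrow> j \<in> D \<longrightarrow> \<sigma> i \<in> L \<longrightarrow> \<sigma> j \<notin> L \<longrightarrow> i < j) \<and>
     (i \<notin> D \<longrightarrow> j \<notin> D \<longrightarrow> \<sigma> i \<in> L \<longrightarrow> \<sigma> j \<notin> L \<longrightarrow> i < j) \<and>
     (i \<in> D \<longrightarrow> j \<notin> D \<longrightarrow> \<sigma> i \<in> L \<longrightarrow> \<sigma> j \<in> L \<longrightarrow> \<sigma> i < \<sigma> j) \<and>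
     (i \<in> D \<longrightarrow> j \<notin> D \<longrightarrow> \<sigma> i \<notin> L \<longrightarrow> \<sigma> j \<notin> L \<longrightarrow> \<sigma> i < \<sigma> j))"

text \<open>All four chains have a nonnegative length, and the chain of down columns and left rows is not
  empty. The lengths are \<open>a\<close>, \<open>rk D n - a\<close>, \<open>rk L n - a\<close>
  and \<open>n + a - rk D n - rk L n\<close>.\<close>

definition in_range :: "int \<Rightarrow> int set \<times> int set \<times> int \<Rightarrow> bool" where
  "in_range n = (\<lambda>(D, L, a). 1 \<le> a \<and> a \<le> rk D n \<and> a \<le> rk L n \<and> rk D n + rk L n \<le> n + a)"

text \<open>Were the rows \<open>\<sigma> i\<close> and \<open>\<tau> i\<close> of different kinds, then the
  two equations for their ranks would add up to a left rank and a right rank of total more than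
  \<open>n\<close>, or one of these ranks would not be positive.\<close>

lemma decodes_unique:
  assumes "decodes n (D, L, a) \<sigma>" "decodes n (D, L, a) \<tau>" "i \<in> {1..n}"
  shows "\<sigma> i = \<tau> i"
proof -
  have n: "0 \<le> n" using assms(3) by auto
  note * = assms(1,2)[unfolded decodes_def split, rule_format, OF assms(3)]
  have L: "rk L j + rk ({1..n} - L) k \<le> n" if "j \<in> {1..n}" "k \<in> {1..n}" for j k
  proof -
    have "rk L j \<le> rk L n" "rk ({1..n} - L) k \<le> rk ({1..n} - L) n" using that by (auto intro: rk_mono)
    then show ?thesis using rk_compl[of n n L] n by simp
  qed
  have pos: "1 \<le> rk L j" if "j \<in> L" "j \<in> {1..n}" for j using rk_pos[of j L] that by auto
  have pos': "1 \<le> rk ({1..n} - L) j" if "j \<notin> L" "j \<in> {1..n}" for j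
    using rk_pos[of j "{1..n} - L"] that by auto
  have inj: "j = k" if "j \<in> L" "k \<in> L" "rk L j = rk L k" "j \<in> {1..n}" "k \<in> {1..n}" for j k
    using rk_inj[of j L k] that by auto
  have inj': "j = k" if "j \<notin> L" "k \<notin> L" "rk ({1..n} - L) j = rk ({1..n} - L) k" "j \<in> {1..n}" "k \<in> {1..n}" for j k
    using rk_inj[of j "{1..n} - L" k] that by auto
  show ?thesis
    using * L[of "\<sigma> i" "\<tau> i"] L[of "\<tau> i" "\<sigma> i"] pos[of "\<sigma> i"] pos[of "\<tau> i"] pos'[of "\<sigma> i"] pos'[of "\<tau> i"]
    by (cases "\<sigma> i \<in> L"; cases "\<tau> i \<in> L"; cases "i \<in> D") (auto intro: inj inj')
qed

lemma decodes_chained: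
  assumes dec: "decodes n (D, L, a) \<sigma>"
  shows "chained n D L \<sigma>"
  unfolding chained_def
proof (intro ballI)
  fix i j assume ij: "i \<in> {1..n}" "j \<in> {1..n}"
  then have n: "0 \<le> n" by auto
  let ?D = "{1..n} - D" and ?L = "{1..n} - L"
  note di = dec[unfolded decodes_def split, rule_format, OF ij(1)]
  note dj = dec[unfolded decodes_def split, rule_format, OF ij(2)]
  have L: "rk L (\<sigma> i) + rk ?L (\<sigma> j) \<le> n"
  proof -
    have "rk L (\<sigma> i) \<le> rk L n" "rk ?L (\<sigma> j) \<le> rk ?L n" using di dj by (auto intro: rk_mono)
    then show ?thesis using rk_compl[of n n L] n by simp
  qed
  have 1: "rk D i < rk D j \<longleftrightarrow> i < j" if "i \<in> D" "j \<in> D" using that ij by (simp add: rk_less_iff)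
  have 2: "rk ?D i < rk ?D j \<longleftrightarrow> i < j" if "i \<notin> D" "j \<notin> D" using that ij by (simp add: rk_less_iff)
  have 3: "rk L (\<sigma> i) < rk L (\<sigma> j) \<longleftrightarrow> \<sigma> i < \<sigma> j" if "\<sigma> i \<in> L" "\<sigma> j \<in> L" using that di dj by (simp add: rk_less_iff)
  have 4: "rk ?L (\<sigma> i) < rk ?L (\<sigma> j) \<longleftrightarrow> \<sigma> i < \<sigma> j" if "\<sigma> i \<notin> L" "\<sigma> j \<notin> L" using that di dj by (simp add: rk_less_iff)
  have 5: "rk L (\<sigma> j) < rk L (\<sigma> i) \<longleftrightarrow> \<sigma> j < \<sigma> i" if "\<sigma> i \<in> L" "\<sigma> j \<in> L" using that di dj by (simp add: rk_less_iff)
  have 6: "rk ?L (\<sigma> j) < rk ?L (\<sigma> i) \<longleftrightarrow> \<sigma> j < \<sigma> i" if "\<sigma> i \<notin> L" "\<sigma> j \<notin> L" using that di dj by (simp add: rk_less_iff)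
  have p: "1 \<le> rk L (\<sigma> i)" if "\<sigma> i \<in> L" using that di by (simp add: rk_pos)
  have p': "1 \<le> rk ?L (\<sigma> j)" if "\<sigma> j \<notin> L" using that dj by (simp add: rk_pos)
  have d: "1 \<le> rk D i" if "i \<in> D" using that ij by (simp add: rk_pos)
  have d': "1 \<le> rk ?D j" if "j \<notin> D" using that ij by (simp add: rk_pos)
  have total: "rk D i + rk ?D j \<le> n"
  proof -
    have "rk D i \<le> rk D n" "rk ?D j \<le> rk ?D n" using ij by (auto intro: rk_mono)
    then show ?thesis using rk_compl[of n n D] n by simp
  qed
  show "(i \<in> D \<longrightarrow> j \<in> D \<longrightarrow> \<sigma> i \<in> L \<longrightarrow> \<sigma> j \<in> L \<longrightarrow> i < j \<longrightarrow> \<sigma> j < \<sigma> i) \<and>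
     (i \<in> D \<longrightarrow> j \<in> D \<longrightarrow> \<sigma> i \<notin> L \<longrightarrow> \<sigma> j \<notin> L \<longrightarrow> i < j \<longrightarrow> \<sigma> i < \<sigma> j) \<and>
     (i \<notin> D \<longrightarrow> j \<notin> D \<longrightarrow> \<sigma> i \<in> L \<longrightarrow> \<sigma> j \<in> L \<longrightarrow> i < j \<longrightarrow> \<sigma> i < \<sigma> j) \<and>
     (i \<notin> D \<longrightarrow> j \<notin> D \<longrightarrow> \<sigma> i \<notin> L \<longrightarrow> \<sigma> j \<notin> L \<longrightarrow> i < j \<longrightarrow> \<sigma> j < \<sigma> i) \<and>
     (i \<in> D \<longrightarrow> j \<in> D \<longrightarrow> \<sigma> i \<in> L \<longrightarrow> \<sigma> j \<notin> L \<longrightarrow> i < j) \<and>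
     (i \<notin> D \<longrightarrow> j \<notin> D \<longrightarrow> \<sigma> i \<in> L \<longrightarrow> \<sigma> j \<notin> L \<longrightarrow> i < j) \<and>
     (i \<in> D \<longrightarrow> j \<notin> D \<longrightarrow> \<sigma> i \<in> L \<longrightarrow> \<sigma> j \<in> L \<longrightarrow> \<sigma> i < \<sigma> j) \<and>
     (i \<in> D \<longrightarrow> j \<notin> D \<longrightarrow> \<sigma> i \<notin> L \<longrightarrow> \<sigma> j \<notin> L \<longrightarrow> \<sigma> i < \<sigma> j)"
    using di dj L total
    by (intro conjI impI)
       (simp_all flip: 1 2 3 4 5 6, (smt (verit) p p' d d' 1 2)+)
qed

lemma decodes_inj:
  assumes dec: "decodes n (D, L, a) \<sigma>"
  shows "inj_on \<sigma> {1..n}"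
proof (rule inj_onI)
  fix i j assume ij: "i \<in> {1..n}" "j \<in> {1..n}" and eq: "\<sigma> i = \<sigma> j"
  let ?D = "{1..n} - D" and ?L = "{1..n} - L"
  note di = dec[unfolded decodes_def split, rule_format, OF ij(1)]
  note dj = dec[unfolded decodes_def split, rule_format, OF ij(2)]
  have n: "0 \<le> n" using ij by auto
  have tot: "rk D k + rk ?D k' \<le> n" if "k \<in> {1..n}" "k' \<in> {1..n}" for k k'
  proof -
    have "rk D k \<le> rk D n" "rk ?D k' \<le> rk ?D n" using that by (auto intro: rk_mono)
    then show ?thesis using rk_compl[of n n D] n by simp
  qed
  have d: "1 \<le> rk D k" if "k \<in> D" "k \<in> {1..n}" for k using that by (simp add: rk_pos)
  have d': "1 \<le> rk ?D k" if "k \<notin> D" "k \<in> {1..n}" for k using that by (simp add: rk_pos)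
  have e1: "i = j" if "i \<in> D" "j \<in> D" "rk D i = rk D j" using rk_inj[of i D j] that ij by auto
  have e2: "i = j" if "i \<notin> D" "j \<notin> D" "rk ?D i = rk ?D j" using rk_inj[of i ?D j] that ij by auto
  show "i = j"
    using di dj eq tot[OF ij] tot[OF ij(2,1)] d[of i] d[of j] d'[of i] d'[of j] ij
    by (cases "i \<in> D"; cases "j \<in> D"; cases "\<sigma> j \<in> L") (auto intro: e1 e2)
qed

text \<open>The rank that the equation prescribes for the row of a column can be realised because the lengths
  of the chains are consistent.\<close>

lemma decodes_exists:
  assumes rng: "in_range n (D, L, a)" and n: "0 \<le> n"
  shows "\<exists>\<sigma>. decodes n (D, L, a) \<sigma>"
proof -
  let ?D = "{1..n} - D" and ?L = "{1..n} - L"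
  have "\<exists>j\<in>{1..n}.
      (if i \<in> D
      then if j \<in> L then rk D i + rk L j = a + 1 else rk D i = a + rk ?L j
      else if j \<in> L then rk L j = a + rk ?D i
      else rk ?D i + rk ?L j = n + 1 - a)" if i: "i \<in> {1..n}" for i
  proof -
    have b: "rk D i \<le> rk D n" "rk ?D i \<le> n - rk D n" "rk ?L n = n - rk L n"
      using i rk_compl[of n n D] rk_compl[of n n L] rk_mono[of i n ?D] by (auto intro: rk_mono)
    have p: "i \<in> D \<Longrightarrow> 1 \<le> rk D i" "i \<notin> D \<Longrightarrow> 1 \<le> rk ?D i" using i by (auto intro: rk_pos)
    note r = rng[unfolded in_range_def split]
    consider "i \<in> D" "rk D i \<le> a" | "i \<in> D" "a < rk D i" | "i \<notin> D" "a + rk ?D i \<le> rk L n" | "i \<notin> D" "rk L n < a + rk ?D i"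
      by linarith
    then show ?thesis
    proof cases
      case 1
      then obtain j where "j \<in> L" "1 \<le> j" "j \<le> n" "rk L j = a + 1 - rk D i"
        using rk_surj[of "a + 1 - rk D i" L n] r p n by (smt (verit))
      then show ?thesis using 1 by (intro bexI[of _ j]) auto
    next
      case 2
      then obtain j where "j \<in> ?L" "1 \<le> j" "j \<le> n" "rk ?L j = rk D i - a"
        using rk_surj[of "rk D i - a" ?L n] r p b n by (smt (verit))
      then show ?thesis using 2 by (intro bexI[of _ j]) auto
    next
      case 3
      then obtain j where "j \<in> L" "1 \<le> j" "j \<le> n" "rk L j = a + rk ?D i"
        using rk_surj[of "a + rk ?D i" L n] r p n by (smt (verit))
      then show ?thesis using 3 by (intro bexI[of _ j]) auto
    next
      case 4
      then obtain j where "j \<in> ?L" "1 \<le> j" "j \<le> n" "rk ?L j = n + 1 - a - rk ?D i"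
        using rk_surj[of "n + 1 - a - rk ?D i" ?L n] r p b n by (smt (verit))
      then show ?thesis using 4 by (intro bexI[of _ j]) auto
    qed
  qed
  then obtain \<sigma> where "\<forall>i\<in>{1..n}. \<sigma> i \<in> {1..n} \<and>
      (if i \<in> D
      then if \<sigma> i \<in> L then rk D i + rk L (\<sigma> i) = a + 1 else rk D i = a + rk ?L (\<sigma> i)
      else if \<sigma> i \<in> L then rk L (\<sigma> i) = a + rk ?D i
      else rk ?D i + rk ?L (\<sigma> i) = n + 1 - a)" by metis
  then show ?thesis unfolding decodes_def by blast
qed

lemma card_left_down:
  assumes dec: "decodes n (D, L, a) \<sigma>" and "0 \<le> a" "a \<le> rk D n" "0 \<le> n"
  shows "int (card {i\<in>{1..n}. i \<in> D \<and> \<sigma> i \<in> L}) = a"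
proof -
  let ?B = "{i\<in>{1..n}. i \<in> D \<and> \<sigma> i \<in> L}"
  have "rk D ` ?B = {1..a}"
  proof
    show "rk D ` ?B \<subseteq> {1..a}"
    proof (clarsimp, intro conjI)
      fix i assume i: "1 \<le> i" "i \<le> n" "i \<in> D" "\<sigma> i \<in> L"
      then show "1 \<le> rk D i" by (simp add: rk_pos)
      from dec i have "rk D i + rk L (\<sigma> i) = a + 1" "\<sigma> i \<ge> 1" unfolding decodes_def by auto
      then show "rk D i \<le> a" using rk_pos[of "\<sigma> i" L] i by linarith
    qed
    show "{1..a} \<subseteq> rk D ` ?B"
    proof
      fix r assume r: "r \<in> {1..a}"
      then obtain i where i: "i \<in> D" "1 \<le> i" "i \<le> n" "rk D i = r"
        using rk_surj[of r D n] assms by auto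
      have "\<sigma> i \<in> L"
      proof (rule ccontr)
        assume "\<sigma> i \<notin> L"
        then have "rk D i = a + rk ({1..n} - L) (\<sigma> i)" "\<sigma> i \<in> {1..n}" using dec i unfolding decodes_def by auto
        moreover have "1 \<le> rk ({1..n} - L) (\<sigma> i)" using \<open>\<sigma> i \<notin> L\<close> calculation(2) by (intro rk_pos) auto
        ultimately show False using r i by auto
      qed
      then show "r \<in> rk D ` ?B" using i by auto
    qed
  qed
  moreover have "inj_on (rk D) ?B" by (rule inj_on_rk) auto
  ultimately have "card ?B = card {1..a}" using card_image[of "rk D" ?B] by simp
  then show ?thesis using assms by simp
qed

text \<open>The rank of a column counts the points to the left of it in columns of the same kind. By the
  conditions on chains these are exactly the points of its own chain that precede it, and possibly
  all points of the neighbouring chain. The same holds for rows, so that the ranks of the row and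
  of the column of a point are related by the length of a chain.\<close>

lemma chained_decodes:
  assumes bij: "bij_betw \<sigma> {1..n} {1..n}" and ch: "chained n D L \<sigma>"
    and a: "a = int (card {i\<in>{1..n}. i \<in> D \<and> \<sigma> i \<in> L})"
  shows "decodes n (D, L, a) \<sigma>" and "1 \<le> a \<Longrightarrow> 0 \<le> n \<Longrightarrow> in_range n (D, L, a)"
proof -
  let ?D = "{1..n} - D" and ?L = "{1..n} - L"
  define c where "c P = int (card {i\<in>{1..n}. P i})" for P :: "int \<Rightarrow> bool"
  have inj: "\<sigma> i = \<sigma> j \<longleftrightarrow> i = j" if "i \<in> {1..n}" "j \<in> {1..n}" for i j
    using bij that by (auto simp: bij_betw_def inj_on_eq_iff)
  have rng: "\<sigma> i \<in> {1..n}" if "i \<in> {1..n}" for i using bij that by (auto simp: bij_betw_def)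
  have cong: "c P = c Q" if "\<And>i. i \<in> {1..n} \<Longrightarrow> P i = Q i" for P Q
    unfolding c_def using that by (metis (mono_tags, lifting) Collect_cong)
  have part: "c P = c (\<lambda>i. P i \<and> Q i) + c (\<lambda>i. P i \<and> \<not> Q i)" for P Q
  proof -
    have "{i\<in>{1..n}. P i} = {i\<in>{1..n}. P i \<and> Q i} \<union> {i\<in>{1..n}. P i \<and> \<not> Q i}" by auto
    moreover have "card (\<dots>) = card {i\<in>{1..n}. P i \<and> Q i} + card {i\<in>{1..n}. P i \<and> \<not> Q i}"
      by (rule card_Un_disjoint) (auto intro: finite_subset[of _ "{1..n}"])
    ultimately show ?thesis by (simp add: c_def)
  qed
  have rD: "rk D i = c (\<lambda>k. k \<in> D \<and> k \<le> i)" if "i \<in> {1..n}" for i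
    unfolding rk_def c_def using that by (intro arg_cong[of _ _ "\<lambda>A. int (card A)"]) auto
  have rD': "rk ?D i = c (\<lambda>k. k \<notin> D \<and> k \<le> i)" if "i \<in> {1..n}" for i
    unfolding rk_def c_def using that by (intro arg_cong[of _ _ "\<lambda>A. int (card A)"]) auto
  have im: "card {k\<in>{1..n}. P (\<sigma> k)} = card {j\<in>{1..n}. P j}" for P
  proof -
    have "\<sigma> ` {k\<in>{1..n}. P (\<sigma> k)} = {j\<in>\<sigma> ` {1..n}. P j}" by blast
    then have "\<sigma> ` {k\<in>{1..n}. P (\<sigma> k)} = {j\<in>{1..n}. P j}" using bij by (simp only: bij_betw_def)
    moreover have "inj_on \<sigma> {k\<in>{1..n}. P (\<sigma> k)}" using bij by (auto simp: bij_betw_def inj_on_def)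
    ultimately show ?thesis by (metis card_image)
  qed
  have rL: "rk L j = c (\<lambda>k. \<sigma> k \<in> L \<and> \<sigma> k \<le> j)" if "j \<in> {1..n}" for j
    unfolding c_def im[of "\<lambda>k. k \<in> L \<and> k \<le> j"] rk_def using that
    by (intro arg_cong[of _ _ "\<lambda>A. int (card A)"]) auto
  have rL': "rk ?L j = c (\<lambda>k. \<sigma> k \<notin> L \<and> \<sigma> k \<le> j)" if "j \<in> {1..n}" for j
    unfolding c_def im[of "\<lambda>k. k \<notin> L \<and> k \<le> j"] rk_def using that
    by (intro arg_cong[of _ _ "\<lambda>A. int (card A)"]) auto
  have a': "a = c (\<lambda>k. k \<in> D \<and> \<sigma> k \<in> L)" by (simp add: a c_def)
  have one: "c (\<lambda>k. P k \<and> k \<le> i) + c (\<lambda>k. P k \<and> i \<le> k) = c P + 1" if "i \<in> {1..n}" "P i" for P i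
  proof -
    have "c (\<lambda>k. P k \<and> i \<le> k) = c (\<lambda>k. (P k \<and> i \<le> k) \<and> k = i) + c (\<lambda>k. (P k \<and> i \<le> k) \<and> k \<noteq> i)" by (rule part)
    also have "c (\<lambda>k. (P k \<and> i \<le> k) \<and> k = i) = 1"
    proof -
      have "{k\<in>{1..n}. (P k \<and> i \<le> k) \<and> k = i} = {i}" using that by auto
      then show ?thesis by (simp add: c_def)
    qed
    also have "c (\<lambda>k. (P k \<and> i \<le> k) \<and> k \<noteq> i) = c (\<lambda>k. P k \<and> \<not> k \<le> i)" by (rule cong) auto
    finally show ?thesis using part[of P "\<lambda>k. k \<le> i"] by simp
  qed
  have total: "c (\<lambda>k. True) = n" if "i \<in> {1..n}" for i
  proof -
    have "{k\<in>{1..n}. True} = {1..n}" by auto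
    then show ?thesis using that by (simp only: c_def) simp
  qed
  note chd = ch[unfolded chained_def, rule_format]
  have ord: "\<sigma> k \<le> \<sigma> i \<longleftrightarrow> k = i \<or> \<sigma> k < \<sigma> i" if "i \<in> {1..n}" "k \<in> {1..n}" for i k
    using inj[OF that] by force
  show "decodes n (D, L, a) \<sigma>"
    unfolding decodes_def split
  proof (intro ballI conjI)
    fix i assume i: "i \<in> {1..n}"
    then show "\<sigma> i \<in> {1..n}" by (rule rng)
    note r = rD[OF i] rD'[OF i] rL[OF rng[OF i]] rL'[OF rng[OF i]]
    note H = chd[OF _ i] chd[OF i]
    show "if i \<in> D
      then if \<sigma> i \<in> L then rk D i + rk L (\<sigma> i) = a + 1 else rk D i = a + rk ?L (\<sigma> i)
      else if \<sigma> i \<in> L then rk L (\<sigma> i) = a + rk ?D i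
      else rk ?D i + rk ?L (\<sigma> i) = n + 1 - a"
    proof (cases "i \<in> D"; cases "\<sigma> i \<in> L")
      assume t: "i \<in> D" "\<sigma> i \<in> L"
      have "rk D i = c (\<lambda>k. (k \<in> D \<and> \<sigma> k \<in> L) \<and> k \<le> i)"
        unfolding r by (rule cong) (use H t in force)
      moreover have "rk L (\<sigma> i) = c (\<lambda>k. (k \<in> D \<and> \<sigma> k \<in> L) \<and> i \<le> k)"
        unfolding r by (rule cong) (use H t inj[OF i] in \<open>smt (verit)\<close>)
      ultimately show ?thesis using t a' one[OF i, of "\<lambda>k. k \<in> D \<and> \<sigma> k \<in> L"] by simp
    next
      assume t: "i \<in> D" "\<sigma> i \<notin> L"
      have "rk D i = c (\<lambda>k. (k \<in> D \<and> k \<le> i) \<and> \<sigma> k \<in> L) + c (\<lambda>k. (k \<in> D \<and> k \<le> i) \<and> \<sigma> k \<notin> L)"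
        unfolding r by (rule part)
      also have "c (\<lambda>k. (k \<in> D \<and> k \<le> i) \<and> \<sigma> k \<in> L) = a"
        unfolding a' by (rule cong) (use H t in force)
      also have "c (\<lambda>k. (k \<in> D \<and> k \<le> i) \<and> \<sigma> k \<notin> L) = rk ?L (\<sigma> i)"
        unfolding r by (rule cong) (use H t inj[OF i] in \<open>smt (verit)\<close>)
      finally show ?thesis using t by simp
    next
      assume t: "i \<notin> D" "\<sigma> i \<in> L"
      have "rk L (\<sigma> i) = c (\<lambda>k. (\<sigma> k \<in> L \<and> \<sigma> k \<le> \<sigma> i) \<and> k \<in> D) + c (\<lambda>k. (\<sigma> k \<in> L \<and> \<sigma> k \<le> \<sigma> i) \<and> k \<notin> D)"
        unfolding r by (rule part)
      also have "c (\<lambda>k. (\<sigma> k \<in> L \<and> \<sigma> k \<le> \<sigma> i) \<and> k \<in> D) = a"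
        unfolding a' by (rule cong) (use H t in force)
      also have "c (\<lambda>k. (\<sigma> k \<in> L \<and> \<sigma> k \<le> \<sigma> i) \<and> k \<notin> D) = rk ?D i"
        unfolding r by (rule cong) (use H t inj[OF i] in \<open>smt (verit)\<close>)
      finally show ?thesis using t by simp
    next
      assume t: "i \<notin> D" "\<sigma> i \<notin> L"
      have "rk ?D i = c (\<lambda>k. (k \<notin> D \<and> k \<le> i) \<and> \<sigma> k \<in> L) + c (\<lambda>k. (k \<notin> D \<and> k \<le> i) \<and> \<sigma> k \<notin> L)"
        unfolding r by (rule part)
      also have "c (\<lambda>k. (k \<notin> D \<and> k \<le> i) \<and> \<sigma> k \<in> L) = c (\<lambda>k. k \<notin> D \<and> \<sigma> k \<in> L)"
        by (rule cong) (use H t in force)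
      also have "c (\<lambda>k. (k \<notin> D \<and> k \<le> i) \<and> \<sigma> k \<notin> L) = c (\<lambda>k. (k \<notin> D \<and> \<sigma> k \<notin> L) \<and> k \<le> i)" by (rule cong) auto
      finally have 1: "rk ?D i = c (\<lambda>k. k \<notin> D \<and> \<sigma> k \<in> L) + c (\<lambda>k. (k \<notin> D \<and> \<sigma> k \<notin> L) \<and> k \<le> i)" .
      have "rk ?L (\<sigma> i) = c (\<lambda>k. (\<sigma> k \<notin> L \<and> \<sigma> k \<le> \<sigma> i) \<and> k \<in> D) + c (\<lambda>k. (\<sigma> k \<notin> L \<and> \<sigma> k \<le> \<sigma> i) \<and> k \<notin> D)"
        unfolding r by (rule part)
      also have "c (\<lambda>k. (\<sigma> k \<notin> L \<and> \<sigma> k \<le> \<sigma> i) \<and> k \<in> D) = c (\<lambda>k. k \<in> D \<and> \<sigma> k \<notin> L)"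
        by (rule cong) (use H t in force)
      also have "c (\<lambda>k. (\<sigma> k \<notin> L \<and> \<sigma> k \<le> \<sigma> i) \<and> k \<notin> D) = c (\<lambda>k. (k \<notin> D \<and> \<sigma> k \<notin> L) \<and> i \<le> k)"
        by (rule cong) (use H t inj[OF i] in \<open>smt (verit)\<close>)
      finally have 2: "rk ?L (\<sigma> i) = c (\<lambda>k. k \<in> D \<and> \<sigma> k \<notin> L) + c (\<lambda>k. (k \<notin> D \<and> \<sigma> k \<notin> L) \<and> i \<le> k)" .
      have "c (\<lambda>k. True) = c (\<lambda>k. True \<and> k \<in> D) + c (\<lambda>k. True \<and> k \<notin> D)" by (rule part)
      moreover have "c (\<lambda>k. True \<and> k \<in> D) = c (\<lambda>k. k \<in> D \<and> \<sigma> k \<in> L) + c (\<lambda>k. k \<in> D \<and> \<sigma> k \<notin> L)"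
        using part[of "\<lambda>k. k \<in> D" "\<lambda>k. \<sigma> k \<in> L"] by simp
      moreover have "c (\<lambda>k. True \<and> k \<notin> D) = c (\<lambda>k. k \<notin> D \<and> \<sigma> k \<in> L) + c (\<lambda>k. k \<notin> D \<and> \<sigma> k \<notin> L)"
        using part[of "\<lambda>k. k \<notin> D" "\<lambda>k. \<sigma> k \<in> L"] by simp
      ultimately show ?thesis using t 1 2 a' one[OF i, of "\<lambda>k. k \<notin> D \<and> \<sigma> k \<notin> L"] total[OF i] by simp
    qed
  qed
  show "in_range n (D, L, a)" if a1: "1 \<le> a" and n: "0 \<le> n"
  proof -
    have "n \<noteq> 0" using a1 a by (intro notI) simp
    then have nn: "n \<in> {1..n}" using n by simp
    have "rk D n = c (\<lambda>k. k \<in> D)" unfolding rD[OF nn] by (rule cong) auto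
    also have "\<dots> = a + c (\<lambda>k. k \<in> D \<and> \<sigma> k \<notin> L)" unfolding a' by (rule part)
    finally have 1: "rk D n = a + c (\<lambda>k. k \<in> D \<and> \<sigma> k \<notin> L)" .
    have "rk L n = c (\<lambda>k. \<sigma> k \<in> L)" unfolding rL[OF nn] by (rule cong) (use rng in auto)
    also have "\<dots> = c (\<lambda>k. \<sigma> k \<in> L \<and> k \<in> D) + c (\<lambda>k. \<sigma> k \<in> L \<and> k \<notin> D)" by (rule part)
    also have "c (\<lambda>k. \<sigma> k \<in> L \<and> k \<in> D) = a" unfolding a' by (rule cong) auto
    finally have 2: "rk L n = a + c (\<lambda>k. \<sigma> k \<in> L \<and> k \<notin> D)" .
    have "n - rk D n = rk ?D n" using rk_compl[of n n D] n by simp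
    also have "\<dots> = c (\<lambda>k. k \<notin> D)" unfolding rD'[OF nn] by (rule cong) auto
    also have "\<dots> = c (\<lambda>k. k \<notin> D \<and> \<sigma> k \<in> L) + c (\<lambda>k. k \<notin> D \<and> \<sigma> k \<notin> L)" by (rule part)
    also have "c (\<lambda>k. k \<notin> D \<and> \<sigma> k \<in> L) = c (\<lambda>k. \<sigma> k \<in> L \<and> k \<notin> D)" by (rule cong) auto
    finally have 3: "n - rk D n = c (\<lambda>k. \<sigma> k \<in> L \<and> k \<notin> D) + c (\<lambda>k. k \<notin> D \<and> \<sigma> k \<notin> L)" .
    have "0 \<le> c P" for P by (simp add: c_def)
    with 1 2 3 a1 show ?thesis unfolding in_range_def split by (smt (verit))
  qed
qed

section \<open>Codes of square permutations\<close>

definition codes :: "nat \<Rightarrow> (int set \<times> int set \<times> int) set" where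
  "codes n = Pow {1..int n} \<times> Pow {1..int n} \<times> {1..int n}"

text \<open>The record types of the point in column \<open>i\<close> of the graph of \<open>\<sigma>\<close>: bottom-left, upper-left,
  bottom-right and upper-right.\<close>

definition bl :: "int \<Rightarrow> (int \<Rightarrow> int) \<Rightarrow> int \<Rightarrow> bool" where
  "bl n \<sigma> i \<longleftrightarrow> (\<forall>j\<in>{1..n}. j < i \<longrightarrow> \<sigma> i \<le> \<sigma> j)"

definition ul :: "int \<Rightarrow> (int \<Rightarrow> int) \<Rightarrow> int \<Rightarrow> bool" where
  "ul n \<sigma> i \<longleftrightarrow> (\<forall>j\<in>{1..n}. j < i \<longrightarrow> \<sigma> j \<le> \<sigma> i)"

definition br :: "int \<Rightarrow> (int \<Rightarrow> int) \<Rightarrow> int \<Rightarrow> bool" where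
  "br n \<sigma> i \<longleftrightarrow> (\<forall>j\<in>{1..n}. i < j \<longrightarrow> \<sigma> i \<le> \<sigma> j)"

definition ur :: "int \<Rightarrow> (int \<Rightarrow> int) \<Rightarrow> int \<Rightarrow> bool" where
  "ur n \<sigma> i \<longleftrightarrow> (\<forall>j\<in>{1..n}. i < j \<longrightarrow> \<sigma> j \<le> \<sigma> i)"

lemma square_permutations_iff:
  "\<sigma> \<in> square_permutations n \<longleftrightarrow> \<sigma> permutes {1..int n} \<and>
     (\<forall>i\<in>{1..int n}. bl n \<sigma> i \<or> ur n \<sigma> i \<or> ul n \<sigma> i \<or> br n \<sigma> i)"
proof -
  let ?S = "{(i, \<sigma> i) |i. i \<in> {1..int n}}"
  have "exterior ?S (i, \<sigma> i) \<longleftrightarrow> bl n \<sigma> i \<or> ur n \<sigma> i \<or> ul n \<sigma> i \<or> br n \<sigma> i" for i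
  proof -
    have "bottom_left_record ?S (i, \<sigma> i) = bl n \<sigma> i" "upper_right_record ?S (i, \<sigma> i) = ur n \<sigma> i"
      "upper_left_record ?S (i, \<sigma> i) = ul n \<sigma> i" "bottom_right_record ?S (i, \<sigma> i) = br n \<sigma> i"
      unfolding bottom_left_record_def upper_right_record_def upper_left_record_def bottom_right_record_def
        bl_def ur_def ul_def br_def by force+
    then show ?thesis by (auto simp: exterior_def)
  qed
  then show ?thesis unfolding square_permutations_def no_interior_point_def by auto
qed

text \<open>Every exterior point is given one of its record types, where bottom-left takes precedence over
  upper-right, upper-right over upper-left, and upper-left over bottom-right. The columns of
  bottom records are down, and the rows of left records are left. With this order of priority the classes
  form chains in the sense of \<open>chained\<close>.\<close>

definition down :: "int \<Rightarrow> (int \<Rightarrow> int) \<Rightarrow> int \<Rightarrow> bool" where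
  "down n \<sigma> i \<longleftrightarrow> bl n \<sigma> i \<or> \<not> ur n \<sigma> i \<and> \<not> ul n \<sigma> i"

definition left :: "int \<Rightarrow> (int \<Rightarrow> int) \<Rightarrow> int \<Rightarrow> bool" where
  "left n \<sigma> i \<longleftrightarrow> bl n \<sigma> i \<or> \<not> ur n \<sigma> i \<and> ul n \<sigma> i"

definition square_code :: "nat \<Rightarrow> (int \<Rightarrow> int) \<Rightarrow> int set \<times> int set \<times> int" where
  "square_code n \<sigma> = ({i\<in>{1..int n}. down n \<sigma> i}, \<sigma> ` {i\<in>{1..int n}. left n \<sigma> i},
     int (card {i\<in>{1..int n}. bl n \<sigma> i}))"

text \<open>What remains to be tested on a decoded code: the labels that the code assigns to the points are
  those that the points deserve.\<close>

definition square_ok :: "int \<Rightarrow> int set \<Rightarrow> int set \<Rightarrow> (int \<Rightarrow> int) \<Rightarrow> bool" where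
  "square_ok n D L \<sigma> \<longleftrightarrow> (\<forall>i\<in>{1..n}. (bl n \<sigma> i \<or> ur n \<sigma> i \<or> ul n \<sigma> i \<or> br n \<sigma> i) \<and>
     (i \<in> D \<longleftrightarrow> down n \<sigma> i) \<and> (\<sigma> i \<in> L \<longleftrightarrow> left n \<sigma> i))"

text \<open>Points of the same record type are monotone. For the order between neighbouring chains, say a
  bottom-left point \<open>i\<close> and a bottom-right point \<open>j\<close> that is not a
  bottom-left record: some point lies to the left of and below \<open>j\<close>, and if
  \<open>j\<close> were to the left of \<open>i\<close>, then \<open>i\<close> would show that
  \<open>j\<close> is too high.\<close>

lemma square_ok_chained:
  assumes inj: "inj_on \<sigma> {1..n}" and ok: "square_ok n D L \<sigma>"
  shows "chained n D L \<sigma>"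
  unfolding chained_def
proof (intro ballI)
  fix i j assume i: "i \<in> {1..n}" and j: "j \<in> {1..n}"
  have ne: "\<sigma> i = \<sigma> j \<longleftrightarrow> i = j" using inj i j by (simp add: inj_on_eq_iff)
  have t: "k \<in> D \<longleftrightarrow> bl n \<sigma> k \<or> \<not> ur n \<sigma> k \<and> \<not> ul n \<sigma> k" "\<sigma> k \<in> L \<longleftrightarrow> bl n \<sigma> k \<or> \<not> ur n \<sigma> k \<and> ul n \<sigma> k"
     "bl n \<sigma> k \<or> ur n \<sigma> k \<or> ul n \<sigma> k \<or> br n \<sigma> k" if "k \<in> {1..n}" for k
    using ok that unfolding square_ok_def down_def left_def by auto
  have ur2: "\<not> ur n \<sigma> k \<Longrightarrow> \<exists>m\<in>{1..n}. k < m \<and> \<sigma> k < \<sigma> m" for k by (auto simp: ur_def not_le)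
  have bl2: "\<not> bl n \<sigma> k \<Longrightarrow> \<exists>m\<in>{1..n}. m < k \<and> \<sigma> m < \<sigma> k" for k by (auto simp: bl_def not_le)
  have bl1: "bl n \<sigma> k \<Longrightarrow> m \<in> {1..n} \<Longrightarrow> m < k \<Longrightarrow> \<sigma> k \<le> \<sigma> m" for k m by (auto simp: bl_def)
  have ur1: "ur n \<sigma> k \<Longrightarrow> m \<in> {1..n} \<Longrightarrow> k < m \<Longrightarrow> \<sigma> m \<le> \<sigma> k" for k m by (auto simp: ur_def)
  have ul1: "ul n \<sigma> k \<Longrightarrow> m \<in> {1..n} \<Longrightarrow> m < k \<Longrightarrow> \<sigma> m \<le> \<sigma> k" for k m by (auto simp: ul_def)
  have br1: "br n \<sigma> k \<Longrightarrow> m \<in> {1..n} \<Longrightarrow> k < m \<Longrightarrow> \<sigma> k \<le> \<sigma> m" for k m by (auto simp: br_def)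
  consider "bl n \<sigma> i" | "\<not> bl n \<sigma> i" "ur n \<sigma> i" | "\<not> bl n \<sigma> i" "\<not> ur n \<sigma> i" "ul n \<sigma> i"
    | "\<not> bl n \<sigma> i" "\<not> ur n \<sigma> i" "\<not> ul n \<sigma> i" "br n \<sigma> i" using t[OF i] by blast
  note ci = this
  consider "bl n \<sigma> j" | "\<not> bl n \<sigma> j" "ur n \<sigma> j" | "\<not> bl n \<sigma> j" "\<not> ur n \<sigma> j" "ul n \<sigma> j"
    | "\<not> bl n \<sigma> j" "\<not> ur n \<sigma> j" "\<not> ul n \<sigma> j" "br n \<sigma> j" using t[OF j] by blast
  note cj = this
  note ti = t(1,2)[OF i] t(1,2)[OF j]
  have A: "\<sigma> j < \<sigma> i" if "bl n \<sigma> j" "i < j" using bl1[of j i] that i ne by force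
  have B: "\<sigma> i < \<sigma> j" if "br n \<sigma> i" "i < j" using br1[of i j] that j ne by force
  have C: "\<sigma> i < \<sigma> j" if "ul n \<sigma> j" "i < j" using ul1[of j i] that i ne by force
  have E: "\<sigma> j < \<sigma> i" if "ur n \<sigma> i" "i < j" using ur1[of i j] that j ne by force
  have F: "i < j" if h: "bl n \<sigma> i" "\<not> bl n \<sigma> j" "br n \<sigma> j"
  proof (rule ccontr)
    assume "\<not> i < j"
    then have "j < i" using that by (cases "i = j") auto
    moreover obtain m where "m \<in> {1..n}" "m < j" "\<sigma> m < \<sigma> j" using bl2[OF h(2)] by auto
    ultimately show False using bl1[OF that(1), of m] br1[OF that(3), of i] i by simp
  qed
  have G: "i < j" if h: "ul n \<sigma> i" "\<not> ur n \<sigma> i" "ur n \<sigma> j"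
  proof (rule ccontr)
    assume "\<not> i < j"
    then have ji: "j < i" using that by (cases "i = j") auto
    obtain m where "m \<in> {1..n}" "i < m" "\<sigma> i < \<sigma> m" using ur2[OF h(2)] by auto
    then show False using ul1[OF that(1) j ji] ur1[OF that(3), of m] ji by simp
  qed
  have H: "\<sigma> i < \<sigma> j" if "bl n \<sigma> i" "\<not> bl n \<sigma> j" "ul n \<sigma> j"
  proof (rule ccontr)
    assume "\<not> \<sigma> i < \<sigma> j"
    then have s: "\<sigma> j < \<sigma> i" using that ne by (cases "i = j") auto
    then have "i < j" using bl1[OF that(1) j] ne by force
    then show False using ul1[OF that(3) i] s by simp
  qed
  have K: "\<sigma> i < \<sigma> j" if "br n \<sigma> i" "\<not> ur n \<sigma> i" "ur n \<sigma> j"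
  proof (rule ccontr)
    assume "\<not> \<sigma> i < \<sigma> j"
    then have s: "\<sigma> j < \<sigma> i" using that ne by (cases "i = j") auto
    then have "j < i" using br1[OF that(1) j] ne by force
    then show False using ur1[OF that(3) i] s by simp
  qed
  show "(i \<in> D \<longrightarrow> j \<in> D \<longrightarrow> \<sigma> i \<in> L \<longrightarrow> \<sigma> j \<in> L \<longrightarrow> i < j \<longrightarrow> \<sigma> j < \<sigma> i) \<and>
     (i \<in> D \<longrightarrow> j \<in> D \<longrightarrow> \<sigma> i \<notin> L \<longrightarrow> \<sigma> j \<notin> L \<longrightarrow> i < j \<longrightarrow> \<sigma> i < \<sigma> j) \<and>
     (i \<notin> D \<longrightarrow> j \<notin> D \<longrightarrow> \<sigma> i \<in> L \<longrightarrow> \<sigma> j \<in> L \<longrightarrow> i < j \<longrightarrow> \<sigma> i < \<sigma> j) \<and>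
     (i \<notin> D \<longrightarrow> j \<notin> D \<longrightarrow> \<sigma> i \<notin> L \<longrightarrow> \<sigma> j \<notin> L \<longrightarrow> i < j \<longrightarrow> \<sigma> j < \<sigma> i) \<and>
     (i \<in> D \<longrightarrow> j \<in> D \<longrightarrow> \<sigma> i \<in> L \<longrightarrow> \<sigma> j \<notin> L \<longrightarrow> i < j) \<and>
     (i \<notin> D \<longrightarrow> j \<notin> D \<longrightarrow> \<sigma> i \<in> L \<longrightarrow> \<sigma> j \<notin> L \<longrightarrow> i < j) \<and>
     (i \<in> D \<longrightarrow> j \<notin> D \<longrightarrow> \<sigma> i \<in> L \<longrightarrow> \<sigma> j \<in> L \<longrightarrow> \<sigma> i < \<sigma> j) \<and>
     (i \<in> D \<longrightarrow> j \<notin> D \<longrightarrow> \<sigma> i \<notin> L \<longrightarrow> \<sigma> j \<notin> L \<longrightarrow> \<sigma> i < \<sigma> j)"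
    unfolding ti using A B C E F G H K t(3)[OF i] t(3)[OF j] by argo
qed

lemma square_ok_square_code:
  assumes "\<sigma> \<in> square_permutations n" and "square_code n \<sigma> = (D, L, a)"
  shows "square_ok n D L \<sigma>" "a = int (card {i\<in>{1..int n}. i \<in> D \<and> \<sigma> i \<in> L})"
proof -
  have perm: "\<sigma> permutes {1..int n}" and ext: "\<forall>i\<in>{1..int n}. bl n \<sigma> i \<or> ur n \<sigma> i \<or> ul n \<sigma> i \<or> br n \<sigma> i"
    using assms(1) by (auto simp: square_permutations_iff)
  have inj: "inj \<sigma>" using perm by (rule permutes_inj)
  have D: "D = {i\<in>{1..int n}. down n \<sigma> i}" and L: "L = \<sigma> ` {i\<in>{1..int n}. left n \<sigma> i}"
    and a: "a = int (card {i\<in>{1..int n}. bl n \<sigma> i})" using assms(2) by (auto simp: square_code_def)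
  have inL: "\<sigma> i \<in> L \<longleftrightarrow> left n \<sigma> i" if "i \<in> {1..int n}" for i
    using that inj by (auto simp: L inj_image_mem_iff)
  show "square_ok n D L \<sigma>" unfolding square_ok_def using ext inL by (auto simp: D)
  have "{i\<in>{1..int n}. bl n \<sigma> i} = {i\<in>{1..int n}. i \<in> D \<and> \<sigma> i \<in> L}"
    using inL by (auto simp: D down_def left_def)
  then show "a = int (card {i\<in>{1..int n}. i \<in> D \<and> \<sigma> i \<in> L})" using a by simp
qed

lemma square_code_decodes:
  assumes s: "\<sigma> \<in> square_permutations n" and n: "1 \<le> n"
  shows "decodes n (square_code n \<sigma>) \<sigma>" "in_range n (square_code n \<sigma>)" "square_code n \<sigma> \<in> codes n"
proof -
  obtain D L a where c: "square_code n \<sigma> = (D, L, a)" by (cases "square_code n \<sigma>")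
  have perm: "\<sigma> permutes {1..int n}" using s by (auto simp: square_permutations_iff)
  note ok = square_ok_square_code[OF s c]
  have ch: "chained n D L \<sigma>" using square_ok_chained ok(1) perm by (metis permutes_inj_on)
  have "bl n \<sigma> 1" by (auto simp: bl_def)
  then have "{1} \<subseteq> {i\<in>{1..int n}. bl n \<sigma> i}" using n by auto
  then have "card {1::int} \<le> card {i\<in>{1..int n}. bl n \<sigma> i}"
    by (intro card_mono) (auto intro: finite_subset[of _ "{1..int n}"])
  then have a: "1 \<le> a" using c by (auto simp: square_code_def)
  show "decodes n (square_code n \<sigma>) \<sigma>" "in_range n (square_code n \<sigma>)"
    unfolding c using chained_decodes[OF permutes_imp_bij[OF perm] ch ok(2)] a by auto
  have "card {i\<in>{1..int n}. i \<in> D \<and> \<sigma> i \<in> L} \<le> card {1..int n}" by (rule card_mono) auto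
  then have "a \<le> n" using ok(2) by simp
  moreover have "\<sigma> ` {i\<in>{1..int n}. left n \<sigma> i} \<subseteq> {1..int n}"
    using permutes_image[OF perm] by blast
  ultimately show "square_code n \<sigma> \<in> codes n" using a c
    unfolding codes_def square_code_def by auto
qed

definition perm_of :: "int \<Rightarrow> (int \<Rightarrow> int) \<Rightarrow> int \<Rightarrow> int" where
  "perm_of n \<sigma> = (\<lambda>i. if i \<in> {1..n} then \<sigma> i else i)"

lemma perm_of_permutes: "decodes n (D, L, a) \<sigma> \<Longrightarrow> perm_of n \<sigma> permutes {1..n}"
proof (rule bij_imp_permutes)
  assume dec: "decodes n (D, L, a) \<sigma>"
  have "inj_on (perm_of n \<sigma>) {1..n}"
    using decodes_inj[OF dec] by (auto simp: inj_on_def perm_of_def)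
  moreover have "perm_of n \<sigma> ` {1..n} \<subseteq> {1..n}"
    using dec by (auto simp: decodes_def perm_of_def)
  ultimately show "bij_betw (perm_of n \<sigma>) {1..n} {1..n}"
    by (simp add: bij_betw_def endo_inj_surj)
qed (auto simp: perm_of_def)

lemma records_perm_of:
  assumes "i \<in> {1..n}"
  shows "bl n (perm_of n \<sigma>) i = bl n \<sigma> i" "ur n (perm_of n \<sigma>) i = ur n \<sigma> i"
    "ul n (perm_of n \<sigma>) i = ul n \<sigma> i" "br n (perm_of n \<sigma>) i = br n \<sigma> i"
  using assms by (auto simp: bl_def ur_def ul_def br_def perm_of_def)

text \<open>The code of a square permutation determines it, as decoding is unique; so one only has to see
  whether the decoded permutation is square and has the code it was decoded from.\<close>

lemma square_code_iff:
  assumes c: "(D, L, a) \<in> codes n" and rng: "in_range n (D, L, a)" and dec: "decodes n (D, L, a) \<sigma>"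
  shows "(D, L, a) \<in> square_code n ` square_permutations n \<longleftrightarrow> square_ok n D L \<sigma>"
    and "\<tau> \<in> square_permutations n \<Longrightarrow> square_code n \<tau> = (D, L, a) \<Longrightarrow> \<tau> = perm_of n \<sigma>"
proof -
  have n: "1 \<le> n" using c by (auto simp: codes_def)
  let ?p = "perm_of (int n) \<sigma>"
  have perm: "?p permutes {1..int n}" by (rule perm_of_permutes[OF dec])
  show uniq: "\<tau> = ?p" if t: "\<tau> \<in> square_permutations n" "square_code n \<tau> = (D, L, a)" for \<tau>
  proof
    fix i
    have "\<tau> i = \<sigma> i" if "i \<in> {1..int n}"
      using decodes_unique[OF _ dec that, of \<tau>] square_code_decodes(1)[OF t(1) n] t(2) by simp
    moreover have "\<tau> i = i" if "i \<notin> {1..int n}"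
      using t(1) that by (auto simp: square_permutations_iff permutes_def)
    ultimately show "\<tau> i = ?p i" by (auto simp: perm_of_def)
  qed
  have ok: "square_ok n D L ?p = square_ok n D L \<sigma>"
    unfolding square_ok_def down_def left_def
    by (intro ball_cong refl) (simp add: records_perm_of, simp add: perm_of_def)
  show "(D, L, a) \<in> square_code n ` square_permutations n \<longleftrightarrow> square_ok n D L \<sigma>"
  proof
    assume "(D, L, a) \<in> square_code n ` square_permutations n"
    then obtain \<tau> where t: "\<tau> \<in> square_permutations n" "square_code n \<tau> = (D, L, a)" by auto
    then show "square_ok n D L \<sigma>" using square_ok_square_code(1)[OF t] uniq[OF t] ok by simp
  next
    assume "square_ok n D L \<sigma>"
    then have o: "square_ok n D L ?p" using ok by simp
    then have sq: "?p \<in> square_permutations n" using perm by (auto simp: square_permutations_iff square_ok_def)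
    have "D = {i\<in>{1..int n}. down n ?p i}" using o c by (auto simp: square_ok_def codes_def)
    moreover have "L = ?p ` {i\<in>{1..int n}. left n ?p i}"
    proof -
      have "L = ?p ` {i\<in>{1..int n}. ?p i \<in> L}"
        using c permutes_image[OF perm] by (fastforce simp: codes_def)
      also have "{i\<in>{1..int n}. ?p i \<in> L} = {i\<in>{1..int n}. left n ?p i}" using o by (auto simp: square_ok_def)
      finally show ?thesis .
    qed
    moreover have "int (card {i\<in>{1..int n}. bl n ?p i}) = a"
    proof -
      have "{i\<in>{1..int n}. bl n ?p i} = {i\<in>{1..int n}. i \<in> D \<and> \<sigma> i \<in> L}"
        using o by (auto simp: square_ok_def down_def left_def perm_of_def)
      then show ?thesis using card_left_down[OF dec] rng by (simp add: in_range_def)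
    qed
    ultimately have "square_code n ?p = (D, L, a)" by (simp add: square_code_def)
    then show "(D, L, a) \<in> square_code n ` square_permutations n" using sq by force
  qed
qed

lemma finite_codes: "finite (codes n)" and card_codes: "card (codes n) = n * 4 ^ n"
  by (simp_all add: codes_def card_cartesian_product card_Pow power_mult_distrib[symmetric])

section \<open>Codes of convex permutominoes\<close>

text \<open>The height of the lower of the two horizontal edges between the columns \<open>x\<close> and
  \<open>x + 1\<close>. The lower path is traversed from left to right and keeps its height until
  the next down column, which it leaves on the row \<open>\<sigma> x\<close>.\<close>

definition lower :: "int set \<Rightarrow> (int \<Rightarrow> int) \<Rightarrow> int \<Rightarrow> int" where
  "lower D \<sigma> x = \<sigma> (Max (D \<inter> {1..x}))"

text \<open>The upper path is traversed from right to left, so that its height between the columns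
  \<open>x\<close> and \<open>x + 1\<close> has been determined by the next up column on the
  right.\<close>

definition upper :: "int \<Rightarrow> int set \<Rightarrow> (int \<Rightarrow> int) \<Rightarrow> int \<Rightarrow> int" where
  "upper n D \<sigma> x = \<sigma> (Min ({x+1..n} - D))"

text \<open>The combinatorial data of a convex permutomino: the column \<open>1\<close> belongs to the lower
  path and the column \<open>n\<close> to the upper one, the lower path first descends and then
  ascends, the upper path first ascends and then descends, and the former stays below the latter.\<close>

definition shapes :: "nat \<Rightarrow> ((int \<Rightarrow> int) \<times> int set) set" where
  "shapes n = {(\<sigma>, D). \<sigma> permutes {1..int n} \<and> D \<subseteq> {1..int n} \<and> 1 \<in> D \<and> int n \<notin> D \<and>
     (\<forall>i\<in>D. \<forall>j\<in>D. \<forall>k\<in>D. i < j \<longrightarrow> j < k \<longrightarrow> \<sigma> i < \<sigma> j \<longrightarrow> \<sigma> j < \<sigma> k) \<and>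
     (\<forall>i\<in>{1..int n} - D. \<forall>j\<in>{1..int n} - D. \<forall>k\<in>{1..int n} - D. i < j \<longrightarrow> j < k \<longrightarrow> \<sigma> j < \<sigma> i \<longrightarrow> \<sigma> k < \<sigma> j) \<and>
     (\<forall>x\<in>{1..int n - 1}. lower D \<sigma> x < upper n D \<sigma> x)}"

text \<open>The walk runs along the lower path from left to right and back along the upper path, so a row is
  left when it lies on the descending part of the former or on the ascending part of the latter.
  The lowest row counts as left and the highest one as right.\<close>

definition shape_left :: "int \<Rightarrow> int set \<Rightarrow> (int \<Rightarrow> int) \<Rightarrow> int \<Rightarrow> bool" where
  "shape_left n D \<sigma> i \<longleftrightarrow> (if i \<in> D then \<forall>j\<in>D. j < i \<longrightarrow> \<sigma> i < \<sigma> j else \<exists>j\<in>{1..n} - D. i < j \<and> \<sigma> i < \<sigma> j)"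

definition shape_code :: "nat \<Rightarrow> (int \<Rightarrow> int) \<times> int set \<Rightarrow> int set \<times> int set \<times> int" where
  "shape_code n = (\<lambda>(\<sigma>, D). (D, \<sigma> ` {i\<in>{1..int n}. shape_left n D \<sigma> i},
     int (card {i\<in>{1..int n}. i \<in> D \<and> shape_left n D \<sigma> i})))"

definition shape_ok :: "int \<Rightarrow> int set \<Rightarrow> int set \<Rightarrow> (int \<Rightarrow> int) \<Rightarrow> bool" where
  "shape_ok n D L \<sigma> \<longleftrightarrow> 1 \<in> D \<and> n \<notin> D \<and> 1 \<in> L \<and> n \<notin> L \<and>
     (\<forall>x\<in>{1..n-1}. lower D \<sigma> x < upper n D \<sigma> x)"

lemma lower_at: "i \<in> D \<Longrightarrow> 1 \<le> i \<Longrightarrow> i \<le> x \<Longrightarrow> (\<And>j. j \<in> D \<Longrightarrow> i < j \<Longrightarrow> x < j) \<Longrightarrow> lower D \<sigma> x = \<sigma> i"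
  unfolding lower_def by (intro arg_cong[of _ _ \<sigma>] Max_eqI) (auto simp: not_less[symmetric])

lemma upper_at: "i \<notin> D \<Longrightarrow> x < i \<Longrightarrow> i \<le> n \<Longrightarrow> (\<And>j. j \<notin> D \<Longrightarrow> x < j \<Longrightarrow> i \<le> j) \<Longrightarrow> upper n D \<sigma> x = \<sigma> i"
  unfolding upper_def by (intro arg_cong[of _ _ \<sigma>] Min_eqI) auto

lemma lower_obtain:
  assumes "1 \<in> D" "1 \<le> x"
  obtains i where "i \<in> D" "1 \<le> i" "i \<le> x" "lower D \<sigma> x = \<sigma> i" "\<And>j. j \<in> D \<Longrightarrow> i < j \<Longrightarrow> x < j"
proof
  have *: "finite (D \<inter> {1..x})" "D \<inter> {1..x} \<noteq> {}" using assms by auto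
  from Max_in[OF *] show "Max (D \<inter> {1..x}) \<in> D" "1 \<le> Max (D \<inter> {1..x})" "Max (D \<inter> {1..x}) \<le> x" by auto
  show "x < j" if "j \<in> D" "Max (D \<inter> {1..x}) < j" for j
  proof (rule ccontr)
    assume "\<not> x < j"
    then have "j \<in> D \<inter> {1..x}" using that \<open>1 \<le> Max (D \<inter> {1..x})\<close> by simp
    from Max_ge[OF *(1) this] that show False by simp
  qed
qed (simp add: lower_def)

lemma upper_obtain:
  assumes "n \<notin> D" "x < n"
  obtains i where "i \<notin> D" "x < i" "i \<le> n" "upper n D \<sigma> x = \<sigma> i" "\<And>j. j \<notin> D \<Longrightarrow> x < j \<Longrightarrow> i \<le> j"
proof
  have "n \<in> {x+1..n} - D" using assms by simp
  then have *: "finite ({x+1..n} - D)" "{x+1..n} - D \<noteq> {}" by blast+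
  from Min_in[OF *] show "Min ({x+1..n} - D) \<notin> D" "x < Min ({x+1..n} - D)" "Min ({x+1..n} - D) \<le> n" by auto
  show "Min ({x+1..n} - D) \<le> j" if "j \<notin> D" "x < j" for j
    using that Min_le[OF *(1), of j] \<open>Min ({x+1..n} - D) \<le> n\<close> by (cases "j \<le> n") auto
qed (simp add: upper_def)

text \<open>The lowest point of the permutation lies on the lower path, and the highest one on the upper path.\<close>

lemma shape_extremes:
  assumes perm: "bij_betw \<sigma> {1..n} {1..n}" and D: "1 \<in> D" "n \<notin> D" "D \<subseteq> {1..n}"
    and lt: "\<forall>x\<in>{1..n - 1}. lower D \<sigma> x < upper n D \<sigma> x"
  shows "j \<in> {1..n} \<Longrightarrow> \<sigma> j = 1 \<Longrightarrow> j \<in> D" "j \<in> {1..n} \<Longrightarrow> \<sigma> j = n \<Longrightarrow> j \<notin> D"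
proof -
  have rng: "\<sigma> i \<in> {1..n}" if "i \<in> {1..n}" for i using perm that by (auto simp: bij_betw_def)
  show "j \<in> D" if j: "j \<in> {1..n}" "\<sigma> j = 1"
  proof (rule ccontr)
    assume nj: "j \<notin> D"
    then have j1: "j \<noteq> 1" using D by auto
    then have x: "j - 1 \<in> {1..n-1}" using j by auto
    then obtain i where i: "i \<in> D" "1 \<le> i" "i \<le> j - 1" "lower D \<sigma> (j-1) = \<sigma> i"
      using lower_obtain[OF D(1), of "j - 1"] by (metis atLeastAtMost_iff)
    have "upper n D \<sigma> (j - 1) = \<sigma> j" using nj j by (intro upper_at) auto
    then show False using lt x i rng[of i] j by fastforce
  qed
  show "j \<notin> D" if j: "j \<in> {1..n}" "\<sigma> j = n"
  proof
    assume jD: "j \<in> D"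
    then have "j \<noteq> n" using D by auto
    then have x: "j \<in> {1..n-1}" using j by auto
    then obtain i where i: "i \<notin> D" "j < i" "i \<le> n" "upper n D \<sigma> j = \<sigma> i"
      using upper_obtain[OF D(2), of j] by (metis atLeastAtMost_iff less_eq_int_code(1) zle_diff1_eq)
    have "lower D \<sigma> j = \<sigma> j" using jD j by (intro lower_at) auto
    then show False using lt x i rng[of i] j by fastforce
  qed
qed

text \<open>Each of the two paths is unimodal and splits into two chains. The order between chains of
  different paths follows from the fact that the lower path stays below the upper one: the rows on
  the descending part of the lower path are at most \<open>lower D \<sigma> 1\<close>, for
  instance, and those on the ascending part of the upper path are at least \<open>upper n D
  \<sigma> 1\<close>.\<close>

lemma shape_chained:
  assumes s: "(\<sigma>, D) \<in> shapes n" and n: "2 \<le> n" and c: "shape_code n (\<sigma>, D) = (D', L, a)"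
  shows "D' = D" "chained n D L \<sigma>" "1 \<in> L" "int n \<notin> L" "a = int (card {i\<in>{1..int n}. i \<in> D \<and> \<sigma> i \<in> L})"
    "1 \<le> a" "a \<le> n" "L \<subseteq> {1..int n}"
proof -
  have perm: "\<sigma> permutes {1..int n}" and D: "D \<subseteq> {1..int n}" "1 \<in> D" "int n \<notin> D"
    and val: "\<And>i j k. i \<in> D \<Longrightarrow> j \<in> D \<Longrightarrow> k \<in> D \<Longrightarrow> i < j \<Longrightarrow> j < k \<Longrightarrow> \<sigma> i < \<sigma> j \<Longrightarrow> \<sigma> j < \<sigma> k"
    and mou: "\<And>i j k. i \<in> {1..int n} - D \<Longrightarrow> j \<in> {1..int n} - D \<Longrightarrow> k \<in> {1..int n} - D \<Longrightarrow> i < j \<Longrightarrow> j < k \<Longrightarrow>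
       \<sigma> j < \<sigma> i \<Longrightarrow> \<sigma> k < \<sigma> j"
    and lt: "\<forall>x\<in>{1..int n - 1}. lower D \<sigma> x < upper n D \<sigma> x"
    using s unfolding shapes_def mem_Collect_eq split by blast+
  have c': "D = D' \<and> \<sigma> ` {i\<in>{1..int n}. shape_left n D \<sigma> i} = L \<and>
     int (card {i\<in>{1..int n}. i \<in> D \<and> shape_left n D \<sigma> i}) = a"
    using c unfolding shape_code_def split prod.inject .
  then show D': "D' = D" by blast
  have L: "L = \<sigma> ` {i\<in>{1..int n}. shape_left n D \<sigma> i}" using c' by blast
  have a: "a = int (card {i\<in>{1..int n}. i \<in> D \<and> shape_left n D \<sigma> i})" using c' by blast
  have inj: "inj \<sigma>" using perm by (rule permutes_inj)
  have ne: "\<sigma> i = \<sigma> j \<longleftrightarrow> i = j" for i j using inj by (simp add: inj_eq)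
  have inL: "\<sigma> i \<in> L \<longleftrightarrow> shape_left n D \<sigma> i" if "i \<in> {1..int n}" for i
    using that inj by (auto simp: L inj_image_mem_iff)
  have rng: "\<sigma> i \<in> {1..int n}" if "i \<in> {1..int n}" for i using that by (simp only: permutes_in_image[OF perm])
  show "L \<subseteq> {1..int n}" unfolding L using rng by blast
  have nN: "int n \<in> {1..int n} - D" "1 \<in> {1..int n}" using n D by auto
  note bij = permutes_imp_bij[OF perm]
  note ext = shape_extremes[OF bij D(2,3,1) lt]
  show "1 \<in> L"
  proof -
    obtain z where z: "z \<in> {1..int n}" "\<sigma> z = 1" using bij nN by (metis bij_betw_def imageE)
    then have zD: "z \<in> D" by (rule ext(1))
    have "shape_left n D \<sigma> z" unfolding shape_left_def
    proof (simp add: zD, intro ballI impI)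
      fix j assume "j \<in> D" "j < z"
      then show "\<sigma> z < \<sigma> j" using rng[of j] z ne[of z j] D by fastforce
    qed
    then show ?thesis using inL z by force
  qed
  show "int n \<notin> L"
  proof -
    obtain t where t: "t \<in> {1..int n}" "\<sigma> t = n" using bij nN by (metis bij_betw_def imageE DiffD1)
    then have tD: "t \<notin> D" by (rule ext(2))
    have "\<not> shape_left n D \<sigma> t"
    proof
      assume "shape_left n D \<sigma> t"
      then obtain j where "j \<in> {1..int n}" "\<sigma> t < \<sigma> j" using tD by (auto simp: shape_left_def)
      then show False using rng[of j] t(2) by simp
    qed
    then show ?thesis using inL t by force
  qed
  show "a = int (card {i\<in>{1..int n}. i \<in> D \<and> \<sigma> i \<in> L})"
    unfolding a using inL by (intro arg_cong[of _ _ "\<lambda>A. int (card A)"]) auto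
  have "{1} \<subseteq> {i\<in>{1..int n}. i \<in> D \<and> shape_left n D \<sigma> i}"
    using D n by (auto simp: shape_left_def)
  then have "card {1::int} \<le> card {i\<in>{1..int n}. i \<in> D \<and> shape_left n D \<sigma> i}"
    by (intro card_mono) (auto intro: finite_subset[of _ "{1..int n}"])
  then show "1 \<le> a" by (simp add: a)
  have "card {i\<in>{1..int n}. i \<in> D \<and> shape_left n D \<sigma> i} \<le> card {1..int n}" by (rule card_mono) auto
  then show "a \<le> n" by (simp add: a)
  show "chained n D L \<sigma>"
    unfolding chained_def
  proof (intro ballI)
    fix i j assume i: "i \<in> {1..int n}" and j: "j \<in> {1..int n}"
    have A: "\<sigma> j < \<sigma> i" if "i \<in> D" "j \<in> D" "shape_left n D \<sigma> j" "i < j"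
      using that by (auto simp: shape_left_def)
    have B: "\<sigma> i < \<sigma> j" if h: "i \<in> D" "j \<in> D" "\<not> shape_left n D \<sigma> i" "i < j"
    proof -
      obtain k where k: "k \<in> D" "k < i" "\<not> \<sigma> i < \<sigma> k" using h by (auto simp: shape_left_def)
      then have "\<sigma> k < \<sigma> i" using ne[of k i] by auto
      then show ?thesis using val[OF k(1) h(1,2) k(2) h(4)] by simp
    qed
    have C: "\<sigma> i < \<sigma> j" if h: "i \<notin> D" "j \<notin> D" "shape_left n D \<sigma> j" "i < j"
    proof (rule ccontr)
      assume "\<not> \<sigma> i < \<sigma> j"
      then have "\<sigma> j < \<sigma> i" using ne[of i j] h by auto
      moreover obtain k where k: "k \<in> {1..int n} - D" "j < k" "\<sigma> j < \<sigma> k" using h by (auto simp: shape_left_def)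
      ultimately show False using mou[of i j k] h i j by auto
    qed
    have E: "\<sigma> j < \<sigma> i" if h: "i \<notin> D" "j \<notin> D" "\<not> shape_left n D \<sigma> i" "i < j"
    proof -
      have "j \<in> {1..int n} - D" using h j by blast
      then have "\<not> \<sigma> i < \<sigma> j" using h unfolding shape_left_def by metis
      then show ?thesis using ne[of i j] h(4) by linarith
    qed
    have F: "i < j" if h: "i \<in> D" "j \<in> D" "shape_left n D \<sigma> i" "\<not> shape_left n D \<sigma> j"
    proof (rule ccontr)
      assume "\<not> i < j"
      then have ji: "j < i" using h by (cases "i = j") auto
      obtain k where k: "k \<in> D" "k < j" "\<not> \<sigma> j < \<sigma> k" using h by (auto simp: shape_left_def)
      then have "\<sigma> k < \<sigma> j" using ne[of k j] by auto
      then have "\<sigma> j < \<sigma> i" using val[OF k(1) h(2,1) k(2) ji] by simp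
      moreover have "\<sigma> i < \<sigma> j" using h ji by (auto simp: shape_left_def)
      ultimately show False by simp
    qed
    have G: "i < j" if h: "i \<notin> D" "j \<notin> D" "shape_left n D \<sigma> i" "\<not> shape_left n D \<sigma> j"
    proof (rule ccontr)
      assume "\<not> i < j"
      then have ji: "j < i" using h by (cases "i = j") auto
      have "i \<in> {1..int n} - D" using h i by blast
      then have "\<not> \<sigma> j < \<sigma> i" using h ji unfolding shape_left_def by metis
      then have "\<sigma> i < \<sigma> j" using ne[of i j] ji by linarith
      moreover obtain k where k: "k \<in> {1..int n} - D" "i < k" "\<sigma> i < \<sigma> k" using h by (auto simp: shape_left_def)
      ultimately show False using mou[of j i k] h i j ji by auto
    qed
    have H: "\<sigma> i < \<sigma> j" if h: "i \<in> D" "j \<notin> D" "shape_left n D \<sigma> i" "shape_left n D \<sigma> j"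
    proof -
      have "\<sigma> i \<le> \<sigma> 1"
      proof (cases "i = 1")
        case False
        then have "1 < i" using i by auto
        then have "\<sigma> i < \<sigma> 1" using h(1,3) D(2) by (auto simp: shape_left_def)
        then show ?thesis by simp
      qed simp
      also have "\<sigma> 1 = lower D \<sigma> 1" using D by (intro lower_at[symmetric]) auto
      also have "\<dots> < upper n D \<sigma> 1" using lt n by auto
      also have "\<dots> \<le> \<sigma> j"
      proof -
        have j1: "1 < j" using h D j by (cases "j = 1") auto
        obtain f where f: "f \<notin> D" "1 < f" "f \<le> int n" "upper n D \<sigma> 1 = \<sigma> f" "\<And>j. j \<notin> D \<Longrightarrow> 1 < j \<Longrightarrow> f \<le> j"
          using upper_obtain[OF D(3), of 1] n by auto
        have fj: "f \<le> j" using f(5) h j1 by simp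
        obtain k where k: "k \<in> {1..int n} - D" "j < k" "\<sigma> j < \<sigma> k" using h by (auto simp: shape_left_def)
        have "\<not> \<sigma> j < \<sigma> f" using mou[of f j k] f k fj h j by (cases "f = j") auto
        then show ?thesis using f by simp
      qed
      finally show ?thesis .
    qed
    have K: "\<sigma> i < \<sigma> j" if h: "i \<in> D" "j \<notin> D" "\<not> shape_left n D \<sigma> i" "\<not> shape_left n D \<sigma> j"
    proof -
      have iN: "i \<le> int n - 1" using h i D by (cases "i = int n") auto
      obtain e where e: "e \<in> D" "1 \<le> e" "e \<le> int n - 1" "lower D \<sigma> (int n - 1) = \<sigma> e"
         "\<And>j. j \<in> D \<Longrightarrow> e < j \<Longrightarrow> int n - 1 < j" using lower_obtain[OF D(2), of "int n - 1"] n by auto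
      have ie: "i \<le> e" using e(5)[of i] h iN by force
      obtain k where k: "k \<in> D" "k < i" "\<not> \<sigma> i < \<sigma> k" using h by (auto simp: shape_left_def)
      then have ki: "\<sigma> k < \<sigma> i" using ne[of k i] by auto
      have "\<sigma> i \<le> \<sigma> e"
        using val[OF k(1) h(1) e(1) k(2)] ki ie by (cases "i = e") auto
      also have "\<dots> < upper n D \<sigma> (int n - 1)"
        unfolding e(4)[symmetric] using n by (intro lt[rule_format]) simp
      also have "\<dots> = \<sigma> n" using D n by (intro upper_at) auto
      also have "\<dots> \<le> \<sigma> j"
      proof (cases "j = int n")
        case False
        then have "j < int n" using j by simp
        then have "\<not> \<sigma> j < \<sigma> n" using h(2,4) nN(1) unfolding shape_left_def by metis
        then show ?thesis by simp
      qed simp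
      finally show ?thesis .
    qed
    show "(i \<in> D \<longrightarrow> j \<in> D \<longrightarrow> \<sigma> i \<in> L \<longrightarrow> \<sigma> j \<in> L \<longrightarrow> i < j \<longrightarrow> \<sigma> j < \<sigma> i) \<and>
     (i \<in> D \<longrightarrow> j \<in> D \<longrightarrow> \<sigma> i \<notin> L \<longrightarrow> \<sigma> j \<notin> L \<longrightarrow> i < j \<longrightarrow> \<sigma> i < \<sigma> j) \<and>
     (i \<notin> D \<longrightarrow> j \<notin> D \<longrightarrow> \<sigma> i \<in> L \<longrightarrow> \<sigma> j \<in> L \<longrightarrow> i < j \<longrightarrow> \<sigma> i < \<sigma> j) \<and>
     (i \<notin> D \<longrightarrow> j \<notin> D \<longrightarrow> \<sigma> i \<notin> L \<longrightarrow> \<sigma> j \<notin> L \<longrightarrow> i < j \<longrightarrow> \<sigma> j < \<sigma> i) \<and>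
     (i \<in> D \<longrightarrow> j \<in> D \<longrightarrow> \<sigma> i \<in> L \<longrightarrow> \<sigma> j \<notin> L \<longrightarrow> i < j) \<and>
     (i \<notin> D \<longrightarrow> j \<notin> D \<longrightarrow> \<sigma> i \<in> L \<longrightarrow> \<sigma> j \<notin> L \<longrightarrow> i < j) \<and>
     (i \<in> D \<longrightarrow> j \<notin> D \<longrightarrow> \<sigma> i \<in> L \<longrightarrow> \<sigma> j \<in> L \<longrightarrow> \<sigma> i < \<sigma> j) \<and>
     (i \<in> D \<longrightarrow> j \<notin> D \<longrightarrow> \<sigma> i \<notin> L \<longrightarrow> \<sigma> j \<notin> L \<longrightarrow> \<sigma> i < \<sigma> j)"
      unfolding inL[OF i] inL[OF j] using A B C E F G H K by blast
  qed
qed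

lemma shape_code_decodes:
  assumes s: "(\<sigma>, D) \<in> shapes n" and n: "2 \<le> n"
  shows "decodes n (shape_code n (\<sigma>, D)) \<sigma>" "in_range n (shape_code n (\<sigma>, D))" "shape_code n (\<sigma>, D) \<in> codes n"
proof -
  obtain D' L a where c: "shape_code n (\<sigma>, D) = (D', L, a)" by (cases "shape_code n (\<sigma>, D)")
  note ch = shape_chained[OF s n c]
  have perm: "\<sigma> permutes {1..int n}" "D \<subseteq> {1..int n}" using s by (auto simp: shapes_def)
  show "decodes n (shape_code n (\<sigma>, D)) \<sigma>" "in_range n (shape_code n (\<sigma>, D))"
    unfolding c ch(1) using chained_decodes[OF permutes_imp_bij[OF perm(1)] ch(2,5)] ch(6) by auto
  show "shape_code n (\<sigma>, D) \<in> codes n" unfolding c ch(1) codes_def using ch perm by auto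
qed

lemma shape_code_iff:
  assumes c: "(D, L, a) \<in> codes n" and rng: "in_range n (D, L, a)" and dec: "decodes n (D, L, a) \<sigma>"
    and n: "2 \<le> n"
  shows "(D, L, a) \<in> shape_code n ` shapes n \<longleftrightarrow> shape_ok n D L \<sigma>"
    and "s \<in> shapes n \<Longrightarrow> shape_code n s = (D, L, a) \<Longrightarrow> s = (perm_of n \<sigma>, D)"
proof -
  let ?p = "perm_of (int n) \<sigma>"
  have perm: "?p permutes {1..int n}" by (rule perm_of_permutes[OF dec])
  show uniq: "s = (?p, D)" if t: "s \<in> shapes n" "shape_code n s = (D, L, a)" for s
  proof -
    obtain \<tau> D' where s: "s = (\<tau>, D')" by (cases s)
    have D': "D' = D" using t(2) by (simp add: s shape_code_def)
    have tp: "\<tau> permutes {1..int n}" using t(1) by (auto simp: s shapes_def)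
    have "\<tau> = ?p"
    proof
      fix i
      have "\<tau> i = \<sigma> i" if "i \<in> {1..int n}"
        using decodes_unique[OF _ dec that, of \<tau>] shape_code_decodes(1)[OF t(1)[unfolded s] n] t(2) s by simp
      moreover have "\<tau> i = i" if "i \<notin> {1..int n}" using tp that by (auto simp: permutes_def)
      ultimately show "\<tau> i = ?p i" by (auto simp: perm_of_def)
    qed
    then show ?thesis by (simp add: s D')
  qed
  have DN: "D \<subseteq> {1..int n}" "L \<subseteq> {1..int n}" using c by (auto simp: codes_def)
  have "shape_ok n D L ?p = shape_ok n D L \<sigma>"
  proof -
    have "lower D ?p x = lower D \<sigma> x \<and> upper n D ?p x = upper n D \<sigma> x"
      if h: "1 \<in> D" "int n \<notin> D" "x \<in> {1..int n - 1}" for x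
    proof
      have "1 \<le> x" using h(3) by simp
      then obtain i where i: "i \<in> D" "1 \<le> i" "i \<le> x" "lower D ?p x = ?p i" "\<And>j. j \<in> D \<Longrightarrow> i < j \<Longrightarrow> x < j"
        by (rule lower_obtain[OF h(1), where \<sigma> = ?p]) (rule that)
      have "lower D \<sigma> x = \<sigma> i" by (rule lower_at) (use i in auto)
      then show "lower D ?p x = lower D \<sigma> x" using DN i by (auto simp: perm_of_def)
      have "x < int n" using h(3) by simp
      then obtain i where i: "i \<notin> D" "x < i" "i \<le> int n" "upper n D ?p x = ?p i" "\<And>j. j \<notin> D \<Longrightarrow> x < j \<Longrightarrow> i \<le> j"
        by (rule upper_obtain[OF h(2), where \<sigma> = ?p]) (rule that)
      have "upper n D \<sigma> x = \<sigma> i" by (rule upper_at) (use i in auto)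
      then show "upper n D ?p x = upper n D \<sigma> x" using i h(3) by (simp add: perm_of_def)
    qed
    then show ?thesis unfolding shape_ok_def by auto
  qed
  note ok = this
  show "(D, L, a) \<in> shape_code n ` shapes n \<longleftrightarrow> shape_ok n D L \<sigma>"
  proof
    assume "(D, L, a) \<in> shape_code n ` shapes n"
    then obtain s where t: "s \<in> shapes n" "shape_code n s = (D, L, a)" by auto
    then have "(?p, D) \<in> shapes n" "shape_code n (?p, D) = (D, L, a)" using uniq by auto
    from shape_chained[OF this(1) n this(2)] this(1)
    have "shape_ok n D L ?p" by (auto simp: shape_ok_def shapes_def)
    then show "shape_ok n D L \<sigma>" using ok by simp
  next
    assume "shape_ok n D L \<sigma>"
    then have "shape_ok n D L ?p" using ok by simp
    then have e: "1 \<in> D" "int n \<notin> D" "1 \<in> L" "int n \<notin> L"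
      and lt: "\<forall>x\<in>{1..int n-1}. lower D ?p x < upper n D ?p x"
      by (auto simp: shape_ok_def)
    have dp: "decodes n (D, L, a) ?p" using dec by (auto simp: decodes_def perm_of_def)
    have a1: "1 \<le> a" "a \<le> rk D n" using rng by (auto simp: in_range_def)
    note ch = decodes_chained[OF dp, unfolded chained_def, rule_format]
    have pN: "?p i \<in> {1..int n}" if "i \<in> {1..int n}" for i using that by (simp only: permutes_in_image[OF perm])
    have inj: "?p i = ?p j \<longleftrightarrow> i = j" for i j using permutes_inj[OF perm] by (simp add: inj_eq)
    note bij = permutes_imp_bij[OF perm]
    note ext = shape_extremes[OF bij e(1,2) DN(1) lt]
    obtain z where z: "z \<in> {1..int n}" "?p z = 1"
      using permutes_image[OF perm] n by (metis atLeastAtMost_iff imageE int_one_le_iff_zero_less of_nat_0_less_iff order.refl pos2 order_less_le_trans)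
    have zD: "z \<in> D" using ext(1) z by blast
    obtain t where t: "t \<in> {1..int n}" "?p t = n"
      using permutes_image[OF perm] n by (metis atLeastAtMost_iff imageE int_one_le_iff_zero_less of_nat_0_less_iff order.refl pos2 order_less_le_trans)
    have tD: "t \<notin> D" using ext(2) t by blast
    have lft: "shape_left n D ?p i \<longleftrightarrow> ?p i \<in> L" if i: "i \<in> {1..int n}" for i
    proof (cases "i \<in> D")
      case True
      have "?p i < ?p j" if "?p i \<in> L" "j \<in> D" "j < i" for j
      proof -
        have j: "j \<in> {1..int n}" using that DN by auto
        then have "?p j \<in> L" using ch[OF i j] True that by auto
        then show ?thesis using ch[OF j i] True that by auto
      qed
      moreover have "?p i \<in> L" if "\<forall>j\<in>D. j < i \<longrightarrow> ?p i < ?p j"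
      proof (rule ccontr)
        assume "?p i \<notin> L"
        then have "z < i" using ch[OF z(1) i] zD True z(2) e by auto
        then show False using that zD z(2) pN[OF i] by force
      qed
      ultimately show ?thesis using True by (auto simp: shape_left_def)
    next
      case False
      have "\<exists>j\<in>{1..int n} - D. i < j \<and> ?p i < ?p j" if "?p i \<in> L"
      proof (rule bexI[of _ t])
        have "i \<noteq> t" using that e t by auto
        then show "i < t \<and> ?p i < ?p t" using ch[OF i t(1)] that t(2) e tD False pN[OF i] inj[of i t] by force
      qed (use t tD in auto)
      moreover have "?p i \<in> L" if "j \<in> {1..int n} - D" "i < j" "?p i < ?p j" for j
      proof (rule ccontr)
        assume "?p i \<notin> L"
        then show False using ch[of i j] ch[of j i] i that False by (cases "?p j \<in> L") auto
      qed
      ultimately show ?thesis using False by (auto simp: shape_left_def)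
    qed
    have "(?p, D) \<in> shapes n"
      unfolding shapes_def mem_Collect_eq split
    proof (intro conjI)
      show "\<forall>i\<in>D. \<forall>j\<in>D. \<forall>k\<in>D. i < j \<longrightarrow> j < k \<longrightarrow> ?p i < ?p j \<longrightarrow> ?p j < ?p k"
      proof (intro ballI impI)
        fix i j k assume h: "i \<in> D" "j \<in> D" "k \<in> D" "i < j" "j < k" "?p i < ?p j"
        then have N: "i \<in> {1..int n}" "j \<in> {1..int n}" "k \<in> {1..int n}" using DN by auto
        have "?p j \<notin> L" using ch[OF N(1,2)] ch[OF N(2,1)] h by (cases "?p i \<in> L") auto
        then have "?p k \<notin> L" using ch[OF N(3,2)] h by auto
        then show "?p j < ?p k" using ch[OF N(2,3)] h \<open>?p j \<notin> L\<close> by auto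
      qed
      show "\<forall>i\<in>{1..int n} - D. \<forall>j\<in>{1..int n} - D. \<forall>k\<in>{1..int n} - D.
           i < j \<longrightarrow> j < k \<longrightarrow> ?p j < ?p i \<longrightarrow> ?p k < ?p j"
      proof (intro ballI impI)
        fix i j k assume h: "i \<in> {1..int n} - D" "j \<in> {1..int n} - D" "k \<in> {1..int n} - D" "i < j" "j < k" "?p j < ?p i"
        then have N: "i \<in> {1..int n}" "j \<in> {1..int n}" "k \<in> {1..int n}" by auto
        have "?p j \<notin> L" using ch[OF N(1,2)] ch[OF N(2,1)] h by (cases "?p i \<in> L") auto
        then have "?p k \<notin> L" using ch[OF N(3,2)] h by auto
        then show "?p k < ?p j" using ch[OF N(2,3)] h \<open>?p j \<notin> L\<close> by auto
      qed
    qed (use perm DN e lt in auto)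
    moreover have "shape_code n (?p, D) = (D, L, a)"
    proof -
      have "?p ` {i\<in>{1..int n}. shape_left n D ?p i} = ?p ` {i\<in>{1..int n}. ?p i \<in> L}" using lft by auto
      also have "\<dots> = L"
      proof -
        have "L \<subseteq> ?p ` {1..int n}" using DN(2) permutes_image[OF perm] by simp
        then show ?thesis by blast
      qed
      finally have 1: "?p ` {i\<in>{1..int n}. shape_left n D ?p i} = L" .
      have "{i\<in>{1..int n}. i \<in> D \<and> shape_left n D ?p i} = {i\<in>{1..int n}. i \<in> D \<and> ?p i \<in> L}" using lft by auto
      then have "int (card {i\<in>{1..int n}. i \<in> D \<and> shape_left n D ?p i}) = a"
        using card_left_down[OF dp] a1 by simp
      with 1 show ?thesis unfolding shape_code_def split by simp
    qed
    ultimately show "(D, L, a) \<in> shape_code n ` shapes n" by force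
  qed
qed

section \<open>A constant proportion of the codes is accepted\<close>

text \<open>The deviation of \<open>2 * rk D i - i\<close> is at most \<open>n / 32\<close>, which is small
  enough for the linear estimates in \<open>balanced_accepted\<close>. The conditions on
  \<open>1\<close> and \<open>n\<close> fix the labels at the places where two chains meet.\<close>

definition balanced :: "int \<Rightarrow> int set \<Rightarrow> bool" where
  "balanced n D \<longleftrightarrow> D \<subseteq> {1..n} \<and> 1 \<in> D \<and> n \<notin> D \<and> (\<forall>i\<in>{1..n}. 32 * \<bar>2 * rk D i - i\<bar> \<le> n)"

text \<open>The equations for the ranks show that every point of the decoded permutation is close to the side
  of the diamond that belongs to its chain. Hence opposite chains are far apart, and a point is a
  record of the type of its label: points of its own chain and of the neighbouring chains are
  ordered suitably by \<open>decodes_chained\<close>, those of the opposite chain by distance.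
  That it is not a record of a type of higher priority is witnessed by the points in the columns
  \<open>1\<close> and \<open>n\<close> and in the rows \<open>1\<close> and \<open>n\<close>.\<close>

lemma balanced_accepted:
  assumes D: "balanced n D" and L: "balanced n L" and a: "32 * \<bar>4 * a - n\<bar> \<le> n" and n: "1000 \<le> n"
  shows "in_range n (D, L, a)" and "decodes n (D, L, a) \<sigma> \<Longrightarrow> square_ok n D L \<sigma> \<and> shape_ok n D L \<sigma>"
proof -
  let ?D = "{1..n} - D" and ?L = "{1..n} - L"
  have sub: "1 \<in> D" "n \<notin> D" "1 \<in> L" "n \<notin> L" "D \<subseteq> {1..n}" "L \<subseteq> {1..n}" using D L by (auto simp: balanced_def)
  have bD: "64 * rk D i \<le> n + 32 * i" "32 * i \<le> n + 64 * rk D i" if "i \<in> {1..n}" for i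
  proof -
    have "32 * \<bar>2 * rk D i - i\<bar> \<le> n" using D that unfolding balanced_def by blast
    then have "64 * rk D i \<le> n + 32 * i \<and> 32 * i \<le> n + 64 * rk D i" by (smt (verit))
    then show "64 * rk D i \<le> n + 32 * i" "32 * i \<le> n + 64 * rk D i" by blast+
  qed
  have bL: "64 * rk L i \<le> n + 32 * i" "32 * i \<le> n + 64 * rk L i" if "i \<in> {1..n}" for i
  proof -
    have "32 * \<bar>2 * rk L i - i\<bar> \<le> n" using L that unfolding balanced_def by blast
    then have "64 * rk L i \<le> n + 32 * i \<and> 32 * i \<le> n + 64 * rk L i" by (smt (verit))
    then show "64 * rk L i \<le> n + 32 * i" "32 * i \<le> n + 64 * rk L i" by blast+
  qed
  have "128 * a \<le> 33 * n \<and> 31 * n \<le> 128 * a" using a by (smt (verit))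
  then have a1: "128 * a \<le> 33 * n" "31 * n \<le> 128 * a" by blast+
  have nn: "n \<in> {1..n}" "1 \<in> {1..n}" using n by auto
  show "in_range n (D, L, a)"
    unfolding in_range_def split using bD[OF nn(1)] bL[OF nn(1)] a1 n by (smt (verit))
  assume dec: "decodes n (D, L, a) \<sigma>"
  have rng: "\<sigma> i \<in> {1..n}" if "i \<in> {1..n}" for i using dec that unfolding decodes_def by blast
  have inj: "\<sigma> i = \<sigma> j \<longleftrightarrow> i = j" if "i \<in> {1..n}" "j \<in> {1..n}" for i j
    using decodes_inj[OF dec] that by (simp add: inj_on_eq_iff)
  have "\<sigma> ` {1..n} = {1..n}" using decodes_inj[OF dec] rng by (intro endo_inj_surj) auto
  then have surj: "\<exists>i\<in>{1..n}. \<sigma> i = j" if "j \<in> {1..n}" for j using that by (metis imageE)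
  note ch = decodes_chained[OF dec, unfolded chained_def, rule_format]
  note de = dec[unfolded decodes_def split, rule_format, THEN conjunct2]
  have cD: "rk ?D i = i - rk D i" if "i \<in> {1..n}" for i using that by (intro rk_compl) auto
  have cL: "rk ?L i = i - rk L i" if "i \<in> {1..n}" for i using that by (intro rk_compl) auto
  \<comment> \<open>The four sides of the diamond: each chain stays within a distance of about
    \<open>n / 16\<close> of a line of slope \<open>1\<close> or \<open>-1\<close>.\<close>
  have "16 * i + 16 * \<sigma> i \<le> n + 32 * a + 32 \<and> 32 * a + 32 \<le> n + 16 * i + 16 * \<sigma> i"
    if h: "i \<in> {1..n}" "i \<in> D" "\<sigma> i \<in> L" for i
  proof -
    have "rk D i + rk L (\<sigma> i) = a + 1" using de[OF h(1)] h by simp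
    then show ?thesis using bD[OF h(1)] bL[OF rng[OF h(1)]] cD[OF h(1)] cL[OF rng[OF h(1)]] by linarith
  qed
  then have BL: "16 * i + 16 * \<sigma> i \<le> n + 32 * a + 32" "32 * a + 32 \<le> n + 16 * i + 16 * \<sigma> i" if "i \<in> {1..n}" "i \<in> D" "\<sigma> i \<in> L" for i using that by blast+
  have "16 * i \<le> n + 16 * \<sigma> i + 32 * a \<and> 32 * a + 16 * \<sigma> i \<le> n + 16 * i"
    if h: "i \<in> {1..n}" "i \<in> D" "\<sigma> i \<notin> L" for i
  proof -
    have "rk D i = a + rk ?L (\<sigma> i)" using de[OF h(1)] h by simp
    then show ?thesis using bD[OF h(1)] bL[OF rng[OF h(1)]] cD[OF h(1)] cL[OF rng[OF h(1)]] by linarith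
  qed
  then have BR: "16 * i \<le> n + 16 * \<sigma> i + 32 * a" "32 * a + 16 * \<sigma> i \<le> n + 16 * i" if "i \<in> {1..n}" "i \<in> D" "\<sigma> i \<notin> L" for i using that by blast+
  have "16 * \<sigma> i \<le> n + 16 * i + 32 * a \<and> 32 * a + 16 * i \<le> n + 16 * \<sigma> i"
    if h: "i \<in> {1..n}" "i \<notin> D" "\<sigma> i \<in> L" for i
  proof -
    have "rk L (\<sigma> i) = a + rk ?D i" using de[OF h(1)] h by simp
    then show ?thesis using bD[OF h(1)] bL[OF rng[OF h(1)]] cD[OF h(1)] cL[OF rng[OF h(1)]] by linarith
  qed
  then have UL: "16 * \<sigma> i \<le> n + 16 * i + 32 * a" "32 * a + 16 * i \<le> n + 16 * \<sigma> i" if "i \<in> {1..n}" "i \<notin> D" "\<sigma> i \<in> L" for i using that by blast+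
  have "16 * i + 16 * \<sigma> i + 32 * a \<le> 33 * n + 32 \<and> 31 * n + 32 \<le> 32 * a + 16 * i + 16 * \<sigma> i"
    if h: "i \<in> {1..n}" "i \<notin> D" "\<sigma> i \<notin> L" for i
  proof -
    have "rk ?D i + rk ?L (\<sigma> i) = n + 1 - a" using de[OF h(1)] h by simp
    then show ?thesis using bD[OF h(1)] bL[OF rng[OF h(1)]] cD[OF h(1)] cL[OF rng[OF h(1)]] by linarith
  qed
  then have UR: "16 * i + 16 * \<sigma> i + 32 * a \<le> 33 * n + 32" "31 * n + 32 \<le> 32 * a + 16 * i + 16 * \<sigma> i" if "i \<in> {1..n}" "i \<notin> D" "\<sigma> i \<notin> L" for i using that by blast+
  have r1: "rk D 1 = 1" "rk L 1 = 1" using rk_Suc[of 0] sub by simp_all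
  have apos: "1 \<le> a" using a1 n by linarith
  have L1: "\<sigma> 1 \<in> L"
  proof (rule ccontr)
    assume h: "\<sigma> 1 \<notin> L"
    then have "rk D 1 = a + rk ?L (\<sigma> 1)" using de[OF nn(2)] sub by simp
    moreover have "1 \<le> rk ?L (\<sigma> 1)" using h rng[OF nn(2)] by (intro rk_pos) auto
    ultimately show False using r1 apos by simp
  qed
  obtain z where z: "z \<in> {1..n}" "\<sigma> z = 1" using surj nn by blast
  have zD: "z \<in> D"
  proof (rule ccontr)
    assume h: "z \<notin> D"
    then have "rk L 1 = a + rk ?D z" using de[OF z(1)] z sub by simp
    moreover have "1 \<le> rk ?D z" using h z by (intro rk_pos) auto
    ultimately show False using r1 apos by simp
  qed
  obtain t where t: "t \<in> {1..n}" "\<sigma> t = n" using surj nn by blast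
  have tD: "t \<notin> D"
  proof
    assume h: "t \<in> D"
    then have "rk D t = a + rk ?L n" using de[OF t(1)] t sub by simp
    moreover have "rk D t \<le> rk D n" using t by (intro rk_mono) auto
    ultimately show False using bD[OF nn(1)] bL[OF nn(1)] cL[OF nn(1)] a1 n by linarith
  qed
  have nR: "\<sigma> n \<notin> L"
  proof
    assume h: "\<sigma> n \<in> L"
    then have "n \<noteq> t" using t sub by auto
    then show False using ch[OF nn(1) t(1)] h tD sub t by auto
  qed
  have sq: "(bl n \<sigma> i \<or> ur n \<sigma> i \<or> ul n \<sigma> i \<or> br n \<sigma> i) \<and>
     (i \<in> D \<longleftrightarrow> down n \<sigma> i) \<and> (\<sigma> i \<in> L \<longleftrightarrow> left n \<sigma> i)" if i: "i \<in> {1..n}" for i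
  proof (cases "i \<in> D"; cases "\<sigma> i \<in> L")
    assume ty: "i \<in> D" "\<sigma> i \<in> L"
    have "bl n \<sigma> i"
      unfolding bl_def
    proof (intro ballI impI, rule ccontr)
      fix j assume j: "j \<in> {1..n}" "j < i" "\<not> \<sigma> i \<le> \<sigma> j"
      then have "j \<notin> D" "\<sigma> j \<notin> L" using ch[OF j(1) i] ch[OF i j(1)] ty by auto
      then show False using UR[OF j(1)] BL[OF i ty] j a1 n by linarith
    qed
    then show ?thesis using ty by (auto simp: down_def left_def)
  next
    assume ty: "i \<notin> D" "\<sigma> i \<notin> L"
    have 1: "ur n \<sigma> i"
      unfolding ur_def
    proof (intro ballI impI, rule ccontr)
      fix j assume j: "j \<in> {1..n}" "i < j" "\<not> \<sigma> j \<le> \<sigma> i"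
      then have "j \<in> D" "\<sigma> j \<in> L" using ch[OF j(1) i] ch[OF i j(1)] ty by auto
      then show False using BL[OF j(1)] UR[OF i ty] j a1 n by linarith
    qed
    have 2: "\<not> bl n \<sigma> i"
    proof
      assume b: "bl n \<sigma> i"
      have "i \<le> z" using b z i rng[OF i] inj[OF i z(1)] ty zD unfolding bl_def by force
      moreover have "\<sigma> i \<le> \<sigma> 1" using b nn i ty sub unfolding bl_def by (cases "i = 1") auto
      ultimately show False
        using UR[OF i ty] BL[OF z(1) zD] BL[OF nn(2) sub(1) L1] z(2) sub a1 n by simp
    qed
    then show ?thesis using 1 2 ty by (auto simp: down_def left_def)
  next
    assume ty: "i \<notin> D" "\<sigma> i \<in> L"
    have 1: "ul n \<sigma> i"
      unfolding ul_def
    proof (intro ballI impI, rule ccontr)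
      fix j assume j: "j \<in> {1..n}" "j < i" "\<not> \<sigma> j \<le> \<sigma> i"
      then have "j \<in> D" "\<sigma> j \<notin> L" using ch[OF j(1) i] ch[OF i j(1)] ty by auto
      then show False using BR[OF j(1)] UL[OF i ty] j a1 n by linarith
    qed
    have "1 < i" "\<sigma> 1 < \<sigma> i" using i ty sub ch[OF nn(2) i] L1 by (cases "i = 1"; auto)+
    then have 2: "\<not> bl n \<sigma> i" using nn unfolding bl_def by force
    have "i < t" using ch[OF i t(1)] ty t sub tD by auto
    moreover have "\<sigma> i < \<sigma> t" using rng[OF i] t ty sub by (cases "\<sigma> i = n") auto
    ultimately have 3: "\<not> ur n \<sigma> i" using t unfolding ur_def by force
    show ?thesis using 1 2 3 ty by (auto simp: down_def left_def)
  next
    assume ty: "i \<in> D" "\<sigma> i \<notin> L"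
    have 1: "br n \<sigma> i"
      unfolding br_def
    proof (intro ballI impI, rule ccontr)
      fix j assume j: "j \<in> {1..n}" "i < j" "\<not> \<sigma> i \<le> \<sigma> j"
      then have "j \<notin> D" "\<sigma> j \<in> L" using ch[OF j(1) i] ch[OF i j(1)] ty by auto
      then show False using UL[OF j(1)] BR[OF i ty] j a1 n by linarith
    qed
    have "z < i" using ch[OF z(1) i] ty zD z sub by auto
    moreover have "\<sigma> z < \<sigma> i" using rng[OF i] z ty sub by (cases "\<sigma> i = 1") auto
    ultimately have 2: "\<not> bl n \<sigma> i" using z unfolding bl_def by force
    have "i < n" "\<sigma> i < \<sigma> n" using i ty sub ch[OF i nn(1)] nR by (cases "i = n"; auto)+
    then have 3: "\<not> ur n \<sigma> i" using nn unfolding ur_def by force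
    have 4: "\<not> ul n \<sigma> i"
    proof
      assume u: "ul n \<sigma> i"
      have "i \<le> t" using u t i rng[OF i] inj[OF i t(1)] ty tD unfolding ul_def by force
      moreover have "\<sigma> 1 \<le> \<sigma> i" using u nn i ty sub L1 unfolding ul_def by (cases "i = 1") auto
      ultimately show False
        using BR[OF i ty] UR[OF t(1) tD] BL[OF nn(2) sub(1) L1] t(2) sub a1 n by simp
    qed
    show ?thesis using 1 2 3 4 ty by (auto simp: down_def left_def)
  qed
  have "lower D \<sigma> x < upper n D \<sigma> x" if x: "x \<in> {1..n-1}" for x
  proof -
    have x': "1 \<le> x" "x < n" using x by auto
    obtain i where i: "i \<in> D" "1 \<le> i" "i \<le> x" "lower D \<sigma> x = \<sigma> i" "\<And>j. j \<in> D \<Longrightarrow> i < j \<Longrightarrow> x < j"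
      using lower_obtain[OF sub(1) x'(1)] by metis
    obtain j where j: "j \<notin> D" "x < j" "j \<le> n" "upper n D \<sigma> x = \<sigma> j" "\<And>k. k \<notin> D \<Longrightarrow> x < k \<Longrightarrow> j \<le> k"
      using upper_obtain[OF sub(2) x'(2)] by metis
    have N: "i \<in> {1..n}" "j \<in> {1..n}" using i j x by auto
    have "\<sigma> i < \<sigma> j"
    proof (cases "\<sigma> i \<in> L"; cases "\<sigma> j \<in> L")
      assume "\<sigma> i \<in> L" "\<sigma> j \<in> L" then show ?thesis using ch[OF N] i j by auto
    next
      assume "\<sigma> i \<notin> L" "\<sigma> j \<notin> L" then show ?thesis using ch[OF N] i j by auto
    next
      assume "\<sigma> i \<notin> L" "\<sigma> j \<in> L"
      then show ?thesis using BR[OF N(1)] UL[OF N(2)] i j a1 n by linarith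
    next
      assume ty: "\<sigma> i \<in> L" "\<sigma> j \<notin> L"
      have "D \<inter> {1..x} = D \<inter> {1..i}" using i by force
      then have e1: "rk D x = rk D i" by (simp add: rk_def)
      have "?D \<inter> {1..j-1} = ?D \<inter> {1..x}" using j by force
      then have "rk ?D (j-1) = rk ?D x" by (simp add: rk_def)
      moreover have "x \<in> {1..n}" "j - 1 \<in> {1..n}" using x j by auto
      ultimately have e2: "j - 1 - rk D (j-1) = x - rk D x" "x \<in> {1..n}" "j - 1 \<in> {1..n}"
        using cD[of x] cD[of "j-1"] by auto
      have "64 * rk D (j-1) \<le> n + 32 * j - 32" using bD(1)[OF e2(3)] by simp
      then show ?thesis
        using BL(1)[OF N(1) i(1) ty(1)] UR(2)[OF N(2) j(1) ty(2)] bD(1)[OF N(1)] bD(2)[OF e2(2)] e1 e2(1) a1 n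
        by linarith
    qed
    then show ?thesis using i j by simp
  qed
  then show "square_ok n D L \<sigma> \<and> shape_ok n D L \<sigma>"
    using sq sub by (auto simp: square_ok_def shape_ok_def)
qed

lemma sum_Pow_insert:
  fixes F :: "'a set \<Rightarrow> 'b::comm_monoid_add"
  assumes "finite A" "x \<notin> A"
  shows "(\<Sum>D\<in>Pow (insert x A). F D) = (\<Sum>D\<in>Pow A. F D + F (insert x D))"
proof -
  have "inj_on (insert x) (Pow A)" using assms by (auto simp: inj_on_def)
  moreover have "Pow A \<inter> insert x ` Pow A = {}" using assms by auto
  ultimately show ?thesis
    using assms by (simp add: Pow_insert sum.union_disjoint sum.reindex sum.distrib)
qed

text \<open>For a uniform random set \<open>D\<close> the quantity \<open>s D i\<close> is the position of the
  simple random walk at time \<open>i\<close>.\<close>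

lemma moments:
  fixes n :: nat
  defines "s D i \<equiv> 2 * rk D (int i) - int i"
  shows "(\<Sum>D\<in>Pow {1..int n}. (s D n)\<^sup>2) = int n * 2 ^ n"
    and "i \<le> n \<Longrightarrow> (\<Sum>D\<in>Pow {1..int n}. (s D i) ^ 4) = (3 * int i ^ 2 - 2 * int i) * 2 ^ n"
proof -
  have ins: "Pow {1..int (Suc n)} = Pow (insert (int n + 1) {1..int n})" for n
    by (rule arg_cong[of _ _ Pow]) auto
  have step: "(\<Sum>D\<in>Pow {1..int (Suc n)}. F D) = (\<Sum>D\<in>Pow {1..int n}. F D + F (insert (int n + 1) D))" for F :: "int set \<Rightarrow> int" and n
    unfolding ins by (rule sum_Pow_insert) auto
  have new: "s D (Suc n) = s D n - 1" "s (insert (int n + 1) D) (Suc n) = s D n + 1" if "D \<in> Pow {1..int n}" for D n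
  proof -
    have c: "int (Suc n) = int n + 1" by simp
    have "int n + 1 \<notin> D" using that by auto
    moreover have "rk (insert (int n + 1) D) (int n) = rk D (int n)"
      unfolding rk_def by (intro arg_cong[of _ _ "\<lambda>A. int (card A)"]) auto
    ultimately show "s D (Suc n) = s D n - 1" "s (insert (int n + 1) D) (Suc n) = s D n + 1"
      unfolding s_def c using rk_Suc[of "int n" D] rk_Suc[of "int n" "insert (int n + 1) D"] by auto
  qed
  have old: "s (insert (int n + 1) D) i = s D i" if "i \<le> n" for D n i
    unfolding s_def rk_def using that by (intro arg_cong[of _ _ "\<lambda>A. 2 * int (card A) - int i"]) auto
  have second: "(\<Sum>D\<in>Pow {1..int n}. (s D n)\<^sup>2) = int n * 2 ^ n" for n
  proof (induction n)
    case 0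
    show ?case by (simp add: s_def)
  next
    case (Suc n)
    have "(\<Sum>D\<in>Pow {1..int (Suc n)}. (s D (Suc n))\<^sup>2) = (\<Sum>D\<in>Pow {1..int n}. 2 * (s D n)\<^sup>2 + 2)"
      unfolding step
    proof (rule sum.cong[OF refl])
      fix D assume "D \<in> Pow {1..int n}"
      then show "(s D (Suc n))\<^sup>2 + (s (insert (int n + 1) D) (Suc n))\<^sup>2 = 2 * (s D n)\<^sup>2 + 2"
        unfolding new[OF \<open>D \<in> Pow {1..int n}\<close>] by (simp add: power2_eq_square algebra_simps)
    qed
    also have "\<dots> = 2 * (int n * 2 ^ n) + 2 * 2 ^ n"
      by (simp only: sum.distrib sum_distrib_left[symmetric] Suc.IH) (simp add: card_Pow)
    finally show ?case by (simp add: algebra_simps)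
  qed
  then show "(\<Sum>D\<in>Pow {1..int n}. (s D n)\<^sup>2) = int n * 2 ^ n" .
  show "i \<le> n \<Longrightarrow> (\<Sum>D\<in>Pow {1..int n}. (s D i) ^ 4) = (3 * int i ^ 2 - 2 * int i) * 2 ^ n"
  proof (induction n arbitrary: i)
    case 0
    then show ?case by (simp add: s_def)
  next
    case (Suc n)
    show ?case
    proof (cases "i \<le> n")
      case True
      have "(\<Sum>D\<in>Pow {1..int (Suc n)}. (s D i) ^ 4) = (\<Sum>D\<in>Pow {1..int n}. 2 * (s D i) ^ 4)"
        unfolding step by (rule sum.cong) (simp_all add: old[OF True])
      then show ?thesis using Suc.IH[OF True] by (simp add: sum_distrib_left[symmetric])
    next
      case False
      then have i: "i = Suc n" using Suc.prems by simp
      have "(x - 1) ^ 4 + (x + 1) ^ 4 = 2 * x ^ 4 + 12 * x\<^sup>2 + 2" for x :: int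
        by (simp add: power4_eq_xxxx power2_eq_square algebra_simps)
      then have "(\<Sum>D\<in>Pow {1..int (Suc n)}. (s D i) ^ 4) = (\<Sum>D\<in>Pow {1..int n}. 2 * (s D n) ^ 4 + 12 * (s D n)\<^sup>2 + 2)"
        unfolding step i by (intro sum.cong) (simp_all add: new)
      also have "\<dots> = 2 * ((3 * int n ^ 2 - 2 * int n) * 2 ^ n) + 12 * (int n * 2 ^ n) + 2 * 2 ^ n"
        by (simp only: sum.distrib sum_distrib_left[symmetric] Suc.IH[OF order.refl] second) (simp add: card_Pow)
      finally show ?thesis by (simp add: i power2_eq_square algebra_simps)
    qed
  qed
qed

text \<open>A quarter of all sets satisfies the conditions on \<open>1\<close> and \<open>n\<close>. By the
  Markov inequality for the fourth moment, the deviation at a given \<open>i\<close> is too large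
  for a proportion of at most \<open>c / n\<^sup>2\<close> of the sets, where \<open>c = 3 * 32 ^
  4\<close>. Summing over \<open>i\<close> excludes a proportion of at most \<open>c / n \<le> 1 /
  8\<close>, which is less than a quarter. The second moment would not suffice for this union
  bound.\<close>

lemma card_balanced:
  assumes n: "24 * 32 ^ 4 \<le> n"
  shows "2 ^ n \<le> 8 * card {D. balanced (int n) D}"
proof -
  let ?N = "{1..int n}"
  define s where "s D i = 2 * rk D (int i) - int i" for D i
  define B where "B i = {D \<in> Pow ?N. int n < 32 * \<bar>s D i\<bar>}" for i
  define E where "E = {D \<in> Pow ?N. 1 \<in> D \<and> int n \<notin> D}"
  define c :: int where "c = 3 * 32 ^ 4"
  have c: "c > 0" "8 * c \<le> int n" using n by (simp_all add: c_def)
  have n2: "2 \<le> n" using n by simp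
  have finB: "finite (B i)" for i unfolding B_def by (rule finite_subset[of _ "Pow ?N"]) auto
  have cB: "int n ^ 2 * int (card (B i)) \<le> c * 2 ^ n" if i: "i \<in> {1..n}" for i
  proof -
    have "int n ^ 4 * int (card (B i)) = (\<Sum>D\<in>B i. int n ^ 4)" by simp
    also have "\<dots> \<le> (\<Sum>D\<in>B i. (32 * s D i) ^ 4)"
    proof (rule sum_mono)
      fix D assume "D \<in> B i"
      then have "int n ^ 4 \<le> (32 * \<bar>s D i\<bar>) ^ 4" by (intro power_mono) (auto simp: B_def)
      also have "\<dots> = (32 * s D i) ^ 4" by (simp add: power_mult_distrib)
      finally show "int n ^ 4 \<le> (32 * s D i) ^ 4" .
    qed
    also have "\<dots> \<le> (\<Sum>D\<in>Pow ?N. (32 * s D i) ^ 4)"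
      by (rule sum_mono2) (auto simp: B_def)
    also have "\<dots> = 32 ^ 4 * (\<Sum>D\<in>Pow ?N. s D i ^ 4)"
      by (simp add: power_mult_distrib sum_distrib_left)
    also have "\<dots> = 32 ^ 4 * ((3 * int i ^ 2 - 2 * int i) * 2 ^ n)"
      using moments(2)[of i n] i unfolding s_def by simp
    also have "\<dots> \<le> 32 ^ 4 * ((3 * int n ^ 2) * 2 ^ n)"
    proof -
      have "int i ^ 2 \<le> int n ^ 2" using i by (intro power_mono) auto
      then have "3 * int i ^ 2 - 2 * int i \<le> 3 * int n ^ 2" by linarith
      then show ?thesis by (intro mult_left_mono mult_right_mono) auto
    qed
    finally have "int n ^ 2 * (int n ^ 2 * int (card (B i))) \<le> int n ^ 2 * (c * 2 ^ n)"
      by (simp add: c_def power_numeral_reduce algebra_simps)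
    moreover have "0 < int n ^ 2" using n2 by simp
    ultimately show ?thesis by (simp only: mult_le_cancel_left_pos)
  qed
  let ?U = "\<Union>i\<in>{1..n}. B i"
  have "int n ^ 2 * int (card ?U) \<le> int n ^ 2 * (\<Sum>i\<in>{1..n}. int (card (B i)))"
    using card_UN_le[of "{1..n}" B] by (intro mult_left_mono) (simp_all flip: of_nat_sum)
  also have "\<dots> = (\<Sum>i\<in>{1..n}. int n ^ 2 * int (card (B i)))" by (rule sum_distrib_left)
  also have "\<dots> \<le> (\<Sum>i\<in>{1..n}. c * 2 ^ n)" by (rule sum_mono) (rule cB)
  also have "\<dots> = int n * (c * 2 ^ n)" by simp
  finally have "int n * int (card ?U) \<le> c * 2 ^ n" using n2 by (simp add: power2_eq_square)
  moreover have "8 * c * int (card ?U) \<le> int n * int (card ?U)" using c by (intro mult_right_mono) auto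
  ultimately have "c * (8 * int (card ?U)) \<le> c * 2 ^ n" by (simp add: mult_ac)
  then have U: "8 * int (card ?U) \<le> 2 ^ n" using c by simp
  have "bij_betw (insert 1) (Pow {2..int n - 1}) E"
  proof (rule bij_betw_byWitness[where f' = "\<lambda>D. D - {1}"])
    show "insert 1 ` Pow {2..int n - 1} \<subseteq> E" using n2 unfolding E_def by fastforce
    show "(\<lambda>D. D - {1}) ` E \<subseteq> Pow {2..int n - 1}"
    proof (intro image_subsetI PowI subsetI)
      fix D x assume "D \<in> E" "x \<in> D - {1}"
      then have "x \<in> ?N" "x \<noteq> int n" "x \<noteq> 1" unfolding E_def by blast+
      then show "x \<in> {2..int n - 1}" by simp
    qed
  qed (auto simp: E_def)
  then have "card E = 2 ^ (n - 2)" using n2 by (simp add: bij_betw_same_card[symmetric] card_Pow nat_diff_distrib)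
  moreover have "(2::int) ^ n = 2 ^ (n - 2) * 2 ^ 2"
    by (simp only: power_add[symmetric] le_add_diff_inverse2[OF n2])
  ultimately have E: "4 * int (card E) = 2 ^ n" by simp
  have "E - ?U \<subseteq> {D. balanced (int n) D}"
  proof
    fix D assume D: "D \<in> E - ?U"
    have "32 * \<bar>2 * rk D i - i\<bar> \<le> int n" if "i \<in> {1..int n}" for i
    proof -
      have "nat i \<in> {1..n}" using that by auto
      then have "D \<notin> B (nat i)" using D by blast
      then show ?thesis using D that by (auto simp: B_def E_def s_def)
    qed
    then show "D \<in> {D. balanced (int n) D}" using D by (auto simp: balanced_def E_def)
  qed
  moreover have "finite {D. balanced (int n) D}"
    by (rule finite_subset[of _ "Pow ?N"]) (auto simp: balanced_def)
  ultimately have "card (E - ?U) \<le> card {D. balanced (int n) D}" by (rule card_mono[rotated])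
  moreover have "card E - card ?U \<le> card (E - ?U)" using finB by (intro diff_card_le_card_Diff) auto
  ultimately have "int (card E) - int (card ?U) \<le> int (card {D. balanced (int n) D})" by linarith
  with E U have "2 ^ n \<le> 8 * int (card {D. balanced (int n) D})" by linarith
  then show ?thesis by (metis (mono_tags, lifting) of_nat_le_iff of_nat_mult of_nat_numeral of_nat_power)
qed

text \<open>A proportion of \<open>1 / 8\<close> of the sets is balanced and \<open>1 / 256\<close> of the
  numbers is close enough to \<open>n / 4\<close>; and \<open>8 * 8 * 256 = 2 ^ 14\<close>.\<close>

lemma many_codes_accepted:
  assumes n: "24 * 32 ^ 4 \<le> n"
  obtains A where "A \<subseteq> square_code n ` square_permutations n" "A \<subseteq> shape_code n ` shapes n"
    "card (codes n) \<le> 2 ^ 14 * card A"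
proof
  let ?B = "{D. balanced (int n) D}"
  define I where "I = {a\<in>{1..int n}. 32 * \<bar>4 * a - int n\<bar> \<le> int n}"
  let ?A = "?B \<times> ?B \<times> I"
  have n': "1000 \<le> int n" "2 \<le> n" using n by simp_all
  have "(D, L, a) \<in> square_code n ` square_permutations n \<inter> shape_code n ` shapes n" if "(D, L, a) \<in> ?A" for D L a
  proof -
    have DL: "balanced n D" "balanced n L" "32 * \<bar>4 * a - int n\<bar> \<le> int n" and c: "(D, L, a) \<in> codes n"
      using that by (auto simp: I_def codes_def balanced_def)
    note acc = balanced_accepted[OF DL n'(1)]
    obtain \<sigma> where dec: "decodes n (D, L, a) \<sigma>" using decodes_exists[OF acc(1)] by auto
    show ?thesis using square_code_iff(1)[OF c acc(1) dec] shape_code_iff(1)[OF c acc(1) dec n'(2)] acc(2)[OF dec] by blast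
  qed
  then show "?A \<subseteq> square_code n ` square_permutations n" "?A \<subseteq> shape_code n ` shapes n" by blast+
  have I: "n \<le> 256 * card I"
  proof -
    let ?J = "{int (n div 4 - n div 256)..int (n div 4)}"
    have "?J \<subseteq> I"
    proof
      fix a assume a: "a \<in> ?J"
      have "1 \<le> int (n div 4 - n div 256)" "32 * \<bar>4 * a - int n\<bar> \<le> int n" "int (n div 4) \<le> int n"
        using a n' by auto
      then show "a \<in> I" using a by (auto simp: I_def)
    qed
    then have "card ?J \<le> card I" by (intro card_mono) (auto simp: I_def intro: finite_subset[of _ "{1..int n}"])
    moreover have "n \<le> 256 * card ?J" by simp
    ultimately show ?thesis by linarith
  qed
  have "card (codes n) = n * (2 ^ n * 2 ^ n)" by (simp add: card_codes flip: power_mult_distrib)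
  also have "\<dots> \<le> (256 * card I) * ((8 * card ?B) * (8 * card ?B))"
    using I card_balanced[OF n] by (intro mult_mono) auto
  also have "\<dots> = 2 ^ 14 * card ?A" by (simp add: card_cartesian_product)
  finally show "card (codes n) \<le> 2 ^ 14 * card ?A" .
qed

lemma id_square: "id \<in> square_permutations n"
  by (auto simp: square_permutations_iff permutes_id ul_def)

lemma id_shape: "2 \<le> n \<Longrightarrow> (id, {1..int n - 1}) \<in> shapes n"
proof -
  assume n: "2 \<le> n"
  have "{1..int n - 1} \<inter> {1..x} = {1..x}" "{x+1..int n} - {1..int n - 1} = {int n}" if "x \<in> {1..int n - 1}" for x
    using that by auto
  then have "lower {1..int n - 1} id x < upper n {1..int n - 1} id x" if "x \<in> {1..int n - 1}" for x
    using that by (simp add: lower_def upper_def)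
  then show ?thesis using n by (auto simp: shapes_def permutes_id)
qed

text \<open>For large \<open>n\<close> this is \<open>many_codes_accepted\<close>; for the finitely many small \<open>n\<close>
  it suffices that there is at least one object, such as the identity.\<close>

lemma acceptance:
  "\<exists>C>0. \<forall>n\<ge>2. card (codes n) \<le> C * card (square_code n ` square_permutations n) \<and>
     card (codes n) \<le> C * card (shape_code n ` shapes n)"
proof (intro exI conjI allI impI)
  define N :: nat where "N = 24 * 32 ^ 4"
  define C where "C = 2 ^ 14 + N * 4 ^ N"
  show "0 < C" by (simp add: C_def)
  fix n :: nat assume n: "2 \<le> n"
  have main: "card (codes n) \<le> C * card G"
    if ne: "G \<noteq> {}" "G \<subseteq> codes n" and big: "N \<le> n \<Longrightarrow> card (codes n) \<le> 2 ^ 14 * card G" for G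
  proof (cases "N \<le> n")
    case True
    then have "card (codes n) \<le> 2 ^ 14 * card G" by (rule big)
    also have "\<dots> \<le> C * card G" unfolding C_def by (rule mult_right_mono) auto
    finally show ?thesis .
  next
    case False
    have "0 < card G" using ne finite_codes finite_subset by (auto simp: card_gt_0_iff)
    have "card (codes n) \<le> N * 4 ^ N" unfolding card_codes using False by (intro mult_mono power_increasing) auto
    also have "\<dots> \<le> C * 1" by (simp add: C_def)
    also have "\<dots> \<le> C * card G" using \<open>0 < card G\<close> by (intro mult_left_mono) auto
    finally show ?thesis .
  qed
  have sub: "square_code n ` square_permutations n \<subseteq> codes n" "shape_code n ` shapes n \<subseteq> codes n"
    using square_code_decodes(3)[of _ n] shape_code_decodes(3)[of _ _ n] n by auto
  have big: "card (codes n) \<le> 2 ^ 14 * card (square_code n ` square_permutations n)"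
    "card (codes n) \<le> 2 ^ 14 * card (shape_code n ` shapes n)" if h: "N \<le> n"
  proof -
    obtain A where A: "A \<subseteq> square_code n ` square_permutations n" "A \<subseteq> shape_code n ` shapes n"
      "card (codes n) \<le> 2 ^ 14 * card A" using many_codes_accepted[OF h[unfolded N_def]] .
    have "card A \<le> card (square_code n ` square_permutations n)" "card A \<le> card (shape_code n ` shapes n)"
      using A sub finite_subset[OF _ finite_codes[of n]] by (auto intro!: card_mono)
    then show "card (codes n) \<le> 2 ^ 14 * card (square_code n ` square_permutations n)"
      "card (codes n) \<le> 2 ^ 14 * card (shape_code n ` shapes n)" using A(3) mult_le_mono2[of "card A"] order_trans by blast+
  qed
  show "card (codes n) \<le> C * card (square_code n ` square_permutations n)"
    by (rule main) (use sub big id_square[of n] in blast)+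
  show "card (codes n) \<le> C * card (shape_code n ` shapes n)"
    by (rule main) (use sub big id_shape[OF n] in blast)+
qed

section \<open>Closed walks\<close>

definition links :: "'a list \<Rightarrow> ('a \<times> 'a) set" where
  "links l = set (zip l (rotate1 l))"

lemma rotate1_zip: "length xs = length ys \<Longrightarrow> rotate1 (zip xs ys) = zip (rotate1 xs) (rotate1 ys)"
  by (cases xs; cases ys) auto

lemma links_rotate [simp]: "links (rotate k l) = links l"
proof (induction k)
  case (Suc k)
  have "links (rotate1 m) = links m" for m :: "'a list"
    by (simp add: links_def rotate1_zip[symmetric])
  then show ?case using Suc by simp
qed simp

lemma links_rev: "links (rev l) = (links l)\<inverse>"
proof (cases l rule: rev_cases)
  case (snoc r z)
  have "links (rev l) = set (zip (z # rev r) (rev r @ [z]))" by (simp add: links_def snoc)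
  also have "zip (z # rev r) (rev r @ [z]) = rev (zip (r @ [z]) (z # r))"
    using zip_rev[of "r @ [z]" "z # r"] by simp
  also have "set (rev (zip (r @ [z]) (z # r))) = (set (zip (z # r) (r @ [z])))\<inverse>"
    by (auto simp: in_set_zip)
  also have "set (zip (z # r) (r @ [z])) = links (z # r)" by (simp add: links_def)
  also have "\<dots> = links l" using links_rotate[of 1 "z # r"] by (simp add: snoc)
  finally show ?thesis .
qed (simp add: links_def)

lemma links_nth: "(p, q) \<in> links w \<longleftrightarrow> (\<exists>i<length w. p = w ! i \<and> q = w ! (Suc i mod length w))"
  by (auto simp: links_def in_set_zip nth_rotate1)

lemma links_iff:
  "l \<noteq> [] \<Longrightarrow> (\<forall>(p, q)\<in>links l. P p q) \<longleftrightarrow> successively P l \<and> P (last l) (hd l)"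
proof -
  assume l: "l \<noteq> []"
  have "successively P (x # xs @ [y]) \<longleftrightarrow> (\<forall>(p, q)\<in>set (zip (x # xs) (xs @ [y])). P p q)" for x xs y
    by (induction xs arbitrary: x) auto
  from this[of "hd l" "tl l" "hd l"] l show ?thesis
    by (cases l) (auto simp: links_def successively_append_iff successively_Cons)
qed

lemma closed_walk_iff: "closed_self_avoiding_walk w \<longleftrightarrow> 2 < length w \<and> distinct w \<and> (\<forall>(p, q)\<in>links w. lattice_adjacent p q)"
proof -
  have "(\<forall>(p, q)\<in>links w. lattice_adjacent p q) \<longleftrightarrow> (\<forall>p q. (p, q) \<in> links w \<longrightarrow> lattice_adjacent p q)" by auto
  also have "\<dots> \<longleftrightarrow> (\<forall>i<length w. lattice_adjacent (w ! i) (w ! (Suc i mod length w)))"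
    unfolding links_nth by blast
  finally show ?thesis by (simp add: closed_self_avoiding_walk_def)
qed

lemma lattice_adjacent_sym: "lattice_adjacent p q \<longleftrightarrow> lattice_adjacent q p"
  by (auto simp: lattice_adjacent_def abs_minus_commute)

lemma closed_walk_rev: "closed_self_avoiding_walk (rev w) = closed_self_avoiding_walk w"
proof -
  have "(\<forall>(p, q)\<in>(links w)\<inverse>. lattice_adjacent p q) \<longleftrightarrow> (\<forall>(p, q)\<in>links w. lattice_adjacent q p)" by auto
  then show ?thesis unfolding closed_walk_iff links_rev using lattice_adjacent_sym by simp
qed

lemma links_in_set: "(p, q) \<in> links w \<Longrightarrow> p \<in> set w \<and> q \<in> set w"
  by (auto simp: links_def dest: set_zip_leftD set_zip_rightD)

text \<open>In a closed walk of length more than \<open>2\<close> the successor and the predecessor of a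
  vertex are different.\<close>

lemma neighbours:
  assumes "distinct w" "2 < length w" "i < length w"
  defines "m \<equiv> length w"
  shows "(w ! i, x) \<in> links w \<longleftrightarrow> x = w ! (Suc i mod m)" "(x, w ! i) \<in> links w \<longleftrightarrow> x = w ! ((i + m - 1) mod m)"
    "w ! (Suc i mod m) \<noteq> w ! ((i + m - 1) mod m)"
proof -
  have m: "2 < m" "i < m" using assms by auto
  have eq: "w ! j = w ! k \<longleftrightarrow> j = k" if "j < m" "k < m" for j k
    using assms that by (simp add: nth_eq_iff_index_eq)
  show "(w ! i, x) \<in> links w \<longleftrightarrow> x = w ! (Suc i mod m)"
    unfolding links_nth using eq m by (auto simp: m_def)
  have p: "Suc j mod m = i \<longleftrightarrow> j = (i + m - 1) mod m" if "j < m" for j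
  proof (cases "i = 0")
    case True
    then show ?thesis using m that by (cases "Suc j = m") auto
  next
    case False
    then have "(i + m - 1) mod m = i - 1" using m by (simp add: mod_if)
    then show ?thesis using False m that by (cases "Suc j = m") auto
  qed
  show "(x, w ! i) \<in> links w \<longleftrightarrow> x = w ! ((i + m - 1) mod m)"
  proof
    assume "(x, w ! i) \<in> links w"
    then obtain j where j: "j < m" "x = w ! j" "w ! i = w ! (Suc j mod m)" by (auto simp: links_nth m_def)
    then have "Suc j mod m = i" using eq[of i "Suc j mod m"] m by auto
    then show "x = w ! ((i + m - 1) mod m)" using p[OF j(1)] j by simp
  next
    assume x: "x = w ! ((i + m - 1) mod m)"
    have lt: "(i + m - 1) mod m < m" using m by simp
    then have "Suc ((i + m - 1) mod m) mod m = i" using p by blast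
    then show "(x, w ! i) \<in> links w" unfolding links_nth using lt x by (auto simp: m_def)
  qed
  have "Suc i mod m \<noteq> (i + m - 1) mod m"
    using m by (cases "i = 0"; cases "Suc i = m") (auto simp: mod_if)
  then show "w ! (Suc i mod m) \<noteq> w ! ((i + m - 1) mod m)" using eq m by simp
qed

subsection \<open>Turning points\<close>

text \<open>The vertices of a walk, between the vertices \<open>p\<close> and \<open>q\<close>, at which it
  changes direction. In contrast to the indices in \<open>turnpoints\<close> this is compatible
  with concatenation.\<close>

primrec bends :: "(int \<times> int) \<Rightarrow> (int \<times> int) list \<Rightarrow> (int \<times> int) \<Rightarrow> (int \<times> int) list" where
  "bends p [] q = []"
| "bends p (u # us) q = (if u - p \<noteq> hd (us @ [q]) - u then [u] else []) @ bends u us q"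

lemma bends_append: "bends p (us @ vs) q = bends p us (hd (vs @ [q])) @ bends (last (p # us)) vs q"
proof (induction us arbitrary: p)
  case (Cons u us)
  have "hd ((us @ vs) @ [q]) = hd (us @ [hd (vs @ [q])])" by (cases us) auto
  then show ?case using Cons[of u] by simp
qed simp

lemma bends_rev: "bends q (rev w) p = rev (bends p w q)"
proof (induction w arbitrary: p)
  case (Cons u us)
  have "last (q # rev us) = hd (us @ [q])" by (cases us) auto
  moreover have "u - hd (us @ [q]) \<noteq> p - u \<longleftrightarrow> u - p \<noteq> hd (us @ [q]) - u" by (auto simp: algebra_simps)
  ultimately show ?case using Cons[of u] by (simp add: bends_append)
qed simp

lemma nths_cong: "(\<And>i. i < length w \<Longrightarrow> i \<in> A \<longleftrightarrow> i \<in> B) \<Longrightarrow> nths w A = nths w B"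
  unfolding nths_def by (intro arg_cong[of _ _ "map fst"] filter_cong) (auto simp: set_zip)

lemma bends_nths: "bends p w q = nths w {i. w ! i - (p # w) ! i \<noteq> (w @ [q]) ! Suc i - w ! i}"
proof (induction w arbitrary: p)
  case (Cons u us)
  have "hd (us @ [q]) = (us @ [q]) ! 0" by (cases us) auto
  then show ?case using Cons[of u] by (simp add: nths_Cons)
qed simp

lemma turnpoints_bends:
  assumes "w \<noteq> []"
  shows "turnpoints w = bends (last w) w (hd w)"
  unfolding turnpoints_def bends_nths
proof (rule nths_cong, unfold mem_Collect_eq)
  fix i assume i: "i < length w"
  have "(last w # w) ! i = w ! ((i + length w - 1) mod length w)"
    using i assms by (cases i) (auto simp: last_conv_nth)
  moreover have "(w @ [hd w]) ! Suc i = w ! (Suc i mod length w)"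
  proof (cases "Suc i = length w")
    case True
    then show ?thesis using assms by (simp add: nth_append hd_conv_nth)
  qed (use i in \<open>simp add: nth_append\<close>)
  ultimately show "turns_at w i = (w ! i - (last w # w) ! i \<noteq> (w @ [hd w]) ! Suc i - w ! i)"
    by (simp add: turns_at_def Let_def)
qed

lemma turnpoints_rev: "turnpoints (rev w) = rev (turnpoints w)"
proof (cases "w = []")
  case False
  then show ?thesis by (simp add: turnpoints_bends bends_rev last_rev hd_rev)
qed (simp add: turnpoints_def)

text \<open>Moving the first vertex to the end of the walk moves the first turnpoint to the end if this vertex
  is one, and has no effect on the turnpoints otherwise.\<close>

lemma turnpoints_rotate1: "turnpoints (rotate1 w) \<in> {turnpoints w, rotate1 (turnpoints w)}"
proof (cases w)
  case (Cons u r)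
  show ?thesis
  proof (cases "r = []")
    case False
    have "turnpoints w = (if u - last r \<noteq> hd r - u then [u] else []) @ bends u r u"
      using False by (simp add: Cons turnpoints_bends)
    moreover have "turnpoints (rotate1 w) = bends u r u @ (if u - last r \<noteq> hd r - u then [u] else [])"
      using False by (simp add: Cons turnpoints_bends bends_append)
    ultimately show ?thesis by auto
  qed (simp add: Cons)
qed simp

lemma turnpoints_rotate: "\<exists>j. turnpoints (rotate k w) = rotate j (turnpoints w)"
proof (induction k)
  case 0
  show ?case by (rule exI[of _ 0]) simp
next
  case (Suc k)
  then obtain j where j: "turnpoints (rotate k w) = rotate j (turnpoints w)" by blast
  from turnpoints_rotate1[of "rotate k w"] have "turnpoints (rotate (Suc k) w) \<in> {rotate j (turnpoints w), rotate (Suc j) (turnpoints w)}"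
    by (simp add: j)
  then show ?case by blast
qed

lemma bends_first:
  assumes "bends p w q = t # ts"
  obtains us vs where "w = us @ t # vs" "bends p us t = []" "t - last (p # us) \<noteq> hd (vs @ [q]) - t" "ts = bends t vs q"
  using assms
proof (induction w arbitrary: p thesis)
  case (Cons u us)
  show ?case
  proof (cases "u - p \<noteq> hd (us @ [q]) - u")
    case True
    then show ?thesis using Cons.prems(2) by (intro Cons.prems(1)[of "[]" us]) auto
  next
    case False
    then have "bends u us q = t # ts" using Cons.prems(2) by simp
    from Cons.IH[OF _ this] obtain us' vs where us: "us = us' @ t # vs" "bends u us' t = []"
      "t - last (u # us') \<noteq> hd (vs @ [q]) - t" "ts = bends t vs q" by blast
    have "hd (us @ [q]) = hd (us' @ [t])" by (cases us') (auto simp: us)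
    then have "bends p (u # us') t = []" using False us(2) by simp
    then show ?thesis using us Cons.prems(1)[of "u # us'" vs] by simp
  qed
qed simp

text \<open>To bring a given turnpoint to the front, rotate the walk just past the turnpoints that precede it.\<close>

lemma turnpoints_rotate_onto: "\<exists>k. turnpoints (rotate k w) = rotate j (turnpoints w)"
proof (induction j)
  case 0
  show ?case by (rule exI[of _ 0]) simp
next
  case (Suc j)
  then obtain k where k: "turnpoints (rotate k w) = rotate j (turnpoints w)" by blast
  show ?case
  proof (cases "turnpoints (rotate k w)")
    case Nil
    then show ?thesis using k by (intro exI[of _ k]) simp
  next
    case (Cons t ts)
    define v where "v = rotate k w"
    have v: "v \<noteq> []" using Cons by (auto simp: v_def turnpoints_def)
    have tv: "bends (last v) v (hd v) = t # ts" using Cons turnpoints_bends[OF v] by (simp add: v_def)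
    then obtain us vs where us: "v = us @ t # vs" "bends (last v) us t = []"
      "t - last (last v # us) \<noteq> hd (vs @ [hd v]) - t" "ts = bends t vs (hd v)" by (rule bends_first)
    have "rotate (length (us @ [t])) v = vs @ us @ [t]" using rotate_append[of "us @ [t]" vs] us by simp
    moreover have "turnpoints (vs @ us @ [t]) = ts @ [t]"
    proof -
      have hv: "hd v = hd (us @ [t])" using us by (cases us) auto
      have lv: "last v = last (t # vs)" using us by simp
      have "turnpoints (vs @ us @ [t]) = bends t (vs @ us @ [t]) (hd (vs @ [hd v]))"
        using hv by (subst turnpoints_bends) (auto simp: hd_append)
      also have "\<dots> = bends t vs (hd (us @ [t])) @ bends (last (t # vs)) us t @ bends (last (last (t # vs) # us)) [t] (hd (vs @ [hd v]))"
        by (simp only: bends_append append_assoc) (cases us; simp)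
      finally show ?thesis using us(2-4) hv lv by simp
    qed
    ultimately have "turnpoints (rotate (length (us @ [t]) + k) w) = rotate1 (t # ts)"
      unfolding rotate_add v_def by (simp add: rotate_rotate[symmetric])
    then show ?thesis using k Cons by (metis rotate_Suc)
  qed
qed

lemma sides_links: "sides w = links (turnpoints w)"
  by (simp add: sides_def links_def)

lemma sides_rotate: "sides (rotate k w) = sides w"
  using turnpoints_rotate[of k w] by (auto simp: sides_links)

lemma sides_rev: "sides (rev w) = (sides w)\<inverse>"
  by (simp add: sides_links turnpoints_rev links_rev)

subsection \<open>Walks up to starting point and orientation\<close>

lemma rotations_rotate: "{rotate k (rotate j w) |k. True} = {rotate k w |k. True}"
proof (cases "w = []")
  case False
  have "rotate k w = rotate (k + j * (length w - 1)) (rotate j w)" for k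
  proof -
    have "k + j * (length w - 1) + j = k + j * length w" using False by (cases w) auto
    then have "rotate (k + j * (length w - 1)) (rotate j w) = rotate (k + j * length w) w"
      by (simp only: rotate_rotate)
    also have "\<dots> = rotate k w" by (metis mod_mult_self1 mult.commute rotate_conv_mod)
    finally show ?thesis by simp
  qed
  then show ?thesis by (auto simp: rotate_rotate)
qed simp

lemma rev_rotate: "\<exists>j. rev (rotate k w) = rotate j (rev w)"
  by (metis rev_rev_ident rotate_rev)

lemma cyclic_class_rotate [simp]: "cyclic_class (rotate j w) = cyclic_class w"
proof -
  obtain i where i: "rev (rotate j w) = rotate i (rev w)" using rev_rotate by blast
  show ?thesis unfolding cyclic_class_def i rotations_rotate ..
qed

lemma cyclic_class_rev [simp]: "cyclic_class (rev w) = cyclic_class w"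
  by (auto simp: cyclic_class_def)

lemma cyclic_class_self: "w \<in> cyclic_class w"
  unfolding cyclic_class_def by (metis (mono_tags, lifting) UnI1 mem_Collect_eq rotate0 id_apply)

lemma turnpoint_cycle_cyclic_class: "turnpoint_cycle (cyclic_class w) = cyclic_class (turnpoints w)"
proof -
  have "turnpoints ` {rotate k v |k. True} = {rotate k (turnpoints v) |k. True}" for v
  proof
    show "turnpoints ` {rotate k v |k. True} \<subseteq> {rotate k (turnpoints v) |k. True}"
      using turnpoints_rotate by fastforce
    show "{rotate k (turnpoints v) |k. True} \<subseteq> turnpoints ` {rotate k v |k. True}"
    proof clarify
      fix k
      obtain j where "turnpoints (rotate j v) = rotate k (turnpoints v)" using turnpoints_rotate_onto by blast
      then show "rotate k (turnpoints v) \<in> turnpoints ` {rotate k v |k. True}"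
        by (metis (mono_tags, lifting) imageI mem_Collect_eq)
    qed
  qed
  then show ?thesis by (simp add: turnpoint_cycle_def cyclic_class_def image_Un turnpoints_rev)
qed

text \<open>Two neighbours of each vertex are all there is: a closed walk \<open>s\<close> on the edges of
  \<open>w\<close> that starts in the direction of \<open>w\<close> has to follow
  \<open>w\<close>, as it may not turn back, until it closes.\<close>

lemma follow_walk:
  assumes w: "closed_self_avoiding_walk w" and s: "distinct s" "2 < length s"
    and sub: "links s \<subseteq> links w \<union> (links w)\<inverse>" and first: "(s ! 0, s ! 1) \<in> links w"
  shows "\<exists>k. s = rotate k w"
proof -
  from first obtain i where i: "i < length w" "s ! 0 = w ! i" by (auto simp: links_nth)
  define v where "v = rotate i w"
  have v: "distinct v" "2 < length v" "links v = links w" using w by (simp_all add: v_def closed_walk_iff)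
  have v0: "v ! 0 = s ! 0" using i nth_rotate[of 0 w i] by (cases w) (auto simp: v_def)
  note nb = neighbours[OF v(1,2)]
  have seq: "s ! a = s ! b \<longleftrightarrow> a = b" if "a < length s" "b < length s" for a b
    using s(1) that by (simp add: nth_eq_iff_index_eq)
  have link: "(s ! k, s ! Suc k) \<in> links w \<union> (links w)\<inverse>" if "Suc k < length s" for k
  proof -
    have "(s ! k, s ! Suc k) \<in> links s" unfolding links_nth using that by (intro exI[of _ k]) auto
    then show ?thesis using sub by blast
  qed
  have main: "Suc k < length s \<Longrightarrow> Suc k < length v \<and> s ! k = v ! k \<and> s ! Suc k = v ! Suc k" for k
  proof (induction k)
    case 0
    have "s ! 1 = v ! (Suc 0 mod length v)" using nb(1)[of 0 "s ! 1"] v first v0 by (cases "v = []") auto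
    then show ?case using v v0 by simp
  next
    case (Suc k)
    then have IH: "Suc k < length v" "s ! k = v ! k" "s ! Suc k = v ! Suc k" by simp_all
    \<comment> \<open>The next vertex of \<open>s\<close> is a neighbour in \<open>v\<close>
      of the present one, and the other neighbour has just been visited.\<close>
    have "s ! Suc (Suc k) = v ! (Suc (Suc k) mod length v) \<or> s ! Suc (Suc k) = v ! ((Suc k + length v - 1) mod length v)"
      using link[OF Suc.prems] nb(1,2)[OF IH(1)] v(3) IH(3) by auto
    moreover have "(Suc k + length v - 1) mod length v = k" using IH(1) by simp
    moreover have "s ! Suc (Suc k) \<noteq> s ! k" "s ! Suc (Suc k) \<noteq> s ! 0"
      using seq[of "Suc (Suc k)" k] seq[of "Suc (Suc k)" 0] Suc.prems by (cases "s = []", auto)+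
    ultimately have *: "s ! Suc (Suc k) = v ! (Suc (Suc k) mod length v)" "Suc (Suc k) mod length v \<noteq> 0"
      using IH(2) v0 by metis+
    then have "Suc (Suc k) < length v" using IH(1) by (metis Suc_lessI mod_self)
    then show ?case using * IH by simp
  qed
  \<comment> \<open>The last link of \<open>s\<close>, which leads back to its first vertex,
    shows that \<open>v\<close> closes at the same time.\<close>
  define L where "L = length s"
  have L: "2 < L" "Suc (L - 2) < L" "Suc (L - 2) = L - 1" using s by (auto simp: L_def)
  have lt: "L - 1 < length v" "s ! (L - 1) = v ! (L - 1)" "s ! (L - 2) = v ! (L - 2)"
    using main[of "L - 2"] L by (simp_all add: L_def)
  have lk: "(s ! (L - 1), s ! 0) \<in> links s"
  proof -
    have "Suc (L - 1) = L" using L by simp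
    then show ?thesis unfolding links_nth L_def[symmetric] using L by (intro exI[of _ "L - 1"]) simp
  qed
  then have "(v ! (L - 1), s ! 0) \<in> links w \<union> (links w)\<inverse>" using sub unfolding lt(2) by (rule rev_subsetD)
  then have "s ! 0 = v ! (Suc (L - 1) mod length v) \<or> s ! 0 = v ! ((L - 1 + length v - 1) mod length v)"
    by (simp only: Un_iff converse_iff nb(1,2)[OF lt(1), unfolded v(3)])
  moreover have "(L - 1 + length v - 1) mod length v = L - 2"
  proof -
    have e: "L - 1 + length v - 1 = L - 2 + length v" using L by simp
    show ?thesis by (subst e, subst mod_add_self2, rule mod_less) (use lt(1) L in simp)
  qed
  moreover have "s ! 0 \<noteq> s ! (L - 2)" using seq[of 0 "L - 2"] L by (cases "s = []") (simp_all add: L_def)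
  ultimately have "v ! 0 = v ! (Suc (L - 1) mod length v)" using v0 lt(3) by auto
  have "0 = Suc (L - 1) mod length v"
  proof -
    note e = \<open>v ! 0 = v ! (Suc (L - 1) mod length v)\<close>
    have "0 < length v" using v(2) by (rule less_trans[rotated]) simp
    then show ?thesis using nth_eq_iff_index_eq[OF v(1), of 0 "Suc (L - 1) mod length v"] e
      by (meson mod_less_divisor)
  qed
  moreover have "Suc (L - 1) = L" "0 < L" "L \<le> length v" using lt(1) L by simp_all
  ultimately have len: "L = length v" by (metis le_neq_implies_less less_numeral_extra(3) mod_less)
  have "s = v"
  proof (rule nth_equalityI)
    fix k assume k: "k < length s"
    show "s ! k = v ! k"
    proof (cases k)
      case 0
      then show ?thesis using v0 by simp
    next
      case (Suc j)
      then show ?thesis using main[of j] k by simp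
    qed
  qed (use len in \<open>simp add: L_def\<close>)
  then show ?thesis by (auto simp: v_def)
qed

lemma closed_walk_unique:
  assumes w: "closed_self_avoiding_walk w" and s: "distinct s" "2 < length s"
    and sub: "links s \<subseteq> links w \<union> (links w)\<inverse>"
  shows "cyclic_class s = cyclic_class w"
proof -
  have "(s ! 0, s ! 1) \<in> links s" unfolding links_nth using s by (intro exI[of _ 0]) auto
  then consider "(s ! 0, s ! 1) \<in> links w" | "(s ! 0, s ! 1) \<in> links (rev w)" using sub by (auto simp: links_rev)
  then show ?thesis
  proof cases
    case 1
    then show ?thesis using follow_walk[OF w s sub] by auto
  next
    case 2
    then obtain k where "s = rotate k (rev w)"
      using follow_walk[of "rev w" s] w s sub by (auto simp: closed_walk_rev links_rev Un_commute)
    then show ?thesis by simp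
  qed
qed

subsection \<open>Vertical runs\<close>

text \<open>The vertices of a vertical segment from \<open>(x, a)\<close> to \<open>(x, b)\<close>, in either
  direction. It is a single vertex if \<open>a = b\<close>, so that a path may pass through a
  column without turning.\<close>

definition run :: "int \<Rightarrow> int \<Rightarrow> int \<Rightarrow> (int \<times> int) list" where
  "run x a b = map (\<lambda>k. (x, a + sgn (b - a) * int k)) [0..<Suc (nat \<bar>b - a\<bar>)]"

lemma run_same [simp]: "run x a a = [(x, a)]"
  by (simp add: run_def)

lemma length_run [simp]: "length (run x a b) = Suc (nat \<bar>b - a\<bar>)"
  by (simp add: run_def)

lemma nth_run: "k < Suc (nat \<bar>b - a\<bar>) \<Longrightarrow> run x a b ! k = (x, a + sgn (b - a) * int k)"
  by (simp add: run_def del: upt_Suc)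

lemma run_not_Nil [simp]: "run x a b \<noteq> []"
  by (simp add: run_def)

lemma hd_run [simp]: "hd (run x a b) = (x, a)"
  by (simp add: run_def upt_conv_Cons del: upt_Suc)

lemma last_run [simp]: "last (run x a b) = (x, b)"
proof -
  have "last (run x a b) = (x, a + sgn (b - a) * int (nat \<bar>b - a\<bar>))" by (simp add: run_def)
  then show ?thesis by (simp add: sgn_if)
qed

lemma set_run: "set (run x a b) = {x} \<times> {min a b..max a b}"
proof
  show "set (run x a b) \<subseteq> {x} \<times> {min a b..max a b}" by (auto simp: run_def sgn_if)
  show "{x} \<times> {min a b..max a b} \<subseteq> set (run x a b)"
  proof clarsimp
    fix y assume y: "min a b \<le> y" "y \<le> max a b"
    have "y = a + sgn (b - a) * int (nat \<bar>y - a\<bar>)" "nat \<bar>y - a\<bar> < Suc (nat \<bar>b - a\<bar>)"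
      using y by (auto simp: sgn_if min_def max_def split: if_splits)
    then have "(x, y) = run x a b ! nat \<bar>y - a\<bar>" "nat \<bar>y - a\<bar> < length (run x a b)" by (simp_all add: nth_run)
    then show "(x, y) \<in> set (run x a b)" by (metis nth_mem)
  qed
qed

lemma distinct_run: "distinct (run x a b)"
  by (auto simp: run_def distinct_map inj_on_def sgn_if simp del: upt_Suc)

lemma successively_run:
  assumes "\<And>y. min a b \<le> y \<Longrightarrow> y < max a b \<Longrightarrow> P (x, y) (x, y + 1) \<and> P (x, y + 1) (x, y)"
  shows "successively P (run x a b)"
  unfolding successively_conv_nth
proof (intro allI impI)
  fix i assume "Suc i < length (run x a b)"
  then have i: "Suc i < Suc (nat \<bar>b - a\<bar>)" by simp
  have *: "run x a b ! i = (x, a + sgn (b - a) * int i)" "run x a b ! Suc i = (x, a + sgn (b - a) * int (Suc i))"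
    using i by (simp_all add: nth_run)
  show "P (run x a b ! i) (run x a b ! Suc i)"
  proof (cases "a < b")
    case True
    then show ?thesis using assms[of "a + int i"] i * by (simp add: algebra_simps)
  next
    case False
    then have "b < a" using i by simp
    then show ?thesis using assms[of "a - int i - 1"] i * by (simp add: algebra_simps)
  qed
qed

lemma bends_run:
  assumes "a \<noteq> b"
  shows "bends p (run x a b) q = (if (x, a) - p \<noteq> (0, sgn (b - a)) then [(x, a)] else []) @
    (if q - (x, b) \<noteq> (0, sgn (b - a)) then [(x, b)] else [])"
proof -
  define d where "d = sgn (b - a)"
  define f where "f k = (x, a + d * int k)" for k
  have fd: "f (Suc k) - f k = (0, d)" for k by (simp add: f_def algebra_simps)
  have "bends p (map f [0..<Suc (Suc h)]) q = (if f 0 - p \<noteq> (0, d) then [f 0] else []) @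
     (if q - f (Suc h) \<noteq> (0, d) then [f (Suc h)] else [])" for h q
  proof (induction h arbitrary: q)
    case 0
    show ?case using fd[of 0] by auto
  next
    case (Suc h)
    have "bends p (map f [0..<Suc (Suc (Suc h))]) q = bends p (map f [0..<Suc (Suc h)]) (f (Suc (Suc h))) @ bends (f (Suc h)) [f (Suc (Suc h))] q"
      by (simp add: bends_append)
    then show ?case unfolding Suc using fd[of "Suc h"] by auto
  qed
  note main = this
  obtain h where h: "nat \<bar>b - a\<bar> = Suc h" using assms by (cases "nat \<bar>b - a\<bar>") auto
  have r: "run x a b = map f [0..<Suc (Suc h)]" unfolding run_def h f_def d_def ..
  have f0: "f 0 = (x, a)" by (simp add: f_def)
  have "f (Suc h) = (x, a + d * int (nat \<bar>b - a\<bar>))" by (simp only: f_def h)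
  then have fh: "f (Suc h) = (x, b)" by (simp add: d_def sgn_if)
  show ?thesis unfolding r main f0 fh d_def ..
qed

lemma side_of_run:
  assumes w: "closed_self_avoiding_walk w" and bt: "b < t"
    and run: "\<And>y. b \<le> y \<Longrightarrow> y < t \<Longrightarrow> ((x, y), (x, y + 1)) \<in> links w \<union> (links w)\<inverse>"
    and ends: "((x, b), (u, b)) \<in> links w \<union> (links w)\<inverse>" "((x, t), (v, t)) \<in> links w \<union> (links w)\<inverse>"
      "u \<noteq> x" "v \<noteq> x"
  shows "((x, b), (x, t)) \<in> sides w \<or> ((x, t), (x, b)) \<in> sides w"
proof -
  have up: "((x, b), (x, t)) \<in> sides w"
    if w: "closed_self_avoiding_walk w" and up: "((x, b), (x, b + 1)) \<in> links w"
      and run: "\<And>y. b \<le> y \<Longrightarrow> y < t \<Longrightarrow> ((x, y), (x, y + 1)) \<in> links w \<union> (links w)\<inverse>"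
      and ends: "((x, b), (u, b)) \<in> links w \<union> (links w)\<inverse>" "((x, t), (v, t)) \<in> links w \<union> (links w)\<inverse>" for w
  proof -
    from up obtain i where i: "i < length w" "(x, b) = w ! i" by (auto simp: links_nth)
    define l where "l = rotate i w"
    have l: "distinct l" "2 < length l" "links l = links w" using w by (simp_all add: l_def closed_walk_iff)
    have l0: "l ! 0 = (x, b)" using i nth_rotate[of 0 w i] by (cases w) (auto simp: l_def)
    note nb = neighbours[OF l(1,2)]
    define h where "h = nat (t - b)"
    have h: "0 < h" "int h = t - b" using bt by (simp_all add: h_def)
    have main: "k < h \<Longrightarrow> Suc k < length l \<and> l ! k = (x, b + int k) \<and> l ! Suc k = (x, b + int k + 1)" for k
    proof (induction k)
      case 0
      have "(x, b + 1) = l ! (Suc 0 mod length l)" using nb(1)[of 0 "(x, b + 1)"] l l0 up by (cases "l = []") auto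
      then show ?case using l l0 by simp
    next
      case (Suc k)
      then have IH: "Suc k < length l" "l ! k = (x, b + int k)" "l ! Suc k = (x, b + int k + 1)" by simp_all
      have "((x, b + int k + 1), (x, b + int k + 2)) \<in> links w \<union> (links w)\<inverse>"
        using run[of "b + int k + 1"] Suc.prems h by (simp add: algebra_simps)
      then have "(x, b + int k + 2) = l ! (Suc (Suc k) mod length l) \<or> (x, b + int k + 2) = l ! ((Suc k + length l - 1) mod length l)"
        using nb(1,2)[OF IH(1)] l(3) IH(3) by auto
      moreover have "(Suc k + length l - 1) mod length l = k" using IH(1) by simp
      moreover have "(x, b + int k + 2) \<noteq> l ! k" "(x, b + int k + 2) \<noteq> l ! 0" using IH(2) l0 by auto
      ultimately have *: "(x, b + int k + 2) = l ! (Suc (Suc k) mod length l)" "Suc (Suc k) mod length l \<noteq> 0"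
        by metis+
      then have "Suc (Suc k) < length l" using IH(1) by (metis Suc_lessI mod_self)
      then show ?case using * IH by (simp add: algebra_simps)
    qed
    have hl: "h < length l" using main[of "h - 1"] h by simp
    have lh: "l ! k = (x, b + int k)" if "k \<le> h" for k
    proof (cases k)
      case (Suc j)
      then show ?thesis using main[of j] that by (simp add: algebra_simps)
    qed (use l0 in simp)
    have tk: "take (Suc h) l = run x b t"
    proof (rule nth_equalityI)
      show "length (take (Suc h) l) = length (run x b t)" using hl h by (simp add: h_def)
      fix k assume "k < length (take (Suc h) l)"
      then have k: "k \<le> h" by simp
      then show "take (Suc h) l ! k = run x b t ! k"
        using lh[OF k] bt h by (simp add: nth_run h_def)
    qed
    have lne: "l \<noteq> []" using l by auto
    have lastl: "last l = (u, b)"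
    proof -
      have "(u, b) = l ! (Suc 0 mod length l) \<or> (u, b) = l ! ((0 + length l - 1) mod length l)"
        using ends(1) nb(1,2)[of 0 "(u, b)"] l l0 lne by auto
      moreover have "l ! (Suc 0 mod length l) = (x, b + 1)" using main[of 0] h l by simp
      ultimately show ?thesis using l lne by (auto simp: last_conv_nth)
    qed
    define q where "q = hd (drop (Suc h) l @ [hd l])"
    have q: "q = (v, t)"
    proof -
      have ql: "q = l ! (Suc h mod length l)"
        using hl lne by (cases "Suc h = length l") (auto simp: q_def hd_append hd_drop_conv_nth hd_conv_nth)
      have "(v, t) = l ! (Suc h mod length l) \<or> (v, t) = l ! ((h + length l - 1) mod length l)"
        using ends(2) nb(1,2)[of h "(v, t)"] l hl lh[of h] h by auto
      moreover have "l ! ((h + length l - 1) mod length l) = (x, b + int (h - 1))"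
      proof -
        have e: "h + length l - 1 = h - 1 + length l" using h by simp
        have "(h + length l - 1) mod length l = h - 1"
          by (subst e, subst mod_add_self2, rule mod_less) (use hl in simp)
        then show ?thesis using lh[of "h - 1"] by simp
      qed
      ultimately show ?thesis using ql \<open>v \<noteq> x\<close> by auto
    qed
    have "turnpoints l = bends (last l) (run x b t @ drop (Suc h) l) (hd l)"
      using turnpoints_bends[OF lne] tk by (metis append_take_drop_id)
    also have "\<dots> = bends (last l) (run x b t) q @ bends (x, t) (drop (Suc h) l) (hd l)"
      by (simp add: bends_append q_def)
    also have "bends (last l) (run x b t) q = [(x, b), (x, t)]"
      using bt \<open>u \<noteq> x\<close> \<open>v \<noteq> x\<close> by (simp add: bends_run lastl q)
    finally obtain r where "turnpoints l = (x, b) # (x, t) # r" by simp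
    then have "((x, b), (x, t)) \<in> sides l" by (simp add: sides_links links_def)
    then show ?thesis by (simp add: l_def sides_rotate)
  qed
  show ?thesis
  proof (cases "((x, b), (x, b + 1)) \<in> links w")
    case True
    then show ?thesis using up[OF w] run ends by blast
  next
    case False
    then have "((x, b), (x, b + 1)) \<in> links (rev w)" using run[of b] bt by (auto simp: links_rev)
    then have "((x, b), (x, t)) \<in> sides (rev w)"
      using up[of "rev w"] w run ends by (auto simp: closed_walk_rev links_rev Un_commute)
    then show ?thesis by (simp add: sides_rev)
  qed
qed

section \<open>The convex permutomino of a shape\<close>

text \<open>The vertices of the graph of the step function \<open>h\<close> in the columns from
  \<open>i\<close> to \<open>j\<close>, where \<open>h x\<close> is the height between the columns
  \<open>x\<close> and \<open>x + 1\<close>.\<close>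

definition stair :: "(int \<Rightarrow> int) \<Rightarrow> int \<Rightarrow> int \<Rightarrow> (int \<times> int) list" where
  "stair h i j = concat (map (\<lambda>x. run x (h (x - 1)) (h x)) [i..j])"

definition corners :: "(int \<Rightarrow> int) \<Rightarrow> int \<Rightarrow> int \<Rightarrow> (int \<times> int) list" where
  "corners h i j = concat (map (\<lambda>x. if h (x - 1) = h x then [] else [(x, h (x - 1)), (x, h x)]) [i..j])"

lemma stair_Cons: "i \<le> j \<Longrightarrow> stair h i j = run i (h (i - 1)) (h i) @ stair h (i + 1) j"
  by (simp add: stair_def upto.simps)

lemma corners_Cons: "i \<le> j \<Longrightarrow> corners h i j = (if h (i - 1) = h i then [] else [(i, h (i - 1)), (i, h i)]) @ corners h (i + 1) j"
  by (simp add: corners_def upto.simps)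

lemma stair_Nil: "j < i \<Longrightarrow> stair h i j = []" and corners_Nil: "j < i \<Longrightarrow> corners h i j = []"
  by (simp_all add: stair_def corners_def)

lemma hd_stair: "i \<le> j + 1 \<Longrightarrow> hd (stair h i j @ [(j + 1, h j)]) = (i, h (i - 1))"
proof (cases "i \<le> j")
  case False
  moreover assume "i \<le> j + 1"
  ultimately have "j = i - 1" by simp
  then show ?thesis by (simp add: stair_Nil)
qed (simp add: stair_Cons)

lemma last_stair: "i \<le> j + 1 \<Longrightarrow> last ((i - 1, h (i - 1)) # stair h i j) = (j, h j)"
proof (induction "nat (j + 1 - i)" arbitrary: i)
  case 0
  then have "j = i - 1" by simp
  then show ?case by (simp add: stair_Nil)
next
  case (Suc k)
  then have "last ((i + 1 - 1, h (i + 1 - 1)) # stair h (i + 1) j) = (j, h j)" by (intro Suc.hyps) auto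
  then show ?case using Suc.hyps(2) by (cases "stair h (i + 1) j = []") (auto simp: stair_Cons)
qed

lemma set_stair: "set (stair h i j) = {(x, y). i \<le> x \<and> x \<le> j \<and> min (h (x - 1)) (h x) \<le> y \<and> y \<le> max (h (x - 1)) (h x)}"
  by (auto simp: stair_def set_run simp del: atLeastAtMost_iff) (auto simp: min_le_iff_disj)

lemma bends_stair:
  "i \<le> j + 1 \<Longrightarrow> bends (i - 1, h (i - 1)) (stair h i j) (j + 1, h j) = corners h i j"
proof (induction "nat (j + 1 - i)" arbitrary: i)
  case 0
  then show ?case by (simp add: stair_Nil corners_Nil)
next
  case (Suc k)
  then have ij: "i \<le> j" by simp
  have "bends (i + 1 - 1, h (i + 1 - 1)) (stair h (i + 1) j) (j + 1, h j) = corners h (i + 1) j"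
    using Suc.hyps ij by (intro Suc.hyps(1)) auto
  moreover have "bends (i - 1, h (i - 1)) (run i (h (i - 1)) (h i)) (i + 1, h i) =
      (if h (i - 1) = h i then [] else [(i, h (i - 1)), (i, h i)])"
    by (cases "h (i - 1) = h i") (auto simp: bends_run)
  ultimately show ?case using hd_stair[of "i + 1" j h] ij
    by (simp add: stair_Cons corners_Cons bends_append)
qed

lemma successively_stair:
  assumes "i \<le> j + 1"
    and hor: "\<And>x. i - 1 \<le> x \<Longrightarrow> x \<le> j \<Longrightarrow> P (x, h x) (x + 1, h x)"
    and ver: "\<And>x y. i \<le> x \<Longrightarrow> x \<le> j \<Longrightarrow> min (h (x - 1)) (h x) \<le> y \<Longrightarrow> y < max (h (x - 1)) (h x) \<Longrightarrow>
      P (x, y) (x, y + 1) \<and> P (x, y + 1) (x, y)"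
  shows "successively P ((i - 1, h (i - 1)) # stair h i j @ [(j + 1, h j)])"
  using assms
proof (induction "nat (j + 1 - i)" arbitrary: i)
  case 0
  then have "i = j + 1" by simp
  then show ?case using 0(3)[of j] by (simp add: stair_Nil)
next
  case (Suc k)
  then have ij: "i \<le> j" by simp
  let ?r = "run i (h (i - 1)) (h i)"
  have IH: "successively P ((i, h i) # stair h (i + 1) j @ [(j + 1, h j)])"
    using Suc.hyps(1)[of "i + 1"] Suc.hyps(2) Suc.prems by simp
  have r: "successively P ?r" by (rule successively_run) (use Suc.prems ij in auto)
  have "P (i - 1, h (i - 1)) (i, h (i - 1))" using Suc.prems(2)[of "i - 1"] ij by simp
  moreover have "successively P (stair h (i + 1) j @ [(j + 1, h j)])" "P (i, h i) (hd (stair h (i + 1) j @ [(j + 1, h j)]))"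
    using IH by (auto simp: successively_Cons)
  ultimately have "successively P ((i - 1, h (i - 1)) # ?r @ stair h (i + 1) j @ [(j + 1, h j)])"
    using r by (auto simp: successively_Cons successively_append_iff)
  then show ?case using ij by (simp add: stair_Cons)
qed

lemma fst_run: "p \<in> set (run x a b) \<Longrightarrow> fst p = x"
  by (auto simp: run_def)

lemma fst_stair: "p \<in> set (stair h i j) \<Longrightarrow> i \<le> fst p \<and> fst p \<le> j"
  by (auto simp: stair_def run_def)

lemma distinct_stair: "distinct (stair h i j)"
proof (induction "nat (j + 1 - i)" arbitrary: i)
  case 0
  then show ?case by (simp add: stair_Nil)
next
  case (Suc k)
  then have "distinct (stair h (i + 1) j)" by (intro Suc.hyps(1)) auto
  moreover have "set (run i (h (i - 1)) (h i)) \<inter> set (stair h (i + 1) j) = {}"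
    using fst_run fst_stair by fastforce
  ultimately show ?case using Suc.hyps(2) by (simp add: stair_Cons distinct_run)
qed

text \<open>Down in column \<open>1\<close>, along the lower path to the right, up in column \<open>n\<close>,
  and back along the upper path.\<close>

definition shape_walk :: "nat \<Rightarrow> (int \<Rightarrow> int) \<times> int set \<Rightarrow> (int \<times> int) list" where
  "shape_walk n = (\<lambda>(\<sigma>, D). let lo = lower D \<sigma>; hi = upper n D \<sigma> in
     run 1 (hi 1) (lo 1) @ stair lo 2 (int n - 1) @ run n (lo (int n - 1)) (hi (int n - 1)) @ rev (stair hi 2 (int n - 1)))"

locale shape =
  fixes n :: nat and \<sigma> :: "int \<Rightarrow> int" and D :: "int set"
  assumes shape: "(\<sigma>, D) \<in> shapes n" and n2: "2 \<le> n"
begin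

abbreviation lo where "lo \<equiv> lower D \<sigma>"
abbreviation hi where "hi \<equiv> upper n D \<sigma>"
abbreviation w where "w \<equiv> shape_walk n (\<sigma>, D)"

lemma perm: "\<sigma> permutes {1..int n}" and D: "D \<subseteq> {1..int n}" "1 \<in> D" "int n \<notin> D"
  and valley: "i \<in> D \<Longrightarrow> j \<in> D \<Longrightarrow> k \<in> D \<Longrightarrow> i < j \<Longrightarrow> j < k \<Longrightarrow> \<sigma> i < \<sigma> j \<Longrightarrow> \<sigma> j < \<sigma> k"
  and mountain: "i \<in> {1..int n} - D \<Longrightarrow> j \<in> {1..int n} - D \<Longrightarrow> k \<in> {1..int n} - D \<Longrightarrow> i < j \<Longrightarrow> j < k \<Longrightarrow>
       \<sigma> j < \<sigma> i \<Longrightarrow> \<sigma> k < \<sigma> j"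
  using shape unfolding shapes_def mem_Collect_eq split by blast+

lemma lo_hi: "1 \<le> x \<Longrightarrow> x < int n \<Longrightarrow> lo x < hi x"
  using shape by (auto simp: shapes_def)

lemma inj: "\<sigma> i = \<sigma> j \<longleftrightarrow> i = j"
  using permutes_inj[OF perm] by (simp add: inj_eq)

lemma lo_D: "x \<in> D \<Longrightarrow> lo x = \<sigma> x"
  using D by (intro lower_at) auto

lemma hi_D: "1 \<le> x \<Longrightarrow> x \<le> int n \<Longrightarrow> x \<notin> D \<Longrightarrow> hi (x - 1) = \<sigma> x"
  by (intro upper_at) auto

lemma lo_U: "2 \<le> x \<Longrightarrow> x \<notin> D \<Longrightarrow> lo (x - 1) = lo x"
proof -
  assume x: "2 \<le> x" "x \<notin> D"
  then have "1 \<le> x - 1" by simp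
  then obtain i where i: "i \<in> D" "1 \<le> i" "i \<le> x - 1" "lo (x - 1) = \<sigma> i" "\<And>j. j \<in> D \<Longrightarrow> i < j \<Longrightarrow> x - 1 < j"
    by (rule lower_obtain[OF D(2), where \<sigma> = \<sigma>]) (rule that)
  have "lo x = \<sigma> i"
  proof (rule lower_at)
    fix j assume "j \<in> D" "i < j"
    then have "x - 1 < j" "j \<noteq> x" using i x by auto
    then show "x < j" by simp
  qed (use i in auto)
  then show ?thesis using i by simp
qed

lemma hi_U: "x < int n \<Longrightarrow> x \<in> D \<Longrightarrow> hi (x - 1) = hi x"
proof -
  assume x: "x < int n" "x \<in> D"
  then obtain i where i: "i \<notin> D" "x < i" "i \<le> int n" "hi x = \<sigma> i" "\<And>j. j \<notin> D \<Longrightarrow> x < j \<Longrightarrow> i \<le> j"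
    using upper_obtain[OF D(3) x(1), where \<sigma> = \<sigma>] by blast
  have "hi (x - 1) = \<sigma> i"
  proof (rule upper_at)
    fix j assume "j \<notin> D" "x - 1 < j"
    then have "x < j" using x by (cases "j = x") auto
    then show "i \<le> j" using i \<open>j \<notin> D\<close> by simp
  qed (use i in auto)
  then show ?thesis using i by simp
qed

lemma lo_ne: "2 \<le> x \<Longrightarrow> x \<in> D \<Longrightarrow> lo (x - 1) \<noteq> lo x"
proof -
  assume x: "2 \<le> x" "x \<in> D"
  then have "1 \<le> x - 1" by simp
  then obtain i where "i \<le> x - 1" "lo (x - 1) = \<sigma> i"
    by (rule lower_obtain[OF D(2), where \<sigma> = \<sigma>]) (rule that)
  then show ?thesis using lo_D[OF x(2)] inj[of i x] by auto
qed

lemma hi_ne: "1 \<le> x \<Longrightarrow> x < int n \<Longrightarrow> x \<notin> D \<Longrightarrow> hi (x - 1) \<noteq> hi x"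
proof -
  assume x: "1 \<le> x" "x < int n" "x \<notin> D"
  obtain i where "x < i" "hi x = \<sigma> i" using upper_obtain[OF D(3) x(2), where \<sigma> = \<sigma>] by blast
  then show ?thesis using hi_D[of x] x inj[of i x] by auto
qed

lemma lo_eq_iff: "2 \<le> x \<Longrightarrow> lo (x - 1) = lo x \<longleftrightarrow> x \<notin> D"
  using lo_ne lo_U by blast

lemma hi_eq_iff: "1 \<le> x \<Longrightarrow> x < int n \<Longrightarrow> hi (x - 1) = hi x \<longleftrightarrow> x \<in> D"
  using hi_ne hi_U by blast

text \<open>Once the lower path has ascended it does not descend any more, since its heights are values of
  \<open>\<sigma>\<close> at down columns.\<close>

lemma lo_valley:
  assumes "1 \<le> u" "u < v" "v < x" "lo u < lo v"
  shows "lo v \<le> lo x"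
proof -
  obtain i where i: "i \<in> D" "1 \<le> i" "i \<le> u" "lo u = \<sigma> i" "\<And>j. j \<in> D \<Longrightarrow> i < j \<Longrightarrow> u < j"
    using assms(1) by (rule lower_obtain[OF D(2), where \<sigma> = \<sigma>]) (rule that)
  have "1 \<le> v" using assms by simp
  then obtain j where j: "j \<in> D" "1 \<le> j" "j \<le> v" "lo v = \<sigma> j" "\<And>k. k \<in> D \<Longrightarrow> j < k \<Longrightarrow> v < k"
    by (rule lower_obtain[OF D(2), where \<sigma> = \<sigma>]) (rule that)
  have "1 \<le> x" using assms by simp
  then obtain k where k: "k \<in> D" "1 \<le> k" "k \<le> x" "lo x = \<sigma> k" "\<And>j. j \<in> D \<Longrightarrow> k < j \<Longrightarrow> x < j"
    by (rule lower_obtain[OF D(2), where \<sigma> = \<sigma>]) (rule that)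
  have "i \<noteq> j" using assms(4) i j by auto
  then have "i < j" using j(5)[of i] i assms by force
  have "j \<le> k" using k(5)[of j] j assms by force
  then show ?thesis using valley[OF i(1) j(1) k(1) \<open>i < j\<close>] assms(4) i j k by (cases "j = k") auto
qed

lemma hi_mountain:
  assumes "0 \<le> u" "u < v" "v < x" "x < int n" "hi v < hi u"
  shows "hi x \<le> hi v"
proof -
  have lt: "u < int n" "v < int n" using assms by auto
  obtain i where i: "i \<notin> D" "u < i" "i \<le> int n" "hi u = \<sigma> i" "\<And>j. j \<notin> D \<Longrightarrow> u < j \<Longrightarrow> i \<le> j"
    using upper_obtain[OF D(3) lt(1), where \<sigma> = \<sigma>] by blast
  obtain j where j: "j \<notin> D" "v < j" "j \<le> int n" "hi v = \<sigma> j" "\<And>k. k \<notin> D \<Longrightarrow> v < k \<Longrightarrow> j \<le> k"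
    using upper_obtain[OF D(3) lt(2), where \<sigma> = \<sigma>] by blast
  obtain k where k: "k \<notin> D" "x < k" "k \<le> int n" "hi x = \<sigma> k" "\<And>j. j \<notin> D \<Longrightarrow> x < j \<Longrightarrow> k \<le> j"
    using upper_obtain[OF D(3) assms(4), where \<sigma> = \<sigma>] by blast
  have "i \<noteq> j" using assms(5) i j by auto
  then have "i < j" using i(5)[of j] j assms by force
  have "j \<le> k" using j(5)[of k] k assms by force
  have N: "i \<in> {1..int n} - D" "j \<in> {1..int n} - D" "k \<in> {1..int n} - D" using i j k assms by auto
  show ?thesis using mountain[OF N \<open>i < j\<close>] \<open>j \<le> k\<close> assms(5) i j k by (cases "j = k") auto
qed

lemma lo_range: "1 \<le> x \<Longrightarrow> x < int n \<Longrightarrow> lo x \<in> {1..int n}"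
proof -
  assume x: "1 \<le> x" "x < int n"
  obtain i where i: "i \<in> D" "lo x = \<sigma> i"
    using x(1) by (rule lower_obtain[OF D(2), where \<sigma> = \<sigma>]) (rule that)
  then have "i \<in> {1..int n}" using D(1) by blast
  then show ?thesis unfolding i(2) by (simp only: permutes_in_image[OF perm])
qed

lemma hi_range: "0 \<le> x \<Longrightarrow> x < int n \<Longrightarrow> hi x \<in> {1..int n}"
proof -
  assume x: "0 \<le> x" "x < int n"
  obtain i where i: "x < i" "i \<le> int n" "hi x = \<sigma> i" using upper_obtain[OF D(3) x(2), where \<sigma> = \<sigma>] by blast
  then have "i \<in> {1..int n}" using x by simp
  then show ?thesis unfolding i(3) by (simp only: permutes_in_image[OF perm])
qed

lemma walk_eq: "w = run 1 (hi 1) (lo 1) @ stair lo 2 (int n - 1) @ run n (lo (int n - 1)) (hi (int n - 1)) @ rev (stair hi 2 (int n - 1))"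
  by (simp add: shape_walk_def Let_def)

lemma hd_walk: "hd w = (1, hi 1)" by (simp add: walk_eq)

lemma last_walk: "last w = (2, hi 1)"
proof (cases "n = 2")
  case True
  then show ?thesis unfolding walk_eq by (simp add: stair_Nil)
next
  case False
  then have "2 \<le> int n - 1" using n2 by simp
  then show ?thesis unfolding walk_eq by (simp add: stair_Cons last_rev)
qed

lemma walk_turnpoints: "turnpoints w = [(1, hi 1), (1, lo 1)] @ corners lo 2 (int n - 1) @
    [(int n, lo (int n - 1)), (int n, hi (int n - 1))] @ rev (corners hi 2 (int n - 1))"
proof -
  let ?p = "stair lo 2 (int n - 1)" and ?q = "stair hi 2 (int n - 1)"
  let ?R = "run (int n) (lo (int n - 1)) (hi (int n - 1))"
  have n2': "2 \<le> int n" using n2 by simp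
  have ne: "w \<noteq> []" by (simp add: walk_eq)
  have h1: "hd (?p @ ?R @ rev ?q @ [(1, hi 1)]) = (2, lo 1)"
    using hd_stair[of 2 "int n - 1" lo] n2' by (cases "?p = []") (auto simp: hd_append)
  have l1: "last ((1, lo 1) # ?p) = (int n - 1, lo (int n - 1))"
    using last_stair[of 2 "int n - 1" lo] n2' by simp
  have h2: "hd (rev ?q @ [(1, hi 1)]) = (int n - 1, hi (int n - 1))"
    using last_stair[of 2 "int n - 1" hi] n2' by (cases "?q = []") (auto simp: hd_append hd_rev stair_Nil split: if_splits)
  have b1: "bends (1, lo 1) ?p (int n, lo (int n - 1)) = corners lo 2 (int n - 1)"
    using bends_stair[of 2 "int n - 1" lo] n2' by simp
  have b2: "bends (int n, hi (int n - 1)) (rev ?q) (1, hi 1) = rev (corners hi 2 (int n - 1))"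
    using bends_stair[of 2 "int n - 1" hi] n2' by (simp add: bends_rev)
  have ne1: "hi 1 \<noteq> lo 1" "lo (int n - 1) \<noteq> hi (int n - 1)" using lo_hi[of 1] lo_hi[of "int n - 1"] n2 by auto
  have "turnpoints w = bends (2, hi 1) w (1, hi 1)" by (simp add: turnpoints_bends[OF ne] hd_walk last_walk)
  also have "\<dots> = bends (2, hi 1) (run 1 (hi 1) (lo 1)) (2, lo 1) @ bends (1, lo 1) ?p (int n, lo (int n - 1)) @
     bends (int n - 1, lo (int n - 1)) ?R (int n - 1, hi (int n - 1)) @ bends (int n, hi (int n - 1)) (rev ?q) (1, hi 1)"
    unfolding walk_eq using h1 h2 l1 by (simp add: bends_append)
  finally show ?thesis using ne1 by (simp add: bends_run b1 b2)
qed

text \<open>A rule of proof for properties of all edges of the walk, which are the horizontal edges on the two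
  paths and the vertical edges in each column.\<close>

lemma walk_links:
  assumes hor: "\<And>x. 1 \<le> x \<Longrightarrow> x < int n \<Longrightarrow> P (x, lo x) (x + 1, lo x) \<and> P (x + 1, hi x) (x, hi x)"
    and ver_lo: "\<And>x y. 2 \<le> x \<Longrightarrow> x < int n \<Longrightarrow> min (lo (x - 1)) (lo x) \<le> y \<Longrightarrow> y < max (lo (x - 1)) (lo x) \<Longrightarrow>
      P (x, y) (x, y + 1) \<and> P (x, y + 1) (x, y)"
    and ver_hi: "\<And>x y. 2 \<le> x \<Longrightarrow> x < int n \<Longrightarrow> min (hi (x - 1)) (hi x) \<le> y \<Longrightarrow> y < max (hi (x - 1)) (hi x) \<Longrightarrow>
      P (x, y) (x, y + 1) \<and> P (x, y + 1) (x, y)"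
    and ver_1: "\<And>y. lo 1 \<le> y \<Longrightarrow> y < hi 1 \<Longrightarrow> P (1, y) (1, y + 1) \<and> P (1, y + 1) (1, y)"
    and ver_n: "\<And>y. lo (int n - 1) \<le> y \<Longrightarrow> y < hi (int n - 1) \<Longrightarrow> P (int n, y) (int n, y + 1) \<and> P (int n, y + 1) (int n, y)"
  shows "\<forall>(p, q)\<in>links w. P p q"
proof -
  let ?p = "stair lo 2 (int n - 1)" and ?q = "stair hi 2 (int n - 1)"
  let ?R1 = "run 1 (hi 1) (lo 1)" and ?R = "run (int n) (lo (int n - 1)) (hi (int n - 1))"
  have n2': "2 \<le> int n" using n2 by simp
  have ne: "w \<noteq> []" by (simp add: walk_eq)
  have ord: "lo 1 < hi 1" "lo (int n - 1) < hi (int n - 1)" using lo_hi[of 1] lo_hi[of "int n - 1"] n2 by auto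
  have R: "successively P ?R1" "successively P ?R"
    using ver_1 ver_n ord by (auto intro!: successively_run simp: min_def max_def)
  have p: "successively P ((1, lo 1) # ?p @ [(int n, lo (int n - 1))])"
    using successively_stair[of 2 "int n - 1" P lo] n2' hor ver_lo by simp
  have "successively (\<lambda>p q. P q p) ((1, hi 1) # ?q @ [(int n, hi (int n - 1))])"
    using successively_stair[of 2 "int n - 1" "\<lambda>p q. P q p" hi] n2' hor ver_hi by simp
  then have "successively P (rev ((1, hi 1) # ?q @ [(int n, hi (int n - 1))]))"
    by (simp only: successively_rev)
  then have q: "successively P ((int n, hi (int n - 1)) # rev ?q @ [(1, hi 1)])" by simp
  have "P (2, hi 1) (1, hi 1)" using hor[of 1] n2' by simp
  moreover have "successively P w"
  proof -
    have "hd (?p @ ?R) = hd (?p @ [(int n, lo (int n - 1))])" by (cases "?p = []") auto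
    then have "successively P (?R1 @ ?p @ ?R)"
      using p R by (auto simp: successively_append_iff successively_Cons)
    then have "successively P ((?R1 @ ?p @ ?R) @ rev ?q)"
    proof (cases "?q = []")
      case False
      then show ?thesis using q \<open>successively P (?R1 @ ?p @ ?R)\<close>
        by (subst successively_append_iff) (simp add: successively_Cons successively_append_iff)
    qed simp
    then show ?thesis by (simp add: walk_eq)
  qed
  ultimately show ?thesis unfolding links_iff[OF ne] hd_walk last_walk by simp
qed

lemma set_walk: "set w = {1} \<times> {lo 1..hi 1} \<union> set (stair lo 2 (int n - 1)) \<union> {int n} \<times> {lo (int n - 1)..hi (int n - 1)} \<union> set (stair hi 2 (int n - 1))"
proof -
  have "lo 1 < hi 1" "lo (int n - 1) < hi (int n - 1)" using lo_hi[of 1] lo_hi[of "int n - 1"] n2 by auto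
  then show ?thesis by (auto simp: walk_eq set_run)
qed

text \<open>The upper and the lower path are disjoint because every column is the place of a step of only one
  of them, while the other one passes at constant height.\<close>

lemma distinct_walk: "distinct w"
proof -
  let ?p = "stair lo 2 (int n - 1)" and ?q = "stair hi 2 (int n - 1)"
  have "set ?p \<inter> set ?q = {}"
  proof (rule ccontr)
    assume "set ?p \<inter> set ?q \<noteq> {}"
    then obtain x y where x: "2 \<le> x" "x \<le> int n - 1"
      and y: "y \<le> max (lo (x - 1)) (lo x)" "min (hi (x - 1)) (hi x) \<le> y" by (auto simp: set_stair)
    have "lo (x - 1) < hi (x - 1)" "lo x < hi x" using x lo_hi[of "x - 1"] lo_hi[of x] by auto
    then show False using lo_U[of x] hi_U[of x] x y by (cases "x \<in> D") auto
  qed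
  moreover have "fst p = 1" if "p \<in> set (run 1 (hi 1) (lo 1))" for p using fst_run[OF that] .
  moreover have "fst p = int n" if "p \<in> set (run (int n) (lo (int n - 1)) (hi (int n - 1)))" for p using fst_run[OF that] .
  moreover have "2 \<le> fst p \<and> fst p \<le> int n - 1" if "p \<in> set ?p \<union> set ?q" for p using fst_stair that by blast
  ultimately show ?thesis using n2 by (fastforce simp: walk_eq distinct_run distinct_stair)
qed

lemma closed_walk: "closed_self_avoiding_walk w"
  unfolding closed_walk_iff
proof (intro conjI distinct_walk)
  have "lo 1 < hi 1" "lo (int n - 1) < hi (int n - 1)" using lo_hi[of 1] lo_hi[of "int n - 1"] n2 by auto
  then show "2 < length w" by (simp add: walk_eq)
  show "\<forall>(p, q)\<in>links w. lattice_adjacent p q"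
    by (rule walk_links) (auto simp: lattice_adjacent_def)
qed

text \<open>Each vertex of the walk lies weakly between the two paths in one of the strips next to its column.\<close>

lemma column:
  assumes "(x, y) \<in> set w"
  obtains u where "u = x \<or> u = x - 1" "1 \<le> u" "u < int n" "lo u \<le> y" "y \<le> hi u"
proof -
  have n2': "2 \<le> int n" using n2 by simp
  consider "x = 1" "lo 1 \<le> y" "y \<le> hi 1" | "x = int n" "lo (int n - 1) \<le> y" "y \<le> hi (int n - 1)"
    | "2 \<le> x" "x < int n" "min (lo (x - 1)) (lo x) \<le> y" "y \<le> max (lo (x - 1)) (lo x)"
    | "2 \<le> x" "x < int n" "min (hi (x - 1)) (hi x) \<le> y" "y \<le> max (hi (x - 1)) (hi x)"
    using assms by (auto simp: set_walk set_stair)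
  then show thesis
  proof cases
    case 1
    then show ?thesis using that[of 1] n2' by auto
  next
    case 2
    then show ?thesis using that[of "int n - 1"] n2' by auto
  next
    case 3
    have h: "lo (x - 1) < hi (x - 1)" "lo x < hi x" using 3 lo_hi[of "x - 1"] lo_hi[of x] by auto
    show ?thesis
    proof (cases "x \<in> D")
      case True
      then show ?thesis using that[of x] that[of "x - 1"] 3 h hi_U[of x] by (cases "lo x \<le> y") auto
    next
      case False
      then show ?thesis using that[of x] 3 h lo_U[of x] by auto
    qed
  next
    case 4
    have h: "lo (x - 1) < hi (x - 1)" "lo x < hi x" using 4 lo_hi[of "x - 1"] lo_hi[of x] by auto
    show ?thesis
    proof (cases "x \<in> D")
      case True
      then show ?thesis using that[of x] 4 h hi_U[of x] by auto
    next
      case False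
      then show ?thesis using that[of x] that[of "x - 1"] 4 h lo_U[of x] by (cases "y \<le> hi x") auto
    qed
  qed
qed

text \<open>A vertex of the lower path that had vertices of the walk on both sides strictly below it would be
  the top of an ascent that is followed by a descent, since the lower path is below all other
  vertices in its strip.\<close>

lemma no_interior: "no_interior_point (set w)"
  unfolding no_interior_point_def
proof
  fix p assume p: "p \<in> set w"
  obtain x y where xy: "p = (x, y)" by (cases p)
  have n2': "2 \<le> int n" using n2 by simp
  have cols: "1 \<le> fst q \<and> fst q \<le> int n" if "q \<in> set w" for q
  proof (cases q)
    case (Pair a b)
    then have "(a, b) \<in> set w" using that by simp
    then obtain u where "u = a \<or> u = a - 1" "1 \<le> u" "u < int n" by (rule column)
    then show ?thesis using Pair by auto
  qed
  consider "x = 1" | "x = int n"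
    | "2 \<le> x" "x < int n" "min (lo (x - 1)) (lo x) \<le> y" "y \<le> max (lo (x - 1)) (lo x)"
    | "2 \<le> x" "x < int n" "min (hi (x - 1)) (hi x) \<le> y" "y \<le> max (hi (x - 1)) (hi x)"
    using p xy by (auto simp: set_walk set_stair)
  then show "exterior (set w) p"
  proof cases
    case 1
    then have "upper_left_record (set w) p" using cols xy unfolding upper_left_record_def by force
    then show ?thesis by (simp add: exterior_def)
  next
    case 2
    then have "upper_right_record (set w) p" using cols xy unfolding upper_right_record_def by force
    then show ?thesis by (simp add: exterior_def)
  next
    case 3
    have "bottom_left_record (set w) p \<or> bottom_right_record (set w) p"
    proof (rule ccontr)
      assume "\<not> ?thesis"
      then obtain a b c d where q: "(a, b) \<in> set w" "a < x" "b < y" and r: "(c, d) \<in> set w" "x < c" "d < y"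
        by (auto simp: bottom_left_record_def bottom_right_record_def xy)
      obtain u where u: "u = a \<or> u = a - 1" "1 \<le> u" "u < int n" "lo u \<le> b" by (rule column[OF q(1)])
      obtain v where v: "v = c \<or> v = c - 1" "1 \<le> v" "v < int n" "lo v \<le> d" by (rule column[OF r(1)])
      have ux: "u \<le> x - 1" and vx: "x \<le> v" using u v q r by auto
      show False
      proof (cases "y \<le> lo x")
        case True
        then have "v \<noteq> x" using v r by auto
        then show False using lo_valley[of u x v] u v ux vx q r True by auto
      next
        case False
        then have yl: "y \<le> lo (x - 1)" using 3 by auto
        then have "u \<noteq> x - 1" using u q by auto
        then show False using lo_valley[of u "x - 1" v] u v ux vx q r yl by auto
      qed
    qed
    then show ?thesis by (auto simp: exterior_def)
  next
    case 4
    have "upper_left_record (set w) p \<or> upper_right_record (set w) p"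
    proof (rule ccontr)
      assume "\<not> ?thesis"
      then obtain a b c d where q: "(a, b) \<in> set w" "a < x" "b > y" and r: "(c, d) \<in> set w" "x < c" "d > y"
        by (auto simp: upper_left_record_def upper_right_record_def xy)
      obtain u where u: "u = a \<or> u = a - 1" "1 \<le> u" "u < int n" "b \<le> hi u" by (rule column[OF q(1)])
      obtain v where v: "v = c \<or> v = c - 1" "1 \<le> v" "v < int n" "d \<le> hi v" by (rule column[OF r(1)])
      have ux: "u \<le> x - 1" and vx: "x \<le> v" using u v q r by auto
      show False
      proof (cases "hi x \<le> y")
        case True
        then have "v \<noteq> x" using v r by auto
        then show False using hi_mountain[of u x v] u v ux vx q r True by auto
      next
        case False
        then have yl: "hi (x - 1) \<le> y" using 4 by auto
        then have "u \<noteq> x - 1" using u q by auto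
        then show False using hi_mountain[of u "x - 1" v] u v ux vx q r yl by auto
      qed
    qed
    then show ?thesis by (auto simp: exterior_def)
  qed
qed

lemma set_walk_square: "set w \<subseteq> {1..int n} \<times> {1..int n}"
proof clarify
  fix x y assume "(x, y) \<in> set w"
  then obtain u where u: "u = x \<or> u = x - 1" "1 \<le> u" "u < int n" "lo u \<le> y" "y \<le> hi u" by (rule column)
  then show "x \<in> {1..int n} \<and> y \<in> {1..int n}" using lo_range[of u] hi_range[of u] by auto
qed

end

subsection \<open>Zigzags\<close>

text \<open>A triple \<open>(x, a, b)\<close> is a vertical side in column \<open>x\<close> that enters on the
  row \<open>a\<close> and leaves on the row \<open>b\<close>; successive sides of a chain are
  joined by a horizontal side.\<close>

primrec chain :: "int \<Rightarrow> (int \<times> int \<times> int) list \<Rightarrow> int \<Rightarrow> bool" where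
  "chain a [] b \<longleftrightarrow> a = b"
| "chain a (v # vs) b \<longleftrightarrow> fst (snd v) = a \<and> chain (snd (snd v)) vs b"

definition zigzag :: "(int \<times> int \<times> int) list \<Rightarrow> (int \<times> int) list" where
  "zigzag vs = concat (map (\<lambda>(x, a, b). [(x, a), (x, b)]) vs)"

lemma chain_append: "chain a (us @ vs) b \<longleftrightarrow> (\<exists>c. chain a us c \<and> chain c vs b)"
  by (induction us arbitrary: a) auto

lemma chain_rev: "chain a vs b \<Longrightarrow> chain b (rev (map (\<lambda>(x, a, b). (x, b, a)) vs)) a"
  by (induction vs arbitrary: a) (auto simp: chain_append)

lemma zigzag_append: "zigzag (us @ vs) = zigzag us @ zigzag vs"
  by (simp add: zigzag_def)

lemma zigzag_rev: "zigzag (rev (map (\<lambda>(x, a, b). (x, b, a)) vs)) = rev (zigzag vs)"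
  by (induction vs) (auto simp: zigzag_def)

lemma zigzag_links:
  assumes "chain a vs a"
  shows "(x, c, d) \<in> set vs \<Longrightarrow> ((x, c), (x, d)) \<in> links (zigzag vs)"
    and "(x, c, d) \<in> set vs \<Longrightarrow> \<exists>y e. (y, d, e) \<in> set vs \<and> ((x, d), (y, d)) \<in> links (zigzag vs)"
proof -
  have mid: "(p, q) \<in> links (us @ p # q # vs)" for p q us and vs :: "(int \<times> int) list"
    unfolding links_nth by (rule exI[of _ "length us"]) (simp add: nth_append)
  have wrap: "(last l, hd l) \<in> links l" if "l \<noteq> []" for l :: "(int \<times> int) list"
    using links_iff[OF that, of "\<lambda>p q. (p, q) \<in> links l"] by auto
  assume v: "(x, c, d) \<in> set vs"
  then obtain us ws where vs: "vs = us @ (x, c, d) # ws" by (meson split_list)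
  have z: "zigzag vs = zigzag us @ (x, c) # (x, d) # zigzag ws" by (simp add: vs zigzag_def)
  show "((x, c), (x, d)) \<in> links (zigzag vs)" unfolding z by (rule mid)
  from assms have ch: "chain d ws a" "chain a us c" by (auto simp: vs chain_append)
  show "\<exists>y e. (y, d, e) \<in> set vs \<and> ((x, d), (y, d)) \<in> links (zigzag vs)"
  proof (cases ws)
    case Nil
    then have da: "d = a" using ch by simp
    obtain v vs' where v: "vs = v # vs'" using vs by (metis list.exhaust append_is_Nil_conv list.discI)
    obtain y c' e where y: "v = (y, c', e)" by (cases v)
    have h: "vs = (y, d, e) # vs'" using assms da v y by simp
    have "last (zigzag vs) = (x, d)" unfolding z Nil by (simp add: zigzag_def)
    moreover have "hd (zigzag vs) = (y, d)" "zigzag vs \<noteq> []" by (simp_all add: h zigzag_def)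
    ultimately have "((x, d), (y, d)) \<in> links (zigzag vs)" using wrap by metis
    then show ?thesis using h by auto
  next
    case (Cons v ws')
    then obtain y e where v: "v = (y, d, e)" using ch by (cases v) auto
    have "zigzag vs = (zigzag us @ [(x, c)]) @ (x, d) # (y, d) # ((y, e) # zigzag ws')"
      unfolding z by (simp add: Cons v zigzag_def)
    then have "((x, d), (y, d)) \<in> links (zigzag vs)" using mid by metis
    then show ?thesis using vs Cons v by auto
  qed
qed

lemma links_functional:
  assumes "distinct l" "(p, q) \<in> links l" "(p, q') \<in> links l"
  shows "q = q'"
proof -
  obtain i j where "i < length l" "p = l ! i" "q = l ! (Suc i mod length l)"
    "j < length l" "p = l ! j" "q' = l ! (Suc j mod length l)" using assms(2,3) by (auto simp: links_nth)
  then show ?thesis using assms(1) by (metis nth_eq_iff_index_eq)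
qed

lemma zigzag_links_cases:
  assumes ch: "chain a vs a" and d: "distinct (zigzag vs)" and s: "(p, q) \<in> links (zigzag vs)"
  obtains x c d where "(x, c, d) \<in> set vs" "p = (x, c)" "q = (x, d)"
  | x c d y e where "(x, c, d) \<in> set vs" "p = (x, d)" "q = (y, d)" "(y, d, e) \<in> set vs"
proof -
  have "p \<in> set (zigzag vs)" using links_in_set[OF s] by simp
  then obtain x c d' where v: "(x, c, d') \<in> set vs" "p = (x, c) \<or> p = (x, d')" by (auto simp: zigzag_def)
  then show thesis
    using zigzag_links[OF ch v(1)] links_functional[OF d s] that by metis
qed

definition rises :: "(int \<Rightarrow> int) \<Rightarrow> int \<Rightarrow> int \<Rightarrow> (int \<times> int \<times> int) list" where
  "rises h i j = concat (map (\<lambda>x. if h (x - 1) = h x then [] else [(x, h (x - 1), h x)]) [i..j])"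

lemma rises_Cons: "i \<le> j \<Longrightarrow> rises h i j = (if h (i - 1) = h i then [] else [(i, h (i - 1), h i)]) @ rises h (i + 1) j"
  by (simp add: rises_def upto.simps)

lemma rises_Nil: "j < i \<Longrightarrow> rises h i j = []"
  by (simp add: rises_def)

lemma rises:
  "i \<le> j + 1 \<Longrightarrow> chain (h (i - 1)) (rises h i j) (h j) \<and> zigzag (rises h i j) = corners h i j"
proof (induction "nat (j + 1 - i)" arbitrary: i)
  case 0
  then have "j = i - 1" by simp
  then show ?case by (simp add: rises_Nil corners_Nil zigzag_def)
next
  case (Suc k)
  then have ij: "i \<le> j" by simp
  then have "chain (h (i + 1 - 1)) (rises h (i + 1) j) (h j) \<and> zigzag (rises h (i + 1) j) = corners h (i + 1) j"
    using Suc.hyps(2) by (intro Suc.hyps(1)) auto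
  then show ?case using ij by (auto simp: rises_Cons corners_Cons zigzag_append) (simp_all add: zigzag_def)
qed

lemma set_rises: "set (rises h i j) = {(x, h (x - 1), h x) |x. i \<le> x \<and> x \<le> j \<and> h (x - 1) \<noteq> h x}"
  by (auto simp: rises_def)

context shape
begin

definition vs where
  "vs = (1, hi 1, lo 1) # rises lo 2 (int n - 1) @ (int n, lo (int n - 1), hi (int n - 1)) #
     rev (map (\<lambda>(x, a, b). (x, b, a)) (rises hi 2 (int n - 1)))"

lemma zigzag_vs: "zigzag vs = turnpoints w" and chain_vs: "chain (hi 1) vs (hi 1)"
proof -
  have n2': "2 \<le> int n" using n2 by simp
  note r = rises[of 2 "int n - 1" lo] rises[of 2 "int n - 1" hi]
  have "zigzag vs = [(1, hi 1), (1, lo 1)] @ zigzag (rises lo 2 (int n - 1)) @ [(int n, lo (int n - 1)), (int n, hi (int n - 1))] @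
    zigzag (rev (map (\<lambda>(x, a, b). (x, b, a)) (rises hi 2 (int n - 1))))"
    by (simp add: vs_def zigzag_def)
  then show "zigzag vs = turnpoints w" using r n2' by (simp add: walk_turnpoints zigzag_rev)
  have "chain (lo 1) (rises lo 2 (int n - 1)) (lo (int n - 1))" using r(1) n2' by simp
  moreover have "chain (hi (int n - 1)) (rev (map (\<lambda>(x, a, b). (x, b, a)) (rises hi 2 (int n - 1)))) (hi 1)"
    using r(2) n2' by (intro chain_rev) simp
  ultimately show "chain (hi 1) vs (hi 1)" by (auto simp: vs_def chain_append)
qed

lemma set_vs:
  "(x, c, d) \<in> set vs \<longleftrightarrow> x \<in> {1..int n} \<and> d = \<sigma> x \<and>
     c = (if x = 1 then hi 1 else if x = int n then lo (int n - 1) else if x \<in> D then lo (x - 1) else hi x)"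
proof -
  have n2': "2 \<le> int n" using n2 by simp
  have e: "lo 1 = \<sigma> 1" "hi (int n - 1) = \<sigma> n" using lo_D D hi_D[of "int n"] n2 by auto
  have "(x, c, d) \<in> set vs \<longleftrightarrow> x = 1 \<and> c = hi 1 \<and> d = lo 1 \<or> x = int n \<and> c = lo (int n - 1) \<and> d = hi (int n - 1) \<or>
     2 \<le> x \<and> x \<le> int n - 1 \<and> lo (x - 1) \<noteq> lo x \<and> c = lo (x - 1) \<and> d = lo x \<or>
     2 \<le> x \<and> x \<le> int n - 1 \<and> hi (x - 1) \<noteq> hi x \<and> c = hi x \<and> d = hi (x - 1)"
    by (auto simp: vs_def set_rises image_iff)
  also have "\<dots> \<longleftrightarrow> x = 1 \<and> c = hi 1 \<and> d = \<sigma> x \<or> x = int n \<and> c = lo (int n - 1) \<and> d = \<sigma> x \<or>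
     2 \<le> x \<and> x \<le> int n - 1 \<and> x \<in> D \<and> c = lo (x - 1) \<and> d = \<sigma> x \<or>
     2 \<le> x \<and> x \<le> int n - 1 \<and> x \<notin> D \<and> c = hi x \<and> d = \<sigma> x"
  proof -
    have "2 \<le> x \<Longrightarrow> lo (x - 1) \<noteq> lo x \<longleftrightarrow> x \<in> D" using lo_eq_iff by blast
    moreover have "2 \<le> x \<Longrightarrow> x \<le> int n - 1 \<Longrightarrow> hi (x - 1) \<noteq> hi x \<longleftrightarrow> x \<notin> D" using hi_eq_iff by simp
    moreover have "x \<in> D \<Longrightarrow> lo x = \<sigma> x" by (rule lo_D)
    moreover have "2 \<le> x \<Longrightarrow> x \<le> int n - 1 \<Longrightarrow> x \<notin> D \<Longrightarrow> hi (x - 1) = \<sigma> x" by (intro hi_D) auto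
    ultimately show ?thesis using e by auto
  qed
  finally show ?thesis using n2' D by auto
qed

lemma vs_turn: "(x, c, d) \<in> set vs \<Longrightarrow> c \<noteq> d"
proof -
  assume "(x, c, d) \<in> set vs"
  then have x: "x \<in> {1..int n}" "d = \<sigma> x"
    "c = (if x = 1 then hi 1 else if x = int n then lo (int n - 1) else if x \<in> D then lo (x - 1) else hi x)"
    by (auto simp: set_vs)
  have "lo 1 \<noteq> hi 1" "lo (int n - 1) \<noteq> hi (int n - 1)" using lo_hi[of 1] lo_hi[of "int n - 1"] n2 by auto
  moreover have "lo 1 = \<sigma> 1" "hi (int n - 1) = \<sigma> n" using lo_D D hi_D[of "int n"] n2 by auto
  ultimately show ?thesis using x lo_ne[of x] hi_ne[of x] lo_D[of x] hi_D[of x] by (auto split: if_splits)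
qed

text \<open>The vertical side in column \<open>x\<close> ends at \<open>(x, \<sigma> x)\<close>, and there
  starts a horizontal side on the row \<open>\<sigma> x\<close>. So the condition on the rows is
  the bijectivity of \<open>\<sigma>\<close>.\<close>

lemma permutomino: "permutomino_walk n w"
  unfolding permutomino_walk_def
proof (intro conjI closed_walk set_walk_square ballI)
  have dist: "distinct (turnpoints w)" unfolding turnpoints_def by (rule distinct_nthsI) (rule distinct_walk)
  have S: "sides w = links (zigzag vs)" by (simp add: sides_links zigzag_vs)
  have dz: "distinct (zigzag vs)" using dist by (simp add: zigzag_vs)
  fix i assume i: "i \<in> {1..int n}"
  obtain c where c: "(i, c, \<sigma> i) \<in> set vs" using i unfolding set_vs by blast
  show "\<exists>!s. s \<in> sides w \<and> fst (fst s) = i \<and> fst (snd s) = i"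
  proof (rule ex1I[of _ "((i, c), (i, \<sigma> i))"])
    show "((i, c), (i, \<sigma> i)) \<in> sides w \<and> fst (fst ((i, c), (i, \<sigma> i))) = i \<and> fst (snd ((i, c), (i, \<sigma> i))) = i"
      using zigzag_links(1)[OF chain_vs c] by (simp add: S)
    fix s assume s: "s \<in> sides w \<and> fst (fst s) = i \<and> fst (snd s) = i"
    obtain p q where pq: "s = (p, q)" by (cases s)
    have l: "(p, q) \<in> links (zigzag vs)" using s pq S by simp
    show "s = ((i, c), (i, \<sigma> i))"
    proof (cases rule: zigzag_links_cases[OF chain_vs dz l])
      case (1 x c' d)
      then show ?thesis using s pq c by (auto simp: set_vs)
    next
      case (2 x c' d y e)
      then have "x = y" using s pq by simp
      then have "c' = d" using 2(1,4) by (simp add: set_vs)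
      then show ?thesis using vs_turn[OF 2(1)] by simp
    qed
  qed
  obtain z where z: "z \<in> {1..int n}" "\<sigma> z = i" using i permutes_image[OF perm] by (metis imageE)
  obtain c where c: "(z, c, i) \<in> set vs" using z unfolding set_vs by blast
  obtain y e where y: "(y, i, e) \<in> set vs" "((z, i), (y, i)) \<in> links (zigzag vs)"
    using zigzag_links(2)[OF chain_vs c] by blast
  show "\<exists>!s. s \<in> sides w \<and> snd (fst s) = i \<and> snd (snd s) = i"
  proof (rule ex1I[of _ "((z, i), (y, i))"])
    show "((z, i), (y, i)) \<in> sides w \<and> snd (fst ((z, i), (y, i))) = i \<and> snd (snd ((z, i), (y, i))) = i"
      using y by (simp add: S)
    fix s assume s: "s \<in> sides w \<and> snd (fst s) = i \<and> snd (snd s) = i"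
    obtain p q where pq: "s = (p, q)" by (cases s)
    have l: "(p, q) \<in> links (zigzag vs)" using s pq S by simp
    show "s = ((z, i), (y, i))"
    proof (cases rule: zigzag_links_cases[OF chain_vs dz l])
      case (1 x c' d)
      then show ?thesis using vs_turn[OF 1(1)] s pq by simp
    next
      case (2 x c' d y' e')
      then have "d = i" using s pq by simp
      then have "\<sigma> x = \<sigma> z" using 2(1) z by (simp add: set_vs)
      then have "p = (z, i)" using 2 \<open>d = i\<close> inj by simp
      then show ?thesis using links_functional[OF dz l, of "(y, i)"] y pq by simp
    qed
  qed
qed

lemma convex_permutomino: "cyclic_class w \<in> convex_permutominoes n"
  unfolding convex_permutominoes_def using permutomino no_interior by blast

end

section \<open>Every convex permutomino comes from a shape\<close>

locale convex_walk =
  fixes n :: nat and w :: "(int \<times> int) list"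
  assumes walk: "permutomino_walk n w" and no_int: "no_interior_point (set w)" and n2: "2 \<le> n"
begin

definition adj where "adj p q \<longleftrightarrow> (p, q) \<in> links w \<union> (links w)\<inverse>"
definition H where "H x y \<longleftrightarrow> adj (x, y) (x + 1, y)"
definition V where "V x y \<longleftrightarrow> adj (x, y) (x, y + 1)"

lemma closed: "closed_self_avoiding_walk w" and square: "set w \<subseteq> {1..int n} \<times> {1..int n}"
  and columns: "x \<in> {1..int n} \<Longrightarrow> \<exists>!s. s \<in> sides w \<and> fst (fst s) = x \<and> fst (snd s) = x"
  and rows: "x \<in> {1..int n} \<Longrightarrow> \<exists>!s. s \<in> sides w \<and> snd (fst s) = x \<and> snd (snd s) = x"
  using walk by (simp_all add: permutomino_walk_def)

lemma dist: "distinct w" and len: "2 < length w" and lattice: "(p, q) \<in> links w \<Longrightarrow> lattice_adjacent p q"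
  using closed by (auto simp: closed_walk_iff)

lemma adj_sym: "adj p q \<longleftrightarrow> adj q p"
  by (auto simp: adj_def)

lemma adj_in: "adj p q \<Longrightarrow> p \<in> set w \<and> q \<in> set w"
  using links_in_set[of p q w] links_in_set[of q p w] by (auto simp: adj_def)

lemma H_in: "H x y \<Longrightarrow> (x, y) \<in> set w \<and> (x + 1, y) \<in> set w"
  using adj_in by (simp add: H_def)

lemma V_in: "V x y \<Longrightarrow> (x, y) \<in> set w \<and> (x, y + 1) \<in> set w"
  using adj_in by (simp add: V_def)

lemma in_square: "(x, y) \<in> set w \<Longrightarrow> 1 \<le> x \<and> x \<le> int n \<and> 1 \<le> y \<and> y \<le> int n"
  using square by auto

lemma two_neighbours:
  assumes "p \<in> set w"
  obtains q r where "q \<noteq> r" "\<And>z. adj p z \<longleftrightarrow> z = q \<or> z = r"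
    "p \<in> set (turnpoints w) \<longleftrightarrow> p - q \<noteq> r - p"
proof -
  obtain i where i: "i < length w" "p = w ! i" using assms by (metis in_set_conv_nth)
  note nb = neighbours[OF dist len i(1)]
  let ?r = "w ! (Suc i mod length w)" and ?q = "w ! ((i + length w - 1) mod length w)"
  have "adj p z \<longleftrightarrow> z = ?q \<or> z = ?r" for z using nb(1,2)[of z] i by (auto simp: adj_def)
  moreover have "p \<in> set (turnpoints w) \<longleftrightarrow> turns_at w i"
    unfolding turnpoints_def set_nths using i dist by (auto simp: nth_eq_iff_index_eq)
  moreover have "turns_at w i \<longleftrightarrow> p - ?q \<noteq> ?r - p" by (simp add: turns_at_def Let_def i)
  ultimately show thesis using that[of ?q ?r] nb(3) by metis
qed

text \<open>Every vertex has exactly two neighbours. It has one horizontal and one vertical edge if it is a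
  turnpoint, and two edges in a line otherwise.\<close>

lemma degree:
  assumes "(x, y) \<in> set w"
  shows "H x y \<and> H (x - 1) y \<and> \<not> V x y \<and> \<not> V x (y - 1) \<and> (x, y) \<notin> set (turnpoints w) \<or>
    \<not> H x y \<and> \<not> H (x - 1) y \<and> V x y \<and> V x (y - 1) \<and> (x, y) \<notin> set (turnpoints w) \<or>
    (H x y \<noteq> H (x - 1) y) \<and> (V x y \<noteq> V x (y - 1)) \<and> (x, y) \<in> set (turnpoints w)"
proof -
  obtain q r where qr: "q \<noteq> r" "\<And>z. adj (x, y) z \<longleftrightarrow> z = q \<or> z = r"
    "(x, y) \<in> set (turnpoints w) \<longleftrightarrow> (x, y) - q \<noteq> r - (x, y)" using two_neighbours[OF assms] by blast
  have near: "z \<in> {(x + 1, y), (x - 1, y), (x, y + 1), (x, y - 1)}" if "adj (x, y) z" for z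
  proof -
    have "lattice_adjacent (x, y) z" using that lattice[of "(x, y)" z] lattice[of z "(x, y)"] lattice_adjacent_sym[of z "(x, y)"]
      unfolding adj_def by blast
    then show ?thesis by (cases z) (auto simp: lattice_adjacent_def abs_if split: if_splits)
  qed
  have e: "H x y = adj (x, y) (x + 1, y)" "H (x - 1) y = adj (x, y) (x - 1, y)"
    "V x y = adj (x, y) (x, y + 1)" "V x (y - 1) = adj (x, y) (x, y - 1)"
    using adj_sym by (auto simp: H_def V_def)
  have "q \<in> {(x + 1, y), (x - 1, y), (x, y + 1), (x, y - 1)}" "r \<in> {(x + 1, y), (x - 1, y), (x, y + 1), (x, y - 1)}"
    using near qr(2) by blast+
  note mem = this
  show ?thesis unfolding e qr(2,3)
    by (insert mem qr(1), elim insertE emptyE) simp_all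
qed

text \<open>A predicate that does not change along the edges is constant on the walk. It is used below with
  the regions that an impossible configuration would cut off.\<close>

lemma connected:
  assumes hor: "\<And>x y. H x y \<Longrightarrow> A (x, y) \<longleftrightarrow> A (x + 1, y)" and ver: "\<And>x y. V x y \<Longrightarrow> A (x, y) \<longleftrightarrow> A (x, y + 1)"
    and pq: "p \<in> set w" "q \<in> set w"
  shows "A p \<longleftrightarrow> A q"
proof -
  have step: "A p \<longleftrightarrow> A q" if "(p, q) \<in> links w" for p q
  proof -
    obtain a b c d where e: "p = (a, b)" "q = (c, d)" by (cases p, cases q)
    have pq: "adj (a, b) (c, d)" "adj (c, d) (a, b)" using that by (auto simp: adj_def e)
    have "c = a + 1 \<and> d = b \<or> a = c + 1 \<and> d = b \<or> c = a \<and> d = b + 1 \<or> c = a \<and> b = d + 1"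
      using lattice[OF that] by (auto simp: e lattice_adjacent_def abs_if split: if_splits)
    then show ?thesis using pq hor[of a b] hor[of c d] ver[of a b] ver[of c d] by (auto simp: e H_def V_def)
  qed
  have "A (w ! i) \<longleftrightarrow> A (w ! 0)" if "i < length w" for i
    using that
  proof (induction i)
    case (Suc i)
    then have "(w ! i, w ! Suc i) \<in> links w" unfolding links_nth by (intro exI[of _ i]) auto
    then show ?case using step Suc by auto
  qed simp
  then show ?thesis using pq by (metis in_set_conv_nth)
qed

text \<open>The maximal vertical segment through an edge is a side, as the walk has to leave it horizontally
  at both ends.\<close>

lemma V_segment:
  assumes "V x y"
  obtains b t where "b \<le> y" "y < t" "\<And>z. b \<le> z \<Longrightarrow> z < t \<Longrightarrow> V x z" "\<not> V x t" "\<not> V x (b - 1)"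
    "((x, b), (x, t)) \<in> sides w \<or> ((x, t), (x, b)) \<in> sides w"
proof -
  have up: "\<exists>t>y. (\<forall>z. y \<le> z \<longrightarrow> z < t \<longrightarrow> V x z) \<and> \<not> V x t" if "V x y" for y
    using that
  proof (induction "nat (int n - y)" arbitrary: y)
    case 0
    then show ?case using V_in[of x y] in_square[of x "y + 1"] by auto
  next
    case (Suc k)
    show ?case
    proof (cases "V x (y + 1)")
      case True
      then obtain t where t: "t > y + 1" "\<And>z. y + 1 \<le> z \<Longrightarrow> z < t \<Longrightarrow> V x z" "\<not> V x t"
        using Suc.hyps(1)[of "y + 1", OF _ True] Suc.hyps(2) by fastforce
      have "V x z" if "y \<le> z" "z < t" for z using t(2)[of z] that Suc.prems by (cases "z = y") auto
      then show ?thesis using t by (intro exI[of _ t]) auto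
    next
      case False
      have "V x z" if "y \<le> z" "z < y + 1" for z using that Suc.prems by (cases "z = y") auto
      then show ?thesis using False by (intro exI[of _ "y + 1"]) auto
    qed
  qed
  have down: "\<exists>b\<le>y. (\<forall>z. b \<le> z \<longrightarrow> z \<le> y \<longrightarrow> V x z) \<and> \<not> V x (b - 1)" if "V x y" for y
    using that
  proof (induction "nat y" arbitrary: y)
    case 0
    then show ?case using V_in[of x y] in_square[of x y] by auto
  next
    case (Suc k)
    show ?case
    proof (cases "V x (y - 1)")
      case True
      then obtain b where b: "b \<le> y - 1" "\<And>z. b \<le> z \<Longrightarrow> z \<le> y - 1 \<Longrightarrow> V x z" "\<not> V x (b - 1)"
        using Suc.hyps(1)[of "y - 1", OF _ True] Suc.hyps(2) by fastforce
      have "V x z" if "b \<le> z" "z \<le> y" for z using b(2)[of z] that Suc.prems by (cases "z = y") auto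
      then show ?thesis using b by (intro exI[of _ b]) auto
    next
      case False
      have "V x z" if "y \<le> z" "z \<le> y" for z using that Suc.prems by auto
      then show ?thesis using False by (intro exI[of _ y]) auto
    qed
  qed
  obtain t where t: "t > y" "\<And>z. y \<le> z \<Longrightarrow> z < t \<Longrightarrow> V x z" "\<not> V x t" using up[OF assms] by blast
  obtain b where b: "b \<le> y" "\<And>z. b \<le> z \<Longrightarrow> z \<le> y \<Longrightarrow> V x z" "\<not> V x (b - 1)" using down[OF assms] by blast
  have bt: "V x z" if "b \<le> z" "z < t" for z using b(2)[of z] t(2)[of z] that by linarith
  have "V x b" "V x (t - 1)" using bt b t by auto
  then have "(x, b) \<in> set w" "(x, t) \<in> set w" using V_in[of x b] V_in[of x "t - 1"] by auto
  then have tb: "H x b \<noteq> H (x - 1) b" "H x t \<noteq> H (x - 1) t"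
    using degree[of x b] degree[of x t] \<open>V x b\<close> \<open>V x (t - 1)\<close> b(3) t(3) by auto
  have ends: "\<exists>u. adj (x, y) (u, y) \<and> u \<noteq> x" if h: "H x y \<noteq> H (x - 1) y" for y
  proof (cases "H x y")
    case True
    then show ?thesis by (intro exI[of _ "x + 1"]) (simp add: H_def)
  next
    case False
    then have "adj (x - 1, y) (x, y)" using h by (simp add: H_def)
    then show ?thesis using adj_sym by (intro exI[of _ "x - 1"]) auto
  qed
  obtain u where u: "adj (x, b) (u, b)" "u \<noteq> x" using ends[OF tb(1)] by blast
  obtain v where v: "adj (x, t) (v, t)" "v \<noteq> x" using ends[OF tb(2)] by blast
  have "b < t" using b t by simp
  then have "((x, b), (x, t)) \<in> sides w \<or> ((x, t), (x, b)) \<in> sides w"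
    using side_of_run[OF closed, of b t x u v] bt u v by (auto simp: V_def adj_def)
  then show thesis using that[of b t] b t bt by blast
qed

text \<open>There is only one maximal vertical segment in a column, because it is a side. So crossing this
  column from left to right changes the set of horizontal edges at exactly two heights.\<close>

lemma column_segment:
  assumes x: "x \<in> {1..int n}"
  obtains b t where "b < t" "\<And>y. V x y \<longleftrightarrow> b \<le> y \<and> y < t"
    "\<And>y. (H x y \<noteq> H (x - 1) y) \<longleftrightarrow> y = b \<or> y = t"
proof -
  obtain s where s: "s \<in> sides w" "fst (fst s) = x" "fst (snd s) = x" using columns[OF x] by blast
  have uniq: "s1 = s2" if "s1 \<in> sides w" "fst (fst s1) = x" "fst (snd s1) = x"
    "s2 \<in> sides w" "fst (fst s2) = x" "fst (snd s2) = x" for s1 s2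
    using columns[OF x] that by blast
  have "fst s \<in> set (turnpoints w)" using s(1) links_in_set by (metis sides_links prod.collapse)
  then obtain y0 where y0: "(x, y0) \<in> set (turnpoints w)" using s(2) by (metis prod.collapse)
  then have "(x, y0) \<in> set w" unfolding turnpoints_def using set_nths_subset by fastforce
  then have "V x y0 \<or> V x (y0 - 1)" using degree y0 by blast
  then obtain y1 where "V x y1" by blast
  then obtain b t where bt: "b \<le> y1" "y1 < t" "\<And>z. b \<le> z \<Longrightarrow> z < t \<Longrightarrow> V x z" "\<not> V x t" "\<not> V x (b - 1)"
    "((x, b), (x, t)) \<in> sides w \<or> ((x, t), (x, b)) \<in> sides w" by (rule V_segment) (rule that)
  have V: "V x y \<longleftrightarrow> b \<le> y \<and> y < t" for y
  proof
    assume "V x y"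
    then obtain b' t' where bt': "b' \<le> y" "y < t'" "\<And>z. b' \<le> z \<Longrightarrow> z < t' \<Longrightarrow> V x z" "\<not> V x t'" "\<not> V x (b' - 1)"
    "((x, b'), (x, t')) \<in> sides w \<or> ((x, t'), (x, b')) \<in> sides w" by (rule V_segment) (rule that)
    have "b = b' \<and> t = t' \<or> b = t' \<and> t = b'"
      using uniq[of "((x, b), (x, t))" "((x, b'), (x, t'))"] uniq[of "((x, t), (x, b))" "((x, b'), (x, t'))"]
        uniq[of "((x, b), (x, t))" "((x, t'), (x, b'))"] uniq[of "((x, t), (x, b))" "((x, t'), (x, b'))"] bt(6) bt'(6) by auto
    then show "b \<le> y \<and> y < t" using bt bt' by auto
  qed (use bt in blast)
  have "(H x y \<noteq> H (x - 1) y) \<longleftrightarrow> y = b \<or> y = t" for y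
  proof
    assume h: "H x y \<noteq> H (x - 1) y"
    then have "(x, y) \<in> set w" using H_in[of x y] H_in[of "x - 1" y] by auto
    then have "V x y \<noteq> V x (y - 1)" using degree h by blast
    then show "y = b \<or> y = t" using V[of y] V[of "y - 1"] by auto
  next
    assume y: "y = b \<or> y = t"
    then have v: "V x y \<noteq> V x (y - 1)" using V[of y] V[of "y - 1"] bt(1,2) by auto
    then have "(x, y) \<in> set w" using V_in[of x y] V_in[of x "y - 1"] by auto
    then show "H x y \<noteq> H (x - 1) y" using degree v by blast
  qed
  then show thesis using that[of b t] V bt by simp
qed

lemma row_edge: "y \<in> {1..int n} \<Longrightarrow> \<exists>x. H x y"
proof -
  assume "y \<in> {1..int n}"
  then obtain s where s: "s \<in> sides w" "snd (fst s) = y" using rows by blast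
  have "fst s \<in> set (turnpoints w)" using s(1) links_in_set by (metis sides_links prod.collapse)
  then obtain x where x: "(x, y) \<in> set (turnpoints w)" using s(2) by (metis prod.collapse)
  then have "(x, y) \<in> set w" unfolding turnpoints_def using set_nths_subset by fastforce
  then show ?thesis using degree x by blast
qed

lemma not_interior:
  assumes "(x, y) \<in> set w" "(a, a') \<in> set w" "a < x" "a' < y" "(b, b') \<in> set w" "b < x" "y < b'"
    "(c, c') \<in> set w" "x < c" "c' < y" "(d, d') \<in> set w" "x < d" "y < d'"
  shows False
proof -
  have "exterior (set w) (x, y)" using no_int assms(1) by (auto simp: no_interior_point_def)
  then show False using assms
    by (fastforce simp: exterior_def upper_left_record_def upper_right_record_def bottom_left_record_def bottom_right_record_def)
qed

text \<open>If the segment in column \<open>x\<close> met neither of the two horizontal edges on the left of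
  it, there would be four horizontal edges on the right. When the segment is between those two
  edges, its lower end is an interior point. Otherwise the edges form two pairs, \<open>{l,
  h}\<close> and \<open>{b, t}\<close>, one above the other, and convexity forces the segment in
  the next column to join one of the pairs, which disconnects the walk.\<close>

lemma strip_impossible:
  assumes x: "2 \<le> x" "x < int n"
    and R: "\<And>y. H (x - 1) y \<longleftrightarrow> y = l \<or> y = h" "l < h"
    and V: "\<And>y. V x y \<longleftrightarrow> b \<le> y \<and> y < t" "b < t"
    and R': "\<And>y. H x y \<longleftrightarrow> y = l \<or> y = h \<or> y = b \<or> y = t" "{l, h} \<inter> {b, t} = {}"
  shows False
proof -
  have S: "(x - 1, l) \<in> set w" "(x - 1, h) \<in> set w" "(x, l) \<in> set w" "(x, h) \<in> set w" "(x, b) \<in> set w" "(x, t) \<in> set w"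
    "(x + 1, l) \<in> set w" "(x + 1, h) \<in> set w" "(x + 1, b) \<in> set w" "(x + 1, t) \<in> set w"
    using H_in[of "x - 1"] H_in[of x] R(1) R'(1) by auto
  have out: "\<not> (b \<le> y \<and> y \<le> t)" if "y = l \<or> y = h" for y
  proof
    assume "b \<le> y \<and> y \<le> t"
    moreover have "y \<noteq> b" "y \<noteq> t" using that R'(2) by auto
    ultimately have "V x y" using V by auto
    moreover have "H x y" "H (x - 1) y" using that R R' by auto
    moreover have "(x, y) \<in> set w" using that S by auto
    ultimately show False using degree by blast
  qed
  show False
  proof (cases "l < b \<and> t < h")
    case True
    then show False
      using not_interior[of x b "x - 1" l "x - 1" h "x + 1" l "x + 1" h] S V(2) by simp
  next
    case False
    then have sep: "t < l \<or> h < b" using out[of l] out[of h] R(2) V(2) by linarith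
    obtain y1 y2 y3 y4 where y: "y1 < y2" "y2 < y3" "y3 < y4"
      "y1 = b \<and> y2 = t \<and> y3 = l \<and> y4 = h \<or> y1 = l \<and> y2 = h \<and> y3 = b \<and> y4 = t"
      using sep R(2) V(2) by blast
    have Hy: "H x z \<longleftrightarrow> z = y1 \<or> z = y2 \<or> z = y3 \<or> z = y4" for z using R'(1) y(4) by auto
    then have Sy: "(x, z) \<in> set w \<and> (x + 1, z) \<in> set w" if "z = y1 \<or> z = y2 \<or> z = y3 \<or> z = y4" for z
      using H_in that by blast
    have x1: "x + 1 \<in> {1..int n}" using x by auto
    obtain b' t' where bt': "b' < t'" "\<And>y. V (x + 1) y \<longleftrightarrow> b' \<le> y \<and> y < t'"
      "\<And>y. (H (x + 1) y \<noteq> H x y) \<longleftrightarrow> y = b' \<or> y = t'" using column_segment[OF x1] by auto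
    have right: "(x + 2, z) \<in> set w" if "z = y1 \<or> z = y2 \<or> z = y3 \<or> z = y4" "z \<noteq> b'" "z \<noteq> t'" for z
    proof -
      have "H (x + 1) z" using bt'(3)[of z] Hy that by auto
      then show ?thesis using H_in[of "x + 1" z] by (simp add: add.assoc)
    qed
    \<comment> \<open>One of the two inner edges ends in an interior point if the walk
      continues to the right both below and above it.\<close>
    have mid: False if "y = y2 \<and> lw = y1 \<and> up = y3 \<or> y = y3 \<and> lw = y2 \<and> up = y4" "(x + 2, u) \<in> set w" "u < y" "(x + 2, v) \<in> set w" "y < v" for y u v lw up
      using not_interior[of "x + 1" y x lw x up "x + 2" u "x + 2" v] Sy that y(1-3) by auto
    have "(y1 = b' \<or> y1 = t') \<or> (y3 = b' \<or> y3 = t')" using mid[of y2 y1 y3 y1 y3] right y by auto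
    moreover have "(y1 = b' \<or> y1 = t') \<or> (y4 = b' \<or> y4 = t')" using mid[of y2 y1 y3 y1 y4] right y by auto
    moreover have "(y2 = b' \<or> y2 = t') \<or> (y4 = b' \<or> y4 = t')" using mid[of y3 y2 y4 y2 y4] right y by auto
    moreover have "\<not> (b' = y1 \<and> t' = y4)"
    proof
      assume "b' = y1 \<and> t' = y4"
      then have "V (x + 1) y2" "V (x + 1) (y2 - 1)" using bt'(2) y by auto
      moreover have "H x y2" using Hy by simp
      ultimately show False using degree[of "x + 1" y2] Sy by auto
    qed
    ultimately have pr: "b' = y1 \<and> t' = y2 \<or> b' = y3 \<and> t' = y4" using bt'(1) y(1-3) by auto
    then consider "b' = b" "t' = t" | "b' = l" "t' = h" using y(4) by auto
    then show False
    proof cases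
      case 1
      \<comment> \<open>The rectangle bounded by the segments in the columns
        \<open>x\<close> and \<open>x + 1\<close> is closed.\<close>
      define A where "A p \<longleftrightarrow> (fst p = x \<or> fst p = x + 1) \<and> b \<le> snd p \<and> snd p \<le> t" for p :: "int \<times> int"
      have H1: "H (x + 1) v \<longleftrightarrow> v = l \<or> v = h" for v using bt'(3)[of v] R'(1)[of v] R'(2) 1 by auto
      have "A (x, b) \<longleftrightarrow> A (x - 1, l)"
      proof (rule connected)
        fix u v assume h: "H u v"
        consider "u = x - 1" | "u = x" | "u = x + 1" | "u < x - 1" | "u > x + 1" by linarith
        then show "A (u, v) \<longleftrightarrow> A (u + 1, v)"
        proof cases
          case 1
          then have "v = l \<or> v = h" using h R(1) by simp
          then show ?thesis using out[of v] 1 by (auto simp: A_def)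
        next
          case 3
          then have "v = l \<or> v = h" using h H1 by simp
          then show ?thesis using out[of v] 3 by (auto simp: A_def)
        qed (auto simp: A_def)
      next
        fix u v assume h: "V u v"
        then show "A (u, v) \<longleftrightarrow> A (u, v + 1)"
          using V(1)[of v] bt'(2)[of v] 1 by (auto simp: A_def)
      qed (use S in auto)
      then show False using V(2) by (simp add: A_def)
    next
      case 2
      \<comment> \<open>Everything to the left of column \<open>x\<close>, together with its
        continuation to column \<open>x + 1\<close>, is closed.\<close>
      define A where "A p \<longleftrightarrow> fst p < x \<or> fst p = x \<and> \<not> (b \<le> snd p \<and> snd p \<le> t) \<or> fst p = x + 1 \<and> l \<le> snd p \<and> snd p \<le> h"
        for p :: "int \<times> int"
      have H1: "H (x + 1) v \<longleftrightarrow> v = b \<or> v = t" for v using bt'(3)[of v] R'(1)[of v] R'(2) 2 by auto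
      have out': "\<not> (l \<le> v \<and> v \<le> h)" if "v = b \<or> v = t" for v using sep that R(2) V(2) by auto
      have "A (x, b) \<longleftrightarrow> A (x - 1, l)"
      proof (rule connected)
        fix u v assume h: "H u v"
        consider "u = x - 1" | "u = x" | "u = x + 1" | "u < x - 1" | "u > x + 1" by linarith
        then show "A (u, v) \<longleftrightarrow> A (u + 1, v)"
        proof cases
          case 1
          then have "v = l \<or> v = h" using h R(1) by simp
          then show ?thesis using out[of v] 1 by (auto simp: A_def)
        next
          case 2
          then have "v = l \<or> v = h \<or> v = b \<or> v = t" using h R'(1) by simp
          then show ?thesis using out[of v] out'[of v] 2 R(2) V(2) by (auto simp: A_def)
        next
          case 3
          then have "v = b \<or> v = t" using h H1 by simp
          then show ?thesis using out'[of v] 3 by (auto simp: A_def)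
        qed (auto simp: A_def)
      next
        fix u v assume h: "V u v"
        then show "A (u, v) \<longleftrightarrow> A (u, v + 1)"
          using V(1)[of v] bt'(2)[of v] 2 by (auto simp: A_def)
      qed (use S in auto)
      then show False using V(2) by (simp add: A_def)
    qed
  qed
qed

text \<open>Column by column from the left: at a column the segment exchanges one of the two edges for another
  one. The remaining cases are a segment that joins both edges, which would end the walk before it
  reaches column \<open>n\<close>, and a segment that joins none.\<close>

lemma strip:
  assumes "1 \<le> x" "x < int n"
  shows "\<exists>l h. l < h \<and> (\<forall>y. H x y \<longleftrightarrow> y = l \<or> y = h)"
  using assms
proof (induction x rule: int_ge_induct)
  case base
  have "1 \<in> {1..int n}" using n2 by simp
  then obtain b t where bt: "b < t" "\<And>y. V 1 y \<longleftrightarrow> b \<le> y \<and> y < t" "\<And>y. (H 1 y \<noteq> H (1 - 1) y) \<longleftrightarrow> y = b \<or> y = t"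
    using column_segment by blast
  have "\<not> H 0 y" for y using H_in[of 0 y] in_square[of 0 y] by auto
  then show ?case using bt by (intro exI[of _ b] exI[of _ t]) auto
next
  case (step z)
  define x where "x = z + 1"
  have x: "2 \<le> x" "x < int n" "z = x - 1" using step by (auto simp: x_def)
  obtain l h where R: "l < h" "\<And>y. H (x - 1) y \<longleftrightarrow> y = l \<or> y = h" using step x by auto
  have "x \<in> {1..int n}" using x by simp
  then obtain b t where bt: "b < t" "\<And>y. V x y \<longleftrightarrow> b \<le> y \<and> y < t" "\<And>y. (H x y \<noteq> H (x - 1) y) \<longleftrightarrow> y = b \<or> y = t"
    using column_segment by blast
  have R': "H x y \<longleftrightarrow> (y = l \<or> y = h) \<noteq> (y = b \<or> y = t)" for y using bt(3)[of y] R(2)[of y] by auto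
  consider "b = l" "t = h" | "b = l" "t \<noteq> h" | "b = h" | "b \<noteq> l" "b \<noteq> h" "t = l" | "b \<noteq> l" "b \<noteq> h" "t = h"
    | "{l, h} \<inter> {b, t} = {}" by blast
  then have "\<exists>l h. l < h \<and> (\<forall>y. H x y \<longleftrightarrow> y = l \<or> y = h)"
  proof cases
    case 1
    then have none: "\<not> H x y" for y using R' by auto
    obtain y where y: "(x - 1, y) \<in> set w" using H_in R(2) by blast
    have "int n \<in> {1..int n}" using n2 by simp
    then obtain b' t' where "b' < t'" "\<And>y. V (int n) y \<longleftrightarrow> b' \<le> y \<and> y < t'"
      "\<And>y. (H (int n) y \<noteq> H (int n - 1) y) \<longleftrightarrow> y = b' \<or> y = t'" by (rule column_segment) (rule that)
    then have "V (int n) b'" by simp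
    then have yn: "(int n, b') \<in> set w" using V_in by blast
    \<comment> \<open>No edge leads from column \<open>x\<close> to the right, although there
      are vertices in column \<open>n\<close>.\<close>
    have "fst (x - 1, y) \<le> x \<longleftrightarrow> fst (int n, b') \<le> x"
    proof (rule connected[where A = "\<lambda>p. fst p \<le> x"])
      fix u v assume h: "H u v"
      then have "u \<noteq> x" using none by auto
      then show "(fst (u, v) \<le> x) = (fst (u + 1, v) \<le> x)" by auto
    qed (use y yn in auto)
    then show ?thesis using x by simp
  next
    case 2
    then have "H x y \<longleftrightarrow> y = h \<or> y = t" for y using R' bt(1) R(1) by auto
    then show ?thesis using 2 by (intro exI[of _ "min h t"] exI[of _ "max h t"]) (auto simp: min_def max_def)
  next
    case 3
    then have "H x y \<longleftrightarrow> y = l \<or> y = t" for y using R' bt(1) R(1) by auto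
    then show ?thesis using 3 bt(1) R(1) by (intro exI[of _ l] exI[of _ t]) auto
  next
    case 4
    then have "H x y \<longleftrightarrow> y = b \<or> y = h" for y using R' bt(1) R(1) by auto
    then show ?thesis using 4 bt(1) R(1) by (intro exI[of _ b] exI[of _ h]) auto
  next
    case 5
    then have "H x y \<longleftrightarrow> y = l \<or> y = b" for y using R' bt(1) R(1) by auto
    then show ?thesis using 5 by (intro exI[of _ "min l b"] exI[of _ "max l b"]) (auto simp: min_def max_def)
  next
    case 6
    then have "H x y \<longleftrightarrow> y = l \<or> y = h \<or> y = b \<or> y = t" for y using R' by auto
    then show ?thesis using strip_impossible[OF x(1,2) R(2,1) bt(2,1) _ 6] by blast
  qed
  then show ?case by (simp add: x_def)
qed

end

context convex_walk
begin

definition lo where "lo x = (SOME l. \<exists>h. l < h \<and> (\<forall>y. H x y \<longleftrightarrow> y = l \<or> y = h))"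
definition hi where "hi x = (SOME h. lo x < h \<and> (\<forall>y. H x y \<longleftrightarrow> y = lo x \<or> y = h))"

lemma lo_hi: "1 \<le> x \<Longrightarrow> x < int n \<Longrightarrow> lo x < hi x \<and> (\<forall>y. H x y \<longleftrightarrow> y = lo x \<or> y = hi x)"
proof -
  assume "1 \<le> x" "x < int n"
  then have "\<exists>h. lo x < h \<and> (\<forall>y. H x y \<longleftrightarrow> y = lo x \<or> y = h)"
    unfolding lo_def by (rule someI_ex[OF strip])
  then show ?thesis unfolding hi_def by (rule someI_ex)
qed

lemma in_walk:
  assumes "1 \<le> x" "x < int n"
  shows "(x, lo x) \<in> set w" "(x + 1, lo x) \<in> set w" "(x, hi x) \<in> set w" "(x + 1, hi x) \<in> set w"
  using lo_hi[OF assms] H_in[of x "lo x"] H_in[of x "hi x"] by auto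

text \<open>The segment in column \<open>x\<close> cannot lead from the lower path to the upper one, as it
  would then pass through the other horizontal edge and create a vertex with three edges.\<close>

lemma one_step:
  assumes x: "2 \<le> x" "x < int n"
  shows "lo (x - 1) = lo x \<and> hi (x - 1) \<noteq> hi x \<and> (\<forall>y. V x y \<longleftrightarrow> min (hi (x - 1)) (hi x) \<le> y \<and> y < max (hi (x - 1)) (hi x)) \<or>
    hi (x - 1) = hi x \<and> lo (x - 1) \<noteq> lo x \<and> (\<forall>y. V x y \<longleftrightarrow> min (lo (x - 1)) (lo x) \<le> y \<and> y < max (lo (x - 1)) (lo x))"
proof -
  have x': "1 \<le> x" "1 \<le> x - 1" "x - 1 < int n" "x \<in> {1..int n}" using x by auto
  note R = lo_hi[OF x'(1) x(2), THEN conjunct1] and R' = lo_hi[OF x'(2,3), THEN conjunct1]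
  note Hx = lo_hi[OF x'(1) x(2), THEN conjunct2, rule_format] and Hx' = lo_hi[OF x'(2,3), THEN conjunct2, rule_format]
  obtain b t where bt: "b < t" "\<And>y. V x y \<longleftrightarrow> b \<le> y \<and> y < t"
      "\<And>y. (H x y \<noteq> H (x - 1) y) \<longleftrightarrow> y = b \<or> y = t" using column_segment[OF x'(4)] by auto
  have eq: "((y = lo x \<or> y = hi x) \<noteq> (y = lo (x - 1) \<or> y = hi (x - 1))) \<longleftrightarrow> y = b \<or> y = t" for y
    using bt(3)[of y] unfolding Hx Hx' .
  have straight: "\<not> (b \<le> y \<and> y \<le> t)" if "H x y" "H (x - 1) y" for y
  proof
    assume y: "b \<le> y \<and> y \<le> t"
    have "y \<noteq> b" "y \<noteq> t" using bt(3)[of y] that by auto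
    then have "V x y" using bt(2) y by auto
    then show False using degree[of x y] H_in[OF that(1)] that by blast
  qed
  have "lo (x - 1) = lo x \<or> lo (x - 1) = hi x \<or> hi (x - 1) = lo x \<or> hi (x - 1) = hi x"
  proof (rule ccontr)
    assume "\<not> ?thesis"
    then have "lo (x - 1) = b \<or> lo (x - 1) = t" "hi (x - 1) = b \<or> hi (x - 1) = t" "lo x = b \<or> lo x = t" "lo (x - 1) \<noteq> lo x" "hi (x - 1) \<noteq> lo x"
      using eq[of "lo (x - 1)"] eq[of "hi (x - 1)"] eq[of "lo x"] by auto
    then show False using R' by auto
  qed
  moreover have "\<not> (lo (x - 1) = lo x \<and> hi (x - 1) = hi x)" using eq[of b] by auto
  ultimately consider "lo (x - 1) = lo x" "hi (x - 1) \<noteq> hi x" | "hi (x - 1) = hi x" "lo (x - 1) \<noteq> lo x"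
    | "lo (x - 1) = hi x" | "hi (x - 1) = lo x" by blast
  then show ?thesis
  proof cases
    case 1
    have "hi (x - 1) = b \<or> hi (x - 1) = t" "hi x = b \<or> hi x = t"
      using eq[of "hi x"] eq[of "hi (x - 1)"] R R' 1 by simp_all
    then have "b = min (hi (x - 1)) (hi x)" "t = max (hi (x - 1)) (hi x)" using bt(1) 1 by auto
    then show ?thesis using 1 bt(2) by simp
  next
    case 2
    have "lo (x - 1) = b \<or> lo (x - 1) = t" "lo x = b \<or> lo x = t"
      using eq[of "lo x"] eq[of "lo (x - 1)"] R R' 2 by simp_all
    then have "b = min (lo (x - 1)) (lo x)" "t = max (lo (x - 1)) (lo x)" using bt(1) 2 by auto
    then show ?thesis using 2 bt(2) by simp
  next
    case 3
    have "lo x = b \<or> lo x = t" "hi (x - 1) = b \<or> hi (x - 1) = t"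
      using eq[of "lo x"] eq[of "hi (x - 1)"] R R' 3 by simp_all
    then have "b \<le> hi x \<and> hi x \<le> t" using R R' 3 bt(1) by auto
    moreover have "H x (hi x)" "H (x - 1) (hi x)" unfolding Hx Hx' using 3 by simp_all
    ultimately show ?thesis using straight by blast
  next
    case 4
    have "lo (x - 1) = b \<or> lo (x - 1) = t" "hi x = b \<or> hi x = t"
      using eq[of "hi x"] eq[of "lo (x - 1)"] R R' 4 by simp_all
    then have "b \<le> lo x \<and> lo x \<le> t" using R R' 4 bt(1) by auto
    moreover have "H x (lo x)" "H (x - 1) (lo x)" unfolding Hx Hx' using 4 by simp_all
    ultimately show ?thesis using straight by blast
  qed
qed

lemma first_column: "V 1 y \<longleftrightarrow> lo 1 \<le> y \<and> y < hi 1"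
proof -
  have "1 \<in> {1..int n}" using n2 by simp
  then obtain b t where bt: "b < t" "\<And>y. V 1 y \<longleftrightarrow> b \<le> y \<and> y < t" "\<And>y. (H 1 y \<noteq> H (1 - 1) y) \<longleftrightarrow> y = b \<or> y = t"
    by (rule column_segment) (rule that)
  have "\<not> H 0 y" for y using H_in[of 0 y] in_square[of 0 y] by auto
  then have "y = lo 1 \<or> y = hi 1 \<longleftrightarrow> y = b \<or> y = t" for y using bt(3)[of y] lo_hi[of 1] n2 by auto
  from this[of b] this[of t] have "b = lo 1" "t = hi 1" using bt(1) lo_hi[of 1] n2 by auto
  then show ?thesis using bt(2) by simp
qed

lemma last_column: "V (int n) y \<longleftrightarrow> lo (int n - 1) \<le> y \<and> y < hi (int n - 1)"
proof -
  have "int n \<in> {1..int n}" using n2 by simp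
  then obtain b t where bt: "b < t" "\<And>y. V (int n) y \<longleftrightarrow> b \<le> y \<and> y < t"
    "\<And>y. (H (int n) y \<noteq> H (int n - 1) y) \<longleftrightarrow> y = b \<or> y = t"
    by (rule column_segment) (rule that)
  have "\<not> H (int n) y" for y using H_in[of "int n" y] in_square[of "int n + 1" y] by auto
  then have "y = lo (int n - 1) \<or> y = hi (int n - 1) \<longleftrightarrow> y = b \<or> y = t" for y
    using bt(3)[of y] lo_hi[of "int n - 1"] n2 by auto
  from this[of b] this[of t] have "b = lo (int n - 1)" "t = hi (int n - 1)" using bt(1) lo_hi[of "int n - 1"] n2 by auto
  then show ?thesis using bt(2) by simp
qed

definition D where "D = insert 1 {x\<in>{2..int n - 1}. lo (x - 1) \<noteq> lo x}"
definition \<sigma> where "\<sigma> x = (if x \<in> {1..int n} then if x \<in> D then lo x else hi (x - 1) else x)"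

lemma D: "1 \<in> D" "int n \<notin> D" "D \<subseteq> {1..int n}"
  using n2 by (auto simp: D_def)

lemma lo_U: "2 \<le> x \<Longrightarrow> x < int n \<Longrightarrow> x \<notin> D \<Longrightarrow> lo (x - 1) = lo x"
  by (auto simp: D_def)

lemma hi_D: "2 \<le> x \<Longrightarrow> x < int n \<Longrightarrow> x \<in> D \<Longrightarrow> hi (x - 1) = hi x"
  using one_step[of x] by (auto simp: D_def)

lemma lower_eq: "1 \<le> x \<Longrightarrow> x < int n \<Longrightarrow> lower D \<sigma> x = lo x"
proof -
  assume x: "1 \<le> x" "x < int n"
  obtain i where i: "i \<in> D" "1 \<le> i" "i \<le> x" "lower D \<sigma> x = \<sigma> i" "\<And>j. j \<in> D \<Longrightarrow> i < j \<Longrightarrow> x < j"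
    using x(1) by (rule lower_obtain[OF D(1), where \<sigma> = \<sigma>]) (rule that)
  have "k \<le> x \<longrightarrow> lo k = lo i" if "i \<le> k" for k
    using that
  proof (induction k rule: int_ge_induct)
    case (step k)
    show ?case
    proof
      assume k: "k + 1 \<le> x"
      then have "k + 1 \<notin> D" using i(5)[of "k + 1"] step by auto
      then show "lo (k + 1) = lo i" using lo_U[of "k + 1"] k step x i by auto
    qed
  qed simp
  from this[of x] i(3) have "lo x = lo i" by simp
  moreover have "\<sigma> i = lo i" using i(1-3) x by (simp add: \<sigma>_def)
  ultimately show ?thesis using i(4) by simp
qed

lemma upper_eq: "1 \<le> x \<Longrightarrow> x < int n \<Longrightarrow> upper n D \<sigma> x = hi x"
proof -
  assume x: "1 \<le> x" "x < int n"
  obtain i where i: "i \<notin> D" "x < i" "i \<le> int n" "upper n D \<sigma> x = \<sigma> i" "\<And>j. j \<notin> D \<Longrightarrow> x < j \<Longrightarrow> i \<le> j"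
    using upper_obtain[OF D(2) x(2), where \<sigma> = \<sigma>] by blast
  have "k < i \<longrightarrow> hi k = hi x" if "x \<le> k" for k
    using that
  proof (induction k rule: int_ge_induct)
    case (step k)
    show ?case
    proof
      assume k: "k + 1 < i"
      then have "k + 1 \<in> D" using i(5)[of "k + 1"] step by force
      then show "hi (k + 1) = hi x" using hi_D[of "k + 1"] k step x i by auto
    qed
  qed simp
  from this[of "i - 1"] i(2) have "hi (i - 1) = hi x" by simp
  moreover have "\<sigma> i = hi (i - 1)" using i(1-3) x by (simp add: \<sigma>_def)
  ultimately show ?thesis using i(4) by simp
qed

lemma \<sigma>_range: "x \<in> {1..int n} \<Longrightarrow> \<sigma> x \<in> {1..int n}"
proof -
  assume x: "x \<in> {1..int n}"
  show ?thesis
  proof (cases "x \<in> D")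
    case True
    then have "1 \<le> x" "x < int n" using x D by (auto simp: D_def)
    then show ?thesis using in_walk[of x] in_square[of x "lo x"] True by (auto simp: \<sigma>_def)
  next
    case False
    then have "x \<noteq> 1" using D by auto
    then have "1 \<le> x - 1" "x - 1 < int n" using x by auto
    then show ?thesis using in_walk[of "x - 1"] in_square[of "x - 1" "hi (x - 1)"] False x by (auto simp: \<sigma>_def)
  qed
qed

lemma \<sigma>_permutes: "\<sigma> permutes {1..int n}"
proof (rule bij_imp_permutes)
  have "\<sigma> ` {1..int n} = {1..int n}"
  proof
    show "\<sigma> ` {1..int n} \<subseteq> {1..int n}" using \<sigma>_range by blast
    show "{1..int n} \<subseteq> \<sigma> ` {1..int n}"
    proof
      fix y assume "y \<in> {1..int n}"
      then obtain x where x: "H x y" using row_edge by blast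
      then have x': "1 \<le> x" "x < int n" using H_in[OF x] in_square[of x y] in_square[of "x + 1" y] by auto
      then have "y = lower D \<sigma> x \<or> y = upper n D \<sigma> x" using lo_hi[OF x'] x lower_eq upper_eq by auto
      moreover obtain i where i: "1 \<le> i" "i \<le> x" "lower D \<sigma> x = \<sigma> i"
        using x'(1) by (rule lower_obtain[OF D(1), where \<sigma> = \<sigma>]) (rule that)
      moreover obtain j where j: "x < j" "j \<le> int n" "upper n D \<sigma> x = \<sigma> j"
        using upper_obtain[OF D(2) x'(2), where \<sigma> = \<sigma>] by blast
      moreover have "i \<in> {1..int n}" "j \<in> {1..int n}" using i j x' by auto
      ultimately show "y \<in> \<sigma> ` {1..int n}" by auto
    qed
  qed
  then show "bij_betw \<sigma> {1..int n} {1..int n}" by (simp add: bij_betw_def eq_card_imp_inj_on)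
qed (auto simp: \<sigma>_def)

text \<open>A descent of the lower path that follows an ascent would create an interior point: the vertex
  \<open>(j, lo j)\<close> has lower vertices on both sides, and the vertices of the upper path in
  the neighbouring strips are above it.\<close>

lemma is_shape: "(\<sigma>, D) \<in> shapes n"
  unfolding shapes_def mem_Collect_eq split
proof (intro conjI \<sigma>_permutes D)
  have inj: "\<sigma> i = \<sigma> j \<longleftrightarrow> i = j" for i j using permutes_inj[OF \<sigma>_permutes] by (simp add: inj_eq)
  have Dn: "1 \<le> i \<and> i < int n \<and> \<sigma> i = lo i" if "i \<in> D" for i
  proof -
    have "1 \<le> i" "i < int n" using that D n2 by (auto simp: D_def)
    then show ?thesis using that by (simp add: \<sigma>_def)
  qed
  have Un: "1 < i \<and> i \<le> int n \<and> \<sigma> i = hi (i - 1)" if "i \<in> {1..int n} - D" for i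
    using that D by (cases "i = 1") (auto simp: \<sigma>_def)
  show "\<forall>i\<in>D. \<forall>j\<in>D. \<forall>k\<in>D. i < j \<longrightarrow> j < k \<longrightarrow> \<sigma> i < \<sigma> j \<longrightarrow> \<sigma> j < \<sigma> k"
  proof (intro ballI impI, rule ccontr)
    fix i j k assume h: "i \<in> D" "j \<in> D" "k \<in> D" "i < j" "j < k" "\<sigma> i < \<sigma> j" "\<not> \<sigma> j < \<sigma> k"
    then have kj: "\<sigma> k < \<sigma> j" using inj[of j k] by linarith
    have i: "1 \<le> i" "i < int n" and j: "1 \<le> j" "j < int n" and k: "1 \<le> k" "k < int n" using Dn h by auto
    have j2: "2 \<le> j" "1 \<le> j - 1" "j - 1 < int n" using h i j by auto
    have e: "hi (j - 1) = hi j" using hi_D[OF j2(1) j(2) h(2)] .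
    show False
      using not_interior[of j "lo j" i "lo i" "j - 1" "hi (j - 1)" k "lo k" "j + 1" "hi j"]
        in_walk[OF i] in_walk[OF j] in_walk[OF k] in_walk[OF j2(2,3)] lo_hi[OF j] e h kj Dn[of i] Dn[of j] Dn[of k] by simp
  qed
  show "\<forall>i\<in>{1..int n} - D. \<forall>j\<in>{1..int n} - D. \<forall>k\<in>{1..int n} - D. i < j \<longrightarrow> j < k \<longrightarrow> \<sigma> j < \<sigma> i \<longrightarrow> \<sigma> k < \<sigma> j"
  proof (intro ballI impI, rule ccontr)
    fix i j k assume h: "i \<in> {1..int n} - D" "j \<in> {1..int n} - D" "k \<in> {1..int n} - D" "i < j" "j < k" "\<sigma> j < \<sigma> i" "\<not> \<sigma> k < \<sigma> j"
    then have kj: "\<sigma> j < \<sigma> k" using inj[of j k] by linarith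
    have i: "1 \<le> i - 1" "i - 1 < int n" and j': "1 \<le> j - 1" "j - 1 < int n" and k: "1 \<le> k - 1" "k - 1 < int n"
      using Un[of i] Un[of j] Un[of k] h by auto
    have j: "2 \<le> j" "j < int n" "1 \<le> j" using h j' Un[of k] by auto
    have e: "lo (j - 1) = lo j" using lo_U[OF j(1,2)] h by simp
    show False
      using not_interior[of j "hi (j - 1)" "j - 1" "lo (j - 1)" "i - 1" "hi (i - 1)" "j + 1" "lo j" k "hi (k - 1)"]
        in_walk[OF i] in_walk[OF j'] in_walk[OF k] in_walk[OF j(3,2)] lo_hi[OF j'] e h(4,5,6) kj Un[OF h(1)] Un[OF h(2)] Un[OF h(3)]
      by simp
  qed
  show "\<forall>x\<in>{1..int n - 1}. lower D \<sigma> x < upper n D \<sigma> x"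
    using lower_eq upper_eq lo_hi by simp
qed

text \<open>All edges of the walk of the shape are edges of \<open>w\<close>, and a closed walk on the edges
  of another one is the same up to starting point and orientation.\<close>

lemma same_walk: "cyclic_class w = cyclic_class (shape_walk n (\<sigma>, D))"
proof -
  interpret s: shape n \<sigma> D by unfold_locales (use is_shape n2 in auto)
  have e: "s.lo x = lo x" "s.hi x = hi x" if "1 \<le> x" "x < int n" for x
    using lower_eq[OF that] upper_eq[OF that] by simp_all
  have "\<forall>(p, q)\<in>links s.w. adj p q"
  proof (rule s.walk_links)
    show "adj (x, s.lo x) (x + 1, s.lo x) \<and> adj (x + 1, s.hi x) (x, s.hi x)" if "1 \<le> x" "x < int n" for x
      using e[OF that] lo_hi[OF that] adj_sym by (simp add: H_def)
    show "adj (x, y) (x, y + 1) \<and> adj (x, y + 1) (x, y)"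
      if "2 \<le> x" "x < int n" "min (s.lo (x - 1)) (s.lo x) \<le> y" "y < max (s.lo (x - 1)) (s.lo x)" for x y
      using one_step[OF that(1,2)] that e[of x] e[of "x - 1"] adj_sym by (auto simp: V_def)
    show "adj (x, y) (x, y + 1) \<and> adj (x, y + 1) (x, y)"
      if "2 \<le> x" "x < int n" "min (s.hi (x - 1)) (s.hi x) \<le> y" "y < max (s.hi (x - 1)) (s.hi x)" for x y
      using one_step[OF that(1,2)] that e[of x] e[of "x - 1"] adj_sym by (auto simp: V_def)
    show "adj (1, y) (1, y + 1) \<and> adj (1, y + 1) (1, y)" if "s.lo 1 \<le> y" "y < s.hi 1" for y
      using first_column[of y] that e[of 1] n2 adj_sym by (simp add: V_def)
    show "adj (int n, y) (int n, y + 1) \<and> adj (int n, y + 1) (int n, y)"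
      if "s.lo (int n - 1) \<le> y" "y < s.hi (int n - 1)" for y
      using last_column[of y] that e[of "int n - 1"] n2 adj_sym by (simp add: V_def)
  qed
  then have "links s.w \<subseteq> links w \<union> (links w)\<inverse>" by (auto simp: adj_def)
  then show ?thesis
    using closed_walk_unique[OF closed, of s.w] s.closed_walk by (simp add: closed_walk_iff)
qed

end

lemma (in shape) horizontal_links:
  "((x, y), (x + 1, y)) \<in> links w \<union> (links w)\<inverse> \<Longrightarrow> y = lo x \<or> y = hi x"
proof -
  define P where "P p q \<longleftrightarrow> (let (x, y) = p; (x', y') = q in
     x' = x + 1 \<and> (y = lo x \<or> y = hi x) \<or> x = x' + 1 \<and> (y' = lo x' \<or> y' = hi x') \<or> x = x')" for p q
  have "\<forall>(p, q)\<in>links w. P p q" by (rule walk_links) (auto simp: P_def)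
  moreover assume "((x, y), (x + 1, y)) \<in> links w \<union> (links w)\<inverse>"
  ultimately have "P (x, y) (x + 1, y) \<or> P (x + 1, y) (x, y)" by auto
  then show ?thesis by (auto simp: P_def)
qed

lemma convex_permutominoes_eq:
  assumes n: "2 \<le> n"
  shows "convex_permutominoes n = (\<lambda>s. cyclic_class (shape_walk n s)) ` shapes n"
proof
  show "convex_permutominoes n \<subseteq> (\<lambda>s. cyclic_class (shape_walk n s)) ` shapes n"
  proof
    fix P assume "P \<in> convex_permutominoes n"
    then obtain w where w: "P = cyclic_class w" "permutomino_walk n w" "no_interior_point (set w)"
      by (auto simp: convex_permutominoes_def)
    interpret convex_walk n w by unfold_locales (use w n in auto)
    show "P \<in> (\<lambda>s. cyclic_class (shape_walk n s)) ` shapes n" using w(1) same_walk is_shape by blast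
  qed
  show "(\<lambda>s. cyclic_class (shape_walk n s)) ` shapes n \<subseteq> convex_permutominoes n"
  proof clarify
    fix \<sigma> D assume "(\<sigma>, D) \<in> shapes n"
    then interpret shape n \<sigma> D using n by unfold_locales
    show "cyclic_class (shape_walk n (\<sigma>, D)) \<in> convex_permutominoes n" by (rule convex_permutomino)
  qed
qed

text \<open>The horizontal edges of the walk give back the heights of both paths. The down columns are those
  in which the lower path changes its height, and then the values of \<open>\<sigma>\<close> are
  heights as well.\<close>

lemma inj_shape_walk:
  assumes n: "2 \<le> n"
  shows "inj_on (\<lambda>s. cyclic_class (shape_walk n s)) (shapes n)"
proof (rule inj_onI, clarify)
  fix \<sigma> D \<tau> E assume s: "(\<sigma>, D) \<in> shapes n" and t: "(\<tau>, E) \<in> shapes n"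
    and eq: "cyclic_class (shape_walk n (\<sigma>, D)) = cyclic_class (shape_walk n (\<tau>, E))"
  interpret s: shape n \<sigma> D using s n by unfold_locales
  interpret t: shape n \<tau> E using t n by unfold_locales
  have "s.w \<in> cyclic_class t.w" using eq cyclic_class_self by metis
  then have links: "links s.w \<union> (links s.w)\<inverse> = links t.w \<union> (links t.w)\<inverse>"
    by (auto simp: cyclic_class_def links_rev)
  have same: "s.lo x = t.lo x \<and> s.hi x = t.hi x" if x: "1 \<le> x" "x < int n" for x
  proof -
    interpret c: convex_walk n s.w by unfold_locales (use s.permutomino s.no_interior n in auto)
    have "y = s.lo x \<or> y = s.hi x" "y = t.lo x \<or> y = t.hi x" if "c.H x y" for y
      using s.horizontal_links[of x y] t.horizontal_links[of x y] links that by (auto simp: c.H_def c.adj_def)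
    from this[of "c.lo x"] this[of "c.hi x"] c.lo_hi[OF x] s.lo_hi[OF x] t.lo_hi[OF x] show ?thesis by auto
  qed
  have DE: "x \<in> D \<longleftrightarrow> x \<in> E" for x
  proof -
    consider "x < 1 \<or> x > int n" | "x = 1" | "x = int n" | "2 \<le> x" "x < int n" by linarith
    then show ?thesis
    proof cases
      case 1
      then show ?thesis using s.D(1) t.D(1) by auto
    next
      case 4
      then show ?thesis using s.lo_eq_iff[OF 4(1)] t.lo_eq_iff[OF 4(1)] same[of x] same[of "x - 1"] by auto
    qed (use s.D t.D in auto)
  qed
  then have D: "D = E" by blast
  have "\<sigma> x = \<tau> x" for x
  proof -
    have "x \<notin> {1..int n} \<or> x \<in> D \<and> 1 \<le> x \<and> x < int n \<or> x \<notin> D \<and> 2 \<le> x \<and> x \<le> int n"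
      using s.D by (cases "x = int n"; cases "x = 1") auto
    then consider "x \<notin> {1..int n}" | "x \<in> D" "1 \<le> x" "x < int n" | "x \<notin> D" "2 \<le> x" "x \<le> int n"
      by blast
    then show ?thesis
    proof cases
      case 1
      then show ?thesis using s.perm t.perm by (simp add: permutes_def)
    next
      case 2
      then show ?thesis using s.lo_D t.lo_D D same[of x] by auto
    next
      case 3
      then show ?thesis using s.hi_D[of x] t.hi_D[of x] D same[of "x - 1"] by auto
    qed
  qed
  then show "\<sigma> = \<tau> \<and> D = E" using D by blast
qed

section \<open>Programs that draw, decode and check codes\<close>

text \<open>Weakest preconditions of programs without loops and random choices, which make up the bodies of
  the loops below and are evaluated by simplification.\<close>

primrec wp :: "int \<Rightarrow> com \<Rightarrow> (state \<Rightarrow> bool) \<Rightarrow> state \<Rightarrow> bool" where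
  "wp W Skip Q s = Q (tick s)"
| "wp W (Assign x e) Q s = (\<bar>aval s e\<bar> \<le> W \<and> Q (tick (set_var x (aval s e) s)))"
| "wp W (Store a i e) Q s = (\<bar>aval s i\<bar> \<le> W \<and> \<bar>aval s e\<bar> \<le> W \<and> Q (tick (set_cell a (aval s i) (aval s e) s)))"
| "wp W (Random x e) Q s = False"
| "wp W (Seq c d) Q s = wp W c (wp W d Q) s"
| "wp W (If b c d) Q s = (if bval s b then wp W c Q (tick s) else wp W d Q (tick s))"
| "wp W (While b c) Q s = False"

lemma wp_ok: "wp W c Q s \<Longrightarrow> ok W c Q s"
proof (induction c arbitrary: Q s)
  case (Seq c d)
  then have "ok W c (wp W d Q) s" by simp
  then show ?case using Seq.IH(2) by (intro ok_SeqI) (rule ok_mono)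
qed (auto split: if_splits)

lemma ok_Assign_Seq:
  "\<bar>aval s e\<bar> \<le> W \<Longrightarrow> ok W d Q (tick (set_var x (aval s e) s)) \<Longrightarrow> ok W (Seq (Assign x e) d) Q s"
  by (intro ok_SeqI) simp

abbreviation seq (infixr \<open>;;\<close> 60) where "c ;; d \<equiv> Seq c d"

text \<open>Draws a code: \<open>X\<close> and \<open>Y\<close> hold the indicator functions of
  \<open>D\<close> and \<open>L\<close>.\<close>

definition fill :: com where
  "fill =
     Assign ''i'' (N 0) ;;
     While (Less (V ''i'') (V ''n''))
      (Assign ''i'' (Plus (V ''i'') (N 1)) ;;
       Random ''x'' (N 2) ;; Store ''X'' (V ''i'') (V ''x'') ;;
       Random ''y'' (N 2) ;; Store ''Y'' (V ''i'') (V ''y'')) ;;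
     Random ''a'' (V ''n'') ;; Assign ''a'' (Plus (V ''a'') (N 1))"

definition holds :: "nat \<Rightarrow> int set \<times> int set \<times> int \<Rightarrow> state \<Rightarrow> bool" where
  "holds n = (\<lambda>(D, L, a) s. vars s ''n'' = int n \<and> vars s ''a'' = a \<and> vars s ''done'' = 0 \<and>
     (\<forall>i\<in>{1..int n}. arrays s ''X'' i = of_bool (i \<in> D) \<and> arrays s ''Y'' i = of_bool (i \<in> L)))"

text \<open>The sets of one column more are the sets so far, with or without the new column.\<close>

lemma bij_add_bits:
  fixes x :: int
  defines "f \<equiv> \<lambda>(S, v). if v = (1::int) then insert x S else S"
  assumes "x \<notin> A"
  shows "bij_betw (\<lambda>((D, L), u, v). (f (D, u), f (L, v))) ((Pow A \<times> Pow A) \<times> ({0..<2} \<times> {0..<2}))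
    (Pow (insert x A) \<times> Pow (insert x A))"
proof -
  have B: "{0..<2} = {0, 1::int}" by auto
  show ?thesis
    by (rule bij_betw_byWitness[where f' = "\<lambda>(D, L). ((D - {x}, L - {x}), (of_bool (x \<in> D), of_bool (x \<in> L)))"])
       (use assms(2) in \<open>auto simp: f_def B\<close>)
qed

lemma fill_draws:
  assumes n: "vars s ''n'' = int n" and d: "vars s ''done'' = 0" and n2: "2 \<le> n" and W: "int n \<le> W"
  shows "draws W fill (codes n) (\<lambda>c t. holds n c t \<and> clock t \<le> clock s + 6 * n + 4) s"
proof -
  define F where "F k = (\<lambda>(D, L) (u, v). (if u = (1::int) then insert (int k + 1) D else D, if v = (1::int) then insert (int k + 1) L else L))"
    for k :: nat
  define A where "A k = Pow {1..int k} \<times> Pow {1..int k}" for k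
  define B where "B = {0..<2::int} \<times> {0..<2::int}"
  define I where "I k = (\<lambda>(D, L) (t::state). vars t ''n'' = int n \<and> vars t ''done'' = 0 \<and> vars t ''i'' = int k \<and>
     (\<forall>i\<in>{1..int k}. arrays t ''X'' i = of_bool (i \<in> D) \<and> arrays t ''Y'' i = of_bool (i \<in> L)) \<and>
     clock t \<le> clock s + 2 + 6 * k)" for k :: nat
  let ?w = "While (Less (V ''i'') (V ''n''))
      (Assign ''i'' (Plus (V ''i'') (N 1)) ;;
       Random ''x'' (N 2) ;; Store ''X'' (V ''i'') (V ''x'') ;;
       Random ''y'' (N 2) ;; Store ''Y'' (V ''i'') (V ''y''))"
  have "draws W ?w (A n) (I n) (tick (set_var ''i'' 0 s))"
  proof (rule draws_While[where A = A and B = B and f = F and ?a0.0 = "({}, {})"])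
    show "finite (A k)" for k by (simp add: A_def)
    show "finite B" by (simp add: B_def)
    show "A 0 = {({}, {})}" by (simp add: A_def)
    show "I 0 ({}, {}) (tick (tick (set_var ''i'' 0 s)))" using n d by (simp add: I_def)
    show "bij_betw (\<lambda>(a, v). F k a v) (A k \<times> B) (A (Suc k))" for k
    proof -
      have "insert (int k + 1) {1..int k} = {1..int (Suc k)}" by auto
      moreover have "(\<lambda>(a, v). F k a v) = (\<lambda>((D, L), u, v). (if u = 1 then insert (int k + 1) D else D, if v = 1 then insert (int k + 1) L else L))"
        by (auto simp: F_def fun_eq_iff)
      ultimately show ?thesis using bij_add_bits[of "int k + 1" "{1..int k}"] by (simp add: A_def B_def)
    qed
    show "\<not> bval t (Less (V ''i'') (V ''n''))" if "I n a t" for a t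
      using that by (auto simp: I_def)
    fix k a t assume k: "k < n" and a: "a \<in> A k" and I: "I k a t"
    obtain D L where DL: "a = (D, L)" by (cases a)
    from a DL have sub: "D \<subseteq> {1..int k}" "L \<subseteq> {1..int k}" by (auto simp: A_def)
    define P where "P = (\<lambda>v t'. I (Suc k) (F k a v) (tick t'))"
    have "draws W (Random ''x'' (N 2) ;; Store ''X'' (V ''i'') (V ''x'') ;;
       Random ''y'' (N 2) ;; Store ''Y'' (V ''i'') (V ''y'')) B P (tick (set_var ''i'' (int k + 1) t))"
    proof (rule draws_Seq[where A = "{0..<2}" and B = "{0..<2}" and f = Pair and
          P = "\<lambda>u t'. t' = tick (set_var ''x'' u (tick (set_var ''i'' (int k + 1) t)))"])
      show "draws W (Random ''x'' (N 2)) {0..<2} (\<lambda>u t'. t' = tick (set_var ''x'' u (tick (set_var ''i'' (int k + 1) t))))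
        (tick (set_var ''i'' (int k + 1) t))"
        using draws_Random[of "tick (set_var ''i'' (int k + 1) t)" "N 2" W] n2 W by simp
      show "bij_betw (\<lambda>(a, b). (a, b)) ({0..<2} \<times> {0..<2}) B" by (simp add: B_def bij_betw_def)
      fix u :: int and t1 assume u: "u \<in> {0..<2}" and t1: "t1 = tick (set_var ''x'' u (tick (set_var ''i'' (int k + 1) t)))"
      show "draws W (Store ''X'' (V ''i'') (V ''x'') ;; Random ''y'' (N 2) ;; Store ''Y'' (V ''i'') (V ''y''))
         {0..<2} (\<lambda>v. P (u, v)) t1"
      proof (rule ok_draws, rule wp_ok)
        define t2 where "t2 = tick (set_cell ''X'' (int k + 1) u t1)"
        have "draws W (Random ''y'' (N 2) ;; Store ''Y'' (V ''i'') (V ''y'')) {0..<2} (\<lambda>v. P (u, v)) t2"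
        proof (rule draws_ok[where P = "\<lambda>v t'. t' = tick (set_var ''y'' v t2)"])
          show "draws W (Random ''y'' (N 2)) {0..<2} (\<lambda>v t'. t' = tick (set_var ''y'' v t2)) t2"
            using draws_Random[of t2 "N 2" W] n2 W by simp
          fix v :: int and t3 assume v: "v \<in> {0..<2}" and t3: "t3 = tick (set_var ''y'' v t2)"
          have "u = 0 \<or> u = 1" "v = 0 \<or> v = 1" using u v by auto
          moreover have "int k + 1 \<notin> D" "int k + 1 \<notin> L" using sub by auto
          ultimately show "ok W (Store ''Y'' (V ''i'') (V ''y'')) (P (u, v)) t3"
            using I k W n2 by (intro wp_ok) (auto simp: P_def t3 t2_def t1 I_def F_def DL)
        qed
        then show "wp W (Store ''X'' (V ''i'') (V ''x''))
           (draws W (Random ''y'' (N 2) ;; Store ''Y'' (V ''i'') (V ''y'')) {0..<2} (\<lambda>v. P (u, v))) t1"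
          using u k W n2 by (simp add: t1 t2_def)
      qed
    qed simp_all
    then have "draws W (Assign ''i'' (Plus (V ''i'') (N 1)) ;; Random ''x'' (N 2) ;; Store ''X'' (V ''i'') (V ''x'') ;;
       Random ''y'' (N 2) ;; Store ''Y'' (V ''i'') (V ''y'')) B P t"
      using I k W by (intro ok_draws wp_ok) (simp add: I_def DL)
    moreover have "bval t (Less (V ''i'') (V ''n''))" using I k by (simp add: I_def DL)
    ultimately show "bval t (Less (V ''i'') (V ''n'')) \<and>
       draws W (Assign ''i'' (Plus (V ''i'') (N 1)) ;; Random ''x'' (N 2) ;; Store ''X'' (V ''i'') (V ''x'') ;;
       Random ''y'' (N 2) ;; Store ''Y'' (V ''i'') (V ''y'')) B (\<lambda>v t'. I (Suc k) (F k a v) (tick t')) t"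
      by (simp add: P_def)
  qed
  moreover have "draws W (Random ''a'' (V ''n'') ;; Assign ''a'' (Plus (V ''a'') (N 1))) {0..<int n}
      (\<lambda>v t. holds n (case p of (D, L) \<Rightarrow> (D, L, v + 1)) t \<and> clock t \<le> clock s + 6 * n + 4) t"
    if I: "I n p t" for p t
  proof (rule draws_ok[where P = "\<lambda>v t'. t' = tick (set_var ''a'' v t)"])
    have "vars t ''n'' = int n" using I by (auto simp: I_def)
    then show "draws W (Random ''a'' (V ''n'')) {0..<int n} (\<lambda>v t'. t' = tick (set_var ''a'' v t)) t"
      using draws_Random[of t "V ''n''" W] n2 W by simp
    fix v t' assume "v \<in> {0..<int n}" "t' = tick (set_var ''a'' v t)"
    then show "ok W (Assign ''a'' (Plus (V ''a'') (N 1)))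
       (\<lambda>t. holds n (case p of (D, L) \<Rightarrow> (D, L, v + 1)) t \<and> clock t \<le> clock s + 6 * n + 4) t'"
      using I W by (intro wp_ok) (auto simp: holds_def I_def split: prod.splits)
  qed
  moreover have "bij_betw (\<lambda>(p, v). case p of (D, L) \<Rightarrow> (D, L, v + 1)) (A n \<times> {0..<int n}) (codes n)"
    by (rule bij_betw_byWitness[where f' = "\<lambda>(D, L, a). ((D, L), a - 1)"]) (auto simp: A_def codes_def)
  ultimately have "draws W (?w ;; Random ''a'' (V ''n'') ;; Assign ''a'' (Plus (V ''a'') (N 1))) (codes n)
     (\<lambda>c t. holds n c t \<and> clock t \<le> clock s + 6 * n + 4) (tick (set_var ''i'' 0 s))"
    by (intro draws_Seq[where A = "A n" and B = "{0..<int n}" and P = "I n" and f = "\<lambda>p v. case p of (D, L) \<Rightarrow> (D, L, v + 1)"])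
       (auto simp: A_def)
  then show ?thesis unfolding fill_def using W n2 by (intro ok_draws wp_ok) simp
qed

text \<open>Tabulates the left rows in \<open>P\<close> and the right rows in \<open>Q\<close> by their ranks.
  The totals \<open>d\<close> and \<open>l\<close> are needed to test \<open>in_range\<close>.\<close>

definition rows :: com where
  "rows =
     Assign ''i'' (N 0) ;; Assign ''l'' (N 0) ;; Assign ''d'' (N 0) ;;
     While (Less (V ''i'') (V ''n''))
      (Assign ''i'' (Plus (V ''i'') (N 1)) ;;
       Assign ''d'' (Plus (V ''d'') (Read ''X'' (V ''i''))) ;;
       If (Equal (Read ''Y'' (V ''i'')) (N 1))
        (Assign ''l'' (Plus (V ''l'') (N 1)) ;; Store ''P'' (V ''l'') (V ''i''))
        (Store ''Q'' (Minus (V ''i'') (V ''l'')) (V ''i'')))"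

lemma rows_ok:
  assumes s: "holds n (D, L, a) s" and W: "int n \<le> W"
  shows "ok W rows (\<lambda>t. holds n (D, L, a) t \<and> vars t ''l'' = rk L n \<and> vars t ''d'' = rk D n \<and>
     (\<forall>j\<in>{1..int n}. (j \<in> L \<longrightarrow> arrays t ''P'' (rk L j) = j) \<and> (j \<notin> L \<longrightarrow> arrays t ''Q'' (j - rk L j) = j)) \<and>
     clock t \<le> clock s + 6 * n + 4) s"
proof -
  define I where "I t \<longleftrightarrow> holds n (D, L, a) t \<and> 0 \<le> vars t ''i'' \<and> vars t ''i'' \<le> int n \<and>
     vars t ''l'' = rk L (vars t ''i'') \<and> vars t ''d'' = rk D (vars t ''i'') \<and>
     (\<forall>j\<in>{1..vars t ''i''}. (j \<in> L \<longrightarrow> arrays t ''P'' (rk L j) = j) \<and> (j \<notin> L \<longrightarrow> arrays t ''Q'' (j - rk L j) = j)) \<and>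
     int (clock t) \<le> int (clock s) + 4 + 6 * vars t ''i''" for t
  let ?b = "Less (V ''i'') (V ''n'')"
  let ?c = "Assign ''i'' (Plus (V ''i'') (N 1)) ;;
       Assign ''d'' (Plus (V ''d'') (Read ''X'' (V ''i''))) ;;
       If (Equal (Read ''Y'' (V ''i'')) (N 1))
        (Assign ''l'' (Plus (V ''l'') (N 1)) ;; Store ''P'' (V ''l'') (V ''i''))
        (Store ''Q'' (Minus (V ''i'') (V ''l'')) (V ''i''))"
  have "ok W (While ?b ?c) (\<lambda>t. I t \<and> \<not> bval t ?b) (tick (set_var ''d'' 0 (tick (set_var ''l'' 0 (tick (set_var ''i'' 0 s))))))"
  proof (rule ok_While[where I = I and m = "\<lambda>t. nat (int n - vars t ''i'')"])
    show "I (tick (tick (set_var ''d'' 0 (tick (set_var ''l'' 0 (tick (set_var ''i'' 0 s)))))))"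
      using s by (auto simp: I_def holds_def)
    fix t assume I: "I t" and b: "bval t ?b"
    define i where "i = vars t ''i''"
    have i: "0 \<le> i" "i < int n" "i + 1 \<in> {1..int n}" using I b by (auto simp: I_def holds_def i_def)
    have X: "arrays t ''X'' (i + 1) = of_bool (i + 1 \<in> D)" "arrays t ''Y'' (i + 1) = of_bool (i + 1 \<in> L)"
      using I i(3) by (auto simp: I_def holds_def)
    have r: "rk D (i + 1) = rk D i + of_bool (i + 1 \<in> D)" "rk L (i + 1) = rk L i + of_bool (i + 1 \<in> L)"
      using rk_Suc[OF i(1)] by auto
    have bd: "0 \<le> rk L i" "rk L i \<le> i" "0 \<le> rk D i" "rk D i \<le> i" using rk_le[of i] i by auto
    have P: "rk L j \<noteq> rk L i + 1" if "j \<in> {1..i}" "i + 1 \<in> L" for j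
      using rk_mono[of j i L] that by auto
    have Q: "j - rk L j \<noteq> i + 1 - rk L i" if "j \<in> {1..i}" "i + 1 \<notin> L" for j
      using rk_compl[of j "int n" L] rk_compl[of i "int n" L] rk_mono[of j i "{1..int n} - L"] that i by auto
    have v: "vars t ''i'' = i" "vars t ''n'' = int n" "vars t ''l'' = rk L i" "vars t ''d'' = rk D i" "vars t ''a'' = a"
      "vars t ''done'' = 0" "int (clock t) \<le> int (clock s) + 4 + 6 * i"
      and codes: "\<forall>i\<in>{1..int n}. arrays t ''X'' i = of_bool (i \<in> D) \<and> arrays t ''Y'' i = of_bool (i \<in> L)"
      and tab: "\<And>j. j \<in> {1..i} \<Longrightarrow> (j \<in> L \<longrightarrow> arrays t ''P'' (rk L j) = j) \<and> (j \<notin> L \<longrightarrow> arrays t ''Q'' (j - rk L j) = j)"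
      using I by (auto simp: I_def holds_def i_def)
    have upd: "j = i + 1 \<or> j \<in> {1..i}" if "j \<in> {1..i + 1}" for j using that by auto
    have newP: "\<forall>j\<in>{1..i + 1}. (j \<in> L \<longrightarrow> ((arrays t ''P'')(rk L i + 1 := i + 1)) (rk L j) = j) \<and> (j \<notin> L \<longrightarrow> arrays t ''Q'' (j - rk L j) = j)"
      if "i + 1 \<in> L"
    proof
      fix j assume "j \<in> {1..i + 1}"
      from upd[OF this] show "(j \<in> L \<longrightarrow> ((arrays t ''P'')(rk L i + 1 := i + 1)) (rk L j) = j) \<and> (j \<notin> L \<longrightarrow> arrays t ''Q'' (j - rk L j) = j)"
        using tab[of j] P[of j] r that by auto
    qed
    have newQ: "\<forall>j\<in>{1..i + 1}. (j \<in> L \<longrightarrow> arrays t ''P'' (rk L j) = j) \<and> (j \<notin> L \<longrightarrow> ((arrays t ''Q'')(i + 1 - rk L i := i + 1)) (j - rk L j) = j)"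
      if "i + 1 \<notin> L"
    proof
      fix j assume "j \<in> {1..i + 1}"
      from upd[OF this] show "(j \<in> L \<longrightarrow> arrays t ''P'' (rk L j) = j) \<and> (j \<notin> L \<longrightarrow> ((arrays t ''Q'')(i + 1 - rk L i := i + 1)) (j - rk L j) = j)"
        using tab[of j] Q[of j] r that by auto
    qed
    have "(of_bool (i + 1 \<in> D) :: int) \<le> 1" "(0::int) \<le> of_bool (i + 1 \<in> D)" by simp_all
    then have b1: "\<bar>rk D i + of_bool (i + 1 \<in> D)\<bar> \<le> W" using bd i(1,2) W by linarith
    have b2: "\<bar>i + 1\<bar> \<le> W" using i(1,2) W by linarith
    have b3: "\<bar>i + 1 - rk L i\<bar> \<le> W" using bd i(1,2) W by linarith
    have b4: "\<bar>rk L i + 1\<bar> \<le> W" using bd i(1,2) W by linarith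
    show "ok W ?c (\<lambda>t'. I (tick t') \<and> nat (int n - vars (tick t') ''i'') < nat (int n - vars t ''i'')) t"
    proof (rule wp_ok, cases "i + 1 \<in> L")
      case True
      then show "wp W ?c (\<lambda>t'. I (tick t') \<and> nat (int n - vars (tick t') ''i'') < nat (int n - vars t ''i'')) t"
        using b1 b2 b3 b4 newP[OF True] codes i v(7) by (simp add: I_def holds_def v(1-6) X r)
    next
      case False
      then show "wp W ?c (\<lambda>t'. I (tick t') \<and> nat (int n - vars (tick t') ''i'') < nat (int n - vars t ''i'')) t"
        using b1 b2 b3 b4 newQ[OF False] codes i v(7) by (simp add: I_def holds_def v(1-6) X r)
    qed
  qed auto
  then have "ok W (While ?b ?c) (\<lambda>t. holds n (D, L, a) t \<and> vars t ''l'' = rk L n \<and> vars t ''d'' = rk D n \<and>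
     (\<forall>j\<in>{1..int n}. (j \<in> L \<longrightarrow> arrays t ''P'' (rk L j) = j) \<and> (j \<notin> L \<longrightarrow> arrays t ''Q'' (j - rk L j) = j)) \<and>
     clock t \<le> clock s + 6 * n + 4) (tick (set_var ''d'' 0 (tick (set_var ''l'' 0 (tick (set_var ''i'' 0 s))))))"
  proof (rule ok_mono, goal_cases)
    case (1 t)
    then have "vars t ''i'' = int n" by (auto simp: I_def holds_def)
    then show ?case using 1 by (auto simp: I_def)
  qed
  then show ?thesis unfolding rows_def using W by (intro ok_Assign_Seq) simp_all
qed

text \<open>Solves the equations of \<open>decodes\<close> for the row of each column. For an up column
  \<open>i\<close>, with \<open>k\<close> the number of down columns so far, the row is left if
  \<open>a + (i - k)\<close> does not exceed the number of left rows.\<close>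

definition cols :: com where
  "cols =
     Assign ''i'' (N 0) ;; Assign ''k'' (N 0) ;;
     While (Less (V ''i'') (V ''n''))
      (Assign ''i'' (Plus (V ''i'') (N 1)) ;;
       If (Equal (Read ''X'' (V ''i'')) (N 1))
        (Assign ''k'' (Plus (V ''k'') (N 1)) ;;
         If (Less (V ''a'') (V ''k''))
          (Store ''out'' (V ''i'') (Read ''Q'' (Minus (V ''k'') (V ''a''))))
          (Store ''out'' (V ''i'') (Read ''P'' (Minus (Plus (V ''a'') (N 1)) (V ''k'')))))
        (If (Less (V ''l'') (Plus (V ''a'') (Minus (V ''i'') (V ''k''))))
          (Store ''out'' (V ''i'') (Read ''Q'' (Minus (Plus (V ''n'') (N 1)) (Plus (V ''a'') (Minus (V ''i'') (V ''k''))))))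
          (Store ''out'' (V ''i'') (Read ''P'' (Plus (V ''a'') (Minus (V ''i'') (V ''k'')))))))"

lemma cols_ok:
  assumes s: "holds n (D, L, a) s" and l: "vars s ''l'' = rk L n"
    and tab: "\<forall>j\<in>{1..int n}. (j \<in> L \<longrightarrow> arrays s ''P'' (rk L j) = j) \<and> (j \<notin> L \<longrightarrow> arrays s ''Q'' (j - rk L j) = j)"
    and dec: "decodes n (D, L, a) \<sigma>" and W: "int n \<le> W"
  shows "ok W cols (\<lambda>t. holds n (D, L, a) t \<and> (\<forall>i\<in>{1..int n}. arrays t ''out'' i = \<sigma> i) \<and>
     clock t \<le> clock s + 6 * n + 3) s"
proof -
  define I where "I t \<longleftrightarrow> holds n (D, L, a) t \<and> 0 \<le> vars t ''i'' \<and> vars t ''i'' \<le> int n \<and>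
     vars t ''l'' = rk L n \<and> vars t ''k'' = rk D (vars t ''i'') \<and>
     arrays t ''P'' = arrays s ''P'' \<and> arrays t ''Q'' = arrays s ''Q'' \<and>
     (\<forall>j\<in>{1..vars t ''i''}. arrays t ''out'' j = \<sigma> j) \<and>
     int (clock t) \<le> int (clock s) + 3 + 6 * vars t ''i''" for t
  let ?b = "Less (V ''i'') (V ''n'')"
  let ?c = "Assign ''i'' (Plus (V ''i'') (N 1)) ;;
       If (Equal (Read ''X'' (V ''i'')) (N 1))
        (Assign ''k'' (Plus (V ''k'') (N 1)) ;;
         If (Less (V ''a'') (V ''k''))
          (Store ''out'' (V ''i'') (Read ''Q'' (Minus (V ''k'') (V ''a''))))
          (Store ''out'' (V ''i'') (Read ''P'' (Minus (Plus (V ''a'') (N 1)) (V ''k'')))))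
        (If (Less (V ''l'') (Plus (V ''a'') (Minus (V ''i'') (V ''k''))))
          (Store ''out'' (V ''i'') (Read ''Q'' (Minus (Plus (V ''n'') (N 1)) (Plus (V ''a'') (Minus (V ''i'') (V ''k''))))))
          (Store ''out'' (V ''i'') (Read ''P'' (Plus (V ''a'') (Minus (V ''i'') (V ''k''))))))"
  have "ok W (While ?b ?c) (\<lambda>t. I t \<and> \<not> bval t ?b) (tick (set_var ''k'' 0 (tick (set_var ''i'' 0 s))))"
  proof (rule ok_While[where I = I and m = "\<lambda>t. nat (int n - vars t ''i'')"])
    show "I (tick (tick (set_var ''k'' 0 (tick (set_var ''i'' 0 s)))))"
      using s l by (auto simp: I_def holds_def)
    fix t assume I: "I t" and b: "bval t ?b"
    define i where "i = vars t ''i''"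
    have i: "0 \<le> i" "i < int n" "i + 1 \<in> {1..int n}" using I b by (auto simp: I_def holds_def i_def)
    have X: "arrays t ''X'' (i + 1) = of_bool (i + 1 \<in> D)"
      using I i(3) by (auto simp: I_def holds_def)
    have r: "rk D (i + 1) = rk D i + of_bool (i + 1 \<in> D)" using rk_Suc[OF i(1)] by auto
    have v: "vars t ''i'' = i" "vars t ''n'' = int n" "vars t ''l'' = rk L n" "vars t ''k'' = rk D i" "vars t ''a'' = a"
      "vars t ''done'' = 0" "arrays t ''P'' = arrays s ''P''" "arrays t ''Q'' = arrays s ''Q''"
      "int (clock t) \<le> int (clock s) + 3 + 6 * i"
      and codes: "\<forall>i\<in>{1..int n}. arrays t ''X'' i = of_bool (i \<in> D) \<and> arrays t ''Y'' i = of_bool (i \<in> L)"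
      and out: "\<forall>j\<in>{1..i}. arrays t ''out'' j = \<sigma> j"
      using I by (auto simp: I_def holds_def i_def)
    define j where "j = \<sigma> (i + 1)"
    have j: "j \<in> {1..int n}" using dec i(3) unfolding decodes_def j_def by blast
    note de = dec[unfolded decodes_def split, rule_format, OF i(3), THEN conjunct2, folded j_def]
    have cD: "rk ({1..int n} - D) (i + 1) = i + 1 - rk D (i + 1)" using i by (intro rk_compl) auto
    have cL: "rk ({1..int n} - L) j = j - rk L j" using j by (intro rk_compl) auto
    have Lj: "rk L j \<le> rk L n" using j by (intro rk_mono) auto
    have cL': "j - rk L j \<le> int n - rk L n"
      using rk_mono[of j "int n" "{1..int n} - L"] rk_compl[of "int n" "int n" L] j cL by auto
    have p: "j \<in> L \<Longrightarrow> 1 \<le> rk L j" using j by (intro rk_pos) auto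
    have p': "j \<notin> L \<Longrightarrow> 1 \<le> j - rk L j" using rk_pos[of j "{1..int n} - L"] j cL by auto
    have T: "j \<in> L \<Longrightarrow> arrays s ''P'' (rk L j) = j" "j \<notin> L \<Longrightarrow> arrays s ''Q'' (j - rk L j) = j" using tab j by auto
    have D1: "(if a < rk D i + 1 then arrays s ''Q'' (rk D i + 1 - a) else arrays s ''P'' (a + 1 - (rk D i + 1))) = j"
      if "i + 1 \<in> D"
    proof (cases "j \<in> L")
      case True
      then have "rk D i + 1 + rk L j = a + 1" using de that r by simp
      then have "\<not> a < rk D i + 1" "a + 1 - (rk D i + 1) = rk L j" using p[OF True] by auto
      then show ?thesis using T(1)[OF True] by simp
    next
      case False
      then have "rk D i + 1 = a + (j - rk L j)" using de that r cL by simp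
      then have "a < rk D i + 1" "rk D i + 1 - a = j - rk L j" using p'[OF False] by auto
      then show ?thesis using T(2)[OF False] by simp
    qed
    have D0: "(if rk L n < a + (i + 1 - rk D i) then arrays s ''Q'' (int n + 1 - (a + (i + 1 - rk D i)))
        else arrays s ''P'' (a + (i + 1 - rk D i))) = j" if "i + 1 \<notin> D"
    proof (cases "j \<in> L")
      case True
      then have "rk L j = a + (i + 1 - rk D i)" using de that r cD by simp
      then show ?thesis using T(1)[OF True] Lj by simp
    next
      case False
      then have e: "(i + 1 - rk D i) + (j - rk L j) = int n + 1 - a" using de that r cD cL by simp
      then have "rk L n < a + (i + 1 - rk D i)" "int n + 1 - (a + (i + 1 - rk D i)) = j - rk L j"
        using p'[OF False] cL' by auto
      then show ?thesis using T(2)[OF False] by simp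
    qed
    have new: "\<forall>k\<in>{1..i + 1}. ((arrays t ''out'')(i + 1 := j)) k = \<sigma> k" using out by (auto simp: j_def)
    have b1: "\<bar>i + 1\<bar> \<le> W" using i(1,2) W by linarith
    have b2: "\<bar>rk D i + 1\<bar> \<le> W" using rk_le[OF i(1), of D] i(1,2) W rk_nonneg[of D i] by linarith
    have b3: "\<bar>j\<bar> \<le> W" using j W by simp
    show "ok W ?c (\<lambda>t'. I (tick t') \<and> nat (int n - vars (tick t') ''i'') < nat (int n - vars t ''i'')) t"
    proof (rule wp_ok, cases "i + 1 \<in> D")
      case True
      then show "wp W ?c (\<lambda>t'. I (tick t') \<and> nat (int n - vars (tick t') ''i'') < nat (int n - vars t ''i'')) t"
        using b1 b2 b3 new codes i v(9) D1[OF True]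
        by (cases "a < rk D i + 1") (simp_all add: I_def holds_def v(1-8) X r)
    next
      case False
      then show "wp W ?c (\<lambda>t'. I (tick t') \<and> nat (int n - vars (tick t') ''i'') < nat (int n - vars t ''i'')) t"
        using b1 b2 b3 new codes i v(9) D0[OF False]
        by (cases "rk L n < a + (i + 1 - rk D i)") (simp_all add: I_def holds_def v(1-8) X r)
    qed
  qed auto
  then have "ok W (While ?b ?c) (\<lambda>t. holds n (D, L, a) t \<and> (\<forall>i\<in>{1..int n}. arrays t ''out'' i = \<sigma> i) \<and>
     clock t \<le> clock s + 6 * n + 3) (tick (set_var ''k'' 0 (tick (set_var ''i'' 0 s))))"
  proof (rule ok_mono, goal_cases)
    case (1 t)
    then have "vars t ''i'' = int n" by (auto simp: I_def holds_def)
    then show ?case using 1 by (auto simp: I_def)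
  qed
  then show ?thesis unfolding cols_def using W by (intro ok_Assign_Seq) simp_all
qed

definition decode :: "com \<Rightarrow> com" where
  "decode c = rows ;;
     If (And (Not (Less (V ''d'') (V ''a''))) (And (Not (Less (V ''l'') (V ''a'')))
         (Not (Less (Plus (V ''n'') (V ''a'')) (Plus (V ''d'') (V ''l''))))))
      (cols ;; c) Skip"

lemma decode_ok:
  assumes code: "(D, L, a) \<in> codes n" and s: "holds n (D, L, a) s" and W: "int n \<le> W"
    and c: "\<And>\<sigma> t. in_range n (D, L, a) \<Longrightarrow> decodes n (D, L, a) \<sigma> \<Longrightarrow> holds n (D, L, a) t \<Longrightarrow>
      (\<forall>i\<in>{1..int n}. arrays t ''out'' i = \<sigma> i) \<Longrightarrow> clock t \<le> clock s + 12 * n + 8 \<Longrightarrow> ok W c Q t"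
    and reject: "\<And>t. \<not> in_range n (D, L, a) \<Longrightarrow> holds n (D, L, a) t \<Longrightarrow> clock t \<le> clock s + 6 * n + 6 \<Longrightarrow> Q t"
  shows "ok W (decode c) Q s"
  unfolding decode_def
proof (intro ok_SeqI ok_mono[OF rows_ok[OF s W]], goal_cases)
  case (1 t)
  have rng: "bval t (And (Not (Less (V ''d'') (V ''a''))) (And (Not (Less (V ''l'') (V ''a'')))
         (Not (Less (Plus (V ''n'') (V ''a'')) (Plus (V ''d'') (V ''l'')))))) \<longleftrightarrow> in_range n (D, L, a)"
    using 1 code by (auto simp: in_range_def codes_def holds_def)
  show ?case
  proof (cases "in_range n (D, L, a)")
    case True
    then obtain \<sigma> where dec: "decodes n (D, L, a) \<sigma>" using decodes_exists by fastforce
    have "holds n (D, L, a) (tick t)" "vars (tick t) ''l'' = rk L n"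
      "\<forall>j\<in>{1..int n}. (j \<in> L \<longrightarrow> arrays (tick t) ''P'' (rk L j) = j) \<and> (j \<notin> L \<longrightarrow> arrays (tick t) ''Q'' (j - rk L j) = j)"
      using 1 by (auto simp: holds_def)
    note co = cols_ok[OF this dec W]
    have "ok W (cols ;; c) Q (tick t)"
      by (intro ok_SeqI ok_mono[OF co] c[OF True dec]) (use 1 in auto)
    then show ?thesis using True rng by simp
  next
    case False
    then show ?thesis using rng 1 by (auto intro!: reject simp: holds_def)
  qed
qed

abbreviation either :: "bexp \<Rightarrow> bexp \<Rightarrow> bexp" where
  "either b c \<equiv> Not (And (Not b) (Not c))"

definition match :: bexp where
  "match = (let A = Equal (Read ''A'' (V ''i'')) (N 1); B = Equal (Read ''B'' (V ''i'')) (N 1);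
      u = Equal (V ''u'') (N 1); v = Equal (V ''v'') (N 1);
      X = Equal (Read ''X'' (V ''i'')) (N 1); Y = Equal (Read ''Y'' (Read ''out'' (V ''i''))) (N 1) in
    either (And A (And X Y)) (And (Not A)
      (either (And u (And (Not X) (Not Y))) (And (Not u)
        (either (And B (And (Not X) Y)) (And (Not B) (And v (And X (Not Y)))))))))"

text \<open>In the scan from left to right \<open>lo\<close> and \<open>hi\<close> are the running minimum and
  maximum, and the flags \<open>A\<close> and \<open>B\<close> mark the bottom-left and upper-left
  records. The scan from right to left finds the other two types of record, in \<open>u\<close>
  and \<open>v\<close>, and compares the label of each point with the one of highest priority.\<close>

definition check_square :: com where
  "check_square =
     Assign ''i'' (N 0) ;; Assign ''lo'' (Plus (V ''n'') (N 1)) ;; Assign ''hi'' (N 0) ;;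
     While (Less (V ''i'') (V ''n''))
      (Assign ''i'' (Plus (V ''i'') (N 1)) ;;
       If (Less (Read ''out'' (V ''i'')) (V ''lo''))
        (Assign ''lo'' (Read ''out'' (V ''i'')) ;; Store ''A'' (V ''i'') (N 1)) (Store ''A'' (V ''i'') (N 0)) ;;
       If (Less (V ''hi'') (Read ''out'' (V ''i'')))
        (Assign ''hi'' (Read ''out'' (V ''i'')) ;; Store ''B'' (V ''i'') (N 1)) (Store ''B'' (V ''i'') (N 0))) ;;
     Assign ''lo'' (Plus (V ''n'') (N 1)) ;; Assign ''hi'' (N 0) ;; Assign ''done'' (N 1) ;;
     While (Less (N 0) (V ''i''))
      (If (Less (V ''hi'') (Read ''out'' (V ''i'')))
        (Assign ''hi'' (Read ''out'' (V ''i'')) ;; Assign ''u'' (N 1)) (Assign ''u'' (N 0)) ;;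
       If (Less (Read ''out'' (V ''i'')) (V ''lo''))
        (Assign ''lo'' (Read ''out'' (V ''i'')) ;; Assign ''v'' (N 1)) (Assign ''v'' (N 0)) ;;
       If match Skip (Assign ''done'' (N 0)) ;;
       Assign ''i'' (Minus (V ''i'') (N 1)))"

text \<open>The running minimum of \<open>\<sigma>\<close> over the columns in \<open>A\<close>, described by
  what it is compared with. This covers the initial value \<open>n + 1\<close> for the empty set
  of columns.\<close>

definition below :: "int \<Rightarrow> (int \<Rightarrow> int) \<Rightarrow> int set \<Rightarrow> int \<Rightarrow> bool" where
  "below n \<sigma> A lo \<longleftrightarrow> (\<forall>y\<in>{1..n}. y < lo \<longleftrightarrow> (\<forall>j\<in>A. y < \<sigma> j))"

definition above :: "int \<Rightarrow> (int \<Rightarrow> int) \<Rightarrow> int set \<Rightarrow> int \<Rightarrow> bool" where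
  "above n \<sigma> A hi \<longleftrightarrow> (\<forall>y\<in>{1..n}. hi < y \<longleftrightarrow> (\<forall>j\<in>A. \<sigma> j < y))"

lemma below_insert: "below n \<sigma> A lo \<Longrightarrow> below n \<sigma> (insert i A) (if \<sigma> i < lo then \<sigma> i else lo)"
  unfolding below_def by (auto split: if_splits)

lemma above_insert: "above n \<sigma> A hi \<Longrightarrow> above n \<sigma> (insert i A) (if hi < \<sigma> i then \<sigma> i else hi)"
  unfolding above_def by (auto split: if_splits)

lemma below_empty: "below n \<sigma> {} (n + 1)" and above_empty: "above n \<sigma> {} 0"
  by (auto simp: below_def above_def)

text \<open>The labels in the order in which the program decides them.\<close>

definition fits :: "int \<Rightarrow> int set \<Rightarrow> int set \<Rightarrow> (int \<Rightarrow> int) \<Rightarrow> int \<Rightarrow> bool" where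
  "fits n D L \<sigma> i \<longleftrightarrow> (if bl n \<sigma> i then i \<in> D \<and> \<sigma> i \<in> L else if ur n \<sigma> i then i \<notin> D \<and> \<sigma> i \<notin> L
     else if ul n \<sigma> i then i \<notin> D \<and> \<sigma> i \<in> L else br n \<sigma> i \<and> i \<in> D \<and> \<sigma> i \<notin> L)"

lemma square_ok_fits: "square_ok n D L \<sigma> \<longleftrightarrow> (\<forall>i\<in>{1..n}. fits n D L \<sigma> i)"
  unfolding square_ok_def fits_def down_def left_def by (intro ball_cong refl) auto

lemma records_scan:
  assumes inj: "inj_on \<sigma> {1..n}" and i: "i \<in> {1..n}" and rng: "\<sigma> i \<in> {1..n}"
  shows "below n \<sigma> {1..i - 1} lo \<Longrightarrow> \<sigma> i < lo \<longleftrightarrow> bl n \<sigma> i"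
    and "above n \<sigma> {1..i - 1} hi \<Longrightarrow> hi < \<sigma> i \<longleftrightarrow> ul n \<sigma> i"
    and "below n \<sigma> {i + 1..n} lo \<Longrightarrow> \<sigma> i < lo \<longleftrightarrow> br n \<sigma> i"
    and "above n \<sigma> {i + 1..n} hi \<Longrightarrow> hi < \<sigma> i \<longleftrightarrow> ur n \<sigma> i"
proof -
  have ne: "\<sigma> j \<noteq> \<sigma> i" if "j \<in> {1..n}" "j \<noteq> i" for j using inj i that by (auto simp: inj_on_eq_iff)
  have L: "(\<forall>j\<in>{1..i - 1}. P j) \<longleftrightarrow> (\<forall>j\<in>{1..n}. j < i \<longrightarrow> P j)" for P using i by auto
  have R: "(\<forall>j\<in>{i + 1..n}. P j) \<longleftrightarrow> (\<forall>j\<in>{1..n}. i < j \<longrightarrow> P j)" for P using i by auto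
  have le: "\<sigma> i < \<sigma> j \<longleftrightarrow> \<sigma> i \<le> \<sigma> j" "\<sigma> j < \<sigma> i \<longleftrightarrow> \<sigma> j \<le> \<sigma> i" if "j \<in> {1..n}" "j \<noteq> i" for j
    using ne[OF that] by auto
  show "below n \<sigma> {1..i - 1} lo \<Longrightarrow> \<sigma> i < lo \<longleftrightarrow> bl n \<sigma> i"
    unfolding below_def bl_def L using rng le by (metis less_irrefl)
  show "above n \<sigma> {1..i - 1} hi \<Longrightarrow> hi < \<sigma> i \<longleftrightarrow> ul n \<sigma> i"
    unfolding above_def ul_def L using rng le by (metis less_irrefl)
  show "below n \<sigma> {i + 1..n} lo \<Longrightarrow> \<sigma> i < lo \<longleftrightarrow> br n \<sigma> i"
    unfolding below_def br_def R using rng le by (metis less_irrefl)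
  show "above n \<sigma> {i + 1..n} hi \<Longrightarrow> hi < \<sigma> i \<longleftrightarrow> ur n \<sigma> i"
    unfolding above_def ur_def R using rng le by (metis less_irrefl)
qed

lemma check_square_ok:
  assumes s: "holds n (D, L, a) s" and out: "\<forall>i\<in>{1..int n}. arrays s ''out'' i = \<sigma> i"
    and inj: "inj_on \<sigma> {1..int n}" and rng: "\<forall>i\<in>{1..int n}. \<sigma> i \<in> {1..int n}" and W: "4 * int n + 4 \<le> W"
  shows "ok W check_square (\<lambda>t. vars t ''n'' = int n \<and> (vars t ''done'' = 0 \<longleftrightarrow> \<not> square_ok n D L \<sigma>) \<and>
     (\<forall>i\<in>{1..int n}. arrays t ''out'' i = \<sigma> i) \<and> clock t \<le> clock s + 18 * n + 8) s"
proof -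
  define K where "K t \<longleftrightarrow> vars t ''n'' = int n \<and>
     (\<forall>i\<in>{1..int n}. arrays t ''X'' i = of_bool (i \<in> D) \<and> arrays t ''Y'' i = of_bool (i \<in> L)) \<and>
     (\<forall>i\<in>{1..int n}. arrays t ''out'' i = \<sigma> i)" for t :: state
  define I where "I t \<longleftrightarrow> K t \<and> 0 \<le> vars t ''i'' \<and> vars t ''i'' \<le> int n \<and>
     below n \<sigma> {1..vars t ''i''} (vars t ''lo'') \<and> above n \<sigma> {1..vars t ''i''} (vars t ''hi'') \<and>
     (\<forall>j\<in>{1..vars t ''i''}. arrays t ''A'' j = of_bool (bl n \<sigma> j) \<and> arrays t ''B'' j = of_bool (ul n \<sigma> j)) \<and>
     int (clock t) \<le> int (clock s) + 4 + 8 * vars t ''i''" for t :: state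
  define J where "J t \<longleftrightarrow> K t \<and> 0 \<le> vars t ''i'' \<and> vars t ''i'' \<le> int n \<and>
     below n \<sigma> {vars t ''i'' + 1..int n} (vars t ''lo'') \<and> above n \<sigma> {vars t ''i'' + 1..int n} (vars t ''hi'') \<and>
     (\<forall>j\<in>{1..int n}. arrays t ''A'' j = of_bool (bl n \<sigma> j) \<and> arrays t ''B'' j = of_bool (ul n \<sigma> j)) \<and>
     (vars t ''done'' \<noteq> 0 \<longleftrightarrow> (\<forall>j\<in>{vars t ''i'' + 1..int n}. fits n D L \<sigma> j)) \<and>
     int (clock t) \<le> int (clock s) + 8 + 8 * int n + 10 * (int n - vars t ''i'')" for t :: state
  let ?b = "Less (V ''i'') (V ''n'')"
  let ?c = "Assign ''i'' (Plus (V ''i'') (N 1)) ;;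
       If (Less (Read ''out'' (V ''i'')) (V ''lo''))
        (Assign ''lo'' (Read ''out'' (V ''i'')) ;; Store ''A'' (V ''i'') (N 1)) (Store ''A'' (V ''i'') (N 0)) ;;
       If (Less (V ''hi'') (Read ''out'' (V ''i'')))
        (Assign ''hi'' (Read ''out'' (V ''i'')) ;; Store ''B'' (V ''i'') (N 1)) (Store ''B'' (V ''i'') (N 0))"
  let ?b' = "Less (N 0) (V ''i'')"
  let ?c' = "If (Less (V ''hi'') (Read ''out'' (V ''i'')))
        (Assign ''hi'' (Read ''out'' (V ''i'')) ;; Assign ''u'' (N 1)) (Assign ''u'' (N 0)) ;;
       If (Less (Read ''out'' (V ''i'')) (V ''lo''))
        (Assign ''lo'' (Read ''out'' (V ''i'')) ;; Assign ''v'' (N 1)) (Assign ''v'' (N 0)) ;;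
       If match Skip (Assign ''done'' (N 0)) ;;
       Assign ''i'' (Minus (V ''i'') (N 1))"
  have first: "ok W (While ?b ?c) (\<lambda>t. I t \<and> vars t ''i'' = int n)
     (tick (set_var ''hi'' 0 (tick (set_var ''lo'' (int n + 1) (tick (set_var ''i'' 0 s))))))"
  proof (rule ok_While[where I = I and m = "\<lambda>t. nat (int n - vars t ''i'')"])
    show "I (tick (tick (set_var ''hi'' 0 (tick (set_var ''lo'' (int n + 1) (tick (set_var ''i'' 0 s)))))))"
      using s out below_empty above_empty by (auto simp: I_def K_def holds_def)
    show "I t \<and> vars t ''i'' = int n" if "I t" "\<not> bval t ?b" for t using that by (auto simp: I_def K_def)
    fix t assume I: "I t" and b: "bval t ?b"
    define i where "i = vars t ''i''"
    define lo where "lo = vars t ''lo''"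
    define hi where "hi = vars t ''hi''"
    have i: "0 \<le> i" "i < int n" "i + 1 \<in> {1..int n}" using I b by (auto simp: I_def K_def i_def)
    have v: "vars t ''i'' = i" "vars t ''lo'' = lo" "vars t ''hi'' = hi" "vars t ''n'' = int n"
      "arrays t ''out'' (i + 1) = \<sigma> (i + 1)" using I i(3) by (auto simp: I_def K_def i_def lo_def hi_def)
    have h: "K t" "below n \<sigma> {1..i} lo" "above n \<sigma> {1..i} hi"
      "\<forall>j\<in>{1..i}. arrays t ''A'' j = of_bool (bl n \<sigma> j) \<and> arrays t ''B'' j = of_bool (ul n \<sigma> j)"
      "int (clock t) \<le> int (clock s) + 4 + 8 * i" using I by (auto simp: I_def i_def lo_def hi_def)
    have r: "\<sigma> (i + 1) \<in> {1..int n}" using rng i(3) by blast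
    have e: "i + 1 - 1 = i" by simp
    have f: "\<sigma> (i + 1) < lo \<longleftrightarrow> bl n \<sigma> (i + 1)" "hi < \<sigma> (i + 1) \<longleftrightarrow> ul n \<sigma> (i + 1)"
      using records_scan(1,2)[OF inj i(3) r, unfolded e] h(2,3) by auto
    have upd: "{1..i + 1} = insert (i + 1) {1..i}" using i by auto
    have A: "below n \<sigma> {1..i + 1} (if \<sigma> (i + 1) < lo then \<sigma> (i + 1) else lo)"
      "above n \<sigma> {1..i + 1} (if hi < \<sigma> (i + 1) then \<sigma> (i + 1) else hi)"
      unfolding upd using below_insert[OF h(2)] above_insert[OF h(3)] by blast+
    have fl: "\<forall>j\<in>{1..i + 1}. ((arrays t ''A'')(i + 1 := of_bool (bl n \<sigma> (i + 1)))) j = of_bool (bl n \<sigma> j) \<and>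
        ((arrays t ''B'')(i + 1 := of_bool (ul n \<sigma> (i + 1)))) j = of_bool (ul n \<sigma> j)"
      unfolding upd using h(4) by auto
    have bd: "\<bar>i + 1\<bar> \<le> W" "\<bar>\<sigma> (i + 1)\<bar> \<le> W" "1 \<le> W" using i r W by auto
    show "ok W ?c (\<lambda>t'. I (tick t') \<and> nat (int n - vars (tick t') ''i'') < nat (int n - vars t ''i'')) t"
      using h(1,5) A fl bd i f
      by (intro wp_ok, cases "bl n \<sigma> (i + 1)"; cases "ul n \<sigma> (i + 1)") (simp_all add: I_def K_def v)
  qed
  have second: "ok W (While ?b' ?c') (\<lambda>t. J t \<and> vars t ''i'' = 0) t0" if "J (tick t0)" for t0
  proof (rule ok_While[where I = J and m = "\<lambda>t. nat (vars t ''i'')"])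
    show "J (tick t0)" by (rule that)
    show "J t \<and> vars t ''i'' = 0" if "J t" "\<not> bval t ?b'" for t using that by (auto simp: J_def)
    fix t assume J: "J t" and b: "bval t ?b'"
    define i where "i = vars t ''i''"
    define lo where "lo = vars t ''lo''"
    define hi where "hi = vars t ''hi''"
    have i: "0 < i" "i \<le> int n" "i \<in> {1..int n}" using J b by (auto simp: J_def i_def)
    have r: "\<sigma> i \<in> {1..int n}" using rng i(3) by blast
    have v: "vars t ''i'' = i" "vars t ''lo'' = lo" "vars t ''hi'' = hi" "vars t ''n'' = int n"
      "arrays t ''out'' i = \<sigma> i" "arrays t ''A'' i = of_bool (bl n \<sigma> i)" "arrays t ''B'' i = of_bool (ul n \<sigma> i)"
      "arrays t ''X'' i = of_bool (i \<in> D)" "arrays t ''Y'' (\<sigma> i) = of_bool (\<sigma> i \<in> L)"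
      using J i(3) r by (auto simp: J_def K_def i_def lo_def hi_def)
    have h: "K t" "below n \<sigma> {i+1..int n} lo" "above n \<sigma> {i+1..int n} hi"
      "\<forall>j\<in>{1..int n}. arrays t ''A'' j = of_bool (bl n \<sigma> j) \<and> arrays t ''B'' j = of_bool (ul n \<sigma> j)"
      "int (clock t) \<le> int (clock s) + 8 + 8 * int n + 10 * (int n - i)" using J by (auto simp: J_def i_def lo_def hi_def)
    have dn: "vars t ''done'' \<noteq> 0 \<longleftrightarrow> (\<forall>j\<in>{i+1..int n}. fits n D L \<sigma> j)" using J by (auto simp: J_def i_def)
    have f: "\<sigma> i < lo \<longleftrightarrow> br n \<sigma> i" "hi < \<sigma> i \<longleftrightarrow> ur n \<sigma> i"
      using records_scan(3,4)[OF inj i(3) r] h(2,3) by auto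
    have upd: "{i..int n} = insert i {i+1..int n}" using i by auto
    have A: "below n \<sigma> {i..int n} (if \<sigma> i < lo then \<sigma> i else lo)"
      "above n \<sigma> {i..int n} (if hi < \<sigma> i then \<sigma> i else hi)"
      unfolding upd using below_insert[OF h(2)] above_insert[OF h(3)] by blast+
    have dn': "(\<forall>j\<in>{i..int n}. fits n D L \<sigma> j) \<longleftrightarrow> fits n D L \<sigma> i \<and> vars t ''done'' \<noteq> 0" unfolding upd dn by auto
    have bd: "\<bar>i - 1\<bar> \<le> W" "\<bar>\<sigma> i\<bar> \<le> W" "1 \<le> W" using i r W by auto
    have m: "bval t' match \<longleftrightarrow> fits n D L \<sigma> i"
      if "vars t' ''i'' = i" "arrays t' = arrays t" "vars t' ''u'' = of_bool (ur n \<sigma> i)" "vars t' ''v'' = of_bool (br n \<sigma> i)" for t'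
      unfolding match_def Let_def fits_def using that v by auto
    define m' where "m' = match"
    show "ok W ?c' (\<lambda>t'. J (tick t') \<and> nat (vars (tick t') ''i'') < nat (vars t ''i'')) t"
      using h(1,4,5) A bd i f dn' m unfolding m'_def[symmetric]
      by (intro wp_ok, cases "ur n \<sigma> i"; cases "br n \<sigma> i"; cases "fits n D L \<sigma> i") (simp_all add: J_def K_def v)
  qed
  have third: "ok W (Assign ''lo'' (Plus (V ''n'') (N 1)) ;; Assign ''hi'' (N 0) ;; Assign ''done'' (N 1) ;; While ?b' ?c')
      (\<lambda>t. J t \<and> vars t ''i'' = 0) t" if t: "I t \<and> vars t ''i'' = int n" for t
  proof -
    have n: "vars t ''n'' = int n" using t by (simp add: I_def K_def)
    have "J (tick (tick (set_var ''done'' 1 (tick (set_var ''hi'' 0 (tick (set_var ''lo'' (int n + 1) t)))))))"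
      using t below_empty[of "int n" \<sigma>] above_empty[of "int n" \<sigma>] by (simp add: I_def J_def K_def)
    from second[OF this] show ?thesis using n W by (intro ok_Assign_Seq) simp_all
  qed
  have post: "ok W (Assign ''lo'' (Plus (V ''n'') (N 1)) ;; Assign ''hi'' (N 0) ;; Assign ''done'' (N 1) ;; While ?b' ?c')
      (\<lambda>t. vars t ''n'' = int n \<and> (vars t ''done'' = 0 \<longleftrightarrow> \<not> square_ok n D L \<sigma>) \<and>
     (\<forall>i\<in>{1..int n}. arrays t ''out'' i = \<sigma> i) \<and> clock t \<le> clock s + 18 * n + 8) t" if "I t \<and> vars t ''i'' = int n" for t
    by (rule ok_mono[OF third[OF that]]) (auto simp: J_def K_def square_ok_fits)
  from ok_SeqI[OF ok_mono[OF first post]]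
  show ?thesis unfolding check_square_def using s W by (intro ok_Assign_Seq) (simp_all add: holds_def)
qed

definition put :: com where
  "put =
     Store ''outx'' (V ''m'') (V ''i'') ;; Store ''outy'' (V ''m'') (V ''c'') ;;
     Assign ''c'' (Read ''out'' (V ''i'')) ;; Assign ''m'' (Plus (V ''m'') (N 1)) ;;
     Store ''outx'' (V ''m'') (V ''i'') ;; Store ''outy'' (V ''m'') (V ''c'') ;;
     Assign ''m'' (Plus (V ''m'') (N 1))"

text \<open>The scan from left to right follows the lower path and emits its turnpoints, while
  \<open>c\<close> is the present height and the array \<open>lo\<close> keeps all heights. The
  scan back does the same for the upper path and compares both heights in each strip. The row on
  which the walk enters column \<open>1\<close> is only known at the end: it is replaced by
  \<open>0\<close> and filled in last.\<close>

definition check_shape :: com where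
  "check_shape =
     If (And (Equal (Read ''X'' (N 1)) (N 1)) (And (Equal (Read ''X'' (V ''n'')) (N 0))
        (And (Equal (Read ''Y'' (N 1)) (N 1)) (Equal (Read ''Y'' (V ''n'')) (N 0)))))
      (Assign ''i'' (N 0) ;; Assign ''m'' (N 0) ;; Assign ''c'' (N 0) ;;
       While (Less (V ''i'') (V ''n''))
        (Assign ''i'' (Plus (V ''i'') (N 1)) ;;
         If (Equal (Read ''X'' (V ''i'')) (N 1)) put Skip ;;
         Store ''lo'' (V ''i'') (V ''c'')) ;;
       Assign ''done'' (N 1) ;;
       While (Less (N 0) (V ''i''))
        (If (And (Less (V ''i'') (V ''n'')) (Not (Less (Read ''lo'' (V ''i'')) (V ''c''))))
           (Assign ''done'' (N 0)) Skip ;;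
         If (Equal (Read ''X'' (V ''i'')) (N 0)) put Skip ;;
         Assign ''i'' (Minus (V ''i'') (N 1))) ;;
       Store ''outy'' (N 0) (V ''c''))
      Skip"

text \<open>The output of the two scans, where the scan from left to right has reached column \<open>i\<close> and the
  scan back has reached column \<open>i + 1\<close>. The value \<open>0\<close> is the one to be filled in, and the
  upper path starts in column \<open>n\<close> at the height at which the lower path ends.\<close>

definition asc :: "int set \<Rightarrow> (int \<Rightarrow> int) \<Rightarrow> int \<Rightarrow> (int \<times> int) list" where
  "asc D \<sigma> i = concat (map (\<lambda>x. if x \<in> D then [(x, if x = 1 then 0 else lower D \<sigma> (x - 1)), (x, \<sigma> x)] else []) [1..i])"

definition desc :: "int \<Rightarrow> int set \<Rightarrow> (int \<Rightarrow> int) \<Rightarrow> int \<Rightarrow> (int \<times> int) list" where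
  "desc n D \<sigma> i = concat (map (\<lambda>x. if x \<in> D then [] else [(x, if x = n then lower D \<sigma> n else upper n D \<sigma> x), (x, \<sigma> x)]) (rev [i + 1..n]))"

lemma asc_step: "0 \<le> i \<Longrightarrow> asc D \<sigma> (i + 1) = asc D \<sigma> i @
    (if i + 1 \<in> D then [(i + 1, if i = 0 then 0 else lower D \<sigma> i), (i + 1, \<sigma> (i + 1))] else [])"
  by (simp add: asc_def upto_rec2)

lemma desc_step: "i \<le> n \<Longrightarrow> desc n D \<sigma> (i - 1) = desc n D \<sigma> i @
    (if i \<in> D then [] else [(i, if i = n then lower D \<sigma> n else upper n D \<sigma> i), (i, \<sigma> i)])"
  by (simp add: desc_def upto.simps[of i])

lemma length_asc: "0 \<le> i \<Longrightarrow> int (length (asc D \<sigma> i)) = 2 * rk D i"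
proof (induction i rule: int_ge_induct)
  case base
  show ?case by (simp add: asc_def)
next
  case (step i)
  then show ?case by (simp add: asc_step rk_Suc)
qed

lemma length_desc: "0 \<le> i \<Longrightarrow> i \<le> n \<Longrightarrow> int (length (desc n D \<sigma> i)) = 2 * ((n - i) - (rk D n - rk D i))"
proof (induction "nat (n - i)" arbitrary: i)
  case 0
  then show ?case by (simp add: desc_def)
next
  case (Suc k)
  have "int (length (desc n D \<sigma> (i + 1))) = 2 * ((n - (i + 1)) - (rk D n - rk D (i + 1)))"
    using Suc.hyps(2) Suc.prems by (intro Suc.hyps(1)) auto
  then show ?case using desc_step[of "i + 1" n D \<sigma>] Suc.hyps(2) Suc.prems rk_Suc[of i D] by (auto split: if_splits)
qed

lemma lower_step: "i + 1 \<notin> D \<Longrightarrow> 0 \<le> i \<Longrightarrow> lower D \<sigma> (i + 1) = lower D \<sigma> i"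
proof -
  assume "i + 1 \<notin> D" "0 \<le> i"
  then have "D \<inter> {1..i + 1} = D \<inter> {1..i}" by (auto simp: order_le_less)
  then show ?thesis by (simp add: lower_def)
qed

lemma upper_step: "i \<in> D \<Longrightarrow> upper n D \<sigma> (i - 1) = upper n D \<sigma> i"
proof -
  assume "i \<in> D"
  then have "{i - 1 + 1..n} - D = {i + 1..n} - D" by (auto simp: order_le_less)
  then show ?thesis by (simp add: upper_def)
qed

definition listed :: "(int \<times> int) list \<Rightarrow> (string \<Rightarrow> int \<Rightarrow> int) \<Rightarrow> bool" where
  "listed zs A \<longleftrightarrow> (\<forall>k<length zs. (A ''outx'' (int k), A ''outy'' (int k)) = zs ! k)"

lemma listed_cong: "A ''outx'' = B ''outx'' \<Longrightarrow> A ''outy'' = B ''outy'' \<Longrightarrow> listed zs A = listed zs B"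
  by (simp add: listed_def)

lemma listed_snoc: "listed zs A \<Longrightarrow> m = int (length zs) \<Longrightarrow>
    B ''outx'' = (A ''outx'')(m := x) \<Longrightarrow> B ''outy'' = (A ''outy'')(m := y) \<Longrightarrow> listed (zs @ [(x, y)]) B"
  by (auto simp: listed_def nth_append less_Suc_eq)

lemma put_ok:
  assumes "vars t ''i'' = i" "vars t ''c'' = c" "vars t ''m'' = int (length zs)" "listed zs (arrays t)" "arrays t ''out'' i = \<sigma>i"
    and "\<bar>i\<bar> \<le> W" "\<bar>c\<bar> \<le> W" "\<bar>\<sigma>i\<bar> \<le> W" "int (length zs) + 2 \<le> W"
  shows "ok W put (\<lambda>t'. (\<forall>x. x \<noteq> ''c'' \<longrightarrow> x \<noteq> ''m'' \<longrightarrow> vars t' x = vars t x) \<and>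
     (\<forall>x. x \<noteq> ''outx'' \<longrightarrow> x \<noteq> ''outy'' \<longrightarrow> arrays t' x = arrays t x) \<and> vars t' ''c'' = \<sigma>i \<and>
     vars t' ''m'' = int (length zs) + 2 \<and> listed (zs @ [(i, c), (i, \<sigma>i)]) (arrays t') \<and> clock t' = clock t + 7) t"
proof -
  have "listed ((zs @ [(i, c)]) @ [(i, \<sigma>i)]) ((arrays t)(''outx'' := (arrays t ''outx'')(int (length zs) := i, int (length zs) + 1 := i),
     ''outy'' := (arrays t ''outy'')(int (length zs) := c, int (length zs) + 1 := \<sigma>i)))"
    by (rule listed_snoc[where m = "int (length zs) + 1", OF listed_snoc[where m = "int (length zs)" and
       B = "(arrays t)(''outx'' := (arrays t ''outx'')(int (length zs) := i), ''outy'' := (arrays t ''outy'')(int (length zs) := c))", OF assms(4)]])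
       simp_all
  then have lst: "listed (zs @ [(i, c), (i, \<sigma>i)]) ((arrays t)(''outx'' := (arrays t ''outx'')(int (length zs) := i, int (length zs) + 1 := i),
     ''outy'' := (arrays t ''outy'')(int (length zs) := c, int (length zs) + 1 := \<sigma>i)))" by simp
  show ?thesis
    using lst assms(6-9) unfolding put_def by (intro wp_ok) (simp add: assms(1-5))
qed

text \<open>The invariants \<open>I\<close> and \<open>J\<close> of the two scans say which part of the output
  has been written, that \<open>c\<close> is the height of the path at the present column, and how
  much time each column has taken.\<close>

lemma check_shape_ok:
  assumes s: "holds n (D, L, a) s" and out: "\<forall>i\<in>{1..int n}. arrays s ''out'' i = \<sigma> i"
    and rng: "\<forall>i\<in>{1..int n}. \<sigma> i \<in> {1..int n}" and W: "4 * int n + 4 \<le> W" and n2: "2 \<le> n"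
  shows "ok W check_shape (\<lambda>t. vars t ''n'' = int n \<and> (vars t ''done'' = 0 \<longleftrightarrow> \<not> shape_ok n D L \<sigma>) \<and>
     (vars t ''done'' \<noteq> 0 \<longrightarrow> listed ((asc D \<sigma> n @ desc n D \<sigma> 0)[0 := (1, upper n D \<sigma> 0)]) (arrays t)) \<and>
     clock t \<le> clock s + 23 * n + 10) s"
proof (cases "1 \<in> D \<and> int n \<notin> D \<and> 1 \<in> L \<and> int n \<notin> L")
  case False
  then have "\<not> shape_ok n D L \<sigma>" by (auto simp: shape_ok_def)
  moreover have "arrays s ''X'' 1 = of_bool (1 \<in> D)" "arrays s ''X'' (int n) = of_bool (int n \<in> D)"
    "arrays s ''Y'' 1 = of_bool (1 \<in> L)" "arrays s ''Y'' (int n) = of_bool (int n \<in> L)" "vars s ''n'' = int n" "vars s ''done'' = 0"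
    using s n2 by (auto simp: holds_def)
  ultimately show ?thesis using False unfolding check_shape_def by (auto simp: of_bool_def)
next
  case ends: True
  define K where "K t \<longleftrightarrow> vars t ''n'' = int n \<and>
     (\<forall>i\<in>{1..int n}. arrays t ''X'' i = of_bool (i \<in> D)) \<and> (\<forall>i\<in>{1..int n}. arrays t ''out'' i = \<sigma> i)" for t :: state
  define cur where "cur i = (if i = 0 then 0 else lower D \<sigma> i)" for i
  define cur' where "cur' i = (if i = int n then lower D \<sigma> n else upper n D \<sigma> i)" for i
  have bound: "\<bar>cur i\<bar> \<le> W" "\<bar>cur' i\<bar> \<le> W" if i: "0 \<le> i" "i \<le> int n" for i
  proof -
    have lo: "\<bar>lower D \<sigma> x\<bar> \<le> W" if x: "1 \<le> x" "x \<le> int n" for x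
    proof -
      obtain k where "1 \<le> k" "k \<le> x" "lower D \<sigma> x = \<sigma> k"
        using x(1) by (rule lower_obtain[OF conjunct1[OF ends], where \<sigma> = \<sigma>]) (rule that)
      moreover from this have "\<sigma> k \<in> {1..int n}" using rng x by auto
      ultimately show ?thesis using W by auto
    qed
    show "\<bar>cur i\<bar> \<le> W" using lo[of i] i W by (auto simp: cur_def)
    show "\<bar>cur' i\<bar> \<le> W"
    proof (cases "i = int n")
      case True
      then show ?thesis using lo[of i] n2 by (simp add: cur'_def)
    next
      case False
      then have "i < int n" "int n \<notin> D" using i ends by auto
      then obtain k where "i < k" "k \<le> int n" "upper n D \<sigma> i = \<sigma> k"
        using upper_obtain[of "int n" D i \<sigma>] by blast
      moreover from this have "\<sigma> k \<in> {1..int n}" using rng i by auto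
      ultimately show ?thesis using W False by (auto simp: cur'_def)
    qed
  qed
  define I where "I t \<longleftrightarrow> K t \<and> 0 \<le> vars t ''i'' \<and> vars t ''i'' \<le> int n \<and>
     vars t ''m'' = int (length (asc D \<sigma> (vars t ''i''))) \<and> listed (asc D \<sigma> (vars t ''i'')) (arrays t) \<and>
     vars t ''c'' = cur (vars t ''i'') \<and> (\<forall>j\<in>{1..vars t ''i''}. arrays t ''lo'' j = lower D \<sigma> j) \<and>
     int (clock t) \<le> int (clock s) + 5 + 11 * vars t ''i''" for t :: state
  define zs where "zs i = asc D \<sigma> (int n) @ desc (int n) D \<sigma> i" for i
  define J where "J t \<longleftrightarrow> K t \<and> 0 \<le> vars t ''i'' \<and> vars t ''i'' \<le> int n \<and>
     vars t ''m'' = int (length (zs (vars t ''i''))) \<and> listed (zs (vars t ''i'')) (arrays t) \<and>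
     vars t ''c'' = cur' (vars t ''i'') \<and> (\<forall>j\<in>{1..int n}. arrays t ''lo'' j = lower D \<sigma> j) \<and>
     (vars t ''done'' \<noteq> 0 \<longleftrightarrow> (\<forall>x\<in>{vars t ''i'' + 1..int n - 1}. lower D \<sigma> x < upper n D \<sigma> x)) \<and>
     int (clock t) \<le> int (clock s) + 7 + 11 * int n + 12 * (int n - vars t ''i'')" for t :: state
  let ?b = "Less (V ''i'') (V ''n'')"
  let ?c = "Assign ''i'' (Plus (V ''i'') (N 1)) ;;
         If (Equal (Read ''X'' (V ''i'')) (N 1)) put Skip ;;
         Store ''lo'' (V ''i'') (V ''c'')"
  let ?b' = "Less (N 0) (V ''i'')"
  let ?c' = "If (And (Less (V ''i'') (V ''n'')) (Not (Less (Read ''lo'' (V ''i'')) (V ''c''))))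
           (Assign ''done'' (N 0)) Skip ;;
         If (Equal (Read ''X'' (V ''i'')) (N 0)) put Skip ;;
         Assign ''i'' (Minus (V ''i'') (N 1))"
  have len: "int (length (asc D \<sigma> i)) \<le> 2 * i" if "0 \<le> i" for i
    using length_asc[OF that, of D \<sigma>] rk_le[OF that, of D] by simp
  have len': "int (length (zs i)) \<le> 4 * int n" if "0 \<le> i" "i \<le> int n" for i
  proof -
    have "int (length (desc (int n) D \<sigma> i)) \<le> 2 * int n"
      using length_desc[OF that, of D \<sigma>] rk_mono[OF that(2), of D] that by simp
    then show ?thesis using len[of "int n"] by (simp add: zs_def)
  qed
  have first: "ok W (While ?b ?c) (\<lambda>t. I t \<and> vars t ''i'' = int n) t0" if "I (tick t0)" for t0
  proof (rule ok_While[where I = I and m = "\<lambda>t. nat (int n - vars t ''i'')"])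
    show "I (tick t0)" by (rule that)
    show "I t \<and> vars t ''i'' = int n" if "I t" "\<not> bval t ?b" for t using that by (auto simp: I_def K_def)
    fix t assume I: "I t" and b: "bval t ?b"
    define i where "i = vars t ''i''"
    have i: "0 \<le> i" "i < int n" "i + 1 \<in> {1..int n}" using I b by (auto simp: I_def K_def i_def)
    have v: "vars t ''i'' = i" "vars t ''n'' = int n" "vars t ''m'' = int (length (asc D \<sigma> i))" "vars t ''c'' = cur i"
      "arrays t ''out'' (i + 1) = \<sigma> (i + 1)" "arrays t ''X'' (i + 1) = of_bool (i + 1 \<in> D)"
      using I i(3) by (auto simp: I_def K_def i_def)
    have h: "K t" "listed (asc D \<sigma> i) (arrays t)" "\<forall>j\<in>{1..i}. arrays t ''lo'' j = lower D \<sigma> j"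
      "int (clock t) \<le> int (clock s) + 5 + 11 * i" using I by (auto simp: I_def i_def)
    have bd: "\<bar>i + 1\<bar> \<le> W" "\<bar>cur i\<bar> \<le> W" "\<bar>cur (i + 1)\<bar> \<le> W" "\<bar>\<sigma> (i + 1)\<bar> \<le> W" "int (length (asc D \<sigma> i)) + 2 \<le> W"
      using bound(1)[of i] bound(1)[of "i + 1"] i W rng[rule_format, OF i(3)] len[OF i(1)] by auto
    have upd: "\<forall>j\<in>{1..i + 1}. ((arrays t ''lo'')(i + 1 := lower D \<sigma> (i + 1))) j = lower D \<sigma> j"
      using h(3) by auto
    let ?Q = "\<lambda>t'. I (tick t') \<and> nat (int n - vars (tick t') ''i'') < nat (int n - vars t ''i'')"
    let ?s = "Store ''lo'' (V ''i'') (V ''c'')"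
    define t1 where "t1 = tick (tick (set_var ''i'' (i + 1) t))"
    have "ok W (If (Equal (Read ''X'' (V ''i'')) (N 1)) put Skip) (ok W ?s ?Q) (tick (set_var ''i'' (i + 1) t))"
    proof (cases "i + 1 \<in> D")
      case True
      have c: "cur (i + 1) = \<sigma> (i + 1)" using i True by (auto simp: cur_def intro: lower_at)
      have p: "ok W put (\<lambda>t'. (\<forall>x. x \<noteq> ''c'' \<longrightarrow> x \<noteq> ''m'' \<longrightarrow> vars t' x = vars t1 x) \<and>
        (\<forall>x. x \<noteq> ''outx'' \<longrightarrow> x \<noteq> ''outy'' \<longrightarrow> arrays t' x = arrays t1 x) \<and> vars t' ''c'' = \<sigma> (i + 1) \<and>
        vars t' ''m'' = int (length (asc D \<sigma> i)) + 2 \<and>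
        listed (asc D \<sigma> i @ [(i + 1, cur i), (i + 1, \<sigma> (i + 1))]) (arrays t') \<and> clock t' = clock t1 + 7) t1"
        by (rule put_ok) (use v bd h in \<open>simp_all add: t1_def\<close>)
      have a: "asc D \<sigma> (i + 1) = asc D \<sigma> i @ [(i + 1, cur i), (i + 1, \<sigma> (i + 1))]"
        using i True by (simp add: asc_step cur_def)
      have "ok W put (ok W ?s ?Q) t1"
      proof (rule ok_mono[OF p], goal_cases)
        case (1 t')
        have v': "vars t' ''i'' = i + 1" "vars t' ''c'' = \<sigma> (i + 1)" "vars t' ''n'' = int n" "arrays t' ''X'' = arrays t ''X''"
          "arrays t' ''out'' = arrays t ''out''" "arrays t' ''lo'' = arrays t ''lo''" "clock t' = clock t + 9"
          "vars t' ''m'' = int (length (asc D \<sigma> (i + 1)))" "listed (asc D \<sigma> (i + 1)) (arrays t')"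
          using 1 v by (auto simp: t1_def a)
        have lst: "listed (asc D \<sigma> (i + 1)) ((arrays t')(''lo'' := (arrays t ''lo'')(i + 1 := \<sigma> (i + 1))))"
          using v'(9) by (rule listed_cong[THEN iffD1, rotated 2]) auto
        have "lower D \<sigma> (i + 1) = \<sigma> (i + 1)" using c i by (simp add: cur_def)
        then show ?case
          using h(1,4) bd i lst upd c by (intro wp_ok) (simp add: I_def K_def v'(1-8) v(1))
      qed
      then show ?thesis using True v by (simp add: t1_def)
    next
      case False
      then have i0: "i \<noteq> 0" using ends by auto
      have c: "cur (i + 1) = cur i" "lower D \<sigma> (i + 1) = cur i" using i i0 lower_step[OF False i(1), of \<sigma>] by (simp_all add: cur_def)
      have a: "asc D \<sigma> (i + 1) = asc D \<sigma> i" using i False by (simp add: asc_step)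
      have lst: "listed (asc D \<sigma> i) ((arrays t)(''lo'' := (arrays t ''lo'')(i + 1 := cur i)))"
        using h(2) by (rule listed_cong[THEN iffD1, rotated 2]) auto
      show ?thesis
        using h(1,4) bd i lst upd c a False by (intro wp_ok) (simp add: I_def K_def v)
    qed
    then show "ok W ?c ?Q t" using bd v by (intro ok_Assign_Seq ok_SeqI) simp_all
  qed
  have second: "ok W (While ?b' ?c') (\<lambda>t. J t \<and> vars t ''i'' = 0) t0" if "J (tick t0)" for t0
  proof (rule ok_While[where I = J and m = "\<lambda>t. nat (vars t ''i'')"])
    show "J (tick t0)" by (rule that)
    show "J t \<and> vars t ''i'' = 0" if "J t" "\<not> bval t ?b'" for t using that by (auto simp: J_def)
    fix t assume J: "J t" and b: "bval t ?b'"
    define i where "i = vars t ''i''"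
    have i: "0 < i" "i \<le> int n" "i \<in> {1..int n}" using J b by (auto simp: J_def i_def)
    have v: "vars t ''i'' = i" "vars t ''n'' = int n" "vars t ''m'' = int (length (zs i))" "vars t ''c'' = cur' i"
      "arrays t ''out'' i = \<sigma> i" "arrays t ''X'' i = of_bool (i \<in> D)" "arrays t ''lo'' i = lower D \<sigma> i"
      using J i(3) by (auto simp: J_def K_def i_def)
    have h: "K t" "listed (zs i) (arrays t)" "\<forall>j\<in>{1..int n}. arrays t ''lo'' j = lower D \<sigma> j"
      "int (clock t) \<le> int (clock s) + 7 + 11 * int n + 12 * (int n - i)"
      "vars t ''done'' \<noteq> 0 \<longleftrightarrow> (\<forall>x\<in>{i + 1..int n - 1}. lower D \<sigma> x < upper n D \<sigma> x)" using J by (auto simp: J_def i_def)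
    have bd: "\<bar>i - 1\<bar> \<le> W" "\<bar>i\<bar> \<le> W" "\<bar>cur' i\<bar> \<le> W" "\<bar>\<sigma> i\<bar> \<le> W" "int (length (zs i)) + 2 \<le> W"
      using bound(2)[of i] i(1,2) W rng[rule_format, OF i(3)] len'[of i] by simp_all
    define e where "e = (if i < int n \<and> \<not> lower D \<sigma> i < cur' i then 0 else vars t ''done'')"
    have e: "e \<noteq> 0 \<longleftrightarrow> (\<forall>x\<in>{i..int n - 1}. lower D \<sigma> x < upper n D \<sigma> x)"
    proof (cases "i < int n")
      case True
      then have "{i..int n - 1} = insert i {i + 1..int n - 1}" by auto
      then show ?thesis using True h(5) by (auto simp: e_def cur'_def)
    next
      case False
      then show ?thesis using h(5) i by (auto simp: e_def)
    qed
    let ?Q = "\<lambda>t'. J (tick t') \<and> nat (vars (tick t') ''i'') < nat (vars t ''i'')"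
    let ?s = "Assign ''i'' (Minus (V ''i'') (N 1))"
    let ?p = "If (Equal (Read ''X'' (V ''i'')) (N 0)) put Skip"
    have main: "ok W ?p (ok W ?s ?Q) t1"
      if t1: "\<forall>x. x \<noteq> ''done'' \<longrightarrow> vars t1 x = vars t x" "vars t1 ''done'' = e" "arrays t1 = arrays t" "clock t1 = clock t + 2" for t1
    proof (cases "i \<in> D")
      case False
      have c: "cur' (i - 1) = \<sigma> i" using i False by (auto simp: cur'_def intro: upper_at)
      have p: "ok W put (\<lambda>t'. (\<forall>x. x \<noteq> ''c'' \<longrightarrow> x \<noteq> ''m'' \<longrightarrow> vars t' x = vars (tick t1) x) \<and>
        (\<forall>x. x \<noteq> ''outx'' \<longrightarrow> x \<noteq> ''outy'' \<longrightarrow> arrays t' x = arrays (tick t1) x) \<and> vars t' ''c'' = \<sigma> i \<and>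
        vars t' ''m'' = int (length (zs i)) + 2 \<and>
        listed (zs i @ [(i, cur' i), (i, \<sigma> i)]) (arrays t') \<and> clock t' = clock (tick t1) + 7) (tick t1)"
        by (rule put_ok) (use v bd h t1 in simp_all)
      have a: "zs (i - 1) = zs i @ [(i, cur' i), (i, \<sigma> i)]"
        using i False by (simp add: zs_def desc_step cur'_def)
      have "ok W put (ok W ?s ?Q) (tick t1)"
      proof (rule ok_mono[OF p], goal_cases)
        case (1 t')
        have v': "vars t' ''i'' = i" "vars t' ''c'' = \<sigma> i" "vars t' ''n'' = int n" "arrays t' ''X'' = arrays t ''X''"
          "arrays t' ''out'' = arrays t ''out''" "arrays t' ''lo'' = arrays t ''lo''" "clock t' = clock t + 10"
          "vars t' ''m'' = int (length (zs (i - 1)))" "vars t' ''done'' = e" "listed (zs (i - 1)) (arrays t')"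
          using 1 v t1 by (auto simp: a)
        show ?case
          using h(1,3,4) bd i c e v'(10) by (intro wp_ok) (simp add: J_def K_def v'(1-9) v(1))
      qed
      then show ?thesis using False v t1 by simp
    next
      case True
      then have "i \<noteq> int n" using ends by auto
      then have c: "cur' (i - 1) = cur' i" using i upper_step[OF True, of n \<sigma>] by (simp add: cur'_def)
      have a: "zs (i - 1) = zs i" using i True by (simp add: zs_def desc_step)
      have v': "vars t1 ''i'' = i" "vars t1 ''c'' = cur' i" "vars t1 ''n'' = int n" "vars t1 ''m'' = int (length (zs i))"
        using v t1(1) by auto
      show ?thesis
        using h(1-4) bd i c e a True t1(2-4) by (intro wp_ok) (simp add: J_def K_def v v')
    qed
    have "ok W (If (And (Less (V ''i'') (V ''n'')) (Not (Less (Read ''lo'' (V ''i'')) (V ''c''))))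
           (Assign ''done'' (N 0)) Skip) (ok W ?p (ok W ?s ?Q)) t"
    proof (cases "i < int n \<and> \<not> lower D \<sigma> i < cur' i")
      case True
      then have "e = 0" by (simp add: e_def)
      then show ?thesis using True v main[of "tick (set_var ''done'' 0 (tick t))"] bd by simp
    next
      case False
      then have "e = vars t ''done''" by (auto simp: e_def)
      then show ?thesis using False v main[of "tick (tick t)"] by auto
    qed
    then show "ok W ?c' ?Q t" by (intro ok_SeqI) (rule ok_mono, assumption, rule ok_SeqI)
  qed
  let ?post = "\<lambda>t. vars t ''n'' = int n \<and> (vars t ''done'' = 0 \<longleftrightarrow> \<not> shape_ok n D L \<sigma>) \<and>
     (vars t ''done'' \<noteq> 0 \<longrightarrow> listed ((asc D \<sigma> n @ desc n D \<sigma> 0)[0 := (1, upper n D \<sigma> 0)]) (arrays t)) \<and>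
     clock t \<le> clock s + 23 * n + 10"
  have final: "ok W (Store ''outy'' (N 0) (V ''c'')) ?post t" if t: "J t \<and> vars t ''i'' = 0" for t
  proof -
    have J: "K t" "listed (zs 0) (arrays t)" "vars t ''c'' = upper n D \<sigma> 0"
      "vars t ''done'' \<noteq> 0 \<longleftrightarrow> (\<forall>x\<in>{1..int n - 1}. lower D \<sigma> x < upper n D \<sigma> x)"
      "int (clock t) \<le> int (clock s) + 7 + 11 * int n + 12 * int n"
      using t n2 by (auto simp: J_def cur'_def)
    have sok: "shape_ok n D L \<sigma> \<longleftrightarrow> vars t ''done'' \<noteq> 0" using J(4) ends by (simp add: shape_ok_def)
    have "[1..int n] = 1 # [1 + 1..int n]" using n2 by (intro upto_rec1) simp
    then obtain ys where z: "zs 0 = (1, 0) # ys" using ends by (auto simp: zs_def asc_def)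
    then have x0: "arrays t ''outx'' 0 = 1" using J(2) by (auto simp: listed_def)
    have "listed ((zs 0)[0 := (1, upper n D \<sigma> 0)]) ((arrays t)(''outy'' := (arrays t ''outy'')(0 := upper n D \<sigma> 0)))"
      using J(2) x0 by (auto simp: listed_def z nth_Cons')
    moreover have "\<bar>upper n D \<sigma> 0\<bar> \<le> W" using bound(2)[of 0] n2 by (simp add: cur'_def)
    ultimately show ?thesis using J(1,3,5) sok W by (intro wp_ok) (simp add: K_def zs_def)
  qed
  have "ok W (Assign ''done'' (N 1) ;; While ?b' ?c' ;; Store ''outy'' (N 0) (V ''c'')) ?post t"
    if t: "I t \<and> vars t ''i'' = int n" for t
  proof -
    have "J (tick (tick (set_var ''done'' 1 t)))"
      using t n2 by (auto simp: I_def J_def K_def cur_def cur'_def zs_def desc_def)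
    from second[OF this] have "ok W (While ?b' ?c' ;; Store ''outy'' (N 0) (V ''c'')) ?post (tick (set_var ''done'' 1 t))"
      by (intro ok_SeqI) (rule ok_mono, assumption, rule final)
    then show ?thesis using W by (intro ok_Assign_Seq) simp_all
  qed
  note third = this
  let ?s = "tick (set_var ''c'' 0 (tick (set_var ''m'' 0 (tick (set_var ''i'' 0 (tick s))))))"
  have "I (tick ?s)"
    using s out by (auto simp: I_def K_def holds_def cur_def asc_def listed_def)
  from first[OF this] have "ok W (While ?b ?c ;; Assign ''done'' (N 1) ;; While ?b' ?c' ;; Store ''outy'' (N 0) (V ''c'')) ?post ?s"
    by (intro ok_SeqI) (rule ok_mono, assumption, rule third)
  then have "ok W (Assign ''i'' (N 0) ;; Assign ''m'' (N 0) ;; Assign ''c'' (N 0) ;; While ?b ?c ;; Assign ''done'' (N 1) ;;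
      While ?b' ?c' ;; Store ''outy'' (N 0) (V ''c'')) ?post (tick s)"
    using W by (intro ok_Assign_Seq) simp_all
  moreover have "bval s (And (Equal (Read ''X'' (N 1)) (N 1)) (And (Equal (Read ''X'' (V ''n'')) (N 0))
        (And (Equal (Read ''Y'' (N 1)) (N 1)) (Equal (Read ''Y'' (V ''n'')) (N 0)))))"
    using s ends n2 by (simp add: holds_def)
  ultimately show ?thesis unfolding check_shape_def by simp
qed

lemma (in shape) walk_turnpoints_eq:
  "turnpoints w = (asc D \<sigma> n @ desc n D \<sigma> 0)[0 := (1, upper n D \<sigma> 0)]" "length (turnpoints w) = 2 * n"
proof -
  have n2': "2 \<le> int n" using n2 by simp
  have "[1..int n] = 1 # [1 + 1..int n]" using n2' by (intro upto_rec1) simp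
  moreover have "[2..int n] = [2..int n - 1] @ [int n]" using n2' by (intro upto_rec2) simp
  ultimately have up: "[1..int n] = 1 # [2..int n - 1] @ [int n]" by simp
  have l1: "lo 1 = \<sigma> 1" "hi (int n - 1) = \<sigma> n" "lo n = lo (int n - 1)" "hi 0 = hi 1"
    using lo_D D hi_D[of "int n"] lo_U[of "int n"] hi_U[of 1] n2 by auto
  have lo_corners: "corners lo 2 (int n - 1) =
    concat (map (\<lambda>x. if x \<in> D then [(x, if x = 1 then 0 else lo (x - 1)), (x, \<sigma> x)] else []) [2..int n - 1])"
    unfolding corners_def using lo_eq_iff lo_D by (intro arg_cong[of _ _ concat] map_cong refl) auto
  have "rev (corners hi 2 (int n - 1)) =
     concat (map (\<lambda>x. rev (if hi (x - 1) = hi x then [] else [(x, hi (x - 1)), (x, hi x)])) (rev [2..int n - 1]))"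
    by (simp only: corners_def rev_concat rev_map map_map o_def)
  also have "\<dots> = concat (map (\<lambda>x. if x \<in> D then [] else [(x, if x = int n then lo n else hi x), (x, \<sigma> x)]) (rev [2..int n - 1]))"
    using hi_eq_iff hi_D by (intro arg_cong[of _ _ concat] map_cong refl) auto
  finally have hi_corners: "rev (corners hi 2 (int n - 1)) = \<dots>" .
  have a: "asc D \<sigma> n = [(1, 0), (1, lo 1)] @ corners lo 2 (int n - 1)"
    unfolding asc_def up lo_corners using D l1 by simp
  have "desc n D \<sigma> 0 = [(int n, lo (int n - 1)), (int n, hi (int n - 1))] @ rev (corners hi 2 (int n - 1))"
    unfolding desc_def hi_corners using D l1 by (simp add: up)
  then show eq: "turnpoints w = (asc D \<sigma> n @ desc n D \<sigma> 0)[0 := (1, upper n D \<sigma> 0)]"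
    by (simp add: a walk_turnpoints l1(4))
  have "int (length (turnpoints w)) = 2 * int n"
    using length_asc[of "int n" D \<sigma>] length_desc[of 0 "int n" D \<sigma>] by (simp add: eq)
  then show "length (turnpoints w) = 2 * n" by linarith
qed

section \<open>Sampling in linear time\<close>

text \<open>The variable \<open>done\<close> is initially \<open>0\<close>, and \<open>check\<close> sets it
  if it accepts.\<close>

definition sampler :: "com \<Rightarrow> com" where
  "sampler check = While (Equal (V ''done'') (N 0)) (fill ;; decode check)"

text \<open>One round takes time at most \<open>41 * n + 23 \<le> 60 * n\<close>, and the expected number of
  rounds is at most \<open>C\<close>.\<close>

lemma sampler_samples:
  fixes G :: "nat \<Rightarrow> (int set \<times> int set \<times> int) set"
  assumes G: "\<And>n. 2 \<le> n \<Longrightarrow> G n \<subseteq> codes n" "\<And>n. 2 \<le> n \<Longrightarrow> card (codes n) \<le> C * card (G n)"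
    and rejects: "\<And>n D L a. 2 \<le> n \<Longrightarrow> (D, L, a) \<in> G n \<Longrightarrow> in_range n (D, L, a)"
    and check: "\<And>n D L a \<sigma> W s. 2 \<le> n \<Longrightarrow> (D, L, a) \<in> codes n \<Longrightarrow> in_range n (D, L, a) \<Longrightarrow> decodes n (D, L, a) \<sigma> \<Longrightarrow>
      holds n (D, L, a) s \<Longrightarrow> \<forall>i\<in>{1..int n}. arrays s ''out'' i = \<sigma> i \<Longrightarrow> 4 * int n + 4 \<le> W \<Longrightarrow>
      ok W check (\<lambda>t. vars t ''n'' = int n \<and> (vars t ''done'' = 0 \<longleftrightarrow> (D, L, a) \<notin> G n) \<and>
       ((D, L, a) \<in> G n \<longrightarrow> output n t = h n (D, L, a)) \<and> clock t \<le> clock s + 23 * n + 10) s"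
    and tick: "\<And>n t. output n (tick t) = output n t"
    and target: "\<And>n. 2 \<le> n \<Longrightarrow> map_spmf (h n) (spmf_of_set (G n)) = law n"
  shows "samples_in_linear_time (sampler check) output law"
  unfolding samples_in_linear_time_def Let_def
proof (intro exI allI impI)
  fix n :: nat assume n: "2 \<le> n"
  \<comment> \<open>The programs are shown to respect every bound from \<open>4 * n + 4\<close>
    on, and at \<open>n = 2\<close> the fourth power is the first one that is large enough.\<close>
  define W where "W = int n ^ 4"
  have "8 * int n \<le> int n ^ 3 * int n"
    using power_mono[of 2 "int n" 3] n by (intro mult_right_mono) auto
  moreover have "int n ^ 3 * int n = W" by (simp add: W_def power3_eq_cube power4_eq_xxxx)
  ultimately have W: "4 * int n + 4 \<le> W" using n by linarith
  let ?b = "\<lambda>t. bval t (Equal (V ''done'') (N 0))"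
  let ?f = "\<lambda>t. bind_spmf (exec W (fill ;; decode check) t) (\<lambda>t'. return_spmf (tick t'))"
  have cards: "0 < card (codes n)" using n by (simp add: card_codes)
  then have ne: "G n \<noteq> {}" using G(2)[OF n] by auto
  interpret rejection ?b ?f "\<lambda>t. vars t ''n'' = int n" "codes n" "G n" clock "60 * n" "output n" "h n"
  proof
    show "finite (codes n)" by (rule finite_codes)
    show "G n \<subseteq> codes n" by (rule G(1)[OF n])
    show "G n \<noteq> {}" by (rule ne)
    fix s assume s: "vars s ''n'' = int n" "?b s"
    have "draws W (fill ;; decode check) (codes n) (\<lambda>c t. vars t ''n'' = int n \<and> (vars t ''done'' = 0 \<longleftrightarrow> c \<notin> G n) \<and>
       (c \<in> G n \<longrightarrow> output n t = h n c) \<and> clock t \<le> clock s + 41 * n + 22) s"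
    proof (rule draws_ok)
      show "draws W fill (codes n) (\<lambda>c t. holds n c t \<and> clock t \<le> clock s + 6 * n + 4) s"
        using s n W by (intro fill_draws) auto
      fix c t assume c: "c \<in> codes n" and t: "holds n c t \<and> clock t \<le> clock s + 6 * n + 4"
      obtain D L a where DLa: "c = (D, L, a)" by (cases c)
      have code: "(D, L, a) \<in> codes n" "holds n (D, L, a) t" "int n \<le> W" using c t W DLa by auto
      show "ok W (decode check) (\<lambda>t. vars t ''n'' = int n \<and> (vars t ''done'' = 0 \<longleftrightarrow> c \<notin> G n) \<and>
         (c \<in> G n \<longrightarrow> output n t = h n c) \<and> clock t \<le> clock s + 41 * n + 22) t"
      proof (rule decode_ok[OF code], goal_cases)
        case (1 \<sigma> t')
        show ?case
          by (rule ok_mono[OF check[OF n code(1) 1(1-4) W]]) (use 1(5) t DLa in auto)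
      next
        case (2 t')
        then show ?case using rejects[OF n, of D L a] t DLa by (auto simp: holds_def)
      qed
    qed
    then obtain g where g: "exec W (fill ;; decode check) s = map_spmf g (spmf_of_set (codes n))"
      "\<forall>c\<in>codes n. vars (g c) ''n'' = int n \<and> (vars (g c) ''done'' = 0 \<longleftrightarrow> c \<notin> G n) \<and>
       (c \<in> G n \<longrightarrow> output n (g c) = h n c) \<and> clock (g c) \<le> clock s + 41 * n + 22" by (auto simp: draws_def)
    have "?f s = map_spmf (\<lambda>c. tick (g c)) (spmf_of_set (codes n))"
      unfolding g(1) by (simp add: bind_map_spmf o_def map_spmf_conv_bind_spmf)
    moreover have "\<forall>c\<in>codes n. vars (tick (g c)) ''n'' = int n \<and> clock (tick (g c)) \<le> clock s + 60 * n \<and>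
      ?b (tick (g c)) = (c \<notin> G n) \<and> (c \<in> G n \<longrightarrow> output n (tick (g c)) = h n c)"
    proof
      fix c assume "c \<in> codes n"
      from g(2)[rule_format, OF this] n
      show "vars (tick (g c)) ''n'' = int n \<and> clock (tick (g c)) \<le> clock s + 60 * n \<and>
        ?b (tick (g c)) = (c \<notin> G n) \<and> (c \<in> G n \<longrightarrow> output n (tick (g c)) = h n c)"
        by (auto simp: tick)
    qed
    ultimately show "\<exists>g. ?f s = map_spmf g (spmf_of_set (codes n)) \<and> (\<forall>c\<in>codes n. vars (g c) ''n'' = int n \<and>
       clock (g c) \<le> clock s + 60 * n \<and> ?b (g c) = (c \<notin> G n) \<and> (c \<in> G n \<longrightarrow> output n (g c) = h n c))"
      by blast
  qed
  have ex: "exec (int n ^ 4) (sampler check) (initial_state n) = loop ?b ?f (tick (initial_state n))"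
    by (simp add: sampler_def W_def)
  have init: "vars (tick (initial_state n)) ''n'' = int n" "?b (tick (initial_state n))"
    by (simp_all add: initial_state_def)
  have "(\<integral>\<^sup>+ s. of_nat (clock s) \<partial>measure_spmf (loop ?b ?f (tick (initial_state n)))) \<le>
    of_nat (clock (tick (initial_state n))) + of_nat (60 * n) * of_nat (card (codes n)) / of_nat (card (G n))"
    by (rule expected_time[OF init])
  also have "\<dots> \<le> of_nat 1 + of_nat (60 * n * C)"
  proof (intro add_mono)
    show "of_nat (clock (tick (initial_state n))) \<le> (of_nat 1 :: ennreal)" by (simp add: initial_state_def)
    have "60 * n * card (codes n) \<le> card (G n) * (60 * n * C)"
      using mult_left_mono[OF G(2)[OF n], of "60 * n"] by (simp add: mult_ac)
    then have "of_nat (60 * n) * of_nat (card (codes n)) \<le> (of_nat (card (G n)) * of_nat (60 * n * C) :: ennreal)"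
      by (metis of_nat_mono of_nat_mult)
    moreover have "0 < (of_nat (card (G n)) :: ennreal)" using cards(1) G(2)[OF n] ne finG by (simp add: card_gt_0_iff)
    ultimately show "of_nat (60 * n) * of_nat (card (codes n)) / of_nat (card (G n)) \<le> (of_nat (60 * n * C) :: ennreal)"
      by (intro divide_le_posI_ennreal) auto
  qed
  also have "\<dots> \<le> of_nat ((60 * C + 1) * n)"
  proof -
    have "1 + 60 * n * C \<le> (60 * C + 1) * n" using n by (simp add: algebra_simps)
    then show ?thesis by (metis of_nat_add of_nat_mono)
  qed
  finally have time: "(\<integral>\<^sup>+ s. of_nat (clock s) \<partial>measure_spmf (loop ?b ?f (tick (initial_state n)))) \<le> of_nat ((60 * C + 1) * n)" .
  show "lossless_spmf (exec (int n ^ 4) (sampler check) (initial_state n)) \<and>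
     map_spmf (output n) (exec (int n ^ 4) (sampler check) (initial_state n)) = law n \<and>
     (\<integral>\<^sup>+ s. of_nat (clock s) \<partial>measure_spmf (exec (int n ^ 4) (sampler check) (initial_state n))) \<le> of_nat ((60 * C + 1) * n)"
    unfolding ex using lossless[OF init] law[OF init] time target[OF n] by simp
qed

lemma square_sampler:
  "samples_in_linear_time (sampler check_square) output_permutation (\<lambda>n. spmf_of_set (square_permutations n))"
proof -
  obtain C where C: "\<forall>n\<ge>2. card (codes n) \<le> C * card (square_code n ` square_permutations n)"
    using acceptance by blast
  define h where "h n = inv_into (square_permutations n) (square_code n)" for n
  have inj: "inj_on (square_code n) (square_permutations n)" if n: "2 \<le> n" for n
  proof (rule inj_onI)
    fix \<sigma> \<tau> assume s: "\<sigma> \<in> square_permutations n" "\<tau> \<in> square_permutations n" "square_code n \<sigma> = square_code n \<tau>"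
    obtain D L a where c: "square_code n \<sigma> = (D, L, a)" by (cases "square_code n \<sigma>")
    have n1: "1 \<le> n" using n by simp
    note d = square_code_decodes[OF s(1) n1, unfolded c]
    show "\<sigma> = \<tau>" using square_code_iff(2)[OF d(3,2,1)] s c by metis
  qed
  show ?thesis
  proof (rule sampler_samples[where G = "\<lambda>n. square_code n ` square_permutations n" and C = C and h = h])
    fix n :: nat assume n: "2 \<le> n"
    then have n1: "1 \<le> n" by simp
    show "square_code n ` square_permutations n \<subseteq> codes n" using square_code_decodes(3)[OF _ n1] by blast
    show "card (codes n) \<le> C * card (square_code n ` square_permutations n)" using C n by blast
    show "in_range n (D, L, a)" if "(D, L, a) \<in> square_code n ` square_permutations n" for D L a
      using square_code_decodes(2)[OF _ n1] that by force
    have "spmf_of_set (square_code n ` square_permutations n) = map_spmf (square_code n) (spmf_of_set (square_permutations n))"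
      using inj[OF n] by simp
    then have "map_spmf (h n) (spmf_of_set (square_code n ` square_permutations n)) =
       map_spmf (h n \<circ> square_code n) (spmf_of_set (square_permutations n))" by (simp add: spmf.map_comp)
    also have "\<dots> = map_spmf id (spmf_of_set (square_permutations n))"
      using inj[OF n] by (intro map_spmf_cong refl) (auto simp: h_def set_spmf_of_set split: if_splits)
    finally show "map_spmf (h n) (spmf_of_set (square_code n ` square_permutations n)) = spmf_of_set (square_permutations n)"
      by (simp add: spmf.map_id0)
    fix D L a \<sigma> W s assume code: "(D, L, a) \<in> codes n" and rng: "in_range n (D, L, a)" and dec: "decodes n (D, L, a) \<sigma>"
      and s: "holds n (D, L, a) s" and out: "\<forall>i\<in>{1..int n}. arrays s ''out'' i = \<sigma> i" and W: "4 * int n + 4 \<le> W"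
    have inN: "\<forall>i\<in>{1..int n}. \<sigma> i \<in> {1..int n}" using dec unfolding decodes_def by blast
    note iff = square_code_iff[OF code rng dec]
    show "ok W check_square (\<lambda>t. vars t ''n'' = int n \<and> (vars t ''done'' = 0 \<longleftrightarrow> (D, L, a) \<notin> square_code n ` square_permutations n) \<and>
       ((D, L, a) \<in> square_code n ` square_permutations n \<longrightarrow> output_permutation n t = h n (D, L, a)) \<and>
       clock t \<le> clock s + 23 * n + 10) s"
    proof (rule ok_mono[OF check_square_ok[OF s out decodes_inj[OF dec] inN W]], goal_cases)
      case (1 t)
      have "output_permutation n t = h n (D, L, a)" if G: "(D, L, a) \<in> square_code n ` square_permutations n"
      proof -
        have "h n (D, L, a) \<in> square_permutations n" "square_code n (h n (D, L, a)) = (D, L, a)"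
          unfolding h_def using G by (rule inv_into_into, rule f_inv_into_f)
        then have "h n (D, L, a) = perm_of n \<sigma>" by (rule iff(2))
        then show ?thesis using 1 by (auto simp: output_permutation_def perm_of_def)
      qed
      then show ?case using 1 iff(1) by auto
    qed
  qed (simp add: output_permutation_def tick_def cong: if_cong)
qed

lemma permutomino_sampler:
  "samples_in_linear_time (sampler check_shape) output_cycle
     (\<lambda>n. map_spmf turnpoint_cycle (spmf_of_set (convex_permutominoes n)))"
proof -
  obtain C where C: "\<forall>n\<ge>2. card (codes n) \<le> C * card (shape_code n ` shapes n)"
    using acceptance by blast
  define inv where "inv n = inv_into (shapes n) (shape_code n)" for n
  define h where "h n c = turnpoint_cycle (cyclic_class (shape_walk n (inv n c)))" for n c
  have inj: "inj_on (shape_code n) (shapes n)" if n: "2 \<le> n" for n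
  proof (rule inj_onI)
    fix s t assume s: "s \<in> shapes n" "t \<in> shapes n" "shape_code n s = shape_code n t"
    obtain D L a where c: "shape_code n s = (D, L, a)" by (cases "shape_code n s")
    obtain \<sigma> E where s': "s = (\<sigma>, E)" by (cases s)
    note d = shape_code_decodes[OF s(1)[unfolded s'] n, folded s', unfolded c]
    show "s = t" using shape_code_iff(2)[OF d(3,2,1) n] s c by metis
  qed
  show ?thesis
  proof (rule sampler_samples[where G = "\<lambda>n. shape_code n ` shapes n" and C = C and h = h])
    fix n :: nat assume n: "2 \<le> n"
    show "shape_code n ` shapes n \<subseteq> codes n" using shape_code_decodes(3)[OF _ n] by auto
    show "card (codes n) \<le> C * card (shape_code n ` shapes n)" using C n by blast
    show "in_range n (D, L, a)" if "(D, L, a) \<in> shape_code n ` shapes n" for D L a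
    proof -
      obtain \<sigma> E where "(\<sigma>, E) \<in> shapes n" "shape_code n (\<sigma>, E) = (D, L, a)" using \<open>(D, L, a) \<in> shape_code n ` shapes n\<close> by auto
      then show ?thesis using shape_code_decodes(2)[OF _ n] by metis
    qed
    let ?\<Phi> = "\<lambda>s. cyclic_class (shape_walk n s)"
    have "spmf_of_set (shape_code n ` shapes n) = map_spmf (shape_code n) (spmf_of_set (shapes n))"
      using inj[OF n] by simp
    then have "map_spmf (h n) (spmf_of_set (shape_code n ` shapes n)) =
       map_spmf (h n \<circ> shape_code n) (spmf_of_set (shapes n))" by (simp add: spmf.map_comp)
    also have "\<dots> = map_spmf (turnpoint_cycle \<circ> ?\<Phi>) (spmf_of_set (shapes n))"
      using inj[OF n] by (intro map_spmf_cong refl) (auto simp: h_def inv_def set_spmf_of_set split: if_splits)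
    also have "\<dots> = map_spmf turnpoint_cycle (map_spmf ?\<Phi> (spmf_of_set (shapes n)))" by (simp add: spmf.map_comp)
    also have "map_spmf ?\<Phi> (spmf_of_set (shapes n)) = spmf_of_set (convex_permutominoes n)"
      unfolding convex_permutominoes_eq[OF n] by (rule map_spmf_of_set_inj_on[OF inj_shape_walk[OF n]])
    finally show "map_spmf (h n) (spmf_of_set (shape_code n ` shapes n)) = map_spmf turnpoint_cycle (spmf_of_set (convex_permutominoes n))" .
    fix D L a \<sigma> W s assume code: "(D, L, a) \<in> codes n" and rng: "in_range n (D, L, a)" and dec: "decodes n (D, L, a) \<sigma>"
      and s: "holds n (D, L, a) s" and out: "\<forall>i\<in>{1..int n}. arrays s ''out'' i = \<sigma> i" and W: "4 * int n + 4 \<le> W"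
    define p where "p = perm_of n \<sigma>"
    have out': "\<forall>i\<in>{1..int n}. arrays s ''out'' i = p i" using out by (auto simp: p_def perm_of_def)
    have dp: "decodes n (D, L, a) p" using dec by (auto simp: decodes_def perm_of_def p_def)
    have pp: "perm_of n p = p" by (auto simp: p_def perm_of_def)
    have inN: "\<forall>i\<in>{1..int n}. p i \<in> {1..int n}" using dp unfolding decodes_def by blast
    note iff = shape_code_iff[OF code rng dp n, unfolded pp]
    show "ok W check_shape (\<lambda>t. vars t ''n'' = int n \<and> (vars t ''done'' = 0 \<longleftrightarrow> (D, L, a) \<notin> shape_code n ` shapes n) \<and>
       ((D, L, a) \<in> shape_code n ` shapes n \<longrightarrow> output_cycle n t = h n (D, L, a)) \<and>
       clock t \<le> clock s + 23 * n + 10) s"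
    proof (rule ok_mono[OF check_shape_ok[OF s out' inN W n]], goal_cases)
      case (1 t)
      have "output_cycle n t = h n (D, L, a)" if G: "(D, L, a) \<in> shape_code n ` shapes n"
      proof -
        have i: "inv n (D, L, a) \<in> shapes n" "shape_code n (inv n (D, L, a)) = (D, L, a)"
          unfolding inv_def using G by (rule inv_into_into, rule f_inv_into_f)
        then have e: "inv n (D, L, a) = (p, D)" by (rule iff(2))
        interpret shape n p D using i(1) n by unfold_locales (simp_all add: e)
        have "listed (turnpoints w) (arrays t)" using 1 G iff(1) by (auto simp: walk_turnpoints_eq(1))
        then have "map (\<lambda>j. (arrays t ''outx'' (int j), arrays t ''outy'' (int j))) [0..<2 * n] = turnpoints w"
          using walk_turnpoints_eq(2) by (intro nth_equalityI) (auto simp: listed_def)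
        then show ?thesis by (simp add: output_cycle_def h_def e turnpoint_cycle_cyclic_class)
      qed
      then show ?case using 1 iff(1) by auto
    qed
  qed (simp add: output_cycle_def tick_def)
qed

theorem corollary9:
  shows "(\<exists>c. samples_in_linear_time c output_permutation
              (\<lambda>n. spmf_of_set (square_permutations n)))
       \<and> (\<exists>c. samples_in_linear_time c output_cycle
              (\<lambda>n. map_spmf turnpoint_cycle (spmf_of_set (convex_permutominoes n))))"
  using square_sampler permutomino_sampler by blast

end
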